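(* The map $$\psi\colon\mathcal{MF}^{ss}\to\widetilde{\mathcal{S}}^{ss},\qquad([A],[B],[F])\mapsto([A_1],[F]),$$ is well-defined (i.e. $([A_1],[F])$ lies in $\widetilde{\mathcal{S}}^{ss}$). Hence one obtains a map $\overline\psi\colon\mathcal{MF}^{ss}\to\widetilde{\mathcal{M}}$ by post-composing with the map $\widetilde{\mathcal{S}}^{ss}\to\widetilde{\mathcal{M}}$ to the quotient. Moreover, $\overline\psi$ is constant on $\Gamma$-orbits.
   Context: We work over $\mathbb{C}$; $x_0,\dots,x_4$ are homogeneous coordinates on $\mathbb{P}^4$. $\mathrm{Pf}$ denotes the Pfaffian, and $(F)$ the ideal generated by $F$. Skew matrices and quotients. Let $\mathcal{S}=\mathbb{P}((\mathbb{C}^5)^{\vee}\otimes\Lambda^2\mathbb{C}^6)$ be the projective space of (classes up to scalar of nonzero) skew-symmetric $6\times 6$ matrices $M$ with entries linear forms in $x_0,\dots,x_4$. The group $G=\mathrm{GL}_6(\mathbb{C})$ acts by $M\mapsto AMA^t$. Let $\mathcal{S}^{ss}\subset\mathcal{S}$ be the locus of semistable points in the sense of GIT (those $[M]$ at which some nonconstant homogeneous $\mathrm{SL}_6(\mathbb{C})$-invariant polynomial does not vanish), and $\pi\colon\mathcal{S}^{ss}\to\mathcal{M}=\mathcal{S}^{ss}/\!/G$ the good categorical quotient. Let $\mathcal{C}=\mathbb{P}(H^0(\mathcal{O}_{\mathbb{P}^4}(3)))$ be the space of cubics, $\mathcal{T}=\{([M],[F])\in\mathcal{S}^{ss}\times\mathcal{C}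 : \mathrm{Pf}(M)\in(F)\}$, and let $\widetilde{\mathcal{S}}^{ss}$ be the closure in $\mathcal{T}$ of $\{([M],[F])\in\mathcal{T}:\mathrm{Pf}(M)\neq0\}$. Let $\widetilde{\mathcal{M}}\subset\mathcal{M}\times\mathcal{C}$ be the image of $\widetilde{\mathcal{S}}^{ss}$ under $\pi\times\mathrm{id}$ (an irreducible closed subset). Matrix factorizations. Let $\mathbb{P}_f=\mathcal{C}$. Let $\mathbb{P}_a$ be the projective space of classes $[A]$, up to homothety, of skew-symmetric maps $$A=\begin{pmatrix}A_3&A_2\\-A_2^t&A_1\end{pmatrix}\colon 2\mathcal{O}_{\mathbb{P}^4}(1)\oplus6\mathcal{O}_{\mathbb{P}^4}(2)\to2\mathcal{O}_{\mathbb{P}^4}(4)\oplus6\mathcal{O}_{\mathbb{P}^4}(3),$$ where the entries of $A_i$ are homogeneous of degree $i$ ($A_3$ is $2\times2$, $A_2$ is $2\times 6$, $A_1$ is $6\times 6$). Let $\mathbb{P}_b$ be the projective space of classes $[B]$, up to homothety, of skew-symmetric maps $$B=\begin{pmatrix}B_0&B_1^t\\-B_1&B_2\end{pmatrix}\colon 2\mathcal{O}_{\mathbb{P}^4}(1)\oplus6\mathcal{O}_{\mathbb{P}^4}\to2\mathcal{O}_{\mathbb{P}^4}(1)\oplus6\mathcal{O}_{\mathbb{P}^4}(2),$$ where the entries of $B_i$ are homogeneous of degree $i$ ($B_0$ is $2\times2$, $B_1$ is $6\times2$, $B_2$ is $6\times6$). $\mathcal{MF}$ is the locally closed subvariety of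 $\mathbb{P}_a\times\mathbb{P}_b\times\mathbb{P}_f$ of triples $([A],[B],[F])$ such that: $AB\neq0$, $BA\neq0$, $\mathrm{Pf}(A)\neq0$, $\mathrm{Pf}(B)\neq0$; $[AB]=[F\cdot\mathrm{id}]$ and $[BA]=[F\cdot\mathrm{id}]$ (equalities up to scalars); and $[\mathrm{Pf}(A)]=[\mathrm{Pf}(B)]=[F^2]$. Let $\Gamma$ be the group of automorphisms of $2\mathcal{O}_{\mathbb{P}^4}(1)\oplus6\mathcal{O}_{\mathbb{P}^4}$, acting on $\mathcal{MF}$ by $\gamma\cdot([A],[B],[F])=([\gamma A\gamma^t],[(\gamma^t)^{-1}B\gamma^{-1}],[F])$. $\mathcal{MF}^{ss}$ is the locus in $\mathcal{MF}$ where $[A_1]$ is semistable. *)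

theory Defs
  imports
    "HOL-Library.Poly_Mapping"
    "HOL-Library.Numeral_Type"
    "HOL-Library.FuncSet"
    "HOL-Algebra.Ideal"
    "HOL-Analysis.Abstract_Topology"
    "Jordan_Normal_Form.Determinant"
begin

section \<open>Polynomials\<close>

text \<open>Polynomials over the complex numbers, as finitely supported functions on monomials, which in
  turn are finitely supported exponent functions on the variables. With the variables indexed by the
  five-element type \<open>5\<close> one gets the homogeneous coordinate ring of projective 4-space.\<close>

type_synonym 'i cpoly = "('i \<Rightarrow>\<^sub>0 nat) \<Rightarrow>\<^sub>0 complex"
type_synonym form = "5 cpoly"

abbreviation const :: "complex \<Rightarrow> 'i cpoly" where
  "const c \<equiv> Poly_Mapping.single 0 c"

definition mon_degree :: "('i \<Rightarrow>\<^sub>0 nat) \<Rightarrow> nat" where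
  "mon_degree m = (\<Sum>i\<in>Poly_Mapping.keys m. Poly_Mapping.lookup m i)"

definition homogeneous :: "nat \<Rightarrow> 'i cpoly \<Rightarrow> bool" where
  "homogeneous d p \<longleftrightarrow> (\<forall>m\<in>Poly_Mapping.keys p. mon_degree m = d)"

definition bihomogeneous :: "nat \<Rightarrow> nat \<Rightarrow> ('i + 'j) cpoly \<Rightarrow> bool" where
  "bihomogeneous d e p \<longleftrightarrow> (\<forall>m\<in>Poly_Mapping.keys p.
     (\<Sum>v\<in>Poly_Mapping.keys m \<inter> range Inl. Poly_Mapping.lookup m v) = d \<and>
     (\<Sum>v\<in>Poly_Mapping.keys m \<inter> range Inr. Poly_Mapping.lookup m v) = e)"

definition eval :: "'i cpoly \<Rightarrow> ('i \<Rightarrow> complex) \<Rightarrow> complex" where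
  "eval p a = (\<Sum>m\<in>Poly_Mapping.keys p.
     Poly_Mapping.lookup p m * (\<Prod>i\<in>Poly_Mapping.keys m. a i ^ Poly_Mapping.lookup m i))"


section \<open>Matrices and Pfaffians\<close>

definition skew :: "'a::ring_1 mat \<Rightarrow> bool" where
  "skew A \<longleftrightarrow> transpose_mat A = - A"

text \<open>The Pfaffian of a matrix of size \<open>2n\<close>. The permutations in the sum are the normalised
  representatives of the perfect matchings \<open>{{\<sigma> 0, \<sigma> 1}, {\<sigma> 2, \<sigma> 3}, \<dots>}\<close> of \<open>{0..<2n}\<close>.\<close>

definition pfaffian :: "'a::comm_ring_1 mat \<Rightarrow> 'a" where
  "pfaffian A = (let n = dim_row A div 2 in
     \<Sum>\<sigma> | \<sigma> permutes {0..<2 * n} \<and> (\<forall>i<n. \<sigma> (2 * i) < \<sigma> (2 * i + 1)) \<and>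
           (\<forall>j<n. \<forall>i<j. \<sigma> (2 * i) < \<sigma> (2 * j)).
       signof \<sigma> * (\<Prod>i<n. A $$ (\<sigma> (2 * i), \<sigma> (2 * i + 1))))"

definition form_mats :: "nat \<Rightarrow> nat \<Rightarrow> nat \<Rightarrow> form mat set" where
  "form_mats d nr nc = {A \<in> carrier_mat nr nc. \<forall>i<nr. \<forall>j<nc. homogeneous d (A $$ (i, j))}"

text \<open>Points of projective spaces are the classes of nonzero vectors up to nonzero scalars.\<close>

definition mat_class :: "form mat \<Rightarrow> form mat set" where
  "mat_class A = {const c \<cdot>\<^sub>m A | c. c \<noteq> 0}"

definition form_class :: "form \<Rightarrow> form set" where
  "form_class F = {const c * F | c. c \<noteq> 0}"


section \<open>Skew matrices of linear forms and cubics\<close>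

definition skew_lin :: "form mat set" where
  "skew_lin = {M \<in> form_mats 1 6 6. skew M}"

definition cubics :: "form set" where
  "cubics = {F. homogeneous 3 F}"

definition S_space :: "form mat set set" where
  "S_space = mat_class ` (skew_lin - {0\<^sub>m 6 6})"

definition C_space :: "form set set" where
  "C_space = form_class ` (cubics - {0})"

text \<open>The coordinate of \<open>M\<close> with index \<open>(i, j, k)\<close> is the coefficient of \<open>x\<^sub>k\<close> in the entry
  \<open>(i, j)\<close>. The coordinates of a cubic \<open>F\<close> are its coefficients \<open>Poly_Mapping.lookup F\<close>.
  Polynomial functions on \<open>skew_lin\<close> are the restrictions of polynomials in these (redundant)
  coordinates.\<close>

definition mat_coords :: "form mat \<Rightarrow> nat \<times> nat \<times> 5 \<Rightarrow> complex" where
  "mat_coords M = (\<lambda>(i, j, k). if i < dim_row M \<and> j < dim_col M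
     then Poly_Mapping.lookup (M $$ (i, j)) (Poly_Mapping.single k 1) else 0)"

definition congr_act :: "complex mat \<Rightarrow> form mat \<Rightarrow> form mat" where
  "congr_act g M = map_mat const g * M * transpose_mat (map_mat const g)"

definition SL6 :: "complex mat set" where
  "SL6 = {g \<in> carrier_mat 6 6. det g = 1}"


section \<open>Semistability and the quotient\<close>

text \<open>The graded ring of \<open>SL\<^sub>6\<close>-invariant polynomial functions on \<open>skew_lin\<close>; functions are
  extended by \<open>undefined\<close> outside \<open>skew_lin\<close>.\<close>

definition poly_fun :: "(nat \<times> nat \<times> 5) cpoly \<Rightarrow> form mat \<Rightarrow> complex" where
  "poly_fun p = (\<lambda>M\<in>skew_lin. eval p (mat_coords M))"

definition SL_invariant :: "(form mat \<Rightarrow> complex) \<Rightarrow> bool" where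
  "SL_invariant f \<longleftrightarrow> (\<forall>g\<in>SL6. \<forall>M\<in>skew_lin. f (congr_act g M) = f M)"

definition invariants :: "(form mat \<Rightarrow> complex) set" where
  "invariants = {poly_fun p | p. SL_invariant (poly_fun p)}"

definition hom_invariants :: "nat \<Rightarrow> (form mat \<Rightarrow> complex) set" where
  "hom_invariants d = {poly_fun p | p. homogeneous d p \<and> SL_invariant (poly_fun p)}"

definition invariant_ring :: "(form mat \<Rightarrow> complex) ring" where
  "invariant_ring = \<lparr>carrier = invariants,
     monoid.mult = (\<lambda>f g. \<lambda>M\<in>skew_lin. f M * g M), one = (\<lambda>M\<in>skew_lin. 1),
     ring.zero = (\<lambda>M\<in>skew_lin. 0), ring.add = (\<lambda>f g. \<lambda>M\<in>skew_lin. f M + g M)\<rparr>"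

definition semistable :: "form mat \<Rightarrow> bool" where
  "semistable M \<longleftrightarrow> M \<in> skew_lin \<and> (\<exists>d>0. \<exists>f\<in>hom_invariants d. f M \<noteq> 0)"

definition S_ss :: "form mat set set" where
  "S_ss = mat_class ` {M \<in> skew_lin - {0\<^sub>m 6 6}. semistable M}"

text \<open>The good quotient of \<open>S_ss\<close> by \<open>GL\<^sub>6\<close> is Proj of the invariant ring, as constructed in
  geometric invariant theory. Its (closed) points are the maximal elements among the homogeneous
  prime ideals not containing the irrelevant ideal, and the quotient map sends a point to the
  ideal of the invariants vanishing on the corresponding line.\<close>

definition relevant_primes :: "(form mat \<Rightarrow> complex) set set" where
  "relevant_primes = {I. primeideal I invariant_ring \<and>
     Idl\<^bsub>invariant_ring\<^esub> (I \<inter> (\<Union>d. hom_invariants d)) = I \<and>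
     \<not> (\<Union>d\<in>{0<..}. hom_invariants d) \<subseteq> I}"

definition M_space :: "(form mat \<Rightarrow> complex) set set" where
  "M_space = {I \<in> relevant_primes. \<forall>J\<in>relevant_primes. I \<subseteq> J \<longrightarrow> J = I}"

definition quot_map :: "form mat set \<Rightarrow> (form mat \<Rightarrow> complex) set" where
  "quot_map a = {f \<in> invariants. \<forall>M\<in>a. f M = 0}"


section \<open>The incidence variety and its closure\<close>

text \<open>The Zariski topology on the product of the two projective spaces, generated by the
  nonvanishing loci of bihomogeneous polynomials.\<close>

definition nonvanishing ::
  "((nat \<times> nat \<times> 5) + (5 \<Rightarrow>\<^sub>0 nat)) cpoly \<Rightarrow> (form mat set \<times> form set) set" where
  "nonvanishing p = {(mat_class M, form_class F) | M F.
     M \<in> skew_lin - {0\<^sub>m 6 6} \<and> F \<in> cubics - {0} \<and>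
     eval p (case_sum (mat_coords M) (Poly_Mapping.lookup F)) \<noteq> 0}"

definition zariski :: "(form mat set \<times> form set) topology" where
  "zariski = topology_generated_by {nonvanishing p | p d e. bihomogeneous d e p}"

definition T_space :: "(form mat set \<times> form set) set" where
  "T_space = {(mat_class M, form_class F) | M F.
     mat_class M \<in> S_ss \<and> M \<in> skew_lin \<and> F \<in> cubics - {0} \<and> F dvd pfaffian M}"

definition T_nonzero :: "(form mat set \<times> form set) set" where
  "T_nonzero = {(a, c) \<in> T_space. \<forall>M\<in>a. pfaffian M \<noteq> 0}"

definition S_tilde_ss :: "(form mat set \<times> form set) set" where
  "S_tilde_ss = subtopology zariski T_space closure_of T_nonzero"

definition to_M_tilde :: "form mat set \<times> form set \<Rightarrow> (form mat \<Rightarrow> complex) set \<times> form set" where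
  "to_M_tilde = map_prod quot_map id"

definition M_tilde :: "((form mat \<Rightarrow> complex) set \<times> form set) set" where
  "M_tilde = to_M_tilde ` S_tilde_ss"


section \<open>Matrix factorizations\<close>

definition A_space :: "form mat set" where
  "A_space = {four_block_mat A3 A2 (- transpose_mat A2) A1 | A3 A2 A1.
     A3 \<in> form_mats 3 2 2 \<and> skew A3 \<and> A2 \<in> form_mats 2 2 6 \<and> A1 \<in> form_mats 1 6 6 \<and> skew A1}"

definition B_space :: "form mat set" where
  "B_space = {four_block_mat B0 (transpose_mat B1) (- B1) B2 | B0 B1 B2.
     B0 \<in> form_mats 0 2 2 \<and> skew B0 \<and> B1 \<in> form_mats 1 6 2 \<and> B2 \<in> form_mats 2 6 6 \<and> skew B2}"

definition is_factorization :: "form mat \<Rightarrow> form mat \<Rightarrow> form \<Rightarrow> bool" where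
  "is_factorization A B F \<longleftrightarrow>
     A * B \<noteq> 0\<^sub>m 8 8 \<and> B * A \<noteq> 0\<^sub>m 8 8 \<and> pfaffian A \<noteq> 0 \<and> pfaffian B \<noteq> 0 \<and>
     mat_class (A * B) = mat_class (F \<cdot>\<^sub>m 1\<^sub>m 8) \<and> mat_class (B * A) = mat_class (F \<cdot>\<^sub>m 1\<^sub>m 8) \<and>
     form_class (pfaffian A) = form_class (F ^ 2) \<and>
     form_class (pfaffian B) = form_class (F ^ 2)"

definition MF :: "(form mat set \<times> form mat set \<times> form set) set" where
  "MF = {(mat_class A, mat_class B, form_class F) | A B F.
     A \<in> A_space - {0\<^sub>m 8 8} \<and> B \<in> B_space - {0\<^sub>m 8 8} \<and> F \<in> cubics - {0} \<and>
     is_factorization A B F}"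

definition block_A1 :: "form mat \<Rightarrow> form mat" where
  "block_A1 A = mat 6 6 (\<lambda>(i, j). A $$ (i + 2, j + 2))"

definition MF_ss :: "(form mat set \<times> form mat set \<times> form set) set" where
  "MF_ss = {(a, b, c) \<in> MF. block_A1 ` a \<in> S_ss}"

text \<open>Endomorphisms and automorphisms of \<open>2\<O>(1) \<oplus> 6\<O>\<close>: the block \<open>2\<O>(1) \<rightarrow> 6\<O>\<close> vanishes.\<close>

definition End_E :: "form mat set" where
  "End_E = {four_block_mat g h (0\<^sub>m 6 2) k | g h k.
     g \<in> form_mats 0 2 2 \<and> h \<in> form_mats 1 2 6 \<and> k \<in> form_mats 0 6 6}"

definition Gamma :: "form mat set" where
  "Gamma = {\<gamma> \<in> End_E. \<exists>\<delta>\<in>End_E. \<gamma> * \<delta> = 1\<^sub>m 8 \<and> \<delta> * \<gamma> = 1\<^sub>m 8}"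

definition mat_inv :: "form mat \<Rightarrow> form mat" where
  "mat_inv X = (THE Y. Y \<in> carrier_mat (dim_col X) (dim_row X) \<and>
     inverts_mat X Y \<and> inverts_mat Y X)"

definition Gamma_act ::
  "form mat \<Rightarrow> form mat set \<times> form mat set \<times> form set
    \<Rightarrow> form mat set \<times> form mat set \<times> form set" where
  "Gamma_act \<gamma> = (\<lambda>(a, b, c).
     ((\<lambda>A. \<gamma> * A * transpose_mat \<gamma>) ` a,
      (\<lambda>B. mat_inv (transpose_mat \<gamma>) * B * mat_inv \<gamma>) ` b, c))"

text \<open>The image of the line \<open>[A]\<close> under the linear map \<open>A \<mapsto> A\<^sub>1\<close> is the line \<open>[A\<^sub>1]\<close>.\<close>

definition psi :: "form mat set \<times> form mat set \<times> form set \<Rightarrow> form mat set \<times> form set" where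
  "psi = (\<lambda>(a, b, c). (block_A1 ` a, c))"

definition psi_bar ::
  "form mat set \<times> form mat set \<times> form set \<Rightarrow> (form mat \<Rightarrow> complex) set \<times> form set" where
  "psi_bar = to_M_tilde \<circ> psi"


section \<open>The quotient map takes values in the quotient\<close>

definition mon_eval :: "('i \<Rightarrow>\<^sub>0 nat) \<Rightarrow> ('i \<Rightarrow> complex) \<Rightarrow> complex" where
  "mon_eval m a = (\<Prod>i\<in>Poly_Mapping.keys m. a i ^ Poly_Mapping.lookup m i)"

lemma mon_eval_superset:
  assumes "finite S" "Poly_Mapping.keys m \<subseteq> S"
  shows "mon_eval m a = (\<Prod>i\<in>S. a i ^ Poly_Mapping.lookup m i)"
  unfolding mon_eval_def using assms
  by (intro prod.mono_neutral_left) (auto simp: in_keys_iff)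

lemma mon_eval_add: "mon_eval (m + n) a = mon_eval m a * mon_eval n a"
proof -
  let ?S = "Poly_Mapping.keys m \<union> Poly_Mapping.keys n"
  show ?thesis
    using keys_add[of m n]
    by (simp add: mon_eval_superset[of ?S] lookup_add power_add prod.distrib)
qed

lemma mon_degree_superset:
  assumes "finite S" "Poly_Mapping.keys m \<subseteq> S"
  shows "mon_degree m = (\<Sum>i\<in>S. Poly_Mapping.lookup m i)"
  unfolding mon_degree_def using assms
  by (intro sum.mono_neutral_left) (auto simp: in_keys_iff)

lemma mon_degree_add: "mon_degree (m + n) = mon_degree m + mon_degree n"
proof -
  let ?S = "Poly_Mapping.keys m \<union> Poly_Mapping.keys n"
  show ?thesis
    using keys_add[of m n]
    by (simp add: mon_degree_superset[of ?S] lookup_add sum.distrib)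
qed

lemma mon_eval_scale: "mon_eval m (\<lambda>i. t * a i) = t ^ mon_degree m * mon_eval m a"
  by (simp add: mon_eval_def mon_degree_def power_mult_distrib prod.distrib power_sum)

lemma eval_alt: "eval p a = (\<Sum>m\<in>Poly_Mapping.keys p. Poly_Mapping.lookup p m * mon_eval m a)"
  by (simp add: eval_def mon_eval_def)

lemma eval_superset:
  assumes "finite S" "Poly_Mapping.keys p \<subseteq> S"
  shows "eval p a = (\<Sum>m\<in>S. Poly_Mapping.lookup p m * mon_eval m a)"
  unfolding eval_def mon_eval_def[symmetric] using assms
  by (intro sum.mono_neutral_left) (auto simp: in_keys_iff)

lemma eval_add: "eval (p + q) a = eval p a + eval q a"
proof -
  let ?S = "Poly_Mapping.keys p \<union> Poly_Mapping.keys q"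
  show ?thesis
    using keys_add[of p q]
    by (simp add: eval_superset[of ?S] lookup_add ring_distribs sum.distrib)
qed

lemma eval_0 [simp]: "eval 0 a = 0" by (simp add: eval_def)

lemma eval_sum: "eval (\<Sum>x\<in>A. f x) a = (\<Sum>x\<in>A. eval (f x) a)"
  by (induction A rule: infinite_finite_induct) (auto simp: eval_add)

lemma eval_single: "eval (Poly_Mapping.single m c) a = c * mon_eval m a"
  by (subst eval_superset[of "{m}"]) auto

lemma eval_const: "eval (const c) a = c"
  by (simp add: eval_single mon_eval_def)

lemma cpoly_expand: "p = (\<Sum>m\<in>Poly_Mapping.keys p. Poly_Mapping.single m (Poly_Mapping.lookup p m))"
  by (rule poly_mapping_eqI) (auto simp: lookup_sum lookup_single when_def sum.delta in_keys_iff)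

lemma eval_mult: "eval (p * q) a = eval p a * eval q a"
proof -
  have "p * q = (\<Sum>m\<in>Poly_Mapping.keys p. \<Sum>n\<in>Poly_Mapping.keys q.
      Poly_Mapping.single (m + n) (Poly_Mapping.lookup p m * Poly_Mapping.lookup q n))"
    by (subst cpoly_expand[of p], subst cpoly_expand[of q])
       (simp add: sum_product mult_single)
  then have "eval (p * q) a = (\<Sum>m\<in>Poly_Mapping.keys p. \<Sum>n\<in>Poly_Mapping.keys q.
      (Poly_Mapping.lookup p m * mon_eval m a) * (Poly_Mapping.lookup q n * mon_eval n a))"
    by (simp add: eval_sum eval_single mon_eval_add mult_ac)
  also have "\<dots> = eval p a * eval q a"
    by (simp add: eval_def mon_eval_def sum_product)
  finally show ?thesis .
qed

lemma eval_homogeneous_scale: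
  assumes "homogeneous d p" shows "eval p (\<lambda>i. t * a i) = t ^ d * eval p a"
  using assms unfolding eval_def mon_eval_def[symmetric] mon_eval_scale homogeneous_def
  by (simp add: sum_distrib_left mult_ac)

lemma homogeneous_add: "homogeneous d p \<Longrightarrow> homogeneous d q \<Longrightarrow> homogeneous d (p + q)"
  using keys_add[of p q] unfolding homogeneous_def by blast

lemma homogeneous_0 [simp]: "homogeneous d 0" by (simp add: homogeneous_def)

lemma homogeneous_sum: "(\<And>x. x \<in> A \<Longrightarrow> homogeneous d (f x)) \<Longrightarrow> homogeneous d (sum f A)"
  by (induction A rule: infinite_finite_induct) (auto intro: homogeneous_add)

lemma homogeneous_mult: "homogeneous d p \<Longrightarrow> homogeneous e q \<Longrightarrow> homogeneous (d + e) (p * q)"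
  using keys_mult[of p q] unfolding homogeneous_def by (fastforce simp: mon_degree_add)

lemma homogeneous_const: "homogeneous 0 (const c)"
  by (simp add: homogeneous_def mon_degree_def)

lemma homogeneous_const_mult: "homogeneous d p \<Longrightarrow> homogeneous d (const c * p)"
  using homogeneous_mult[OF homogeneous_const] by fastforce

definition hom_part :: "nat \<Rightarrow> 'i cpoly \<Rightarrow> 'i cpoly" where
  "hom_part d p = (\<Sum>m | m \<in> Poly_Mapping.keys p \<and> mon_degree m = d.
     Poly_Mapping.single m (Poly_Mapping.lookup p m))"

lemma homogeneous_hom_part: "homogeneous d (hom_part d p)"
  unfolding hom_part_def by (rule homogeneous_sum) (auto simp: homogeneous_def)

lemma eval_hom_parts:
  obtains N where "\<And>a. eval p a = (\<Sum>d\<le>N. eval (hom_part d p) a)"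
proof
  fix a
  let ?N = "Max (insert 0 (mon_degree ` Poly_Mapping.keys p))"
  have *: "(\<Sum>d\<in>{..?N}. \<Sum>m | m \<in> Poly_Mapping.keys p \<and> mon_degree m = d.
      Poly_Mapping.lookup p m * mon_eval m a) =
    (\<Sum>m\<in>Poly_Mapping.keys p. Poly_Mapping.lookup p m * mon_eval m a)"
    by (rule sum.group) auto
  then show "eval p a = (\<Sum>d\<le>?N. eval (hom_part d p) a)"
    unfolding hom_part_def eval_sum eval_single eval_alt[of p] by simp
qed

lemma skew_lin_carrier: "M \<in> skew_lin \<Longrightarrow> M \<in> carrier_mat 6 6"
  by (auto simp: skew_lin_def form_mats_def)


lemma lookup_const_mult:
  fixes p :: form shows "Poly_Mapping.lookup (const c * p) m = c * Poly_Mapping.lookup p m"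
  by (metis (no_types, lifting) map.rep_eq mult.commute mult.right_neutral
    mult_map_scale_conv_mult mult_when single_one)

lemma transpose_smult: "transpose_mat (c \<cdot>\<^sub>m A) = c \<cdot>\<^sub>m transpose_mat A"
  by (rule eq_matI) auto

lemma skew_smult: "skew A \<Longrightarrow> skew (c \<cdot>\<^sub>m A)" for A :: "'a::comm_ring_1 mat"
  unfolding skew_def by (simp add: transpose_smult) (rule eq_matI; simp)

lemma skew_lin_smult: "M \<in> skew_lin \<Longrightarrow> const t \<cdot>\<^sub>m M \<in> skew_lin"
  unfolding skew_lin_def form_mats_def
  by (auto simp: homogeneous_const_mult intro: skew_smult)

lemma mat_coords_smult: "mat_coords (const t \<cdot>\<^sub>m M) = (\<lambda>i. t * mat_coords M i)"
  by (auto simp: mat_coords_def lookup_const_mult fun_eq_iff)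

lemma form_mats_mult:
  assumes "A \<in> form_mats d n k" "B \<in> form_mats e k m"
  shows "A * B \<in> form_mats (d + e) n m"
  using assms unfolding form_mats_def
  by (auto simp: scalar_prod_def intro!: homogeneous_sum homogeneous_mult)

lemma congr_act_skew_lin:
  assumes g: "g \<in> carrier_mat 6 6" and M: "M \<in> skew_lin"
  shows "congr_act g M \<in> skew_lin"
proof -
  let ?g = "map_mat const g :: form mat"
  have g': "?g \<in> carrier_mat 6 6" "transpose_mat ?g \<in> carrier_mat 6 6" using g by auto
  have gf: "?g \<in> form_mats 0 6 6" "transpose_mat ?g \<in> form_mats 0 6 6"
    using g by (auto simp: form_mats_def homogeneous_const)
  have Mc: "M \<in> carrier_mat 6 6" and Ms: "transpose_mat M = - M" and Mf: "M \<in> form_mats 1 6 6"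
    using M by (auto simp: skew_lin_def skew_def form_mats_def)
  have "transpose_mat (?g * M * transpose_mat ?g) = ?g * (transpose_mat M * transpose_mat ?g)"
    using g' Mc by (simp add: transpose_mult[of _ 6 6 _ 6])
  also have "\<dots> = - (?g * M * transpose_mat ?g)"
    using g' Mc unfolding Ms by (simp add: assoc_mult_mat[of _ 6 6 _ 6 _ 6])
  finally have "skew (congr_act g M)" unfolding skew_def congr_act_def .
  moreover have "congr_act g M \<in> form_mats 1 6 6"
    unfolding congr_act_def using form_mats_mult[OF form_mats_mult[OF gf(1) Mf] gf(2)] by simp
  ultimately show ?thesis by (simp add: skew_lin_def)
qed

lemma congr_act_smult:
  assumes g: "g \<in> carrier_mat 6 6" and M: "M \<in> skew_lin"
  shows "congr_act g (const t \<cdot>\<^sub>m M) = const t \<cdot>\<^sub>m congr_act g M"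
proof -
  have "M \<in> carrier_mat 6 6" "map_mat const g \<in> carrier_mat 6 6"
    using M g by (auto simp: skew_lin_carrier)
  then show ?thesis unfolding congr_act_def
    by (simp add: mult_smult_distrib[of _ 6 6 _ 6] mult_smult_assoc_mat[of _ 6 6 _ 6])
qed

lemma invariantsE:
  assumes "f \<in> invariants" obtains p where "f = poly_fun p" "SL_invariant (poly_fun p)"
  using assms by (auto simp: invariants_def)

lemma SL_invariant_add:
  "SL_invariant f \<Longrightarrow> SL_invariant g \<Longrightarrow> SL_invariant (\<lambda>M\<in>skew_lin. f M + g M)"
  by (auto simp: SL_invariant_def SL6_def congr_act_skew_lin)

lemma SL_invariant_mult:
  "SL_invariant f \<Longrightarrow> SL_invariant g \<Longrightarrow> SL_invariant (\<lambda>M\<in>skew_lin. f M * g M)"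
  by (auto simp: SL_invariant_def SL6_def congr_act_skew_lin)

lemma SL_invariant_const: "SL_invariant (\<lambda>M\<in>skew_lin. c)"
  by (auto simp: SL_invariant_def SL6_def congr_act_skew_lin)

lemma poly_fun_add: "poly_fun (p + q) = (\<lambda>M\<in>skew_lin. poly_fun p M + poly_fun q M)"
  by (auto simp: poly_fun_def eval_add fun_eq_iff)

lemma poly_fun_mult: "poly_fun (p * q) = (\<lambda>M\<in>skew_lin. poly_fun p M * poly_fun q M)"
  by (auto simp: poly_fun_def eval_mult fun_eq_iff)

lemma poly_fun_const: "poly_fun (const c) = (\<lambda>M\<in>skew_lin. c)"
  by (auto simp: poly_fun_def eval_const fun_eq_iff)

lemma invariants_add: "f \<in> invariants \<Longrightarrow> g \<in> invariants \<Longrightarrow> (\<lambda>M\<in>skew_lin. f M + g M) \<in> invariants"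
proof -
  assume "f \<in> invariants" "g \<in> invariants"
  then obtain p q where "f = poly_fun p" "SL_invariant (poly_fun p)" "g = poly_fun q" "SL_invariant (poly_fun q)"
    by (auto elim!: invariantsE)
  then have "(\<lambda>M\<in>skew_lin. f M + g M) = poly_fun (p + q)" "SL_invariant (poly_fun (p + q))"
    using SL_invariant_add[of f g] by (simp_all add: poly_fun_add)
  then show ?thesis unfolding invariants_def by blast
qed

lemma invariants_mult: "f \<in> invariants \<Longrightarrow> g \<in> invariants \<Longrightarrow> (\<lambda>M\<in>skew_lin. f M * g M) \<in> invariants"
proof -
  assume "f \<in> invariants" "g \<in> invariants"
  then obtain p q where "f = poly_fun p" "SL_invariant (poly_fun p)" "g = poly_fun q" "SL_invariant (poly_fun q)"
    by (auto elim!: invariantsE)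
  then have "(\<lambda>M\<in>skew_lin. f M * g M) = poly_fun (p * q)" "SL_invariant (poly_fun (p * q))"
    using SL_invariant_mult[of f g] by (simp_all add: poly_fun_mult)
  then show ?thesis unfolding invariants_def by blast
qed

lemma invariants_const: "(\<lambda>M\<in>skew_lin. c) \<in> invariants"
proof -
  have "(\<lambda>M\<in>skew_lin. c) = poly_fun (const c)" by (simp add: poly_fun_const)
  moreover have "SL_invariant (poly_fun (const c))" unfolding poly_fun_const by (rule SL_invariant_const)
  ultimately show ?thesis unfolding invariants_def by blast
qed

lemma invariants_ext: "f \<in> invariants \<Longrightarrow> f \<in> extensional skew_lin"
  by (auto simp: invariants_def poly_fun_def)

lemma invariants_outside: "f \<in> invariants \<Longrightarrow> M \<notin> skew_lin \<Longrightarrow> f M = undefined"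
  using invariants_ext by (auto simp: extensional_def)

lemma invariant_ring_simps:
  "carrier invariant_ring = invariants"
  "f \<otimes>\<^bsub>invariant_ring\<^esub> g = (\<lambda>M\<in>skew_lin. f M * g M)"
  "f \<oplus>\<^bsub>invariant_ring\<^esub> g = (\<lambda>M\<in>skew_lin. f M + g M)"
  "\<one>\<^bsub>invariant_ring\<^esub> = (\<lambda>M\<in>skew_lin. 1)"
  "\<zero>\<^bsub>invariant_ring\<^esub> = (\<lambda>M\<in>skew_lin. 0)"
  by (simp_all add: invariant_ring_def)

lemma cring_invariant_ring: "cring invariant_ring"
proof (rule cringI)
  show "abelian_group invariant_ring"
  proof (rule abelian_groupI; unfold invariant_ring_simps)
    fix f g k assume f: "f \<in> invariants" and g: "g \<in> invariants" and k: "k \<in> invariants"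
    show "(\<lambda>M\<in>skew_lin. f M + g M) \<in> invariants" using f g by (rule invariants_add)
    show "(\<lambda>M\<in>skew_lin. (\<lambda>M\<in>skew_lin. f M + g M) M + k M)
        = (\<lambda>M\<in>skew_lin. f M + (\<lambda>M\<in>skew_lin. g M + k M) M)"
      by (rule restrict_ext) simp
    show "(\<lambda>M\<in>skew_lin. f M + g M) = (\<lambda>M\<in>skew_lin. g M + f M)"
      by (rule restrict_ext) simp
    show "(\<lambda>M\<in>skew_lin. (\<lambda>M\<in>skew_lin. 0) M + f M) = f"
      by (rule ext) (simp add: invariants_outside[OF f])
    show "\<exists>g\<in>invariants. (\<lambda>M\<in>skew_lin. g M + f M) = (\<lambda>M\<in>skew_lin. 0)"
    proof
      show "(\<lambda>M\<in>skew_lin. (\<lambda>M\<in>skew_lin. - 1) M * f M) \<in> invariants"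
        using f by (intro invariants_mult invariants_const)
    qed (rule restrict_ext, simp)
  qed (rule invariants_const)
  show "comm_monoid invariant_ring"
  proof (rule comm_monoidI; unfold invariant_ring_simps)
    fix f g k assume f: "f \<in> invariants" and g: "g \<in> invariants" and k: "k \<in> invariants"
    show "(\<lambda>M\<in>skew_lin. f M * g M) \<in> invariants" using f g by (rule invariants_mult)
    show "(\<lambda>M\<in>skew_lin. (\<lambda>M\<in>skew_lin. f M * g M) M * k M)
        = (\<lambda>M\<in>skew_lin. f M * (\<lambda>M\<in>skew_lin. g M * k M) M)"
      by (rule restrict_ext) simp
    show "(\<lambda>M\<in>skew_lin. f M * g M) = (\<lambda>M\<in>skew_lin. g M * f M)"
      by (rule restrict_ext) simp
    show "(\<lambda>M\<in>skew_lin. (\<lambda>M\<in>skew_lin. 1) M * f M) = f"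
      by (rule ext) (simp add: invariants_outside[OF f])
  qed (rule invariants_const)
qed (unfold invariant_ring_simps, rule restrict_ext, simp add: distrib_right)

lemma hom_invariants_subset: "hom_invariants d \<subseteq> invariants"
  by (auto simp: hom_invariants_def invariants_def)

lemma poly_fun_smult_hom:
  assumes "homogeneous d p" "M \<in> skew_lin"
  shows "poly_fun p (const t \<cdot>\<^sub>m M) = t ^ d * poly_fun p M"
  using assms by (simp add: poly_fun_def skew_lin_smult mat_coords_smult eval_homogeneous_scale)

lemma poly_coeffs_zero:
  fixes c :: "nat \<Rightarrow> complex"
  assumes "\<And>t. t \<noteq> 0 \<Longrightarrow> (\<Sum>d\<le>N. c d * t ^ d) = 0" "d \<le> N"
  shows "c d = 0"
proof (rule ccontr)
  assume "c d \<noteq> 0"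
  then have "finite {t. (\<Sum>d\<le>N. c d * t ^ d) = 0}"
    using polyfun_finite_roots[of c N] assms(2) by blast
  moreover have "UNIV - {0} \<subseteq> {t. (\<Sum>d\<le>N. c d * t ^ d) = 0}" using assms(1) by auto
  ultimately have "finite (UNIV - {0::complex})" using finite_subset by blast
  then show False by (simp add: infinite_UNIV_char_0)
qed

lemma invariant_parts:
  assumes "f \<in> invariants"
  obtains N h where "\<And>d. d \<le> N \<Longrightarrow> h d \<in> hom_invariants d"
    "\<And>M. M \<in> skew_lin \<Longrightarrow> f M = (\<Sum>d\<le>N. h d M)"
    "\<And>d M t. M \<in> skew_lin \<Longrightarrow> h d (const t \<cdot>\<^sub>m M) = h d M * t ^ d"
proof -
  obtain p where p: "f = poly_fun p" "SL_invariant (poly_fun p)" using assms by (rule invariantsE)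
  obtain N where N: "\<And>a. eval p a = (\<Sum>d\<le>N. eval (hom_part d p) a)" using eval_hom_parts by blast
  let ?h = "\<lambda>d. poly_fun (hom_part d p)"
  have sm: "?h d (const t \<cdot>\<^sub>m M) = ?h d M * t ^ d" if "M \<in> skew_lin" for d t M
    using poly_fun_smult_hom[OF homogeneous_hom_part that] by (simp add: mult.commute)
  have sum: "f M = (\<Sum>d\<le>N. ?h d M)" if "M \<in> skew_lin" for M
    using that by (simp add: p poly_fun_def N)
  have "?h d (congr_act g M) = ?h d M" if "d \<le> N" and g: "g \<in> SL6" and M: "M \<in> skew_lin" for d g M
  proof -
    have gc: "g \<in> carrier_mat 6 6" using g by (simp add: SL6_def)
    have gM: "congr_act g M \<in> skew_lin" using congr_act_skew_lin[OF gc M] .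
    have "(\<Sum>d\<le>N. (?h d (congr_act g M) - ?h d M) * t ^ d) = 0" for t
    proof -
      have "f (congr_act g (const t \<cdot>\<^sub>m M)) = f (const t \<cdot>\<^sub>m M)"
        using p g M skew_lin_smult by (auto simp: SL_invariant_def)
      then show ?thesis
        by (simp add: congr_act_smult[OF gc M] sum[OF skew_lin_smult] gM M sm left_diff_distrib
            sum_subtractf)
    qed
    then show ?thesis using poly_coeffs_zero[where N = N and d = d and c = "\<lambda>d. ?h d (congr_act g M) - ?h d M"] \<open>d \<le> N\<close> by fastforce
  qed
  then have "?h d \<in> hom_invariants d" if "d \<le> N" for d
    using that homogeneous_hom_part unfolding hom_invariants_def SL_invariant_def by blast
  then show ?thesis by (rule that[of N ?h, OF _ sum sm])
qed

lemma ideal_sum: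
  assumes J: "ideal J invariant_ring" and "\<And>d. d \<le> (N::nat) \<Longrightarrow> h d \<in> J"
  shows "(\<lambda>M\<in>skew_lin. \<Sum>d\<le>N. h d M) \<in> J"
  using assms(2)
proof (induction N)
  case 0
  then have "h 0 \<in> J" by simp
  moreover from this have "h 0 \<in> invariants"
    using additive_subgroup.a_Hcarr[OF ideal.axioms(1)[OF J]] by (simp add: invariant_ring_def)
  ultimately show ?case using extensional_restrict[OF invariants_ext] by simp
next
  case (Suc N)
  have "(\<lambda>M\<in>skew_lin. \<Sum>d\<le>N. h d M) \<oplus>\<^bsub>invariant_ring\<^esub> h (Suc N) \<in> J"
    by (intro additive_subgroup.a_closed[OF ideal.axioms(1)[OF J]] Suc) auto
  then show ?case by (simp add: invariant_ring_def add: restrict_def cong: if_cong)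
qed

lemma hom_invariant_scale:
  assumes "f \<in> hom_invariants d" "M \<in> skew_lin"
  shows "f (const t \<cdot>\<^sub>m M) = t ^ d * f M"
  using assms poly_fun_smult_hom by (auto simp: hom_invariants_def)

lemma hom_invariant_vanish:
  assumes "f \<in> hom_invariants d" "M \<in> skew_lin" "f M = 0"
  shows "f \<in> quot_map (mat_class M)"
  using assms hom_invariants_subset[of d]
  by (auto simp: quot_map_def mat_class_def hom_invariant_scale)

lemma mat_class_self: "M \<in> mat_class M"
proof -
  have "M = const 1 \<cdot>\<^sub>m M" by (auto simp: single_one)
  then show ?thesis unfolding mat_class_def by (metis (mono_tags, lifting) mem_Collect_eq one_neq_zero)
qed

lemma mat_class_skew_lin: "M \<in> skew_lin \<Longrightarrow> mat_class M \<subseteq> skew_lin"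
  by (auto simp: mat_class_def skew_lin_smult)

text \<open>Vanishing on the whole line is the same as vanishing of all homogeneous parts at a point.\<close>

lemma quot_map_parts:
  assumes f: "f \<in> quot_map (mat_class M)" and M: "M \<in> skew_lin"
    and h: "\<And>d. d \<le> N \<Longrightarrow> h d \<in> hom_invariants d" and s: "\<And>M. M \<in> skew_lin \<Longrightarrow> f M = (\<Sum>d\<le>N. h d M)"
    and d: "d \<le> N"
  shows "h d M = 0"
proof -
  have "(\<Sum>d\<le>N. h d M * t ^ d) = 0" if "t \<noteq> 0" for t
  proof -
    have "const t \<cdot>\<^sub>m M \<in> mat_class M" using that by (auto simp: mat_class_def)
    then have "0 = f (const t \<cdot>\<^sub>m M)" using f by (simp add: quot_map_def)
    also have "\<dots> = (\<Sum>d\<le>N. h d M * t ^ d)"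
      using s[OF skew_lin_smult[OF M]] hom_invariant_scale[OF h M] by (simp add: mult.commute)
    finally show ?thesis by simp
  qed
  then show ?thesis using poly_coeffs_zero[where N = N and d = d and c = "\<lambda>d. h d M"] d by blast
qed


lemma quot_map_ideal:
  assumes M: "M \<in> skew_lin" shows "ideal (quot_map (mat_class M)) invariant_ring"
proof -
  interpret cring invariant_ring by (rule cring_invariant_ring)
  let ?I = "quot_map (mat_class M)"
  have sub: "A \<in> mat_class M \<Longrightarrow> A \<in> skew_lin" for A using mat_class_skew_lin[OF M] by blast
  show ?thesis
  proof (rule idealI[OF ring_axioms])
    show "subgroup ?I (add_monoid invariant_ring)"
    proof (rule add.subgroupI)
      show "?I \<subseteq> carrier invariant_ring" by (auto simp: quot_map_def invariant_ring_def)
      have "(\<lambda>M\<in>skew_lin. 0) \<in> ?I" using sub by (auto simp: quot_map_def invariants_const)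
      then show "?I \<noteq> {}" by blast
    next
      fix a assume a: "a \<in> ?I"
      then have ac: "a \<in> carrier invariant_ring" by (auto simp: quot_map_def invariant_ring_def)
      let ?n = "\<lambda>M\<in>skew_lin. (\<lambda>M\<in>skew_lin. - 1) M * a M"
      have n: "?n \<in> invariants" using ac
        by (intro invariants_mult invariants_const) (auto simp: invariant_ring_def)
      then have "?n \<in> carrier invariant_ring" by (simp add: invariant_ring_def)
      moreover have "?n \<oplus>\<^bsub>invariant_ring\<^esub> a = \<zero>\<^bsub>invariant_ring\<^esub>"
        by (auto simp: invariant_ring_def fun_eq_iff)
      ultimately have "\<ominus>\<^bsub>invariant_ring\<^esub> a = ?n" using ac minus_equality by blast
      then show "\<ominus>\<^bsub>invariant_ring\<^esub> a \<in> ?I"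
        using a n sub by (auto simp: quot_map_def)
    next
      fix a b assume "a \<in> ?I" "b \<in> ?I"
      then show "a \<oplus>\<^bsub>invariant_ring\<^esub> b \<in> ?I"
        using sub by (auto simp: quot_map_def invariant_ring_def invariants_add)
    qed
  qed (use sub in \<open>auto simp: quot_map_def invariant_ring_def invariants_mult\<close>)
qed

lemma quot_map_prime:
  assumes M: "M \<in> skew_lin" shows "primeideal (quot_map (mat_class M)) invariant_ring"
proof -
  let ?I = "quot_map (mat_class M)"
  have one: "(\<lambda>M\<in>skew_lin. 1) \<notin> ?I"
    using mat_class_self[of M] M by (auto simp: quot_map_def intro!: bexI[of _ M])
  have mem: "f \<in> ?I" if f: "f \<in> invariants" and z: "\<And>t. f (const t \<cdot>\<^sub>m M) = 0" for f
    using f z by (auto simp: quot_map_def mat_class_def)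
  have prime: "a \<in> ?I \<or> b \<in> ?I" if a: "a \<in> invariants" and b: "b \<in> invariants"
    and ab: "(\<lambda>M\<in>skew_lin. a M * b M) \<in> ?I" for a b
  proof -
    obtain K h where h: "\<And>d. d \<le> K \<Longrightarrow> h d \<in> hom_invariants d"
      "\<And>M. M \<in> skew_lin \<Longrightarrow> a M = (\<Sum>d\<le>K. h d M)"
      "\<And>d M t. M \<in> skew_lin \<Longrightarrow> h d (const t \<cdot>\<^sub>m M) = h d M * t ^ d"
      using invariant_parts[OF a] by metis
    obtain L k where k: "\<And>d. d \<le> L \<Longrightarrow> k d \<in> hom_invariants d"
      "\<And>M. M \<in> skew_lin \<Longrightarrow> b M = (\<Sum>d\<le>L. k d M)"
      "\<And>d M t. M \<in> skew_lin \<Longrightarrow> k d (const t \<cdot>\<^sub>m M) = k d M * t ^ d"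
      using invariant_parts[OF b] by metis
    define P where "P = (\<Sum>d\<le>K. monom (h d M) d)"
    define Q where "Q = (\<Sum>d\<le>L. monom (k d M) d)"
    have P: "poly P t = a (const t \<cdot>\<^sub>m M)" for t
      by (simp add: P_def poly_sum poly_monom h(2)[OF skew_lin_smult[OF M]] h(3)[OF M])
    have Q: "poly Q t = b (const t \<cdot>\<^sub>m M)" for t
      by (simp add: Q_def poly_sum poly_monom k(2)[OF skew_lin_smult[OF M]] k(3)[OF M])
    have "poly (P * Q) t = 0" if "t \<noteq> 0" for t
    proof -
      have "const t \<cdot>\<^sub>m M \<in> mat_class M" using that by (auto simp: mat_class_def)
      then have "(\<lambda>M\<in>skew_lin. a M * b M) (const t \<cdot>\<^sub>m M) = 0"
        using ab by (simp add: quot_map_def)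
      then show ?thesis using skew_lin_smult[OF M] by (simp add: P Q)
    qed
    then have "UNIV - {0} \<subseteq> {t. poly (P * Q) t = 0}" by auto
    moreover have "infinite (UNIV - {0::complex})" by (simp add: infinite_UNIV_char_0)
    ultimately have "P * Q = 0" using poly_roots_finite finite_subset by blast
    then have "P = 0 \<or> Q = 0" by simp
    then show ?thesis
    proof
      assume "P = 0" then have "a (const t \<cdot>\<^sub>m M) = 0" for t using P[of t] by simp
      then show ?thesis using mem a by blast
    next
      assume "Q = 0" then have "b (const t \<cdot>\<^sub>m M) = 0" for t using Q[of t] by simp
      then show ?thesis using mem b by blast
    qed
  qed
  show ?thesis
  proof (intro primeideal.intro primeideal_axioms.intro)
    show "carrier invariant_ring \<noteq> ?I"
      using one invariants_const[of 1] by (auto simp: invariant_ring_def)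
  qed (use prime quot_map_ideal[OF M] cring_invariant_ring in
        \<open>auto simp: invariant_ring_def\<close>)
qed

lemma quot_map_homogeneous:
  assumes M: "M \<in> skew_lin"
  defines "I \<equiv> quot_map (mat_class M)"
  shows "Idl\<^bsub>invariant_ring\<^esub> (I \<inter> (\<Union>d. hom_invariants d)) = I"
proof
  have "ideal I invariant_ring" unfolding I_def by (rule quot_map_ideal[OF M])
  then show "Idl\<^bsub>invariant_ring\<^esub> (I \<inter> (\<Union>d. hom_invariants d)) \<subseteq> I"
    unfolding genideal_def by blast
  show "I \<subseteq> Idl\<^bsub>invariant_ring\<^esub> (I \<inter> (\<Union>d. hom_invariants d))"
  proof
    fix f assume f: "f \<in> I"
    then have fi: "f \<in> invariants" by (simp add: I_def quot_map_def)
    then obtain N h where h: "\<And>d. d \<le> N \<Longrightarrow> h d \<in> hom_invariants d"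
      "\<And>M. M \<in> skew_lin \<Longrightarrow> f M = (\<Sum>d\<le>N. h d M)"
      using invariant_parts by metis
    have hI: "h d \<in> I" if "d \<le> N" for d
      using hom_invariant_vanish[OF h(1)[OF that] M] quot_map_parts[OF f[unfolded I_def] M h that]
      by (simp add: I_def)
    have "f \<in> J" if J: "ideal J invariant_ring" "I \<inter> (\<Union>d. hom_invariants d) \<subseteq> J" for J
    proof -
      have "h d \<in> J" if "d \<le> N" for d using hI[OF that] h(1)[OF that] J(2) by blast
      then have "(\<lambda>M\<in>skew_lin. \<Sum>d\<le>N. h d M) \<in> J" by (rule ideal_sum[OF J(1)])
      moreover have "f = (\<lambda>M\<in>skew_lin. \<Sum>d\<le>N. h d M)"
        using invariants_ext[OF fi] h(2) by (intro extensionalityI[of _ skew_lin]) auto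
      ultimately show ?thesis by simp
    qed
    then show "f \<in> Idl\<^bsub>invariant_ring\<^esub> (I \<inter> (\<Union>d. hom_invariants d))"
      unfolding genideal_def by blast
  qed
qed

lemma hom_invariants_mult:
  assumes "f \<in> hom_invariants d" "g \<in> hom_invariants e"
  shows "(\<lambda>M\<in>skew_lin. f M * g M) \<in> hom_invariants (d + e)"
proof -
  obtain p q where p: "f = poly_fun p" "homogeneous d p" "SL_invariant (poly_fun p)"
    and q: "g = poly_fun q" "homogeneous e q" "SL_invariant (poly_fun q)"
    using assms by (auto simp: hom_invariants_def)
  have "(\<lambda>M\<in>skew_lin. f M * g M) = poly_fun (p * q)" by (simp add: p q poly_fun_mult)
  moreover have "SL_invariant (poly_fun (p * q))"
    using SL_invariant_mult[OF p(3) q(3)] by (simp add: poly_fun_mult)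
  moreover have "homogeneous (d + e) (p * q)" using p q by (intro homogeneous_mult)
  ultimately show ?thesis unfolding hom_invariants_def by blast
qed

lemma hom_invariants_add:
  assumes "f \<in> hom_invariants d" "g \<in> hom_invariants d"
  shows "(\<lambda>M\<in>skew_lin. f M + g M) \<in> hom_invariants d"
proof -
  obtain p q where p: "f = poly_fun p" "homogeneous d p" "SL_invariant (poly_fun p)"
    and q: "g = poly_fun q" "homogeneous d q" "SL_invariant (poly_fun q)"
    using assms by (auto simp: hom_invariants_def)
  have "(\<lambda>M\<in>skew_lin. f M + g M) = poly_fun (p + q)" by (simp add: p q poly_fun_add)
  moreover have "SL_invariant (poly_fun (p + q))"
    using SL_invariant_add[OF p(3) q(3)] by (simp add: poly_fun_add)
  moreover have "homogeneous d (p + q)" using p q by (intro homogeneous_add)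
  ultimately show ?thesis unfolding hom_invariants_def by blast
qed

lemma hom_invariants_const: "(\<lambda>M\<in>skew_lin. c) \<in> hom_invariants 0"
  unfolding hom_invariants_def
  using poly_fun_const[of c] SL_invariant_const[of c] homogeneous_const[of c]
  by (metis (mono_tags, lifting) mem_Collect_eq)

lemma hom_invariants_power:
  assumes f: "f \<in> hom_invariants d"
  shows "(\<lambda>M\<in>skew_lin. f M ^ n) \<in> hom_invariants (n * d)"
proof (induction n)
  case 0 show ?case using hom_invariants_const[of 1] by (simp add: restrict_def)
next
  case (Suc n)
  show ?case using hom_invariants_mult[OF f Suc] by (simp add: restrict_def cong: if_cong)
qed

theorem quot_map_in_M_space: "quot_map \<in> S_ss \<rightarrow> M_space"
proof
  fix a assume "a \<in> S_ss"
  then obtain M where a: "a = mat_class M" and M: "M \<in> skew_lin" and ss: "semistable M"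
    by (auto simp: S_ss_def)
  let ?I = "quot_map a"
  have van: "f M = 0" if "f \<in> ?I" for f using that mat_class_self by (simp add: quot_map_def a)
  have "\<not> (\<Union>d\<in>{0<..}. hom_invariants d) \<subseteq> ?I"
    using ss van unfolding semistable_def by blast
  then have I: "?I \<in> relevant_primes"
    using quot_map_prime[OF M] quot_map_homogeneous[OF M] by (simp add: relevant_primes_def a)
  have "J = ?I" if J: "J \<in> relevant_primes" and IJ: "?I \<subseteq> J" for J
  proof (rule ccontr)
    assume ne: "J \<noteq> ?I"
    have Jp: "primeideal J invariant_ring"
      and Jh: "Idl\<^bsub>invariant_ring\<^esub> (J \<inter> (\<Union>d. hom_invariants d)) = J"
      and Jr: "\<not> (\<Union>d\<in>{0<..}. hom_invariants d) \<subseteq> J"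
      using J by (auto simp: relevant_primes_def)
    interpret J: primeideal J invariant_ring by (rule Jp)
    have Jinv: "f \<in> invariants" if "f \<in> J" for f
      using J.a_Hcarr[OF that] by (simp add: invariant_ring_def)
    have Jmult: "(\<lambda>M\<in>skew_lin. f M * g M) \<in> J" if "f \<in> J" "g \<in> invariants" for f g
      using J.I_r_closed[of f g] that by (simp add: invariant_ring_def)
    have Jadd: "(\<lambda>M\<in>skew_lin. f M + g M) \<in> J" if "f \<in> J" "g \<in> J" for f g
      using additive_subgroup.a_closed[OF ideal.axioms(1)[OF primeideal.axioms(1)[OF Jp]] that]
      by (simp add: invariant_ring_def)
    have Jprime: "f \<in> J \<or> g \<in> J"
      if "(\<lambda>M\<in>skew_lin. f M * g M) \<in> J" "f \<in> invariants" "g \<in> invariants" for f g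
      using J.I_prime[of f g] that by (simp add: invariant_ring_def)
    have J1: "(\<lambda>M\<in>skew_lin. 1) \<notin> J"
      using J.one_imp_carrier J.I_notcarr by (auto simp: invariant_ring_def)
    have "\<not> J \<inter> (\<Union>d. hom_invariants d) \<subseteq> ?I"
    proof
      assume "J \<inter> (\<Union>d. hom_invariants d) \<subseteq> ?I"
      then have "Idl\<^bsub>invariant_ring\<^esub> (J \<inter> (\<Union>d. hom_invariants d)) \<subseteq> ?I"
        using quot_map_ideal[OF M] unfolding genideal_def a by blast
      then show False using Jh IJ ne by blast
    qed
    then obtain h e where h: "h \<in> J" "h \<in> hom_invariants e" "h \<notin> ?I" by blast
    have hM: "h M \<noteq> 0" using hom_invariant_vanish[OF h(2) M] h(3) a by blast
    have "f \<in> J" if d: "d > 0" and f: "f \<in> hom_invariants d" for d f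
    proof -
      have hd: "(\<lambda>M\<in>skew_lin. h M ^ d) \<in> J"
      proof -
        obtain n where "d = Suc n" using d by (cases d) auto
        moreover have "(\<lambda>M\<in>skew_lin. h M ^ n) \<in> invariants"
          using hom_invariants_power[OF h(2)] hom_invariants_subset by blast
        ultimately show ?thesis using Jmult[OF h(1), of "\<lambda>M\<in>skew_lin. h M ^ n"] by (auto simp: restrict_def cong: if_cong)
      qed
      let ?c = "- (f M ^ e / h M ^ d)"
      let ?r = "\<lambda>A\<in>skew_lin. f A ^ e + ?c * h A ^ d"
      have c1: "(\<lambda>A\<in>skew_lin. ?c * h A ^ d) \<in> hom_invariants (e * d)"
        using hom_invariants_mult[OF hom_invariants_const[of ?c] hom_invariants_power[OF h(2), of d]]
        by (simp add: mult.commute add: restrict_def cong: if_cong)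
      have "?r \<in> hom_invariants (e * d)"
        using hom_invariants_add[OF hom_invariants_power[OF f, of e] c1] by (simp add: restrict_def cong: if_cong)
      moreover have "?r M = 0" using M hM by simp
      ultimately have "?r \<in> J" using hom_invariant_vanish[OF _ M] a IJ by blast
      moreover have "(\<lambda>A\<in>skew_lin. - ?c * h A ^ d) \<in> J"
        using Jmult[OF hd invariants_const[of "- ?c"]] by (simp add: mult.commute add: restrict_def cong: if_cong)
      ultimately have "(\<lambda>A\<in>skew_lin. f A ^ e) \<in> J"
        using Jadd[of ?r "\<lambda>A\<in>skew_lin. - ?c * h A ^ d"] by (simp add: restrict_def cong: if_cong)
      then show "f \<in> J"
      proof (induction e)
        case 0 then show ?case using J1 by (simp add: restrict_def)
      next
        case (Suc e)
        have "(\<lambda>M\<in>skew_lin. f M * (\<lambda>A\<in>skew_lin. f A ^ e) M) \<in> J"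
          using Suc.prems by (simp add: restrict_def cong: if_cong)
        then have "f \<in> J \<or> (\<lambda>A\<in>skew_lin. f A ^ e) \<in> J"
          using hom_invariants_subset f hom_invariants_power[OF f, of e] by (intro Jprime) blast+
        then show ?case using Suc.IH by blast
      qed
    qed
    then show False using Jr by blast
  qed
  with I show "?I \<in> M_space" by (simp add: M_space_def)
qed

section \<open>The Zariski topology lives on the product of the two projective spaces\<close>

lemma topspace_zariski: "topspace zariski = S_space \<times> C_space"
proof -
  have "bihomogeneous 0 0 (const 1)" by (auto simp: bihomogeneous_def)
  then have "\<Union>{nonvanishing p | p d e. bihomogeneous d e p} \<supseteq> nonvanishing (const 1)" by blast
  moreover have "nonvanishing (const 1) = S_space \<times> C_space"
    by (auto simp: nonvanishing_def S_space_def C_space_def eval_const simp del: single_one)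
  moreover have "nonvanishing p \<subseteq> S_space \<times> C_space" for p
    by (auto simp: nonvanishing_def S_space_def C_space_def)
  ultimately show ?thesis
    unfolding zariski_def topology_generated_by_topspace by blast
qed

end

theory Submission
  imports Defs
begin

definition pf_term :: "'a::comm_ring_1 mat \<Rightarrow> nat \<Rightarrow> (nat \<Rightarrow> nat) \<Rightarrow> 'a" where
  "pf_term A n \<sigma> = signof \<sigma> * (\<Prod>i<n. A $$ (\<sigma> (2 * i), \<sigma> (2 * i + 1)))"

definition matchings :: "nat \<Rightarrow> (nat \<Rightarrow> nat) set" where
  "matchings n = {\<sigma>. \<sigma> permutes {0..<2 * n} \<and> (\<forall>i<n. \<sigma> (2 * i) < \<sigma> (2 * i + 1)) \<and>
           (\<forall>j<n. \<forall>i<j. \<sigma> (2 * i) < \<sigma> (2 * j))}"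

lemma pfaffian_matchings:
  assumes "A \<in> carrier_mat (2 * n) (2 * n)"
  shows "pfaffian A = (\<Sum>\<sigma>\<in>matchings n. pf_term A n \<sigma>)"
  using assms by (simp add: pfaffian_def matchings_def pf_term_def Let_def)

definition flip :: "nat set \<Rightarrow> nat \<Rightarrow> nat" where
  "flip S m = (if m div 2 \<in> S then (if even m then m + 1 else m - 1) else m)"

definition double :: "(nat \<Rightarrow> nat) \<Rightarrow> nat \<Rightarrow> nat" where
  "double \<pi> m = 2 * \<pi> (m div 2) + m mod 2"

lemma flip_even [simp]: "flip S (2 * i) = (if i \<in> S then 2 * i + 1 else 2 * i)"
  by (simp add: flip_def)

lemma flip_odd [simp]: "flip S (Suc (2 * i)) = (if i \<in> S then 2 * i else 2 * i + 1)"
  by (simp add: flip_def)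

lemma double_even [simp]: "double \<pi> (2 * i) = 2 * \<pi> i"
  by (simp add: double_def)

lemma double_odd [simp]: "double \<pi> (Suc (2 * i)) = Suc (2 * \<pi> i)"
  by (simp add: double_def)

lemma even_odd_ext:
  assumes "\<And>i. f (2 * i) = g (2 * i)" "\<And>i. f (Suc (2 * i)) = g (Suc (2 * i))"
  shows "f = (g :: nat \<Rightarrow> 'a)"
proof
  fix m show "f m = g m" using assms by (cases "even m") (auto elim!: evenE oddE)
qed

lemma flip_flip: "flip S \<circ> flip S = id"
  by (rule even_odd_ext) auto

lemma flip_permutes: "S \<subseteq> {..<n} \<Longrightarrow> flip S permutes {0..<2 * n}"
proof (rule bij_imp_permutes)
  assume S: "S \<subseteq> {..<n}"
  have inv: "flip S (flip S m) = m" for m using fun_cong[OF flip_flip[of S], of m] by simp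
  have lt: "flip S m < 2 * n" if "m < 2 * n" for m
  proof -
    have "even m \<Longrightarrow> m + 1 < 2 * n" using that by presburger
    then show ?thesis using that by (auto simp: flip_def)
  qed
  show "bij_betw (flip S) {0..<2 * n} {0..<2 * n}"
    by (rule bij_betwI[where g = "flip S"]) (auto simp: inv lt)
  show "flip S x = x" if "x \<notin> {0..<2 * n}" for x
    using that S by (auto simp: flip_def)
qed

lemma double_comp: "double (f \<circ> g) = double f \<circ> double g"
  by (rule even_odd_ext) auto

lemma double_id: "double id = id"
  by (rule even_odd_ext) auto

lemma double_permutes:
  assumes p: "\<pi> permutes {..<n}" shows "double \<pi> permutes {0..<2 * n}"
proof (rule bij_imp_permutes)
  have inv: "double (inv_into UNIV \<pi>) (double \<pi> m) = m" "double \<pi> (double (inv_into UNIV \<pi>) m) = m" for m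
    using permutes_inv_o[OF p] double_comp double_id by (metis comp_apply id_apply)+
  have lt: "double \<rho> m < 2 * n" if "\<rho> permutes {..<n}" "m < 2 * n" for m \<rho>
  proof -
    have "\<rho> (m div 2) < n" using permutes_in_image[OF that(1), of "m div 2"] that(2) by auto
    then show ?thesis by (auto simp: double_def)
  qed
  show "bij_betw (double \<pi>) {0..<2 * n} {0..<2 * n}"
    by (rule bij_betwI[where g = "double (inv_into UNIV \<pi>)"])
       (auto simp: inv lt[OF p] lt[OF permutes_inv[OF p]])
  show "double \<pi> x = x" if "x \<notin> {0..<2 * n}" for x
    using that permutes_not_in[OF p, of "x div 2"] by (auto simp: double_def)
qed

lemma sign_flip:
  assumes "finite S" shows "sign (flip S) = (- 1 :: int) ^ card S"
  using assms
proof (induction S)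
  case empty
  have "flip {} = id" by (rule even_odd_ext) auto
  then show ?case by (simp add: sign_id)
next
  case (insert i S)
  have eq: "flip (insert i S) = Transposition.transpose (2 * i) (2 * i + 1) \<circ> flip S"
  proof (rule even_odd_ext)
    fix j
    have "Suc (2 * j) \<noteq> 2 * i" "2 * j \<noteq> Suc (2 * i)" by presburger+
    then show "flip (insert i S) (2 * j) = (Transposition.transpose (2 * i) (2 * i + 1) \<circ> flip S) (2 * j)"
      and "flip (insert i S) (Suc (2 * j)) =
        (Transposition.transpose (2 * i) (2 * i + 1) \<circ> flip S) (Suc (2 * j))"
      using insert(2) by (cases "j = i"; cases "j \<in> S"; simp add: Transposition.transpose_def)+
  qed
  obtain n where "\<forall>s\<in>S. s < n" using insert(1) finite_nat_set_iff_bounded by auto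
  then have "S \<subseteq> {..<n}" by auto
  then have "permutation (flip S)" by (metis finite_atLeastLessThan flip_permutes permutation_permutes)
  then have "sign (flip (insert i S)) = sign (Transposition.transpose (2 * i) (2 * i + 1)) * sign (flip S)"
    unfolding eq by (intro sign_compose) (auto intro: permutation_swap_id)
  then show ?case using insert by (simp add: sign_swap_id)
qed

lemma sign_double:
  assumes p: "\<pi> permutes {..<n}" shows "sign (double \<pi>) = 1"
proof -
  define ev where "ev = (\<lambda>m. if even m then double \<pi> m else m)"
  define od where "od = (\<lambda>m. if odd m then double \<pi> m else m)"
  let ?r = "flip {..<n}"
  have dbl: "double \<pi> = ev \<circ> od"
    by (rule even_odd_ext) (auto simp: ev_def od_def)
  have pn: "i \<ge> n \<Longrightarrow> \<pi> i = i" "i < n \<Longrightarrow> \<pi> i < n" for i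
    using permutes_not_in[OF p, of i] permutes_in_image[OF p, of i] by auto
  have od: "od = ?r \<circ> (ev \<circ> ?r)"
    by (rule even_odd_ext) (auto simp: ev_def od_def pn)
  have evp: "ev permutes {0..<2 * n}"
  proof (rule bij_imp_permutes)
    have inv: "double (inv_into UNIV \<pi>) (double \<pi> m) = m" "double \<pi> (double (inv_into UNIV \<pi>) m) = m" for m
      using permutes_inv_o[OF p] double_comp double_id by (metis comp_apply id_apply)+
    have ed: "even (double \<rho> m) = even m" for m \<rho> by (simp add: double_def)
    note lt = permutes_in_image[OF double_permutes[OF p], simplified]
      permutes_in_image[OF double_permutes[OF permutes_inv[OF p]], simplified]
    show "bij_betw ev {0..<2 * n} {0..<2 * n}"
      by (rule bij_betwI[where g = "\<lambda>m. if even m then double (inv_into UNIV \<pi>) m else m"])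
         (auto simp: ev_def inv ed lt)
    show "ev x = x" if "x \<notin> {0..<2 * n}" for x
      using permutes_not_in[OF double_permutes[OF p] that] by (simp add: ev_def)
  qed
  have P: "permutation ev" "permutation ?r"
    using evp flip_permutes[of "{..<n}" n] by (auto simp: permutation_permutes)
  have "sign (double \<pi>) = sign ev * (sign ?r * (sign ev * sign ?r))"
    unfolding dbl od using P by (simp add: sign_compose permutation_compose)
  also have "\<dots> = 1" by (auto simp: sign_def)
  finally show ?thesis .
qed

lemma strict_mono_image_eq:
  fixes a b :: "nat \<Rightarrow> nat"
  assumes "\<And>i j. i < j \<Longrightarrow> j < n \<Longrightarrow> a i < a j" "\<And>i j. i < j \<Longrightarrow> j < n \<Longrightarrow> b i < b j"
    and "a ` {..<n} = b ` {..<n}" and "i < n"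
  shows "a i = b i"
proof -
  have s: "sorted_wrt (<) (map a [0..<n])" "sorted_wrt (<) (map b [0..<n])"
    using assms(1,2) by (auto simp: sorted_wrt_iff_nth_less)
  have "map a [0..<n] = map b [0..<n]"
    using s assms(3) by (intro sorted_distinct_set_unique)
      (auto simp: strict_sorted_iff atLeast0LessThan)
  then show ?thesis using assms(4) by (metis add.left_neutral diff_zero length_map length_upt nth_map nth_upt)
qed

lemma matching_decomposition:
  "bij_betw (\<lambda>(\<tau>, \<pi>, S). \<tau> \<circ> double \<pi> \<circ> flip S)
     (matchings n \<times> {\<pi>. \<pi> permutes {..<n}} \<times> Pow {..<n}) {\<sigma>. \<sigma> permutes {0..<2 * n}}"
  (is "bij_betw ?f ?D ?R")
proof (rule bij_betw_imageI)
  have sig: "(\<tau> \<circ> double \<pi> \<circ> flip S) (2 * i) = (if i \<in> S then \<tau> (2 * \<pi> i + 1) else \<tau> (2 * \<pi> i))"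
    "(\<tau> \<circ> double \<pi> \<circ> flip S) (2 * i + 1) = (if i \<in> S then \<tau> (2 * \<pi> i) else \<tau> (2 * \<pi> i + 1))"
    for \<tau> :: "nat \<Rightarrow> nat" and \<pi> S i by auto
  show "inj_on ?f ?D"
  proof (rule inj_onI, unfold mem_Times_iff split_paired_all, simp only: split_conv fst_conv snd_conv mem_Collect_eq Pow_iff prod.inject, elim conjE)
    fix \<tau> \<pi> S \<tau>' \<pi>' S'
    assume t: "\<tau> \<in> matchings n" "\<tau>' \<in> matchings n" and p: "\<pi> permutes {..<n}" "\<pi>' permutes {..<n}"
      and S: "S \<subseteq> {..<n}" "S' \<subseteq> {..<n}"
      and eq: "\<tau> \<circ> double \<pi> \<circ> flip S = \<tau>' \<circ> double \<pi>' \<circ> flip S'"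
    have pl: "\<pi> i < n" "\<pi>' i < n" if "i < n" for i
      using permutes_in_image[OF p(1), of i] permutes_in_image[OF p(2), of i] that by auto
    have e1: "(if i \<in> S then \<tau> (2 * \<pi> i + 1) else \<tau> (2 * \<pi> i)) =
        (if i \<in> S' then \<tau>' (2 * \<pi>' i + 1) else \<tau>' (2 * \<pi>' i))"
      and e2: "(if i \<in> S then \<tau> (2 * \<pi> i) else \<tau> (2 * \<pi> i + 1)) =
        (if i \<in> S' then \<tau>' (2 * \<pi>' i) else \<tau>' (2 * \<pi>' i + 1))" for i
      using fun_cong[OF eq, of "2 * i"] fun_cong[OF eq, of "2 * i + 1"] sig by metis+
    have lt: "\<tau> (2 * \<pi> i) < \<tau> (2 * \<pi> i + 1)" "\<tau>' (2 * \<pi>' i) < \<tau>' (2 * \<pi>' i + 1)" if "i < n" for i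
      using t pl[OF that] by (auto simp: matchings_def)
    have "i \<in> S \<longleftrightarrow> i \<in> S'" if "i < n" for i
      using lt[OF that] e1[of i] e2[of i] by (auto split: if_splits)
    then have SS: "S = S'" using S by blast
    have a: "\<tau> (2 * \<pi> i) = \<tau>' (2 * \<pi>' i)" and b: "\<tau> (2 * \<pi> i + 1) = \<tau>' (2 * \<pi>' i + 1)" for i
      using e1[of i] e2[of i] SS by (auto split: if_splits)
    have im: "(\<lambda>i. \<tau> (2 * i)) ` {..<n} = (\<lambda>i. \<tau>' (2 * i)) ` {..<n}"
    proof -
      have "(\<lambda>i. \<tau> (2 * i)) ` {..<n} = (\<lambda>i. \<tau> (2 * i)) ` \<pi> ` {..<n}"
        by (simp only: permutes_image[OF p(1)])
      also have "\<dots> = (\<lambda>i. \<tau>' (2 * i)) ` \<pi>' ` {..<n}" by (simp add: image_image a)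
      finally show ?thesis by (simp only: permutes_image[OF p(2)])
    qed
    have tt: "\<tau> (2 * i) = \<tau>' (2 * i)" if "i < n" for i
      using strict_mono_image_eq[where a = "\<lambda>i. \<tau> (2 * i)" and b = "\<lambda>i. \<tau>' (2 * i)" and n = n, OF _ _ im that] t
      by (auto simp: matchings_def)
    have "\<pi> i = \<pi>' i" for i
    proof (cases "i < n")
      case True
      have "\<tau> (2 * \<pi> i) = \<tau> (2 * \<pi>' i)" using a[of i] tt[OF pl(2)[OF True]] by simp
      then show ?thesis using permutes_inj[of \<tau>] t by (auto simp: matchings_def inj_eq)
    next
      case False then show ?thesis using permutes_not_in[OF p(1), of i] permutes_not_in[OF p(2), of i] by simp
    qed
    then have pp: "\<pi> = \<pi>'" by auto
    have "\<tau> m = \<tau>' m" for m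
    proof (cases "m < 2 * n")
      case True
      then obtain i where i: "i < n" "\<pi> i = m div 2"
        using permutes_image[OF p(1)] by (metis imageE lessThan_iff less_mult_imp_div_less mult.commute)
      then show ?thesis using a[of i] b[of i] pp
        by (cases "even m") (simp_all add: even_two_times_div_two odd_two_times_div_two_succ)
    next
      case False then show ?thesis
        using t permutes_not_in[of \<tau> "{0..<2*n}" m] permutes_not_in[of \<tau>' "{0..<2*n}" m]
        by (auto simp: matchings_def)
    qed
    then show "\<tau> = \<tau>' \<and> \<pi> = \<pi>' \<and> S = S'" using pp SS by auto
  qed
  show "?f ` ?D = ?R"
  proof
    show "?f ` ?D \<subseteq> ?R"
      by (auto simp: matchings_def intro!: permutes_compose flip_permutes double_permutes)
    show "?R \<subseteq> ?f ` ?D"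
    proof
      fix \<sigma> assume "\<sigma> \<in> ?R"
      then have s: "\<sigma> permutes {0..<2 * n}" by simp
      define S where "S = {i. i < n \<and> \<sigma> (2 * i + 1) < \<sigma> (2 * i)}"
      define b where "b = (\<lambda>i. \<sigma> (flip S (2 * i)))"
      have S: "S \<subseteq> {..<n}" by (auto simp: S_def)
      have injb: "inj_on b {..<n}"
      proof (rule inj_onI)
        fix i j assume "b i = b j"
        then have "flip S (2 * i) = flip S (2 * j)"
          using permutes_inj[OF s] by (auto simp: b_def inj_eq simp del: flip_even)
        then show "i = j" by (auto split: if_splits; presburger)
      qed
      define L where "L = sorted_list_of_set (b ` {..<n})"
      have L: "length L = n" "set L = b ` {..<n}" "sorted_wrt (<) L"
        by (simp_all add: L_def card_image[OF injb])
      define \<rho> where "\<rho> = (\<lambda>i. if i < n then inv_into {..<n} b (L ! i) else i)"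
      have br: "b (\<rho> i) = L ! i" "\<rho> i < n" if "i < n" for i
      proof -
        have m: "L ! i \<in> b ` {..<n}" using L that by (metis nth_mem)
        show "b (\<rho> i) = L ! i" using f_inv_into_f[OF m] that by (simp add: \<rho>_def)
        show "\<rho> i < n" using inv_into_into[OF m] that by (simp add: \<rho>_def)
      qed
      have "inj_on \<rho> {..<n}"
      proof (rule inj_onI)
        fix i j assume "i \<in> {..<n}" "j \<in> {..<n}" "\<rho> i = \<rho> j"
        then have "i < n" "j < n" "L ! i = L ! j" using br by (auto, metis)
        then show "i = j" using L strict_sorted_iff nth_eq_iff_index_eq by metis
      qed
      moreover from this have "\<rho> ` {..<n} = {..<n}" using br by (intro endo_inj_surj) auto
      ultimately have rp: "\<rho> permutes {..<n}"
        by (intro bij_imp_permutes) (auto simp: bij_betw_def \<rho>_def)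
      define \<tau> where "\<tau> = \<sigma> \<circ> flip S \<circ> double \<rho>"
      have "\<tau> \<in> matchings n"
      proof -
        have "\<tau> permutes {0..<2 * n}" unfolding \<tau>_def
          by (intro permutes_compose double_permutes[OF rp] flip_permutes S s)
        moreover have "\<tau> (2 * i) < \<tau> (2 * i + 1)" if "i < n" for i
        proof -
          have "\<sigma> (2 * \<rho> i) \<noteq> \<sigma> (2 * \<rho> i + 1)" using permutes_inj[OF s] by (auto simp: inj_eq)
          then show ?thesis using br(2)[OF that] by (auto simp: \<tau>_def S_def)
        qed
        moreover have "\<tau> (2 * i) < \<tau> (2 * j)" if "i < j" "j < n" for i j
        proof -
          have "\<tau> (2 * i) = L ! i" "\<tau> (2 * j) = L ! j"
            using br(1)[of i] br(1)[of j] that by (auto simp: \<tau>_def b_def simp del: flip_even)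
          then show ?thesis using L that by (simp add: sorted_wrt_iff_nth_less)
        qed
        ultimately show ?thesis by (auto simp: matchings_def)
      qed
      moreover have "\<sigma> = \<tau> \<circ> double (inv_into UNIV \<rho>) \<circ> flip S"
      proof -
        have "\<tau> \<circ> double (inv_into UNIV \<rho>) \<circ> flip S = \<sigma> \<circ> flip S \<circ> (double \<rho> \<circ> double (inv_into UNIV \<rho>)) \<circ> flip S"
          by (simp add: \<tau>_def comp_assoc)
        also have "double \<rho> \<circ> double (inv_into UNIV \<rho>) = id"
          using double_comp[of \<rho> "inv_into UNIV \<rho>"] permutes_inv_o[OF rp] double_id by simp
        also have "\<sigma> \<circ> flip S \<circ> id \<circ> flip S = \<sigma>"
          by (simp only: comp_id comp_assoc flip_flip)
        finally show ?thesis by (rule sym)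
      qed
      ultimately show "\<sigma> \<in> ?f ` ?D" using S permutes_inv[OF rp]
        by (intro image_eqI[where x = "(\<tau>, inv_into UNIV \<rho>, S)"]) auto
    qed
  qed
qed

lemma skew_entry:
  assumes "A \<in> carrier_mat N N" "skew A" "i < N" "j < N"
  shows "A $$ (j, i) = - A $$ (i, j)"
proof -
  have "transpose_mat A $$ (i, j) = (- A) $$ (i, j)" using assms(2) by (simp add: skew_def)
  then show ?thesis using assms by simp
qed

lemma pf_term_flip:
  assumes A: "A \<in> carrier_mat (2 * n) (2 * n)" "skew A" and s: "\<sigma> permutes {0..<2 * n}" and S: "S \<subseteq> {..<n}"
  shows "pf_term A n (\<sigma> \<circ> flip S) = pf_term A n \<sigma>"
proof -
  have perm: "permutation \<sigma>" "permutation (flip S)"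
    using s flip_permutes[OF S] by (auto simp: permutation_permutes)
  have "finite S" using S finite_subset by blast
  have lt: "\<sigma> m < 2 * n" if "m < 2 * n" for m using permutes_in_image[OF s, of m] that by simp
  have "(\<Prod>i<n. A $$ ((\<sigma> \<circ> flip S) (2 * i), (\<sigma> \<circ> flip S) (2 * i + 1))) =
      (\<Prod>i<n. (if i \<in> S then - 1 else 1) * A $$ (\<sigma> (2 * i), \<sigma> (2 * i + 1)))"
  proof (rule prod.cong[OF refl])
    fix i assume "i \<in> {..<n}"
    then have "\<sigma> (2 * i) < 2 * n" "\<sigma> (2 * i + 1) < 2 * n" by (intro lt; simp)+
    from skew_entry[OF A this]
    show "A $$ ((\<sigma> \<circ> flip S) (2 * i), (\<sigma> \<circ> flip S) (2 * i + 1)) =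
        (if i \<in> S then - 1 else 1) * A $$ (\<sigma> (2 * i), \<sigma> (2 * i + 1))" by simp
  qed
  also have "\<dots> = (- 1) ^ card S * (\<Prod>i<n. A $$ (\<sigma> (2 * i), \<sigma> (2 * i + 1)))"
    using S by (simp add: prod.distrib prod.If_cases Int_absorb1)
  finally have "(\<Prod>i<n. A $$ ((\<sigma> \<circ> flip S) (2 * i), (\<sigma> \<circ> flip S) (2 * i + 1))) =
      (- 1) ^ card S * (\<Prod>i<n. A $$ (\<sigma> (2 * i), \<sigma> (2 * i + 1)))" .
  then have "pf_term A n (\<sigma> \<circ> flip S) =
      ((- 1) ^ card S * (- 1) ^ card S) * pf_term A n \<sigma>"
    unfolding pf_term_def sign_compose[OF perm] sign_flip[OF \<open>finite S\<close>] by (simp add: mult_ac)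
  then show ?thesis by (simp flip: power_mult_distrib)
qed

lemma pf_term_double:
  assumes p: "\<pi> permutes {..<n}" and s: "\<sigma> permutes {0..<2 * n}"
  shows "pf_term A n (\<sigma> \<circ> double \<pi>) = pf_term A n \<sigma>"
proof -
  have perm: "permutation \<sigma>" "permutation (double \<pi>)"
    using s double_permutes[OF p] by (auto simp: permutation_permutes)
  have "(\<Prod>i<n. A $$ ((\<sigma> \<circ> double \<pi>) (2 * i), (\<sigma> \<circ> double \<pi>) (2 * i + 1))) =
      (\<Prod>i<n. A $$ (\<sigma> (2 * \<pi> i), \<sigma> (2 * \<pi> i + 1)))" by simp
  also have "\<dots> = (\<Prod>i<n. A $$ (\<sigma> (2 * i), \<sigma> (2 * i + 1)))"
    using prod.permute[OF p, of "\<lambda>i. A $$ (\<sigma> (2 * i), \<sigma> (2 * i + 1))"] by (simp add: comp_def)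
  finally show ?thesis using sign_double[OF p] perm by (simp add: pf_term_def sign_compose)
qed

lemma pfaffian_all_permutations:
  assumes A: "A \<in> carrier_mat (2 * n) (2 * n)" "skew A"
  shows "(\<Sum>\<sigma> | \<sigma> permutes {0..<2 * n}. pf_term A n \<sigma>) = of_nat (2 ^ n * fact n) * pfaffian A"
proof -
  have fin: "finite (matchings n)"
    by (rule finite_subset[OF _ finite_permutations[of "{0..<2 * n}"]]) (auto simp: matchings_def)
  have "(\<Sum>\<sigma> | \<sigma> permutes {0..<2 * n}. pf_term A n \<sigma>) =
      (\<Sum>x\<in>matchings n \<times> {\<pi>. \<pi> permutes {..<n}} \<times> Pow {..<n}.
        pf_term A n ((\<lambda>(\<tau>, \<pi>, S). \<tau> \<circ> double \<pi> \<circ> flip S) x))"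
    by (rule sum.reindex_bij_betw[OF matching_decomposition, symmetric])
  also have "\<dots> = (\<Sum>x\<in>matchings n \<times> {\<pi>. \<pi> permutes {..<n}} \<times> Pow {..<n}. pf_term A n (fst x))"
  proof (rule sum.cong)
    fix x assume x: "x \<in> matchings n \<times> {\<pi>. \<pi> permutes {..<n}} \<times> Pow {..<n}"
    obtain \<tau> \<pi> S where e: "x = (\<tau>, \<pi>, S)" by (metis prod_cases3)
    have t: "\<tau> permutes {0..<2 * n}" and p: "\<pi> permutes {..<n}" and S: "S \<subseteq> {..<n}"
      using x e by (auto simp: matchings_def)
    show "pf_term A n ((\<lambda>(\<tau>, \<pi>, S). \<tau> \<circ> double \<pi> \<circ> flip S) x) = pf_term A n (fst x)"
      using pf_term_flip[OF A permutes_compose[OF double_permutes[OF p] t] S] pf_term_double[OF p t]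
      by (simp add: e)
  qed simp
  also have "\<dots> = (\<Sum>\<tau>\<in>matchings n. \<Sum>y\<in>{\<pi>. \<pi> permutes {..<n}} \<times> Pow {..<n}. pf_term A n \<tau>)"
    unfolding sum.cartesian_product by (rule sum.cong) auto
  also have "\<dots> = (\<Sum>\<tau>\<in>matchings n. of_nat (fact n * 2 ^ n) * pf_term A n \<tau>)"
    by (simp add: card_cartesian_product card_permutations card_Pow)
  finally show ?thesis
    by (simp add: pfaffian_matchings[OF A(1)] sum_distrib_left mult_ac)
qed

lemma det_map_columns:
  assumes C: "C \<in> carrier_mat N N" and f: "\<And>j. j < N \<Longrightarrow> f j < N"
  shows "(\<Sum>\<sigma> | \<sigma> permutes {0..<N}. signof \<sigma> * (\<Prod>j<N. C $$ (\<sigma> j, f j))) =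
    det (mat N N (\<lambda>(i, j). C $$ (i, f j)))"
proof -
  have "mat N N (\<lambda>(i, j). C $$ (i, f j)) \<in> carrier_mat N N" by simp
  from det_col[OF this] show ?thesis
  proof (rule sym[OF trans], intro sum.cong refl)
    fix \<sigma> assume "\<sigma> \<in> {\<sigma>. \<sigma> permutes {0..<N}}"
    then have "\<sigma> j < N" if "j < N" for j using permutes_in_image[of \<sigma> "{0..<N}" j] that by simp
    then show "signof \<sigma> * (\<Prod>j<N. mat N N (\<lambda>(i, j). C $$ (i, f j)) $$ (\<sigma> j, j)) =
        signof \<sigma> * (\<Prod>j<N. C $$ (\<sigma> j, f j))"
      by (intro arg_cong2[where f = "(*)"] prod.cong) auto
  qed
qed

lemma det_select_columns:
  assumes C: "C \<in> carrier_mat N N" and f: "\<And>j. j < N \<Longrightarrow> f j < N"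
  shows "det (mat N N (\<lambda>(i, j). C $$ (i, f j))) =
    (if inj_on f {0..<N} then signof (\<lambda>j. if j < N then f j else j) * det C else 0)"
proof (cases "inj_on f {0..<N}")
  case True
  let ?p = "\<lambda>j. if j < N then f j else j"
  have "f ` {0..<N} = {0..<N}" using f True by (intro endo_inj_surj) auto
  then have p: "?p permutes {0..<N}" using True
    by (intro bij_imp_permutes) (auto simp: bij_betw_def inj_on_def)
  have "mat N N (\<lambda>(i, j). C $$ (i, f j)) =
      transpose_mat (mat N N (\<lambda>(i, j). transpose_mat C $$ (?p i, j)))"
    using C f by (intro eq_matI) auto
  then have "det (mat N N (\<lambda>(i, j). C $$ (i, f j))) =
      det (mat N N (\<lambda>(i, j). transpose_mat C $$ (?p i, j)))"
    by (simp add: det_transpose[of _ N])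
  also have "\<dots> = signof ?p * det C"
    using det_permute_rows[OF _ p, of "transpose_mat C"] C by (simp add: det_transpose[of _ N])
  finally show ?thesis using True by simp
next
  case False
  then obtain i j where ij: "i < N" "j < N" "i \<noteq> j" "f i = f j" by (auto simp: inj_on_def)
  have "det (mat N N (\<lambda>(i, j). C $$ (i, f j))) = 0"
    by (rule det_identical_columns[of _ N i j]) (use ij in auto)
  then show ?thesis using False by simp
qed

lemma mult_congr_entry:
  fixes A C :: "'a::comm_ring_1 mat"
  assumes "C \<in> carrier_mat N N" "A \<in> carrier_mat N N" "i < N" "j < N"
  shows "(C * A * transpose_mat C) $$ (i, j) =
    (\<Sum>(a, b)\<in>{0..<N} \<times> {0..<N}. A $$ (a, b) * (C $$ (i, a) * C $$ (j, b)))"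
proof -
  have "(C * A * transpose_mat C) $$ (i, j) =
     (\<Sum>a<N. C $$ (i, a) * (\<Sum>b<N. A $$ (a, b) * C $$ (j, b)))"
    using assms by (simp add: scalar_prod_def atLeast0LessThan)
  also have "\<dots> = (\<Sum>a<N. \<Sum>b<N. A $$ (a, b) * (C $$ (i, a) * C $$ (j, b)))"
    unfolding sum_distrib_left by (intro sum.cong refl) (simp add: mult_ac)
  finally show ?thesis by (simp add: sum.cartesian_product atLeast0LessThan)
qed

lemma skew_congr:
  fixes A C :: "'a::comm_ring_1 mat"
  assumes "C \<in> carrier_mat m n" "A \<in> carrier_mat n n" "skew A"
  shows "skew (C * A * transpose_mat C)"
proof -
  have "transpose_mat (C * A * transpose_mat C) = C * (transpose_mat A * transpose_mat C)"
    using assms transpose_mult[of "C * A" m n "transpose_mat C" m] transpose_mult[of C m n A n] by simp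
  also have "\<dots> = - (C * A * transpose_mat C)"
    using assms by (simp add: skew_def assoc_mult_mat[of _ m n _ n _ m])
  finally show ?thesis by (simp add: skew_def)
qed

lemma pfaffian_congr:
  fixes A C :: "'a::{idom, ring_char_0} mat"
  assumes C: "C \<in> carrier_mat (2 * n) (2 * n)" and A: "A \<in> carrier_mat (2 * n) (2 * n)" "skew A"
  shows "pfaffian (C * A * transpose_mat C) = det C * pfaffian A"
proof -
  let ?N = "2 * n" and ?B = "C * A * transpose_mat C"
  let ?Q = "{0..<?N} \<times> {0..<?N}"
  define sel where "sel = (\<lambda>g :: nat \<Rightarrow> nat \<times> nat. \<lambda>m. if m < ?N
     then (if even m then fst (g (m div 2)) else snd (g (m div 2))) else m)"
  define W where "W = (\<lambda>g :: nat \<Rightarrow> nat \<times> nat. \<Prod>i<n. A $$ g i)"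
  have B: "?B \<in> carrier_mat ?N ?N" "skew ?B" using A C skew_congr[OF C A] by auto
  have two: "(\<Prod>j<?N. h j) = (\<Prod>i<n. h (2 * i) * h (2 * i + 1))" for h :: "nat \<Rightarrow> 'a"
    by (induction n) (auto simp: mult_ac)
  have sel2: "sel g (2 * i) = fst (g i)" "sel g (Suc (2 * i)) = snd (g i)" if "i < n" for g i
    using that by (auto simp: sel_def)
  have lt: "\<sigma> m < ?N" if "\<sigma> permutes {0..<?N}" "m < ?N" for \<sigma> m
    using permutes_in_image[OF that(1), of m] that(2) by simp
  have expand: "pf_term ?B n \<sigma> = (\<Sum>g\<in>{..<n} \<rightarrow>\<^sub>E ?Q. W g * (signof \<sigma> * (\<Prod>j<?N. C $$ (\<sigma> j, sel g j))))"
    if s: "\<sigma> permutes {0..<?N}" for \<sigma>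
  proof -
    have "(\<Prod>i<n. ?B $$ (\<sigma> (2 * i), \<sigma> (2 * i + 1))) =
       (\<Prod>i<n. \<Sum>q\<in>?Q. A $$ q * (C $$ (\<sigma> (2 * i), fst q) * C $$ (\<sigma> (2 * i + 1), snd q)))"
    proof (rule prod.cong[OF refl])
      fix i assume "i \<in> {..<n}"
      then have "\<sigma> (2 * i) < ?N" "\<sigma> (2 * i + 1) < ?N" by (intro lt[OF s]; simp)+
      then show "?B $$ (\<sigma> (2 * i), \<sigma> (2 * i + 1)) =
          (\<Sum>q\<in>?Q. A $$ q * (C $$ (\<sigma> (2 * i), fst q) * C $$ (\<sigma> (2 * i + 1), snd q)))"
        using mult_congr_entry[OF C A(1)] by (simp add: split_beta)
    qed
    also have "\<dots> = (\<Sum>g\<in>{..<n} \<rightarrow>\<^sub>E ?Q. \<Prod>i<n. A $$ g i *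
        (C $$ (\<sigma> (2 * i), fst (g i)) * C $$ (\<sigma> (2 * i + 1), snd (g i))))"
      by (rule prod_sum_PiE) auto
    also have "\<dots> = (\<Sum>g\<in>{..<n} \<rightarrow>\<^sub>E ?Q. W g * (\<Prod>j<?N. C $$ (\<sigma> j, sel g j)))"
      unfolding two W_def by (simp add: prod.distrib sel2 cong: prod.cong_simp)
    finally show ?thesis by (simp add: pf_term_def sum_distrib_left mult_ac)
  qed
  have selN: "sel g j < ?N" if "g \<in> {..<n} \<rightarrow>\<^sub>E ?Q" "j < ?N" for g j
  proof -
    have "g (j div 2) \<in> ?Q" using that by (intro PiE_mem[OF that(1)]) auto
    then show ?thesis using that(2) by (auto simp: sel_def mem_Times_iff)
  qed
  have "(\<Sum>\<sigma> | \<sigma> permutes {0..<?N}. pf_term ?B n \<sigma>) =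
      (\<Sum>g\<in>{..<n} \<rightarrow>\<^sub>E ?Q. \<Sum>\<sigma> | \<sigma> permutes {0..<?N}. W g * (signof \<sigma> * (\<Prod>j<?N. C $$ (\<sigma> j, sel g j))))"
    by (subst sum.swap, rule sum.cong) (auto simp: expand)
  also have "\<dots> = (\<Sum>g\<in>{..<n} \<rightarrow>\<^sub>E ?Q. W g * det (mat ?N ?N (\<lambda>(i, j). C $$ (i, sel g j))))"
    by (intro sum.cong refl, subst sum_distrib_left[symmetric], subst det_map_columns[OF C])
       (auto simp: selN)
  also have "\<dots> = (\<Sum>g\<in>{g \<in> {..<n} \<rightarrow>\<^sub>E ?Q. inj_on (sel g) {0..<?N}}. W g * (signof (sel g) * det C))"
  proof -
    have "finite ({..<n} \<rightarrow>\<^sub>E ?Q)" by (intro finite_PiE) auto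
    moreover have "(\<lambda>j. if j < ?N then sel g j else j) = sel g" for g by (auto simp: sel_def)
    ultimately show ?thesis
      by (intro sum.mono_neutral_cong_right) (auto simp: det_select_columns[OF C selN])
  qed
  also have "\<dots> = (\<Sum>\<sigma> | \<sigma> permutes {0..<?N}. det C * pf_term A n \<sigma>)"
  proof (rule sum.reindex_bij_witness[where i = "\<lambda>\<sigma>. \<lambda>i\<in>{..<n}. (\<sigma> (2 * i), \<sigma> (2 * i + 1))" and j = sel])
    fix g assume g: "g \<in> {g \<in> {..<n} \<rightarrow>\<^sub>E ?Q. inj_on (sel g) {0..<?N}}"
    show "(\<lambda>i\<in>{..<n}. (sel g (2 * i), sel g (2 * i + 1))) = g"
    proof
      fix i show "(\<lambda>i\<in>{..<n}. (sel g (2 * i), sel g (2 * i + 1))) i = g i"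
        using PiE_arb[of g "{..<n}" "\<lambda>_. ?Q" i] g by (cases "i < n") (simp_all add: sel2)
    qed
    have "sel g ` {0..<?N} = {0..<?N}" using g selN by (intro endo_inj_surj) auto
    then have "bij_betw (sel g) {0..<?N} {0..<?N}" using g by (simp add: bij_betw_def)
    then have "sel g permutes {0..<?N}" by (rule bij_imp_permutes) (simp add: sel_def)
    then show "sel g \<in> {\<sigma>. \<sigma> permutes {0..<?N}}" by simp
    show "det C * pf_term A n (sel g) = W g * (signof (sel g) * det C)"
    proof -
      have "(\<Prod>i<n. A $$ (sel g (2 * i), sel g (2 * i + 1))) = W g"
        unfolding W_def by (rule prod.cong[OF refl]) (simp add: sel2)
      then show ?thesis by (simp add: pf_term_def mult_ac)
    qed
  next
    fix \<sigma> assume "\<sigma> \<in> {\<sigma>. \<sigma> permutes {0..<?N}}"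
    then have s: "\<sigma> permutes {0..<?N}" by simp
    have e: "sel (\<lambda>i\<in>{..<n}. (\<sigma> (2 * i), \<sigma> (2 * i + 1))) m = \<sigma> m" for m
      using permutes_not_in[OF s, of m] by (auto simp: sel_def)
    then show "sel (\<lambda>i\<in>{..<n}. (\<sigma> (2 * i), \<sigma> (2 * i + 1))) = \<sigma>" by auto
    then show "(\<lambda>i\<in>{..<n}. (\<sigma> (2 * i), \<sigma> (2 * i + 1))) \<in> {g \<in> {..<n} \<rightarrow>\<^sub>E ?Q. inj_on (sel g) {0..<?N}}"
      using permutes_inj_on[OF s] by (auto intro!: lt[OF s])
  qed
  finally show ?thesis
    unfolding sum_distrib_left[symmetric] pfaffian_all_permutations[OF A] pfaffian_all_permutations[OF B]
    by (simp add: mult.left_commute del: of_nat_mult)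
qed

definition skip :: "nat \<Rightarrow> nat \<Rightarrow> nat" where
  "skip j a = Suc (if a < j then a else Suc a)"

definition minor0 :: "'a mat \<Rightarrow> nat \<Rightarrow> 'a mat" where
  "minor0 A j = mat (dim_row A - 2) (dim_row A - 2) (\<lambda>(a, b). A $$ (skip j a, skip j b))"

definition link :: "nat \<Rightarrow> (nat \<Rightarrow> nat) \<Rightarrow> nat \<Rightarrow> nat" where
  "link j \<tau> = permutation_insert 0 0 (permutation_insert 0 j \<tau>)"

lemma link_simps [simp]: "link j \<tau> 0 = 0" "link j \<tau> (Suc 0) = Suc j" "link j \<tau> (Suc (Suc i)) = skip j (\<tau> i)"
  by (auto simp: link_def permutation_insert_expand skip_def)

lemma skip_less: "skip j a < skip j b \<longleftrightarrow> a < b"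
  by (auto simp: skip_def)

lemma link_image:
  assumes "j < Suc m"
  shows "{\<sigma>. \<sigma> permutes {0..<Suc (Suc m)} \<and> \<sigma> 0 = 0 \<and> \<sigma> 1 = Suc j} = link j ` {\<tau>. \<tau> permutes {0..<m}}"
proof -
  have "{\<sigma>. \<sigma> permutes {0..<Suc (Suc m)} \<and> \<sigma> 0 = 0 \<and> \<sigma> 1 = Suc j} =
      {\<sigma> \<in> permutation_insert 0 0 ` {q. q permutes {0..<Suc m}}. \<sigma> 1 = Suc j}"
    using permutation_fix[of 0 "Suc m" 0] by auto
  also have "\<dots> = permutation_insert 0 0 ` {q. q permutes {0..<Suc m} \<and> q 0 = j}"
    by (auto simp: permutation_insert_expand)
  also have "{q. q permutes {0..<Suc m} \<and> q 0 = j} = permutation_insert 0 j ` {q. q permutes {0..<m}}"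
    using permutation_fix[of 0 m j] assms by simp
  finally show ?thesis by (simp add: image_image link_def)
qed

lemma matchingsD:
  assumes "\<sigma> \<in> matchings n"
  shows "\<sigma> permutes {0..<2 * n}" "\<And>i. i < n \<Longrightarrow> \<sigma> (2 * i) < \<sigma> (2 * i + 1)"
    "\<And>i j. i < j \<Longrightarrow> j < n \<Longrightarrow> \<sigma> (2 * i) < \<sigma> (2 * j)"
  using assms by (simp_all add: matchings_def)

lemma matching_first:
  assumes "\<sigma> \<in> matchings (Suc n)" shows "\<sigma> 0 = 0"
proof -
  have s: "\<sigma> permutes {0..<2 * Suc n}" using assms by (simp add: matchings_def)
  then obtain m where m: "\<sigma> m = 0" "m < 2 * Suc n" using permutes_image[OF s]
    by (metis atLeastLessThan_iff imageE zero_le zero_less_Suc nat_0_less_mult_iff pos2)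
  have "even m"
  proof (rule ccontr)
    assume "odd m"
    then obtain i where "m = 2 * i + 1" by (rule oddE)
    then show False using matchingsD(2)[OF assms, of i] m by simp
  qed
  then obtain i where i: "m = 2 * i" by (rule evenE)
  have "i = 0"
  proof (rule ccontr)
    assume "i \<noteq> 0"
    then show False using matchingsD(3)[OF assms, of 0 i] m i by simp
  qed
  then show ?thesis using m i by simp
qed

lemma matchings_link:
  assumes j: "j < Suc (2 * n)"
  shows "{\<sigma> \<in> matchings (Suc n). \<sigma> 1 = Suc j} = link j ` matchings n"
proof -
  have iff: "link j \<tau> \<in> matchings (Suc n) \<longleftrightarrow> \<tau> \<in> matchings n" if t: "\<tau> permutes {0..<2 * n}" for \<tau>
  proof -
    have "link j \<tau> permutes {0..<2 * Suc n}" using link_image[OF j] t by auto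
    moreover have "(\<forall>i<Suc n. link j \<tau> (2 * i) < link j \<tau> (2 * i + 1)) \<longleftrightarrow> (\<forall>i<n. \<tau> (2 * i) < \<tau> (2 * i + 1))"
      by (subst All_less_Suc2) (simp add: skip_less)
    moreover have "(\<forall>k<Suc n. \<forall>i<k. link j \<tau> (2 * i) < link j \<tau> (2 * k)) \<longleftrightarrow> (\<forall>k<n. \<forall>i<k. \<tau> (2 * i) < \<tau> (2 * k))"
      by (simp add: All_less_Suc2 skip_less) (simp add: skip_def)
    ultimately show ?thesis using t by (simp add: matchings_def)
  qed
  have "{\<sigma> \<in> matchings (Suc n). \<sigma> 1 = Suc j} =
      {\<sigma>. \<sigma> permutes {0..<Suc (Suc (2 * n))} \<and> \<sigma> 0 = 0 \<and> \<sigma> 1 = Suc j} \<inter> matchings (Suc n)"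
    using matching_first by (auto simp: matchings_def)
  also have "\<dots> = link j ` matchings n"
    unfolding link_image[OF j] using iff matchingsD(1) by blast
  finally show ?thesis .
qed

lemma link_inj:
  assumes "j < Suc m" shows "inj_on (link j) {\<tau>. \<tau> permutes {0..<m}}"
proof (rule inj_onI)
  fix \<tau> \<tau>' assume eq: "link j \<tau> = link j \<tau>'"
  have "skip j (\<tau> i) = skip j (\<tau>' i)" for i using fun_cong[OF eq, of "Suc (Suc i)"] by simp
  then have "\<tau> i = \<tau>' i" for i using skip_less[of j "\<tau> i" "\<tau>' i"] skip_less[of j "\<tau>' i" "\<tau> i"]
    by (metis less_irrefl linorder_neqE_nat)
  then show "\<tau> = \<tau>'" by auto
qed

lemma pfaffian_expand:
  assumes A: "A \<in> carrier_mat (2 * Suc n) (2 * Suc n)"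
  shows "pfaffian A = (\<Sum>j<Suc (2 * n). (- 1) ^ j * A $$ (0, Suc j) * pfaffian (minor0 A j))"
proof -
  have fin: "finite (matchings k)" for k
    by (rule finite_subset[OF _ finite_permutations[of "{0..<2 * k}"]]) (auto simp: matchings_def)
  have dim: "minor0 A j \<in> carrier_mat (2 * n) (2 * n)" for j using A by (simp add: minor0_def)
  have un: "matchings (Suc n) = (\<Union>j<Suc (2 * n). {\<sigma> \<in> matchings (Suc n). \<sigma> 1 = Suc j})"
  proof -
    have "\<exists>j<Suc (2 * n). \<sigma> 1 = Suc j" if "\<sigma> \<in> matchings (Suc n)" for \<sigma>
    proof -
      have s: "\<sigma> permutes {0..<2 * Suc n}" using that by (simp add: matchings_def)
      have "\<sigma> 1 < Suc (Suc (2 * n))" using permutes_in_image[OF s, of 1] by simp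
      moreover have "\<sigma> (2 * 0) < \<sigma> (2 * 0 + 1)" by (rule matchingsD(2)[OF that]) simp
      ultimately show ?thesis by (cases "\<sigma> 1") auto
    qed
    then show ?thesis by auto
  qed
  have "pfaffian A = (\<Sum>\<sigma>\<in>(\<Union>j<Suc (2 * n). {\<sigma> \<in> matchings (Suc n). \<sigma> 1 = Suc j}). pf_term A (Suc n) \<sigma>)"
    unfolding pfaffian_matchings[OF A] by (subst un) (rule refl)
  also have "\<dots> = (\<Sum>j<Suc (2 * n). \<Sum>\<sigma>\<in>{\<sigma> \<in> matchings (Suc n). \<sigma> 1 = Suc j}. pf_term A (Suc n) \<sigma>)"
    by (rule sum.UNION_disjoint) (auto simp: fin)
  also have "\<dots> = (\<Sum>j<Suc (2 * n). (- 1) ^ j * A $$ (0, Suc j) * pfaffian (minor0 A j))"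
  proof (rule sum.cong[OF refl])
    fix j assume "j \<in> {..<Suc (2 * n)}"
    then have j: "j < Suc (2 * n)" by simp
    have inj: "inj_on (link j) (matchings n)"
      by (rule inj_on_subset[OF link_inj[OF j]]) (auto simp: matchings_def)
    have "pf_term A (Suc n) (link j \<tau>) = (- 1) ^ j * A $$ (0, Suc j) * pf_term (minor0 A j) n \<tau>"
      if "\<tau> \<in> matchings n" for \<tau>
    proof -
      have t: "\<tau> permutes {0..<2 * n}" using that by (simp add: matchings_def)
      have sg: "(signof (link j \<tau>) :: 'a) = (- 1) ^ j * signof \<tau>"
      proof -
        have "(signof (link j \<tau>) :: 'a) = (- 1) ^ (0 + 0) * signof (permutation_insert 0 j \<tau>)"
          unfolding link_def
          by (rule signof_permutation_insert[OF permutation_insert_permutes[OF t, of 0 j]]) (use j in auto)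
        also have "(signof (permutation_insert 0 j \<tau>) :: 'a) = (- 1) ^ (0 + j) * signof \<tau>"
          by (rule signof_permutation_insert[OF t]) (use j in auto)
        finally show ?thesis by simp
      qed
      have "(\<Prod>i<n. A $$ (skip j (\<tau> (2 * i)), skip j (\<tau> (Suc (2 * i))))) =
          (\<Prod>i<n. minor0 A j $$ (\<tau> (2 * i), \<tau> (2 * i + 1)))"
      proof (rule prod.cong[OF refl])
        fix i assume "i \<in> {..<n}"
        then have "\<tau> (2 * i) < 2 * n" "\<tau> (2 * i + 1) < 2 * n"
          using permutes_in_image[OF t, of "2 * i"] permutes_in_image[OF t, of "2 * i + 1"] by auto
        then show "A $$ (skip j (\<tau> (2 * i)), skip j (\<tau> (Suc (2 * i)))) = minor0 A j $$ (\<tau> (2 * i), \<tau> (2 * i + 1))"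
          using A by (simp add: minor0_def)
      qed
      then show ?thesis unfolding pf_term_def sg by (subst prod.lessThan_Suc_shift) (simp add: mult_ac)
    qed
    then show "(\<Sum>\<sigma>\<in>{\<sigma> \<in> matchings (Suc n). \<sigma> 1 = Suc j}. pf_term A (Suc n) \<sigma>) =
        (- 1) ^ j * A $$ (0, Suc j) * pfaffian (minor0 A j)"
      unfolding matchings_link[OF j] sum.reindex[OF inj] pfaffian_matchings[OF dim]
      by (simp add: sum_distrib_left)
  qed
  finally show ?thesis .
qed

lemma pfaffian_0: "A \<in> carrier_mat 0 0 \<Longrightarrow> pfaffian A = 1"
  using pfaffian_matchings[of A 0] by (simp add: matchings_def pf_term_def sign_id)

lemma minor0_carrier: "A \<in> carrier_mat (Suc (Suc n)) (Suc (Suc n)) \<Longrightarrow> minor0 A j \<in> carrier_mat n n"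
  by (simp add: minor0_def)

lemma minor0_entry: "A \<in> carrier_mat (Suc (Suc n)) (Suc (Suc n)) \<Longrightarrow> a < n \<Longrightarrow> b < n \<Longrightarrow>
   minor0 A j $$ (a, b) = A $$ (skip j a, skip j b)"
  by (simp add: minor0_def)

lemma pfaffian_2:
  assumes A: "A \<in> carrier_mat 2 2" shows "pfaffian A = A $$ (0, 1)"
proof -
  have "minor0 A 0 \<in> carrier_mat 0 0" using A by (simp add: minor0_def)
  then show ?thesis using pfaffian_expand[of A 0] A by (simp add: pfaffian_0)
qed

lemma pfaffian_4:
  assumes A: "A \<in> carrier_mat 4 4"
  shows "pfaffian A = A $$ (0, 1) * A $$ (2, 3) - A $$ (0, 2) * A $$ (1, 3) + A $$ (0, 3) * A $$ (1, 2)"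
proof -
  have "minor0 A j \<in> carrier_mat 2 2" for j using A by (simp add: minor0_def)
  then have m: "pfaffian (minor0 A j) = A $$ (skip j 0, skip j 1)" for j
    using A by (subst pfaffian_2) (auto simp: minor0_def)
  have "pfaffian A = (\<Sum>j<3. (- 1) ^ j * A $$ (0, Suc j) * A $$ (skip j 0, skip j 1))"
    using pfaffian_expand[of A 1] A by (simp add: m)
  then show ?thesis by (simp add: lessThan_nat_numeral lessThan_Suc skip_def numeral_eq_Suc)
qed

definition pf6 :: "(nat \<Rightarrow> nat \<Rightarrow> 'a::comm_ring_1) \<Rightarrow> 'a" where
  "pf6 m = m 0 1 * (m 2 3 * m 4 5 - m 2 4 * m 3 5 + m 2 5 * m 3 4)
    - m 0 2 * (m 1 3 * m 4 5 - m 1 4 * m 3 5 + m 1 5 * m 3 4)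
    + m 0 3 * (m 1 2 * m 4 5 - m 1 4 * m 2 5 + m 1 5 * m 2 4)
    - m 0 4 * (m 1 2 * m 3 5 - m 1 3 * m 2 5 + m 1 5 * m 2 3)
    + m 0 5 * (m 1 2 * m 3 4 - m 1 3 * m 2 4 + m 1 4 * m 2 3)"

lemma pfaffian_6:
  assumes A: "A \<in> carrier_mat 6 6"
  shows "pfaffian A = pf6 (\<lambda>i j. A $$ (i, j))"
proof -
  have "minor0 A j \<in> carrier_mat 4 4" for j using A by (simp add: minor0_def)
  then have m: "pfaffian (minor0 A j) = A $$ (skip j 0, skip j 1) * A $$ (skip j 2, skip j 3)
      - A $$ (skip j 0, skip j 2) * A $$ (skip j 1, skip j 3)
      + A $$ (skip j 0, skip j 3) * A $$ (skip j 1, skip j 2)" for j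
    using A by (subst pfaffian_4) (auto simp: minor0_def)
  have "pfaffian A = (\<Sum>j<5. (- 1) ^ j * A $$ (0, Suc j) * pfaffian (minor0 A j))"
    using pfaffian_expand[of A 2] A by simp
  then show ?thesis
    by (simp add: m pf6_def lessThan_nat_numeral lessThan_Suc skip_def numeral_eq_Suc)
qed

text \<open>The derivative of the Pfaffian at \<open>m\<close> in the direction \<open>n\<close>.\<close>

definition dpf6 :: "(nat \<Rightarrow> nat \<Rightarrow> 'a::comm_ring_1) \<Rightarrow> (nat \<Rightarrow> nat \<Rightarrow> 'a) \<Rightarrow> 'a" where
  "dpf6 m n =
      n 0 1 * (m 2 3 * m 4 5 - m 2 4 * m 3 5 + m 2 5 * m 3 4)
    - n 0 2 * (m 1 3 * m 4 5 - m 1 4 * m 3 5 + m 1 5 * m 3 4)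
    + n 0 3 * (m 1 2 * m 4 5 - m 1 4 * m 2 5 + m 1 5 * m 2 4)
    - n 0 4 * (m 1 2 * m 3 5 - m 1 3 * m 2 5 + m 1 5 * m 2 3)
    + n 0 5 * (m 1 2 * m 3 4 - m 1 3 * m 2 4 + m 1 4 * m 2 3)
    + n 1 2 * (m 0 3 * m 4 5 - m 0 4 * m 3 5 + m 0 5 * m 3 4)
    - n 1 3 * (m 0 2 * m 4 5 - m 0 4 * m 2 5 + m 0 5 * m 2 4)
    + n 1 4 * (m 0 2 * m 3 5 - m 0 3 * m 2 5 + m 0 5 * m 2 3)
    - n 1 5 * (m 0 2 * m 3 4 - m 0 3 * m 2 4 + m 0 4 * m 2 3)
    + n 2 3 * (m 0 1 * m 4 5 - m 0 4 * m 1 5 + m 0 5 * m 1 4)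
    - n 2 4 * (m 0 1 * m 3 5 - m 0 3 * m 1 5 + m 0 5 * m 1 3)
    + n 2 5 * (m 0 1 * m 3 4 - m 0 3 * m 1 4 + m 0 4 * m 1 3)
    + n 3 4 * (m 0 1 * m 2 5 - m 0 2 * m 1 5 + m 0 5 * m 1 2)
    - n 3 5 * (m 0 1 * m 2 4 - m 0 2 * m 1 4 + m 0 4 * m 1 2)
    + n 4 5 * (m 0 1 * m 2 3 - m 0 2 * m 1 3 + m 0 3 * m 1 2)"

lemma pfaffian_8:
  assumes A: "A \<in> carrier_mat 8 8"
  defines "m \<equiv> \<lambda>i j. A $$ (i + 2, j + 2)"
  shows "pfaffian A = A $$ (0, 1) * pf6 m -
    dpf6 m (\<lambda>i j. A $$ (0, i + 2) * A $$ (1, j + 2) - A $$ (1, i + 2) * A $$ (0, j + 2))"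
proof -
  have "minor0 A j \<in> carrier_mat 6 6" for j using A by (simp add: minor0_def)
  then have pm: "pfaffian (minor0 A j) = pf6 (\<lambda>a b. A $$ (skip j a, skip j b))" for j
    using A by (subst pfaffian_6) (auto simp: minor0_def pf6_def)
  have "pfaffian A = (\<Sum>j<7. (- 1) ^ j * A $$ (0, Suc j) * pfaffian (minor0 A j))"
    using pfaffian_expand[of A 3] A by simp
  also have "\<dots> = A $$ (0, 1) * pf6 m -
    dpf6 m (\<lambda>i j. A $$ (0, i + 2) * A $$ (1, j + 2) - A $$ (1, i + 2) * A $$ (0, j + 2))"
    unfolding pm by (simp add: pf6_def dpf6_def m_def lessThan_nat_numeral lessThan_Suc skip_def numeral_eq_Suc)
       (simp add: algebra_simps)
  finally show ?thesis .
qed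

definition mp :: "nat \<Rightarrow> (nat \<Rightarrow> nat \<Rightarrow> 'a::comm_ring_1) \<Rightarrow> (nat \<Rightarrow> nat \<Rightarrow> 'a) \<Rightarrow> nat \<Rightarrow> nat \<Rightarrow> 'a" where
  "mp n A B i j = (\<Sum>l<n. A i l * B l j)"

definition dl :: "nat \<Rightarrow> nat \<Rightarrow> 'a::comm_ring_1" where
  "dl i j = (if i = j then 1 else 0)"

definition inverses :: "nat \<Rightarrow> (nat \<Rightarrow> nat \<Rightarrow> 'a::comm_ring_1) \<Rightarrow> (nat \<Rightarrow> nat \<Rightarrow> 'a) \<Rightarrow> bool" where
  "inverses n k k' \<longleftrightarrow> (\<forall>i<n. \<forall>j<n. mp n k k' i j = dl i j \<and> mp n k' k i j = dl i j)"

lemma mp_assoc: "mp n (mp m A B) C i j = mp m A (mp n B C) i j"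
  unfolding mp_def sum_distrib_left sum_distrib_right
  by (subst sum.swap) (simp add: mult.assoc)

lemma mp_cong: "(\<And>l. l < n \<Longrightarrow> A i l = A' i l) \<Longrightarrow> (\<And>l. l < n \<Longrightarrow> B l j = B' l j) \<Longrightarrow> mp n A B i j = mp n A' B' i j"
  unfolding mp_def by (intro sum.cong) auto

lemma mp_dl_left: "i < n \<Longrightarrow> mp n dl B i j = B i j"
  and mp_dl_right: "j < n \<Longrightarrow> mp n A dl i j = A i j"
  by (auto simp: mp_def dl_def if_distrib[of "\<lambda>x. x * _"] if_distrib[of "\<lambda>x. _ * x"] cong: if_cong)

lemma inverses_commute: "inverses n k k' \<Longrightarrow> inverses n k' k"
  by (auto simp: inverses_def)

lemma inverses_transpose: "inverses n k k' \<Longrightarrow> inverses n (\<lambda>i j. k' j i) (\<lambda>i j. k j i)"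
  by (auto simp: inverses_def mp_def dl_def mult.commute)

lemma inverses_dl: "inverses n dl dl"
  by (simp add: inverses_def mp_dl_left)

lemma inverses_mp:
  assumes "inverses n k k'" "inverses n h h'"
  shows "inverses n (mp n k h) (mp n h' k')"
proof -
  have "mp n (mp n k h) (mp n h' k') i j = dl i j" if "i < n" "j < n"
    and "inverses n k k'" "inverses n h h'" for i j and k k' h h' :: "nat \<Rightarrow> nat \<Rightarrow> 'a"
  proof -
    have "mp n (mp n k h) (mp n h' k') i j = mp n k (mp n (mp n h h') k') i j"
      unfolding mp_assoc by (intro mp_cong) (auto simp: mp_assoc)
    also have "\<dots> = mp n k (mp n dl k') i j"
      using that by (intro mp_cong refl) (auto simp: inverses_def)
    also have "\<dots> = mp n k k' i j" by (intro mp_cong refl) (auto simp: mp_dl_left)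
    finally show ?thesis using that by (simp add: inverses_def)
  qed
  from this[OF _ _ assms] this[OF _ _ inverses_commute[OF assms(2)] inverses_commute[OF assms(1)]]
  show ?thesis unfolding inverses_def by blast
qed

definition rank_one :: "(nat \<Rightarrow> 'a) \<Rightarrow> (nat \<Rightarrow> 'a) \<Rightarrow> nat \<Rightarrow> nat \<Rightarrow> 'a::comm_ring_1" where
  "rank_one a b i j = dl i j + a i * b j"

lemma mp_rank_one:
  "i < n \<Longrightarrow> mp n (rank_one a b) Z i j = Z i j + a i * (\<Sum>l<n. b l * Z l j)"
  "j < n \<Longrightarrow> mp n Z (rank_one a b) i j = Z i j + (\<Sum>l<n. Z i l * a l) * b j"
proof -
  have "mp n (rank_one a b) Z i j = mp n dl Z i j + a i * (\<Sum>l<n. b l * Z l j)"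
    by (simp add: mp_def rank_one_def distrib_right sum.distrib sum_distrib_left mult.assoc)
  then show "i < n \<Longrightarrow> mp n (rank_one a b) Z i j = Z i j + a i * (\<Sum>l<n. b l * Z l j)"
    by (simp add: mp_dl_left)
  have "mp n Z (rank_one a b) i j = mp n Z dl i j + (\<Sum>l<n. Z i l * a l) * b j"
    by (simp add: mp_def rank_one_def distrib_left sum.distrib sum_distrib_right mult.assoc)
  then show "j < n \<Longrightarrow> mp n Z (rank_one a b) i j = Z i j + (\<Sum>l<n. Z i l * a l) * b j"
    by (simp add: mp_dl_right)
qed

lemma inverses_rank_one:
  fixes a b :: "nat \<Rightarrow> 'a::field"
  assumes "1 + (\<Sum>l<n. b l * a l) \<noteq> 0" (is "1 + ?d \<noteq> 0")
  shows "\<exists>k'. inverses n (rank_one a b) k'"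
proof -
  have "1 + (- 1 / (1 + ?d)) + (- 1 / (1 + ?d)) * ?d = 0" using assms by (simp add: field_simps)
  then obtain s where s: "1 + s + s * ?d = 0" by blast
  let ?k' = "rank_one (\<lambda>i. s * a i) b"
  have m: "(\<Sum>l<n. b l * rank_one a b l j) = b j + ?d * b j" if "j < n" for j
  proof -
    have "(\<Sum>l<n. b l * rank_one a b l j) = mp n (\<lambda>_. b) (rank_one a b) 0 j" by (simp add: mp_def)
    then show ?thesis using mp_rank_one(2)[OF that] by simp
  qed
  have m': "(\<Sum>l<n. b l * ?k' l j) = b j + s * ?d * b j" if "j < n" for j
  proof -
    have "(\<Sum>l<n. b l * ?k' l j) = mp n (\<lambda>_. b) ?k' 0 j" by (simp add: mp_def)
    also have "\<dots> = b j + (\<Sum>l<n. b l * (s * a l)) * b j" by (rule mp_rank_one(2)[OF that])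
    also have "(\<Sum>l<n. b l * (s * a l)) = s * ?d" unfolding sum_distrib_left by (intro sum.cong) auto
    finally show ?thesis .
  qed
  have "mp n (rank_one a b) ?k' i j = dl i j" if "i < n" "j < n" for i j
  proof -
    have "mp n (rank_one a b) ?k' i j = dl i j + (1 + s + s * ?d) * (a i * b j)"
      unfolding mp_rank_one(1)[OF that(1)] m'[OF that(2)] by (simp add: rank_one_def algebra_simps)
    then show ?thesis by (simp only: s) simp
  qed
  moreover have "mp n ?k' (rank_one a b) i j = dl i j" if "i < n" "j < n" for i j
  proof -
    have "mp n ?k' (rank_one a b) i j = dl i j + (1 + s + s * ?d) * (a i * b j)"
      unfolding mp_rank_one(1)[OF that(1)] m[OF that(2)] by (simp add: rank_one_def algebra_simps)
    then show ?thesis by (simp only: s) simp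
  qed
  ultimately show ?thesis unfolding inverses_def by blast
qed

definition equivalent :: "nat \<Rightarrow> nat \<Rightarrow> (nat \<Rightarrow> nat \<Rightarrow> 'a::field) \<Rightarrow> (nat \<Rightarrow> nat \<Rightarrow> 'a) \<Rightarrow> bool" where
  "equivalent m n Z Z' \<longleftrightarrow> (\<exists>k k' g g'. inverses m k k' \<and> inverses n g g' \<and>
     (\<forall>i<m. \<forall>j<n. mp m k (mp n Z g) i j = Z' i j))"

lemma equivalent_trans:
  assumes "equivalent m n Z Z'" "equivalent m n Z' Z''"
  shows "equivalent m n Z Z''"
proof -
  obtain k k' g g' where 1: "inverses m k k'" "inverses n g g'"
    "\<And>i j. i < m \<Longrightarrow> j < n \<Longrightarrow> mp m k (mp n Z g) i j = Z' i j"
    using assms(1) unfolding equivalent_def by blast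
  obtain h h' f f' where 2: "inverses m h h'" "inverses n f f'"
    "\<And>i j. i < m \<Longrightarrow> j < n \<Longrightarrow> mp m h (mp n Z' f) i j = Z'' i j"
    using assms(2) unfolding equivalent_def by blast
  have "mp m (mp m h k) (mp n Z (mp n g f)) i j = Z'' i j" if "i < m" "j < n" for i j
  proof -
    have "mp m (mp m h k) (mp n Z (mp n g f)) i j = mp m h (mp n (mp m k (mp n Z g)) f) i j"
      unfolding mp_assoc by (intro mp_cong refl)
    also have "\<dots> = mp m h (mp n Z' f) i j"
      using that 1(3) by (intro mp_cong refl) auto
    finally show ?thesis using 2(3)[OF that] by simp
  qed
  then show ?thesis unfolding equivalent_def
    using inverses_mp[OF 2(1) 1(1)] inverses_mp[OF 1(2) 2(2)] by blast
qed

lemma equivalent_row: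
  assumes "1 + (\<Sum>l<m. b l * a l) \<noteq> 0"
    "\<And>i j. i < m \<Longrightarrow> j < n \<Longrightarrow> Z' i j = Z i j + a i * (\<Sum>l<m. b l * Z l j)"
  shows "equivalent m n Z Z'"
proof -
  obtain k' where k: "inverses m (rank_one a b) k'" using inverses_rank_one[OF assms(1)] by blast
  have "mp m (rank_one a b) (mp n Z dl) i j = Z' i j" if "i < m" "j < n" for i j
  proof -
    have "mp m (rank_one a b) (mp n Z dl) i j = mp m (rank_one a b) Z i j"
      using that by (intro mp_cong refl) (simp add: mp_dl_right)
    then show ?thesis using that assms(2) by (simp add: mp_rank_one)
  qed
  then show ?thesis using k inverses_dl unfolding equivalent_def by blast
qed

lemma equivalent_col:
  assumes "1 + (\<Sum>l<n. b l * a l) \<noteq> 0"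
    "\<And>i j. i < m \<Longrightarrow> j < n \<Longrightarrow> Z' i j = Z i j + (\<Sum>l<n. Z i l * a l) * b j"
  shows "equivalent m n Z Z'"
proof -
  obtain k' where k: "inverses n (rank_one a b) k'" using inverses_rank_one[OF assms(1)] by blast
  have "mp m dl (mp n Z (rank_one a b)) i j = Z' i j" if "i < m" "j < n" for i j
    using that assms(2) by (simp add: mp_dl_left mp_rank_one)
  then show ?thesis using k inverses_dl unfolding equivalent_def by blast
qed

lemma equivalent_eq:
  "(\<And>i j. i < m \<Longrightarrow> j < n \<Longrightarrow> Z' i j = Z i j) \<Longrightarrow> equivalent m n Z Z'"
  by (rule equivalent_row[where a = "\<lambda>_. 0" and b = "\<lambda>_. 0"]) auto

lemma sum_dl [simp]:
  "i < n \<Longrightarrow> (\<Sum>l<n. dl i l * f l) = f i" "i < n \<Longrightarrow> (\<Sum>l<n. dl l i * f l) = f i"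
  "i < n \<Longrightarrow> (\<Sum>l<n. f l * dl l i) = f i" "i < n \<Longrightarrow> (\<Sum>l<n. f l * dl i l) = f i"
  by (auto simp: dl_def if_distrib[of "\<lambda>x. x * _"] if_distrib[of "\<lambda>x. _ * x"] cong: if_cong)

text \<open>One elimination step: the leading \<open>s \<times> s\<close> block is already the identity.\<close>

lemma elimination_step:
  fixes Z :: "nat \<Rightarrow> nat \<Rightarrow> 'a::field"
  assumes st: "\<And>i j. i < m \<Longrightarrow> j < n \<Longrightarrow> i < s \<or> j < s \<Longrightarrow> Z i j = dl i j"
    and p: "s \<le> p" "p < m" "s \<le> q" "q < n" "Z p q \<noteq> 0"
  shows "\<exists>Z'. equivalent m n Z Z' \<and>
    (\<forall>i<m. \<forall>j<n. i < Suc s \<or> j < Suc s \<longrightarrow> Z' i j = dl i j)"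
proof -
  have sm: "s < m" "s < n" using p by auto
  define c where "c = (\<lambda>i. Z i q)"
  define b where "b = (\<lambda>i. if c s \<noteq> 0 then dl i s / c s else dl i p / c p + dl i s)"
  define a where "a = (\<lambda>i. dl i s - c i)"
  have cp: "c p \<noteq> 0" using p by (simp add: c_def)
  have bc: "(\<Sum>l<m. b l * c l) = 1"
  proof (cases "c s = 0")
    case True
    then have "(\<Sum>l<m. b l * c l) = (\<Sum>l<m. dl l p * (c l / c p)) + (\<Sum>l<m. dl l s * c l)"
      by (simp add: b_def distrib_right sum.distrib)
    then show ?thesis using True cp sm p by (simp del: times_divide_eq_right)
  next
    case False
    then have "(\<Sum>l<m. b l * c l) = (\<Sum>l<m. dl l s * (c l / c s))" by (simp add: b_def)
    then show ?thesis using False sm by (simp del: times_divide_eq_right)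
  qed
  have bs: "b s \<noteq> 0" using cp by (cases "s = p") (auto simp: b_def dl_def)
  have b0: "b i = 0" if "i < s" for i using that p by (auto simp: b_def dl_def)
  have "(\<Sum>l<m. b l * a l) = (\<Sum>l<m. b l * dl l s) - (\<Sum>l<m. b l * c l)"
    by (simp add: a_def right_diff_distrib sum_subtractf)
  then have "1 + (\<Sum>l<m. b l * a l) \<noteq> 0" using bc bs sm by simp
  define Z1 where "Z1 = (\<lambda>i j. Z i j + a i * (\<Sum>l<m. b l * Z l j))"
  have e1: "equivalent m n Z Z1" by (rule equivalent_row[OF \<open>1 + _ \<noteq> 0\<close>]) (simp add: Z1_def)
  have a0: "a i = 0" if "i < s" for i using that p sm st[of i q] by (auto simp: a_def c_def dl_def)
  have z1: "Z1 i j = dl i j" if "i < m" "j < n" "i < s \<or> j < s" for i j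
  proof (cases "i < s")
    case True then show ?thesis using that st a0 by (simp add: Z1_def)
  next
    case False
    then have j: "j < s" "j < m" using that sm by auto
    have "(\<Sum>l<m. b l * Z l j) = (\<Sum>l<m. b l * dl l j)" using that j st by (intro sum.cong) auto
    then show ?thesis using j b0 that st by (simp add: Z1_def)
  qed
  have z1q: "Z1 i q = dl i s" if "i < m" for i
    using bc by (simp add: Z1_def c_def a_def)
  define x where "x = (\<lambda>i. dl i q - dl i s :: 'a)"
  define Z2 where "Z2 = (\<lambda>i j. if s = q then Z1 i j else Z1 i j + (\<Sum>l<n. Z1 i l * x l) * (- x j))"
  have sx: "(\<Sum>l<n. Z1 i l * x l) = Z1 i q - Z1 i s" for i
    using sm p by (simp add: x_def right_diff_distrib sum_subtractf)
  have e2: "equivalent m n Z1 Z2"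
  proof (cases "s = q")
    case True
    have "equivalent m n Z1 Z1" by (rule equivalent_eq) simp
    then show ?thesis using True by (simp add: Z2_def)
  next
    case False
    have "(\<Sum>l<n. - x l * x l) = (\<Sum>l<n. - dl q l * x l) + (\<Sum>l<n. dl s l * x l)"
      by (simp add: x_def dl_def left_diff_distrib sum.distrib[symmetric] eq_commute)
    also have "\<dots> = - 2" using False sm p by (simp add: sum_negf) (simp add: x_def dl_def)
    finally show ?thesis using False
      by (intro equivalent_col[where b = "\<lambda>i. - x i" and a = x]) (auto simp: Z2_def)
  qed
  have z2: "Z2 i j = dl i j" if "i < m" "j < n" "i < s \<or> j < s" for i j
  proof (cases "j < s")
    case True then show ?thesis using that z1 p by (simp add: Z2_def x_def dl_def)
  next
    case False
    then have i: "i < s" using that by simp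
    then have "Z1 i q = 0" "Z1 i s = 0" using z1 sm p that by (auto simp: dl_def)
    then show ?thesis using z1[OF that] by (simp add: Z2_def sx)
  qed
  have xs: "s \<noteq> q \<Longrightarrow> x s = - 1" by (simp add: x_def dl_def)
  have z2s: "Z2 i s = dl i s" if "i < m" for i
    using z1q[OF that] xs by (cases "s = q") (simp_all add: Z2_def sx)
  define y where "y = (\<lambda>j. dl s j - Z2 s j)"
  define Z3 where "Z3 = (\<lambda>i j. Z2 i j + (\<Sum>l<n. Z2 i l * dl l s) * y j)"
  have ys: "y s = 0" using z2s[of s] sm by (simp add: y_def)
  have e3: "equivalent m n Z2 Z3"
    by (rule equivalent_col[where b = y and a = "\<lambda>l. dl l s"]) (use ys sm in \<open>auto simp: Z3_def\<close>)
  have z3: "Z3 i j = Z2 i j + dl i s * y j" if "i < m" for i j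
    using sm z2s[OF that] by (simp add: Z3_def)
  have "Z3 i j = dl i j" if ij: "i < m" "j < n" "i < Suc s \<or> j < Suc s" for i j
  proof -
    consider "i = s" | "i \<noteq> s" "j = s" | "i \<noteq> s" "j \<noteq> s" "i < s \<or> j < s"
      using ij by linarith
    then show ?thesis
    proof cases
      case 1 then show ?thesis using z3[OF ij(1), of j] by (simp add: y_def) (simp add: dl_def)
    next
      case 2 then show ?thesis using z3[OF ij(1)] z2s[OF ij(1)] ys by simp
    next
      case 3 then show ?thesis using z3[OF ij(1)] z2[OF ij(1,2)] by (simp add: dl_def)
    qed
  qed
  then show ?thesis using equivalent_trans[OF e1 equivalent_trans[OF e2 e3]] by blast
qed

theorem rank_normal_form:
  fixes Z :: "nat \<Rightarrow> nat \<Rightarrow> 'a::field"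
  shows "\<exists>r. r \<le> m \<and> r \<le> n \<and> equivalent m n Z (\<lambda>i j. if i < r then dl i j else 0)"
proof -
  have "\<exists>r. r \<le> m \<and> r \<le> n \<and> equivalent m n Z (\<lambda>i j. if i < r then dl i j else 0)"
    if "s \<le> m" "s \<le> n" "\<And>i j. i < m \<Longrightarrow> j < n \<Longrightarrow> i < s \<or> j < s \<Longrightarrow> Z i j = dl i j" for s Z
    using that
  proof (induction "m - s" arbitrary: s Z)
    case (0 s Z)
    then show ?case by (intro exI[of _ s] conjI equivalent_eq) auto
  next
    case (Suc d s Z)
    show ?case
    proof (cases "\<exists>p q. s \<le> p \<and> p < m \<and> s \<le> q \<and> q < n \<and> Z p q \<noteq> 0")
      case True
      then obtain p q where pq: "s \<le> p" "p < m" "s \<le> q" "q < n" "Z p q \<noteq> 0" by blast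
      obtain Z' where Z': "equivalent m n Z Z'"
        "\<And>i j. i < m \<Longrightarrow> j < n \<Longrightarrow> i < Suc s \<or> j < Suc s \<Longrightarrow> Z' i j = dl i j"
        using elimination_step[where Z = Z and s = s, OF Suc.prems(3) pq] by blast
      have "\<exists>r. r \<le> m \<and> r \<le> n \<and> equivalent m n Z' (\<lambda>i j. if i < r then dl i j else 0)"
        by (rule Suc.hyps(1)[of "Suc s"]) (use Suc.hyps(2) pq Z'(2) in auto)
      then show ?thesis using equivalent_trans[OF Z'(1)] by blast
    next
      case False
      have "Z i j = (if i < s then dl i j else 0)" if "i < m" "j < n" for i j
      proof (cases "i < s \<or> j < s")
        case True then show ?thesis using Suc.prems(3)[OF that] that by (auto simp: dl_def)
      next
        case F: False then show ?thesis using False that by auto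
      qed
      then show ?thesis using Suc.prems(1,2)
        by (intro exI[of _ s] conjI equivalent_eq) auto
    qed
  qed
  from this[of 0] show ?thesis by simp
qed

type_synonym pt = "nat \<Rightarrow> complex"

definition lin :: "(pt \<Rightarrow> complex) \<Rightarrow> bool" where
  "lin f \<longleftrightarrow> (\<exists>c. \<forall>x. f x = (\<Sum>k<5. c k * x k))"

definition quad :: "(pt \<Rightarrow> complex) \<Rightarrow> bool" where
  "quad f \<longleftrightarrow> (\<exists>c. \<forall>x. f x = (\<Sum>a<5. \<Sum>b<5. c a b * (x a * x b)))"

definition cub :: "(pt \<Rightarrow> complex) \<Rightarrow> bool" where
  "cub f \<longleftrightarrow> (\<exists>c. \<forall>x. f x = (\<Sum>a<5. \<Sum>b<5. \<Sum>d<5. c a b d * (x a * x b * x d)))"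

lemma lin_0 [simp]: "lin (\<lambda>x. 0)" unfolding lin_def by (intro exI[of _ "\<lambda>_. 0"]) simp

lemma lin_coord: "k < 5 \<Longrightarrow> lin (\<lambda>x. x k)"
  unfolding lin_def by (intro exI[of _ "dl k"]) simp

lemma lin_cmult: "lin f \<Longrightarrow> lin (\<lambda>x. c * f x)"
  unfolding lin_def by (elim exE, rule_tac x = "\<lambda>k. c * ca k" in exI) (simp add: sum_distrib_left mult_ac)

lemma lin_plus: "lin f \<Longrightarrow> lin g \<Longrightarrow> lin (\<lambda>x. f x + g x)"
  unfolding lin_def by (elim exE, rule_tac x = "\<lambda>k. c k + ca k" in exI) (simp add: sum.distrib distrib_right)

lemma lin_uminus: "lin f \<Longrightarrow> lin (\<lambda>x. - f x)" using lin_cmult[of f "- 1"] by simp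

lemma lin_minus: "lin f \<Longrightarrow> lin g \<Longrightarrow> lin (\<lambda>x. f x - g x)"
  using lin_plus[OF _ lin_uminus, of f g] by simp

lemma lin_multc: "lin f \<Longrightarrow> lin (\<lambda>x. f x * c)" using lin_cmult[of f c] by (simp add: mult.commute)

lemma lin_sum: "(\<And>i. i \<in> S \<Longrightarrow> lin (f i)) \<Longrightarrow> lin (\<lambda>x. \<Sum>i\<in>S. f i x)"
  by (induction S rule: infinite_finite_induct) (auto intro: lin_plus)

lemma lin_add: "lin f \<Longrightarrow> f (\<lambda>k. x k + y k) = f x + f y"
  unfolding lin_def by (auto simp: sum.distrib distrib_left)

lemma lin_scale: "lin f \<Longrightarrow> f (\<lambda>k. t * x k) = t * f x"
  unfolding lin_def by (auto simp: sum_distrib_left mult_ac)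

lemma lin_axes: "lin f \<Longrightarrow> f x = (\<Sum>k<5. f (dl k) * x k)"
  unfolding lin_def by auto

lemma lin_axes_zero: "lin f \<Longrightarrow> (\<And>k. k < 5 \<Longrightarrow> f (dl k) = 0) \<Longrightarrow> f x = 0"
  by (subst lin_axes) auto

lemma quad_0 [simp]: "quad (\<lambda>x. 0)" unfolding quad_def by (intro exI[of _ "\<lambda>_ _. 0"]) simp

lemma quad_plus: "quad f \<Longrightarrow> quad g \<Longrightarrow> quad (\<lambda>x. f x + g x)"
  unfolding quad_def by (elim exE, rule_tac x = "\<lambda>k l. c k l + ca k l" in exI) (simp add: sum.distrib distrib_right)

lemma quad_cmult: "quad f \<Longrightarrow> quad (\<lambda>x. c * f x)"
  unfolding quad_def by (elim exE, rule_tac x = "\<lambda>k l. c * ca k l" in exI) (simp add: sum_distrib_left mult_ac)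

lemma quad_minus: "quad f \<Longrightarrow> quad g \<Longrightarrow> quad (\<lambda>x. f x - g x)"
  using quad_plus[OF _ quad_cmult[of g "- 1"], of f] by simp

lemma quad_sum: "(\<And>i. i \<in> S \<Longrightarrow> quad (f i)) \<Longrightarrow> quad (\<lambda>x. \<Sum>i\<in>S. f i x)"
  by (induction S rule: infinite_finite_induct) (auto intro: quad_plus)

lemma quad_mult: assumes "lin f" "lin g" shows "quad (\<lambda>x. f x * g x)"
proof -
  obtain c d where "\<And>x. f x = (\<Sum>k<5. c k * x k)" "\<And>x. g x = (\<Sum>k<5. d k * x k)"
    using assms unfolding lin_def by blast
  then show ?thesis unfolding quad_def
    by (intro exI[of _ "\<lambda>a b. c a * d b"]) (simp add: sum_product mult_ac)
qed

lemma cub_0 [simp]: "cub (\<lambda>x. 0)" unfolding cub_def by (intro exI[of _ "\<lambda>_ _ _. 0"]) simp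

lemma cub_plus: "cub f \<Longrightarrow> cub g \<Longrightarrow> cub (\<lambda>x. f x + g x)"
  unfolding cub_def by (elim exE, rule_tac x = "\<lambda>k l m. c k l m + ca k l m" in exI) (simp add: sum.distrib distrib_right)

lemma cub_cmult: "cub f \<Longrightarrow> cub (\<lambda>x. c * f x)"
  unfolding cub_def by (elim exE, rule_tac x = "\<lambda>k l m. c * ca k l m" in exI) (simp add: sum_distrib_left mult_ac)

lemma cub_minus: "cub f \<Longrightarrow> cub g \<Longrightarrow> cub (\<lambda>x. f x - g x)"
  using cub_plus[OF _ cub_cmult[of g "- 1"], of f] by simp

lemma cub_sum: "(\<And>i. i \<in> S \<Longrightarrow> cub (f i)) \<Longrightarrow> cub (\<lambda>x. \<Sum>i\<in>S. f i x)"
  by (induction S rule: infinite_finite_induct) (auto intro: cub_plus)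

lemma cub_mult: assumes "quad f" "lin g" shows "cub (\<lambda>x. f x * g x)"
proof -
  obtain c d where "\<And>x. f x = (\<Sum>a<5. \<Sum>b<5. c a b * (x a * x b))" "\<And>x. g x = (\<Sum>k<5. d k * x k)"
    using assms unfolding lin_def quad_def by blast
  then show ?thesis unfolding cub_def
    by (intro exI[of _ "\<lambda>a b e. c a b * d e"]) (simp add: sum_distrib_right sum_distrib_left mult_ac)
qed

lemma cub_mult': "lin f \<Longrightarrow> quad g \<Longrightarrow> cub (\<lambda>x. f x * g x)"
  using cub_mult[of g f] by (simp add: mult.commute)

lemma cub_mult3: "lin f \<Longrightarrow> lin g \<Longrightarrow> lin h \<Longrightarrow> cub (\<lambda>x. f x * (g x * h x))"
  by (intro cub_mult' quad_mult)

definition app :: "(nat \<Rightarrow> nat \<Rightarrow> complex) \<Rightarrow> pt \<Rightarrow> pt" where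
  "app g x = (\<lambda>i. \<Sum>l<5. g i l * x l)"

lemma lin_app: "lin f \<Longrightarrow> lin (\<lambda>x. f (app g x))"
  unfolding lin_def[of f] app_def by (auto intro!: lin_sum lin_cmult lin_coord)

lemma quad_app: "quad f \<Longrightarrow> quad (\<lambda>x. f (app g x))"
  unfolding quad_def[of f] app_def by (auto intro!: quad_sum quad_cmult quad_mult lin_sum lin_cmult lin_coord)

lemma cub_app: "cub f \<Longrightarrow> cub (\<lambda>x. f (app g x))"
  unfolding cub_def[of f] app_def
  by (auto intro!: cub_sum cub_cmult cub_mult quad_mult lin_sum lin_cmult lin_coord)

lemma app_app:
  assumes "inverses 5 g g'" "k < 5" shows "app g (app g' x) k = x k"
proof -
  have "app g (app g' x) k = mp 5 g (mp 5 g' (\<lambda>l _. x l)) k 0" by (simp add: app_def mp_def)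
  also have "\<dots> = mp 5 (mp 5 g g') (\<lambda>l _. x l) k 0" by (simp add: mp_assoc)
  also have "\<dots> = mp 5 dl (\<lambda>l _. x l) k 0" using assms by (intro mp_cong refl) (auto simp: inverses_def)
  finally show ?thesis using assms by (simp add: mp_dl_left)
qed

lemma lin_app_app: "inverses 5 g g' \<Longrightarrow> lin f \<Longrightarrow> f (app g (app g' x)) = f x"
  unfolding lin_def by (auto simp: app_app)

lemma cub_app_app: "inverses 5 g g' \<Longrightarrow> cub f \<Longrightarrow> f (app g (app g' x)) = f x"
  unfolding cub_def by (auto simp: app_app)

text \<open>Skew matrices\<close>

definition skew6 :: "(nat \<Rightarrow> nat \<Rightarrow> complex) \<Rightarrow> bool" where
  "skew6 m \<longleftrightarrow> (\<forall>i<6. \<forall>j<6. m j i = - m i j)"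

definition skewl :: "(nat \<Rightarrow> nat \<Rightarrow> pt \<Rightarrow> complex) \<Rightarrow> bool" where
  "skewl M \<longleftrightarrow> (\<forall>i<6. \<forall>j<6. lin (M i j) \<and> (\<forall>x. M j i x = - M i j x))"

abbreviation val :: "(nat \<Rightarrow> nat \<Rightarrow> pt \<Rightarrow> complex) \<Rightarrow> pt \<Rightarrow> nat \<Rightarrow> nat \<Rightarrow> complex" where
  "val M x \<equiv> \<lambda>i j. M i j x"

lemma skewlI:
  "(\<And>i j. i < 6 \<Longrightarrow> j < 6 \<Longrightarrow> lin (M i j)) \<Longrightarrow>
   (\<And>i j x. i < 6 \<Longrightarrow> j < 6 \<Longrightarrow> M j i x = - M i j x) \<Longrightarrow> skewl M"
  unfolding skewl_def by blast

lemma skewl_lin: "skewl M \<Longrightarrow> i < 6 \<Longrightarrow> j < 6 \<Longrightarrow> lin (M i j)"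
  and skewl_skew: "skewl M \<Longrightarrow> i < 6 \<Longrightarrow> j < 6 \<Longrightarrow> M j i x = - M i j x"
  unfolding skewl_def by blast+

lemma skew6_skew: "skew6 m \<Longrightarrow> i < 6 \<Longrightarrow> j < 6 \<Longrightarrow> m j i = - m i j"
  unfolding skew6_def by blast

lemma skewl_val: "skewl M \<Longrightarrow> skew6 (val M x)"
  unfolding skewl_def skew6_def by blast

definition cg :: "(nat \<Rightarrow> nat \<Rightarrow> complex) \<Rightarrow> (nat \<Rightarrow> nat \<Rightarrow> complex) \<Rightarrow> nat \<Rightarrow> nat \<Rightarrow> complex" where
  "cg k m i j = (\<Sum>a<6. \<Sum>b<6. k i a * k j b * m a b)"

lemma cg_cong: "(\<And>a b. a < 6 \<Longrightarrow> b < 6 \<Longrightarrow> m a b = m' a b) \<Longrightarrow> cg k m i j = cg k m' i j"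
  unfolding cg_def by (intro sum.cong) auto

lemma cg_mp: "cg k m = mp 6 k (mp 6 m (\<lambda>a b. k b a))"
  by (simp add: fun_eq_iff cg_def mp_def sum_distrib_left mult_ac)

lemma cg_cg:
  assumes "inverses 6 k k'" "i < 6" "j < 6" shows "cg k (cg k' m) i j = m i j"
proof -
  let ?T = "\<lambda>k :: nat \<Rightarrow> nat \<Rightarrow> complex. \<lambda>a b. k b a"
  have assoc: "mp 6 (mp 6 A B) C = mp 6 A (mp 6 B C)" for A B C :: "nat \<Rightarrow> nat \<Rightarrow> complex"
    by (simp add: fun_eq_iff mp_assoc)
  have "cg k (cg k' m) i j = mp 6 (mp 6 k k') (mp 6 m (mp 6 (?T k') (?T k))) i j"
    by (simp only: cg_mp assoc)
  also have "\<dots> = mp 6 dl (mp 6 m dl) i j"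
    using inverses_transpose[OF assms(1)] assms
    by (intro mp_cong refl) (auto simp: inverses_def)
  finally show ?thesis using assms by (simp add: mp_dl_left mp_dl_right)
qed

lemma skew6_cg:
  assumes "skew6 m" shows "skew6 (cg k m)"
proof -
  have m: "m a b = - m b a" if "a < 6" "b < 6" for a b using assms that unfolding skew6_def by blast
  have "cg k m j i = - cg k m i j" for i j
  proof -
    have "cg k m j i = (\<Sum>b<6. \<Sum>a<6. k j a * k i b * m a b)" unfolding cg_def by (rule sum.swap)
    also have "\<dots> = (\<Sum>b<6. \<Sum>a<6. - (k i b * k j a * m b a))"
      proof (intro sum.cong refl)
      fix a b :: nat assume "a \<in> {..<6}" "b \<in> {..<6}"
      then show "k j b * k i a * m b a = - (k i a * k j b * m a b)" using m[of b a] by simp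
    qed
    finally show ?thesis by (simp add: cg_def sum_negf)
  qed
  then show ?thesis unfolding skew6_def by blast
qed

lemma pf6_mat: "pf6 m = pfaffian (mat 6 6 (\<lambda>(i, j). m i j))"
  by (subst pfaffian_6) (auto simp: pf6_def)

lemma pf6_cg:
  assumes "skew6 m" shows "pf6 (cg k m) = det (mat 6 6 (\<lambda>(i, j). k i j)) * pf6 m"
proof -
  let ?K = "mat 6 6 (\<lambda>(i, j). k i j)" and ?m = "mat 6 6 (\<lambda>(i, j). m i j)"
  have s: "skew ?m" unfolding skew_def
  proof (rule eq_matI)
    fix i j assume "i < dim_row (- ?m)" "j < dim_col (- ?m)"
    then have ij: "i < 6" "j < 6" by auto
    from skew6_skew[OF assms ij] ij show "transpose_mat ?m $$ (i, j) = (- ?m) $$ (i, j)" by simp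
  qed auto
  have "mat 6 6 (\<lambda>(i, j). cg k m i j) = ?K * ?m * transpose_mat ?K"
  proof (rule eq_matI)
    fix i j assume "i < dim_row (?K * ?m * transpose_mat ?K)" "j < dim_col (?K * ?m * transpose_mat ?K)"
    then have ij: "i < 6" "j < 6" by auto
    have "(?K * ?m * transpose_mat ?K) $$ (i, j) =
      (\<Sum>(a, b)\<in>{0..<6} \<times> {0..<6}. ?m $$ (a, b) * (?K $$ (i, a) * ?K $$ (j, b)))"
      by (rule mult_congr_entry) (use ij in auto)
    also have "\<dots> = (\<Sum>(a, b)\<in>{..<6} \<times> {..<6}. k i a * k j b * m a b)"
      using ij by (intro sum.cong) auto
    finally show "mat 6 6 (\<lambda>(i, j). cg k m i j) $$ (i, j) = (?K * ?m * transpose_mat ?K) $$ (i, j)"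
      using ij by (simp add: cg_def sum.cartesian_product)
  qed auto
  then show ?thesis unfolding pf6_mat using pfaffian_congr[of ?K 3 ?m] s by simp
qed

lemma det_inverses: "inverses 6 k k' \<Longrightarrow> det (mat 6 6 (\<lambda>(i, j). k i j :: complex)) \<noteq> 0"
proof -
  assume k: "inverses 6 k k'"
  let ?K = "mat 6 6 (\<lambda>(i, j). k i j)" and ?K' = "mat 6 6 (\<lambda>(i, j). k' i j)"
  have "?K * ?K' = 1\<^sub>m 6"
    using k by (intro eq_matI) (auto simp: scalar_prod_def inverses_def mp_def dl_def atLeast0LessThan)
  then have "det ?K * det ?K' = 1" by (metis det_mult det_one mat_carrier)
  then show ?thesis by auto
qed

lemma pf6_line: "pf6 (\<lambda>i j. m i j + t * n i j) = pf6 m + t * dpf6 m n + t\<^sup>2 * dpf6 n m + t ^ 3 * pf6 n"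
  unfolding pf6_def dpf6_def by (simp add: algebra_simps power2_eq_square power3_eq_cube)

lemma cg_line: "cg k (\<lambda>i j. m i j + t * n i j) = (\<lambda>i j. cg k m i j + t * cg k n i j)"
  by (simp add: fun_eq_iff cg_def sum.distrib sum_distrib_left algebra_simps)

lemma dpf6_cg:
  assumes m: "skew6 m" and n: "skew6 n"
  shows "dpf6 (cg k m) (cg k n) = det (mat 6 6 (\<lambda>(i, j). k i j)) * dpf6 m n"
proof -
  let ?d = "det (mat 6 6 (\<lambda>(i, j). k i j))"
  have s: "skew6 (\<lambda>i j. m i j + t * n i j)" for t
    unfolding skew6_def
  proof (intro allI impI)
    fix i j :: nat assume "i < 6" "j < 6"
    from skew6_skew[OF m this] skew6_skew[OF n this]
    show "m j i + t * n j i = - (m i j + t * n i j)" by simp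
  qed
  have "pf6 (cg k m) + t * dpf6 (cg k m) (cg k n) + t\<^sup>2 * dpf6 (cg k n) (cg k m) + t ^ 3 * pf6 (cg k n) =
      ?d * (pf6 m + t * dpf6 m n + t\<^sup>2 * dpf6 n m + t ^ 3 * pf6 n)" for t
    using pf6_cg[OF s[of t], of k] by (simp only: pf6_line cg_line)
  from this[of 1] this[of "- 1"]
  have "dpf6 (cg k m) (cg k n) + dpf6 (cg k n) (cg k m) = ?d * dpf6 m n + ?d * dpf6 n m"
    "dpf6 (cg k n) (cg k m) + ?d * dpf6 m n = dpf6 (cg k m) (cg k n) + ?d * dpf6 n m"
    unfolding pf6_cg[OF m] pf6_cg[OF n] by (simp_all add: algebra_simps)
  moreover have "a = x" if "a + b = x + y" "b + x = a + y" for a b x y :: complex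
  proof -
    have "(a - x) + (a - x) = (a + b) - (x + y) - ((b + x) - (a + y))" by simp
    also have "\<dots> = 0" unfolding that by simp
    finally show ?thesis by (simp flip: mult_2)
  qed
  ultimately show ?thesis by blast
qed

text \<open>Reachability\<close>

inductive reach :: "(nat \<Rightarrow> nat \<Rightarrow> pt \<Rightarrow> complex) \<Rightarrow> (pt \<Rightarrow> complex) \<Rightarrow> bool" where
  pfaffian: "skewl M \<Longrightarrow> cub F \<Longrightarrow> c \<noteq> 0 \<Longrightarrow> (\<And>x. pf6 (val M x) = c * F x) \<Longrightarrow> F x0 \<noteq> 0 \<Longrightarrow> reach M F"
| limit: "(\<And>i. i \<le> n \<Longrightarrow> skewl (N i)) \<Longrightarrow> (\<And>i. i \<le> n \<Longrightarrow> cub (G i)) \<Longrightarrow> finite T \<Longrightarrow>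
    (\<And>t. t \<notin> T \<Longrightarrow> reach (\<lambda>i j x. \<Sum>m\<le>n. t ^ m * N m i j x) (\<lambda>x. \<Sum>m\<le>n. t ^ m * G m x)) \<Longrightarrow>
    (\<And>x. pf6 (val (N 0) x) = 0) \<Longrightarrow> reach (N 0) (G 0)"
| same: "reach M F \<Longrightarrow> (\<And>i j. i < 6 \<Longrightarrow> j < 6 \<Longrightarrow> M' i j = M i j) \<Longrightarrow> reach M' F"

lemma skewl_cg: "skewl M \<Longrightarrow> skewl (\<lambda>i j x. cg k (val M (app g x)) i j)"
proof (rule skewlI)
  fix i j :: nat and x assume M: "skewl M" and ij: "i < 6" "j < 6"
  show "lin (\<lambda>x. cg k (val M (app g x)) i j)"
    unfolding cg_def by (intro lin_sum lin_cmult lin_app skewl_lin[OF M]) auto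
  show "cg k (val M (app g x)) j i = - cg k (val M (app g x)) i j"
    by (rule skew6_skew[OF skew6_cg[OF skewl_val[OF M]] ij])
qed

lemma cg_sum: "cg k (\<lambda>i j. \<Sum>m\<le>n. t ^ m * N m i j) i j = (\<Sum>m\<le>n. t ^ m * cg k (N m) i j)"
proof -
  have "cg k (\<lambda>i j. \<Sum>m\<le>n. t ^ m * N m i j) i j =
      (\<Sum>a<6. \<Sum>b<6. \<Sum>m\<le>n. t ^ m * (k i a * k j b * N m a b))"
    by (simp add: cg_def sum_distrib_left mult_ac)
  also have "\<dots> = (\<Sum>a<6. \<Sum>m\<le>n. \<Sum>b<6. t ^ m * (k i a * k j b * N m a b))"
    by (intro sum.cong refl sum.swap)
  also have "\<dots> = (\<Sum>m\<le>n. \<Sum>a<6. \<Sum>b<6. t ^ m * (k i a * k j b * N m a b))"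
    by (rule sum.swap)
  finally show ?thesis by (simp add: cg_def sum_distrib_left)
qed

lemma reach_transport:
  assumes "reach M F" and k: "inverses 6 k k'" and g: "inverses 5 g g'"
  shows "reach (\<lambda>i j x. cg k (val M (app g x)) i j) (\<lambda>x. F (app g x))"
  using assms(1)
proof (induction rule: reach.induct)
  case (pfaffian M F c x0)
  let ?d = "det (mat 6 6 (\<lambda>(i, j). k i j))"
  show ?case
  proof (rule reach.pfaffian)
    show "?d * c \<noteq> 0" using det_inverses[OF k] pfaffian by simp
    show "F (app g (app g' x0)) \<noteq> 0" using cub_app_app[OF g pfaffian(2)] pfaffian by simp
    show "pf6 (val (\<lambda>i j x. cg k (val M (app g x)) i j) x) = ?d * c * F (app g x)" for x
      using pf6_cg[OF skewl_val[OF pfaffian(1)], of k "app g x"] pfaffian(4) by simp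
  qed (use pfaffian in \<open>auto intro: skewl_cg cub_app\<close>)
next
  case (limit n N G T)
  show ?case
  proof (rule reach.limit[where N = "\<lambda>m i j x. cg k (val (N m) (app g x)) i j" and G = "\<lambda>m x. G m (app g x)"])
    show "reach (\<lambda>i j x. \<Sum>m\<le>n. t ^ m * cg k (val (N m) (app g x)) i j) (\<lambda>x. \<Sum>m\<le>n. t ^ m * G m (app g x))"
      if "t \<notin> T" for t using limit.IH[OF that] by (simp only: cg_sum)
    show "pf6 (val (\<lambda>i j x. cg k (val (N 0) (app g x)) i j) x) = 0" for x
      using pf6_cg[OF skewl_val[OF limit.hyps(1)[of 0]], of k "app g x"] limit.hyps by simp
  qed (use limit.hyps in \<open>auto intro: skewl_cg cub_app\<close>)
next
  case (same M F M')
  show ?case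
  proof (rule reach.same[OF same.IH])
    fix i j :: nat assume "i < 6" "j < 6"
    show "(\<lambda>x. cg k (val M' (app g x)) i j) = (\<lambda>x. cg k (val M (app g x)) i j)"
      using same.hyps by (auto intro!: cg_cong ext)
  qed
qed

lemma reach_transport_back:
  assumes r: "reach (\<lambda>i j x. cg k (val M (app g x)) i j) (\<lambda>x. F (app g x))"
    and k: "inverses 6 k k'" and g: "inverses 5 g g'" and M: "skewl M" and F: "cub F"
  shows "reach M F"
proof -
  have F': "(\<lambda>x. F (app g (app g' x))) = F" using cub_app_app[OF g F] by auto
  from reach_transport[OF r inverses_commute[OF k] inverses_commute[OF g]]
  have "reach (\<lambda>i j x. cg k' (cg k (val M (app g (app g' x)))) i j) F" by (simp only: F')
  then show ?thesis
  proof (rule reach.same)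
    fix i j :: nat assume ij: "i < 6" "j < 6"
    then have "lin (M i j)" by (rule skewl_lin[OF M])
    then show "M i j = (\<lambda>x. cg k' (cg k (val M (app g (app g' x)))) i j)"
      by (simp add: cg_cg[OF inverses_commute[OF k] ij] lin_app_app[OF g] fun_eq_iff)
  qed
qed

lemma reach_first_order:
  assumes M: "skewl M" and N: "skewl N" and F: "cub F" "F x0 \<noteq> 0" "c \<noteq> 0"
    and pf: "\<And>x. pf6 (val M x) = 0" and d: "\<And>x. dpf6 (val M x) (val N x) = c * F x"
  shows "reach M F"
proof -
  define G1 where "G1 = (\<lambda>x. dpf6 (val N x) (val M x) / c)"
  define G2 where "G2 = (\<lambda>x. pf6 (val N x) / c)"
  define NN where "NN = (\<lambda>m::nat. if m = 0 then M else N)"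
  define GG where "GG = (\<lambda>m::nat. if m = 0 then F else if m = 1 then G1 else G2)"
  have l: "lin (M i j)" "lin (N i j)" if "i < 6" "j < 6" for i j
    using skewl_lin[OF M that] skewl_lin[OF N that] by auto
  have cG: "cub G1" "cub G2" unfolding G1_def G2_def dpf6_def pf6_def divide_inverse mult.commute[of _ "inverse c"]
    by (intro cub_cmult cub_plus cub_minus cub_mult' quad_plus quad_minus quad_mult l; simp)+
  have "reach (NN 0) (GG 0)"
  proof (rule reach.limit[where n = 2 and N = "\<lambda>m. if m = 2 then (\<lambda>i j x. 0) else NN m" and G = GG
        and T = "insert 0 {t. F x0 + t * G1 x0 + t\<^sup>2 * G2 x0 = 0}", simplified])
    have "skewl (\<lambda>i j x. 0)" by (rule skewlI) auto
    then show "skewl (if i = 2 then \<lambda>i j x. 0 else NN i)" "cub (GG i)" if "i \<le> 2" for i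
      using M N F cG by (auto simp: NN_def GG_def)
    have "{t. F x0 + t * G1 x0 + t\<^sup>2 * G2 x0 = 0} = {t. poly [:F x0, G1 x0, G2 x0:] t = 0}"
      by (auto simp: algebra_simps power2_eq_square)
    moreover have "[:F x0, G1 x0, G2 x0:] \<noteq> 0" using F by simp
    ultimately show "finite {t. F x0 + t * G1 x0 + t\<^sup>2 * G2 x0 = 0}" using poly_roots_finite by metis
    show "pf6 (val (NN 0) x) = 0" for x using pf by (simp add: NN_def)
    fix t :: complex assume t: "t \<noteq> 0 \<and> F x0 + t * G1 x0 + t\<^sup>2 * G2 x0 \<noteq> 0"
    have e: "(\<lambda>i j x. \<Sum>m\<le>2. t ^ m * (if m = 2 then \<lambda>i j x. 0 else NN m) i j x) = (\<lambda>i j x. M i j x + t * N i j x)"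
      "(\<lambda>x. \<Sum>m\<le>2. t ^ m * GG m x) = (\<lambda>x. F x + t * G1 x + t\<^sup>2 * G2 x)"
      by (auto simp: numeral_2_eq_2 NN_def GG_def fun_eq_iff)
    show "reach (\<lambda>i j x. \<Sum>m\<le>2. t ^ m * (if m = 2 then \<lambda>i j x. 0 else NN m) i j x) (\<lambda>x. \<Sum>m\<le>2. t ^ m * GG m x)"
      unfolding e
    proof (rule reach.pfaffian[where c = "t * c" and ?x0.0 = x0])
      show "skewl (\<lambda>i j x. M i j x + t * N i j x)"
      proof (rule skewlI)
        fix i j :: nat and x assume "i < 6" "j < 6"
        from skewl_skew[OF M this, of x] skewl_skew[OF N this, of x] l[OF this]
        show "M j i x + t * N j i x = - (M i j x + t * N i j x)" "lin (\<lambda>x. M i j x + t * N i j x)"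
          by (auto intro: lin_plus lin_cmult)
      qed
      show "pf6 (val (\<lambda>i j x. M i j x + t * N i j x) x) = t * c * (F x + t * G1 x + t\<^sup>2 * G2 x)" for x
        unfolding pf6_line pf d using F(3)
        by (simp add: G1_def G2_def field_simps power2_eq_square power3_eq_cube)
      show "cub (\<lambda>x. F x + t * G1 x + t\<^sup>2 * G2 x)" using F cG by (intro cub_plus cub_cmult)
    qed (use t F in auto)
  qed
  then show ?thesis by (simp add: NN_def GG_def)
qed

definition conf where
  "conf M z w u F c \<longleftrightarrow> skewl M \<and> (\<forall>i<6. lin (z i) \<and> lin (w i) \<and> quad (u i)) \<and> cub F \<and>
     (\<exists>x. F x \<noteq> 0) \<and> c \<noteq> 0 \<and> (\<forall>x. pf6 (val M x) = 0) \<and>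
     (\<forall>x n. skew6 n \<longrightarrow> dpf6 (val M x) n = c * (\<Sum>i<6. \<Sum>j<6. z i x * n i j * w j x)) \<and>
     (\<forall>x. (\<Sum>i<6. u i x * z i x) = 0) \<and> (\<forall>x. (\<Sum>i<6. u i x * w i x) = F x)"

lemma confD:
  assumes "conf M z w u F c"
  shows "skewl M" "\<And>i. i < 6 \<Longrightarrow> lin (z i)" "\<And>i. i < 6 \<Longrightarrow> lin (w i)" "\<And>i. i < 6 \<Longrightarrow> quad (u i)" "cub F"
    "\<exists>x. F x \<noteq> 0" "c \<noteq> 0" "\<And>x. pf6 (val M x) = 0"
    "\<And>x n. skew6 n \<Longrightarrow> dpf6 (val M x) n = c * (\<Sum>i<6. \<Sum>j<6. z i x * n i j * w j x)"
    "\<And>x. (\<Sum>i<6. u i x * z i x) = 0" "\<And>x. (\<Sum>i<6. u i x * w i x) = F x"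
  using assms unfolding conf_def by blast+

lemma conf_first_order:
  assumes conf: "conf M z w u F c" and N: "skewl N" and d: "d \<noteq> 0"
    and F: "\<And>x. (\<Sum>i<6. \<Sum>j<6. z i x * N i j x * w j x) = d * F x"
  shows "reach M F"
proof -
  obtain x0 where "F x0 \<noteq> 0" using confD(6)[OF conf] by blast
  moreover have "dpf6 (val M x) (val N x) = c * d * F x" for x
    using confD(9)[OF conf skewl_val[OF N], of x x] F[of x] by simp
  moreover have "c * d \<noteq> 0" using confD(7)[OF conf] d by simp
  ultimately show ?thesis
    using reach_first_order[OF confD(1)[OF conf] N confD(5)[OF conf]] confD(8)[OF conf] by blast
qed

lemma contragredient_pairing:
  assumes "inverses n k k'"
  shows "(\<Sum>i<n. (\<Sum>l<n. k i l * u l) * (\<Sum>l<n. k' l i * z l)) = (\<Sum>l<n. u l * z l)"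
proof -
  have "(\<Sum>i<n. (\<Sum>l<n. k i l * u l) * (\<Sum>l<n. k' l i * z l)) =
      (\<Sum>i<n. \<Sum>l<n. \<Sum>m<n. u l * ((k' m i * k i l) * z m))"
    by (simp add: sum_product mult_ac)
  also have "\<dots> = (\<Sum>l<n. \<Sum>i<n. \<Sum>m<n. u l * ((k' m i * k i l) * z m))" by (rule sum.swap)
  also have "\<dots> = (\<Sum>l<n. \<Sum>m<n. \<Sum>i<n. u l * ((k' m i * k i l) * z m))"
    by (intro sum.cong refl sum.swap)
  also have "\<dots> = (\<Sum>l<n. \<Sum>m<n. u l * (mp n k' k m l * z m))"
    by (simp add: mp_def sum_distrib_left sum_distrib_right)
  also have "\<dots> = (\<Sum>l<n. \<Sum>m<n. u l * (dl m l * z m))"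
    using assms by (intro sum.cong refl) (auto simp: inverses_def)
  also have "\<dots> = (\<Sum>l<n. u l * z l)"
    by (intro sum.cong refl) (simp add: sum_distrib_left[symmetric])
  finally show ?thesis .
qed

lemma cg_pairing:
  "(\<Sum>i<6. \<Sum>j<6. z i * cg k' n i j * w j) =
   (\<Sum>i<6. \<Sum>j<6. (\<Sum>l<6. k' l i * z l) * n i j * (\<Sum>l<6. k' l j * w l))"
proof -
  have "(\<Sum>i<6. \<Sum>j<6. z i * cg k' n i j * w j) =
      (\<Sum>i<6. \<Sum>j<6. \<Sum>a<6. \<Sum>b<6. (k' i a * z i) * n a b * (k' j b * w j))"
    by (simp add: cg_def sum_distrib_left sum_distrib_right mult_ac)
  also have "\<dots> = (\<Sum>i<6. \<Sum>a<6. \<Sum>j<6. \<Sum>b<6. (k' i a * z i) * n a b * (k' j b * w j))"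
    by (intro sum.cong refl sum.swap)
  also have "\<dots> = (\<Sum>a<6. \<Sum>i<6. \<Sum>j<6. \<Sum>b<6. (k' i a * z i) * n a b * (k' j b * w j))"
    by (rule sum.swap)
  also have "\<dots> = (\<Sum>a<6. \<Sum>i<6. \<Sum>b<6. \<Sum>j<6. (k' i a * z i) * n a b * (k' j b * w j))"
    by (intro sum.cong refl sum.swap)
  also have "\<dots> = (\<Sum>a<6. \<Sum>b<6. \<Sum>i<6. \<Sum>j<6. (k' i a * z i) * n a b * (k' j b * w j))"
    by (intro sum.cong refl sum.swap)
  finally show ?thesis by (simp add: sum_distrib_left sum_distrib_right mult_ac)
qed

lemma dpf6_cong:
  "(\<And>i j. i < 6 \<Longrightarrow> j < 6 \<Longrightarrow> n i j = n' i j) \<Longrightarrow> dpf6 m n = dpf6 m n'"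
  by (simp add: dpf6_def)

lemma conf_transport:
  assumes conf: "conf M z w u F c" and k: "inverses 6 k k'" and g: "inverses 5 g g'"
  shows "conf (\<lambda>i j x. cg k (val M (app g x)) i j)
     (\<lambda>i x. \<Sum>l<6. k' l i * z l (app g x)) (\<lambda>i x. \<Sum>l<6. k' l i * w l (app g x))
     (\<lambda>i x. \<Sum>l<6. k i l * u l (app g x)) (\<lambda>x. F (app g x)) (det (mat 6 6 (\<lambda>(i, j). k i j)) * c)"
  unfolding conf_def
proof (intro conjI allI impI)
  let ?d = "det (mat 6 6 (\<lambda>(i, j). k i j))"
  show "skewl (\<lambda>i j x. cg k (val M (app g x)) i j)" by (rule skewl_cg[OF confD(1)[OF conf]])
  show "cub (\<lambda>x. F (app g x))" by (rule cub_app[OF confD(5)[OF conf]])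
  show "\<exists>x. F (app g x) \<noteq> 0"
    using confD(6)[OF conf] cub_app_app[OF g confD(5)[OF conf]] by metis
  show "?d * c \<noteq> 0" using det_inverses[OF k] confD(7)[OF conf] by simp
  show "(\<Sum>i<6. (\<Sum>l<6. k i l * u l (app g x)) * (\<Sum>l<6. k' l i * z l (app g x))) = 0" for x
    using contragredient_pairing[OF k, of "\<lambda>l. u l (app g x)" "\<lambda>l. z l (app g x)"] confD(10)[OF conf] by simp
  show "(\<Sum>i<6. (\<Sum>l<6. k i l * u l (app g x)) * (\<Sum>l<6. k' l i * w l (app g x))) = F (app g x)" for x
    using contragredient_pairing[OF k, of "\<lambda>l. u l (app g x)" "\<lambda>l. w l (app g x)"] confD(11)[OF conf] by simp
  show "pf6 (val (\<lambda>i j x. cg k (val M (app g x)) i j) x) = 0" for x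
    using pf6_cg[OF skewl_val[OF confD(1)[OF conf]], of k "app g x"] confD(8)[OF conf] by simp
  fix x n assume n: "skew6 n"
  let ?m = "val M (app g x)"
  have "dpf6 (val (\<lambda>i j x. cg k (val M (app g x)) i j) x) n = dpf6 (cg k ?m) (cg k (cg k' n))"
    by (rule dpf6_cong) (simp add: cg_cg[OF k])
  also have "\<dots> = ?d * dpf6 ?m (cg k' n)"
    by (rule dpf6_cg[OF skewl_val[OF confD(1)[OF conf]] skew6_cg[OF n]])
  also have "\<dots> = ?d * (c * (\<Sum>i<6. \<Sum>j<6. z i (app g x) * cg k' n i j * w j (app g x)))"
    by (subst confD(9)[OF conf skew6_cg[OF n]]) (rule refl)
  finally show "dpf6 (val (\<lambda>i j x. cg k (val M (app g x)) i j) x) n =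
      ?d * c * (\<Sum>i<6. \<Sum>j<6. (\<Sum>l<6. k' l i * z l (app g x)) * n i j * (\<Sum>l<6. k' l j * w l (app g x)))"
    unfolding cg_pairing by (simp only: mult.assoc)
qed (auto intro!: lin_sum lin_cmult lin_app quad_sum quad_cmult quad_app confD[OF conf])

lemma linear_normal_form:
  assumes z: "\<And>i. i < 6 \<Longrightarrow> lin (z i)"
  shows "\<exists>r k k' g g'. r \<le> 5 \<and> inverses 6 k k' \<and> inverses 5 g g' \<and>
    (\<forall>i<6. \<forall>x. (\<Sum>l<6. k' l i * z l (app g x)) = (if i < r then x i else 0))"
proof -
  define Z where "Z = (\<lambda>i k. z i (dl k))"
  obtain r where r: "r \<le> 6" "r \<le> 5" "equivalent 6 5 Z (\<lambda>i j. if i < r then dl i j else 0)"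
    using rank_normal_form[where m = 6 and n = 5 and Z = Z] by blast
  obtain k k' g g' where k: "inverses 6 k k'" "inverses 5 g g'"
    "\<And>i j. i < 6 \<Longrightarrow> j < 5 \<Longrightarrow> mp 6 k (mp 5 Z g) i j = (if i < r then dl i j else 0)"
    using r(3) unfolding equivalent_def by blast
  have "(\<Sum>l<6. k i l * z l (app g x)) = (if i < r then x i else 0)" if i: "i < 6" for i x
  proof -
    have "(\<Sum>l<6. k i l * z l (app g x)) = mp 6 k (mp 5 Z (mp 5 g (\<lambda>l _. x l))) i 0"
      unfolding mp_def
    proof (intro sum.cong refl arg_cong2[where f = "(*)"])
      fix l :: nat assume "l \<in> {..<6}"
      then show "z l (app g x) = (\<Sum>la<5. Z l la * (\<Sum>l<5. g la l * x l))"
        by (subst lin_axes[OF z]) (auto simp: Z_def app_def)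
    qed
    also have "\<dots> = mp 5 (mp 6 k (mp 5 Z g)) (\<lambda>l _. x l) i 0"
      unfolding mp_assoc by (intro mp_cong refl)
    also have "\<dots> = (\<Sum>j<5. (if i < r then dl i j else 0) * x j)"
      using i k(3) by (simp add: mp_def[of 5 "mp 6 k (mp 5 Z g)"])
    also have "\<dots> = (if i < r then x i else 0)" using r by auto
    finally show ?thesis .
  qed
  then show ?thesis
    using r(2) inverses_transpose[OF inverses_commute[OF k(1)]] k(2)
    by (intro exI[of _ r] exI[of _ "\<lambda>i j. k' j i"] exI[of _ "\<lambda>i j. k j i"] exI[of _ g] exI[of _ g']) 
       (auto dest: inverses_transpose inverses_commute)
qed

lemma sum6: "(\<Sum>i<6. f i) = f 0 + f 1 + f 2 + f 3 + f 4 + f (5::nat)"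
  and sum5: "(\<Sum>i<5. f i) = f 0 + f 1 + f 2 + f 3 + f (4::nat)"
  by (simp_all add: lessThan_nat_numeral lessThan_Suc eval_nat_numeral add_ac)

text \<open>Koszul\<close>

definition tri :: "(nat \<Rightarrow> nat \<Rightarrow> nat \<Rightarrow> complex) \<Rightarrow> pt \<Rightarrow> pt \<Rightarrow> pt \<Rightarrow> complex" where
  "tri T x y z = (\<Sum>j<5. \<Sum>a<5. \<Sum>b<5. T j a b * (x j * y a * z b))"

lemma tri_add:
  "tri T (\<lambda>k. x k + x' k) y z = tri T x y z + tri T x' y z"
  "tri T x (\<lambda>k. y k + y' k) z = tri T x y z + tri T x y' z"
  "tri T x y (\<lambda>k. z k + z' k) = tri T x y z + tri T x y z'"
  by (simp_all add: tri_def algebra_simps sum.distrib)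

lemma tri_axes: assumes "j < 5" "a < 5" "b < 5" shows "tri T (dl j) (dl a) (dl b) = T j a b"
proof -
  have "tri T (dl j) (dl a) (dl b) =
      (\<Sum>j'<5. dl j j' * (\<Sum>a'<5. dl a a' * (\<Sum>b'<5. dl b b' * T j' a' b')))"
    unfolding tri_def sum_distrib_left by (intro sum.cong refl) (simp add: mult_ac)
  then show ?thesis using assms by simp
qed

lemma cubic_zero_symmetrization:
  assumes z: "\<And>x. tri T x x x = 0" and sym: "\<And>j a b. T j a b = T j b a"
    and "j < 5" "a < 5" "b < 5"
  shows "T j a b + T a b j + T b j a = 0"
proof -
  let ?t = "tri T" and ?x = "dl j :: pt" and ?y = "dl a :: pt" and ?z = "dl b :: pt"
  have "?t ?x ?y ?z + ?t ?x ?z ?y + ?t ?y ?x ?z + ?t ?y ?z ?x + ?t ?z ?x ?y + ?t ?z ?y ?x =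
     (let p = (\<lambda>k. (?x k + ?y k) + ?z k) in ?t p p p) - (let p = (\<lambda>k. ?x k + ?y k) in ?t p p p)
     - (let p = (\<lambda>k. ?x k + ?z k) in ?t p p p) - (let p = (\<lambda>k. ?y k + ?z k) in ?t p p p)
     + ?t ?x ?x ?x + ?t ?y ?y ?y + ?t ?z ?z ?z"
    unfolding Let_def tri_add by (simp add: algebra_simps)
  also have "\<dots> = 0" by (simp add: z)
  finally have "?t ?x ?y ?z + ?t ?x ?z ?y + ?t ?y ?x ?z + ?t ?y ?z ?x + ?t ?z ?x ?y + ?t ?z ?y ?x = 0" .
  then have "2 * (T j a b + T a b j + T b j a) = 0"
    using assms(3-5) by (simp add: tri_axes sym[of j b a] sym[of a j b] sym[of b a j] algebra_simps)
  then show ?thesis unfolding mult_eq_0_iff by simp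
qed

lemma quad_symmetric:
  assumes "quad f"
  shows "\<exists>U. (\<forall>a b. U a b = U b a) \<and> (\<forall>x. f x = (\<Sum>a<5. \<Sum>b<5. U a b * (x a * x b)))"
proof -
  obtain c where c: "\<And>x. f x = (\<Sum>a<5. \<Sum>b<5. c a b * (x a * x b))" using assms unfolding quad_def by blast
  have "f x = (\<Sum>a<5. \<Sum>b<5. (c a b + c b a) / 2 * (x a * x b))" for x
  proof -
    have "(\<Sum>a<5. \<Sum>b<5. c b a * (x a * x b)) = f x" unfolding c by (subst sum.swap) (simp add: mult_ac)
    moreover have "(\<Sum>a<5. \<Sum>b<5. (c a b + c b a) / 2 * (x a * x b)) =
        ((\<Sum>a<5. \<Sum>b<5. c a b * (x a * x b)) + (\<Sum>a<5. \<Sum>b<5. c b a * (x a * x b))) / 2"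
      by (simp add: sum.distrib[symmetric] sum_divide_distrib field_simps)
    ultimately show ?thesis by (simp add: c)
  qed
  then show ?thesis by (intro exI[of _ "\<lambda>a b. (c a b + c b a) / 2"]) (simp add: add.commute)
qed

lemma sum_split_le: "r \<le> n \<Longrightarrow> (\<Sum>a<n. f a) = (\<Sum>a<r. f a) + (\<Sum>a=r..<n. f (a::nat))"
  by (metis atLeast0LessThan sum.atLeastLessThan_concat zero_le)

lemma koszul:
  assumes u: "\<And>i. i < 6 \<Longrightarrow> quad (u i)" and r: "r \<le> 5" and uz: "\<And>x. (\<Sum>j<r. u j x * x j) = 0"
  obtains N Q where "skewl N"
    "\<And>j x. j < 6 \<Longrightarrow> u j x = (\<Sum>i<r. N j i x * x i) + (if j < r then 0 else (\<Sum>a=r..<5. \<Sum>b=r..<5. Q j a b * (x a * x b)))"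
    "\<And>j a b. Q j a b = Q j b a"
proof -
  let ?P = "\<lambda>i U. (\<forall>a b. U a b = U b a) \<and> (\<forall>x. u i x = (\<Sum>a<5. \<Sum>b<5. U a b * (x a * x b)))"
  define U where "U = (\<lambda>i. if i < 6 then SOME U. ?P i U else (\<lambda>_ _. 0))"
  have P: "?P i (U i)" if "i < 6" for i
  proof -
    have e: "U i = (SOME U. ?P i U)" using that by (simp add: U_def)
    show ?thesis unfolding e by (rule someI_ex[OF quad_symmetric[OF u[OF that]]])
  qed
  then have U: "\<And>i x. i < 6 \<Longrightarrow> u i x = (\<Sum>a<5. \<Sum>b<5. U i a b * (x a * x b))" by blast
  have Us: "U i a b = U i b a" for i a b
    using P[of i] by (cases "i < 6") (blast, simp add: U_def)
  define T where "T = (\<lambda>j a b. if j < r then U j a b else 0)"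
  have T0: "T j a b + T a b j + T b j a = 0" if "j < 5" "a < 5" "b < 5" for j a b
  proof (rule cubic_zero_symmetrization[OF _ _ that])
    fix x
    have "tri T x x x = (\<Sum>j<5. if j < r then u j x * x j else 0)"
      unfolding tri_def
    proof (rule sum.cong[OF refl])
      fix j :: nat assume "j \<in> {..<5}"
      then have j: "j < 6" by simp
      show "(\<Sum>a<5. \<Sum>b<5. T j a b * (x j * x a * x b)) = (if j < r then u j x * x j else 0)"
      proof (cases "j < r")
        case True
        then show ?thesis unfolding U[OF j] sum_distrib_right if_P[OF True]
          by (intro sum.cong refl) (simp add: T_def)
      qed (simp add: T_def)
    qed
    also have "\<dots> = (\<Sum>j<r. u j x * x j)" using r by (intro sum.mono_neutral_cong_right) auto
    finally show "tri T x x x = 0" using uz by simp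
  qed (simp add: T_def Us)
  define n where "n = (\<lambda>j i b. if i < r \<and> j < r then (if b < r then 2 * (T j i b - T i j b) / 3 else 2 * T j i b)
     else if i < r then (if b < r then U j i b else 2 * U j i b)
     else if j < r then - (if b < r then U i j b else 2 * U i j b) else 0)"
  have skew: "n i j b = - n j i b" if "b < 5" for i j b
  proof -
    have "T j i b = - T i j b" if "i < r" "j < r" "\<not> b < r"
      using T0[of j i b] that r \<open>b < 5\<close> by (auto simp: T_def Us add_eq_0_iff)
    then show ?thesis by (auto simp: n_def field_simps)
  qed
  define N where "N = (\<lambda>j i x. \<Sum>b<5. n j i b * x b)"
  have sk: "skewl N"
  proof (rule skewlI)
    show "lin (N i j)" for i j unfolding N_def lin_def by blast
    show "N j i x = - N i j x" for i j x
      unfolding N_def sum_negf[symmetric]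
    proof (rule sum.cong[OF refl])
      fix b :: nat assume "b \<in> {..<5}"
      then show "n j i b * x b = - (n i j b * x b)" using skew[of b j i] by simp
    qed
  qed
  have sq: "(\<Sum>a<r. \<Sum>b<r. V a b * (x b * x a)) = (\<Sum>a<r. \<Sum>b<r. (V a b + V b a) / 2 * (x b * x a))"
    for V :: "nat \<Rightarrow> nat \<Rightarrow> complex" and x
  proof -
    have "(\<Sum>a<r. \<Sum>b<r. V b a * (x b * x a)) = (\<Sum>a<r. \<Sum>b<r. V a b * (x b * x a))"
      by (subst sum.swap) (intro sum.cong refl, simp add: mult.commute)
    moreover have "(\<Sum>a<r. \<Sum>b<r. (V a b + V b a) / 2 * (x b * x a)) =
        ((\<Sum>a<r. \<Sum>b<r. V a b * (x b * x a)) + (\<Sum>a<r. \<Sum>b<r. V b a * (x b * x a))) / 2"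
      by (simp add: sum.distrib[symmetric] sum_divide_distrib field_simps)
    ultimately show ?thesis by simp
  qed
  have main: "u j x = (\<Sum>i<r. N j i x * x i) + (if j < r then 0 else (\<Sum>a=r..<5. \<Sum>b=r..<5. U j a b * (x a * x b)))"
    if j: "j < 6" for j x
  proof -
    have N: "(\<Sum>i<r. N j i x * x i) = (\<Sum>i<r. \<Sum>b<r. n j i b * (x b * x i)) + (\<Sum>i<r. \<Sum>b=r..<5. n j i b * (x b * x i))"
      unfolding N_def sum_split_le[OF r] sum.distrib[symmetric]
      by (intro sum.cong refl) (simp only: distrib_right sum_distrib_right mult.assoc)
    have tail: "(\<Sum>i<r. \<Sum>b=r..<5. n j i b * (x b * x i)) = 2 * (\<Sum>i<r. \<Sum>b=r..<5. U j i b * (x b * x i))"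
      unfolding sum_distrib_left by (intro sum.cong refl) (auto simp: n_def T_def)
    have body: "(\<Sum>i<r. \<Sum>b<r. n j i b * (x b * x i)) = (\<Sum>i<r. \<Sum>b<r. U j i b * (x b * x i))"
    proof (cases "j < r")
      case False then show ?thesis by (intro sum.cong refl) (auto simp: n_def)
    next
      case True
      have "(n j i b + n j b i) / 2 = U j i b" if "i < r" "b < r" for i b
      proof -
        have "T j i b + T i b j + T b j i = 0" using T0[of j i b] that True r by simp
        then have e: "T b j i = - (T j i b + T i b j)" by (metis add_eq_0_iff)
        have "T i j b = T i b j" "T j b i = T j i b" by (simp_all add: T_def Us)
        moreover have "n j i b + n j b i = 2 * (T j i b - T i j b) / 3 + 2 * (T j b i - T b j i) / 3"
          using that True by (simp add: n_def)
        ultimately have "n j i b + n j b i = 2 * T j i b" by (simp only: e) (simp add: field_simps)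
        then show ?thesis using True by (simp add: T_def)
      qed
      then show ?thesis by (subst sq) (intro sum.cong refl, simp)
    qed
    have "u j x = (\<Sum>a<r. \<Sum>b<r. U j a b * (x a * x b)) + (\<Sum>a<r. \<Sum>b=r..<5. U j a b * (x a * x b))
       + ((\<Sum>a=r..<5. \<Sum>b<r. U j a b * (x a * x b)) + (\<Sum>a=r..<5. \<Sum>b=r..<5. U j a b * (x a * x b)))"
      unfolding U[OF j] sum_split_le[OF r] by (simp add: sum.distrib)
    also have "(\<Sum>a=r..<5. \<Sum>b<r. U j a b * (x a * x b)) = (\<Sum>a<r. \<Sum>b=r..<5. U j a b * (x a * x b))"
      by (subst sum.swap) (simp add: Us[of j] mult_ac)
    finally have e: "u j x = (\<Sum>i<r. N j i x * x i) + (\<Sum>a=r..<5. \<Sum>b=r..<5. U j a b * (x a * x b))"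
      unfolding N tail body by (simp add: mult_ac)
    moreover have "(\<Sum>a=r..<5. \<Sum>b=r..<5. U j a b * (x a * x b)) = 0" if "j < r"
    proof (intro sum.neutral ballI)
      fix a b assume "a \<in> {r..<5}" "b \<in> {r..<5}"
      then show "U j a b * (x a * x b) = 0" using T0[of j a b] that r by (simp add: T_def)
    qed
    ultimately show ?thesis by simp
  qed
  show ?thesis by (rule that[OF sk main Us])
qed

lemma sum_if_less: "r \<le> n \<Longrightarrow> (\<Sum>i<n. if i < r then f i else 0) = (\<Sum>i<r. f (i::nat))"
  by (rule sum.mono_neutral_cong_right) auto

lemma skew_pairing:
  assumes N: "skewl N" and r: "r \<le> 6" and z: "\<And>i. i < 6 \<Longrightarrow> z i x = (if i < r then x i else 0)"
  shows "(\<Sum>i<6. \<Sum>j<6. z i x * N i j x * w j x) = - (\<Sum>j<6. (\<Sum>i<r. N j i x * x i) * w j x)"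
proof -
  have "(\<Sum>i<6. \<Sum>j<6. z i x * N i j x * w j x) = (\<Sum>j<6. \<Sum>i<6. z i x * N i j x * w j x)" by (rule sum.swap)
  also have "\<dots> = (\<Sum>j<6. - ((\<Sum>i<r. N j i x * x i) * w j x))"
  proof (rule sum.cong[OF refl])
    fix j :: nat assume "j \<in> {..<6}"
    then have j: "j < 6" by simp
    have "(\<Sum>i<6. z i x * N i j x * w j x) = (\<Sum>i<6. if i < r then x i * N i j x * w j x else 0)"
      by (intro sum.cong refl) (simp add: z)
    also have "\<dots> = (\<Sum>i<r. x i * N i j x * w j x)" by (rule sum_if_less[OF r])
    also have "\<dots> = (\<Sum>i<r. - (N j i x * x i * w j x))"
    proof (rule sum.cong[OF refl])
      fix i assume "i \<in> {..<r}"
      then have "i < 6" using r by simp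
      then show "x i * N i j x * w j x = - (N j i x * x i * w j x)" using skewl_skew[OF N j, of i x] by simp
    qed
    finally show "(\<Sum>i<6. z i x * N i j x * w j x) = - ((\<Sum>i<r. N j i x * x i) * w j x)"
      by (simp add: sum_negf sum_distrib_right)
  qed
  finally show ?thesis by (simp add: sum_negf)
qed

lemma conf_koszul:
  assumes conf: "conf M z w u F c" and r: "r \<le> 5"
    and z: "\<And>i x. i < 6 \<Longrightarrow> z i x = (if i < r then x i else 0)"
  obtains N Q where "skewl N"
    "\<And>j x. j < 6 \<Longrightarrow> u j x = (\<Sum>i<r. N j i x * x i) + (if j < r then 0 else (\<Sum>a=r..<5. \<Sum>b=r..<5. Q j a b * (x a * x b)))"
    "\<And>j a b. Q j a b = Q j b a"
proof -
  have "(\<Sum>j<r. u j x * x j) = 0" for x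
  proof -
    have "(\<Sum>j<6. u j x * z j x) = (\<Sum>j<6. if j < r then u j x * x j else 0)"
      by (intro sum.cong refl) (simp add: z)
    also have "\<dots> = (\<Sum>j<r. u j x * x j)" by (rule sum_if_less) (use r in simp)
    finally show ?thesis using confD(10)[OF conf, of x] by simp
  qed
  show ?thesis
    by (rule koszul[of u r, OF confD(4)[OF conf] r \<open>\<And>x. (\<Sum>j<r. u j x * x j) = 0\<close>]) (assumption, rule that)
qed

lemma reach_coordinates:
  assumes conf: "conf M z w u F c" and z: "\<And>i x. i < 6 \<Longrightarrow> z i x = (if i < 5 then x i else 0)"
  shows "reach M F"
proof -
  obtain N Q where N: "skewl N" "\<And>j x. j < 6 \<Longrightarrow> u j x = (\<Sum>i<5. N j i x * x i) +
      (if j < 5 then 0 else (\<Sum>a=5..<5. \<Sum>b=5..<5. Q j a b * (x a * x b)))"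
    by (rule conf_koszul[OF conf _ z]) auto
  show ?thesis
  proof (rule conf_first_order[OF conf N(1), of "- 1"])
    fix x
    have "(\<Sum>j<6. (\<Sum>i<5. N j i x * x i) * w j x) = F x"
      unfolding confD(11)[OF conf, of x, symmetric] by (intro sum.cong refl) (simp add: N(2))
    then show "(\<Sum>i<6. \<Sum>j<6. z i x * N i j x * w j x) = - 1 * F x"
      using skew_pairing[OF N(1), of 5 z x w] z by simp
  qed simp
qed

lemma reach_injective:
  assumes conf: "conf M z w u F c" and inj: "\<And>x. (\<And>i. i < 6 \<Longrightarrow> z i x = 0) \<Longrightarrow> (\<And>k. k < 5 \<Longrightarrow> x k = 0)"
  shows "reach M F"
proof -
  obtain r k k' g g' where r: "r \<le> 5" and k: "inverses 6 k k'" and g: "inverses 5 g g'"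
    and z: "\<And>i x. i < 6 \<Longrightarrow> (\<Sum>l<6. k' l i * z l (app g x)) = (if i < r then x i else 0)"
    using linear_normal_form[of z, OF confD(2)[OF conf]] by blast
  have "r = 5"
  proof (rule ccontr)
    assume "r \<noteq> 5"
    then have r5: "r < 5" using r by simp
    let ?x = "app g (dl r)"
    have "z i ?x = 0" if "i < 6" for i
    proof -
      have "(\<Sum>i<6. (\<Sum>l<6. k i l * dl j l) * (\<Sum>l<6. k' l i * z l ?x)) = z j ?x" if "j < 6" for j
        using contragredient_pairing[OF k, of "dl j" "\<lambda>l. z l ?x"] that by simp
      moreover have "(\<Sum>l<6. k' l i * z l ?x) = 0" if "i < 6" for i
        using z[OF that, of "dl r"] by (auto simp: dl_def)
      ultimately show ?thesis using that by fastforce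
    qed
    then have "?x k = 0" if "k < 5" for k using inj[of ?x] that by blast
    then have "app g' ?x r = 0" by (simp add: app_def[of g'])
    then show False using app_app[OF inverses_commute[OF g] r5, of "dl r"] by (simp add: dl_def)
  qed
  from reach_coordinates[OF conf_transport[OF conf k g]] z \<open>r = 5\<close>
  have "reach (\<lambda>i j x. cg k (val M (app g x)) i j) (\<lambda>x. F (app g x))" by simp
  then show ?thesis using reach_transport_back[OF _ k g confD(1,5)[OF conf]] by blast
qed

definition alternating :: "(nat \<Rightarrow> nat \<Rightarrow> nat \<Rightarrow> complex) \<Rightarrow> bool" where
  "alternating o3 \<longleftrightarrow> (\<forall>i j k. o3 i j k = - o3 j i k \<and> o3 i j k = - o3 i k j)"

definition om :: "(nat \<Rightarrow> nat \<Rightarrow> nat \<Rightarrow> complex) \<Rightarrow> (nat \<Rightarrow> complex) \<Rightarrow> nat \<Rightarrow> nat \<Rightarrow> complex" where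
  "om o3 y i j = (\<Sum>k<6. o3 k i j * y k)"

definition pfa :: "(nat \<Rightarrow> nat \<Rightarrow> complex) \<Rightarrow> nat \<Rightarrow> nat \<Rightarrow> complex" where
  "pfa m i j = dpf6 m (\<lambda>a b. if a = i \<and> b = j then 1 else 0)"

lemma alternating_sort:
  assumes "alternating o3"
  shows "i < j \<Longrightarrow> o3 j i k = - o3 i j k" "j < k \<Longrightarrow> o3 i k j = - o3 i j k" "o3 i i k = 0" "o3 i k k = 0"
proof -
  have a: "o3 i j k = - o3 j i k" "o3 i j k = - o3 i k j" for i j k
    using assms unfolding alternating_def by blast+
  show "o3 j i k = - o3 i j k" "o3 i k j = - o3 i j k" by (rule a)+
  have "o3 i i k = - o3 i i k" "o3 i k k = - o3 i k k" by (rule a)+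
  then show "o3 i i k = 0" "o3 i k k = 0" by simp_all
qed

lemma om_entries:
  assumes "alternating o3"
  shows
    "om o3 y 0 1 = o3 0 1 2 * y 2 + o3 0 1 3 * y 3 + o3 0 1 4 * y 4 + o3 0 1 5 * y 5"
    "om o3 y 0 2 = - o3 0 1 2 * y 1 + o3 0 2 3 * y 3 + o3 0 2 4 * y 4 + o3 0 2 5 * y 5"
    "om o3 y 0 3 = - o3 0 1 3 * y 1 - o3 0 2 3 * y 2 + o3 0 3 4 * y 4 + o3 0 3 5 * y 5"
    "om o3 y 0 4 = - o3 0 1 4 * y 1 - o3 0 2 4 * y 2 - o3 0 3 4 * y 3 + o3 0 4 5 * y 5"
    "om o3 y 0 5 = - o3 0 1 5 * y 1 - o3 0 2 5 * y 2 - o3 0 3 5 * y 3 - o3 0 4 5 * y 4"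
    "om o3 y 1 2 = o3 0 1 2 * y 0 + o3 1 2 3 * y 3 + o3 1 2 4 * y 4 + o3 1 2 5 * y 5"
    "om o3 y 1 3 = o3 0 1 3 * y 0 - o3 1 2 3 * y 2 + o3 1 3 4 * y 4 + o3 1 3 5 * y 5"
    "om o3 y 1 4 = o3 0 1 4 * y 0 - o3 1 2 4 * y 2 - o3 1 3 4 * y 3 + o3 1 4 5 * y 5"
    "om o3 y 1 5 = o3 0 1 5 * y 0 - o3 1 2 5 * y 2 - o3 1 3 5 * y 3 - o3 1 4 5 * y 4"
    "om o3 y 2 3 = o3 0 2 3 * y 0 + o3 1 2 3 * y 1 + o3 2 3 4 * y 4 + o3 2 3 5 * y 5"
    "om o3 y 2 4 = o3 0 2 4 * y 0 + o3 1 2 4 * y 1 - o3 2 3 4 * y 3 + o3 2 4 5 * y 5"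
    "om o3 y 2 5 = o3 0 2 5 * y 0 + o3 1 2 5 * y 1 - o3 2 3 5 * y 3 - o3 2 4 5 * y 4"
    "om o3 y 3 4 = o3 0 3 4 * y 0 + o3 1 3 4 * y 1 + o3 2 3 4 * y 2 + o3 3 4 5 * y 5"
    "om o3 y 3 5 = o3 0 3 5 * y 0 + o3 1 3 5 * y 1 + o3 2 3 5 * y 2 - o3 3 4 5 * y 4"
    "om o3 y 4 5 = o3 0 4 5 * y 0 + o3 1 4 5 * y 1 + o3 2 4 5 * y 2 + o3 3 4 5 * y 3"
  by (simp_all add: om_def sum6 alternating_sort[OF assms])

lemma pfa_entries:
  "pfa m 0 1 = m 2 3 * m 4 5 - m 2 4 * m 3 5 + m 2 5 * m 3 4"
  "pfa m 0 2 = - (m 1 3 * m 4 5 - m 1 4 * m 3 5 + m 1 5 * m 3 4)"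
  "pfa m 0 3 = m 1 2 * m 4 5 - m 1 4 * m 2 5 + m 1 5 * m 2 4"
  "pfa m 0 4 = - (m 1 2 * m 3 5 - m 1 3 * m 2 5 + m 1 5 * m 2 3)"
  "pfa m 0 5 = m 1 2 * m 3 4 - m 1 3 * m 2 4 + m 1 4 * m 2 3"
  "pfa m 1 2 = m 0 3 * m 4 5 - m 0 4 * m 3 5 + m 0 5 * m 3 4"
  "pfa m 1 3 = - (m 0 2 * m 4 5 - m 0 4 * m 2 5 + m 0 5 * m 2 4)"
  "pfa m 1 4 = m 0 2 * m 3 5 - m 0 3 * m 2 5 + m 0 5 * m 2 3"
  "pfa m 1 5 = - (m 0 2 * m 3 4 - m 0 3 * m 2 4 + m 0 4 * m 2 3)"
  "pfa m 2 3 = m 0 1 * m 4 5 - m 0 4 * m 1 5 + m 0 5 * m 1 4"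
  "pfa m 2 4 = - (m 0 1 * m 3 5 - m 0 3 * m 1 5 + m 0 5 * m 1 3)"
  "pfa m 2 5 = m 0 1 * m 3 4 - m 0 3 * m 1 4 + m 0 4 * m 1 3"
  "pfa m 3 4 = m 0 1 * m 2 5 - m 0 2 * m 1 5 + m 0 5 * m 1 2"
  "pfa m 3 5 = - (m 0 1 * m 2 4 - m 0 2 * m 1 4 + m 0 4 * m 1 2)"
  "pfa m 4 5 = m 0 1 * m 2 3 - m 0 2 * m 1 3 + m 0 3 * m 1 2"
  by (simp_all add: pfa_def dpf6_def)

lemma dpf6_pfa:
  "dpf6 m n = n 0 1 * pfa m 0 1 + n 0 2 * pfa m 0 2 + n 0 3 * pfa m 0 3 + n 0 4 * pfa m 0 4 + n 0 5 * pfa m 0 5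
    + n 1 2 * pfa m 1 2 + n 1 3 * pfa m 1 3 + n 1 4 * pfa m 1 4 + n 1 5 * pfa m 1 5
    + n 2 3 * pfa m 2 3 + n 2 4 * pfa m 2 4 + n 2 5 * pfa m 2 5
    + n 3 4 * pfa m 3 4 + n 3 5 * pfa m 3 5 + n 4 5 * pfa m 4 5"
  unfolding pfa_entries dpf6_def by (simp add: algebra_simps)

definition kmat :: "(nat \<Rightarrow> nat \<Rightarrow> nat \<Rightarrow> complex) \<Rightarrow> nat \<Rightarrow> nat \<Rightarrow> complex" where
  "kmat o3 j l = (let P = (\<lambda>i j y. pfa (om o3 y) i j); pol = (\<lambda>i j a b. P i j (\<lambda>m. dl a m + dl b m) - P i j (dl a) - P i j (dl b)) in
     if j = 0 then (if l = 0 then 0 else if l = 1 then - P 0 1 (dl 1) else - pol 0 1 1 l)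
     else if l = 0 then P 0 j (dl 0) else pol 0 j 0 l)"

lemma all6: "(\<forall>i<6. P i) \<longleftrightarrow> P 0 \<and> P 1 \<and> P 2 \<and> P 3 \<and> P 4 \<and> P (5::nat)"
  by (simp add: eval_nat_numeral All_less_Suc conj_ac)

lemma less6: "i < 6 \<longleftrightarrow> i = 0 \<or> i = 1 \<or> i = 2 \<or> i = 3 \<or> i = 4 \<or> i = (5::nat)" by auto

lemma skew_pairing_expand:
  assumes "skew6 n"
  shows "(\<Sum>i<6. \<Sum>j<6. z i * n i j * w j) =
    n 0 1 * (z 0 * w 1 - z 1 * w 0) + n 0 2 * (z 0 * w 2 - z 2 * w 0) + n 0 3 * (z 0 * w 3 - z 3 * w 0)
  + n 0 4 * (z 0 * w 4 - z 4 * w 0) + n 0 5 * (z 0 * w 5 - z 5 * w 0) + n 1 2 * (z 1 * w 2 - z 2 * w 1)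
  + n 1 3 * (z 1 * w 3 - z 3 * w 1) + n 1 4 * (z 1 * w 4 - z 4 * w 1) + n 1 5 * (z 1 * w 5 - z 5 * w 1)
  + n 2 3 * (z 2 * w 3 - z 3 * w 2) + n 2 4 * (z 2 * w 4 - z 4 * w 2) + n 2 5 * (z 2 * w 5 - z 5 * w 2)
  + n 3 4 * (z 3 * w 4 - z 4 * w 3) + n 3 5 * (z 3 * w 5 - z 5 * w 3) + n 4 5 * (z 4 * w 5 - z 5 * w 4)"
proof -
  have s: "n 1 0 = - n 0 1" "n 2 0 = - n 0 2" "n 3 0 = - n 0 3" "n 4 0 = - n 0 4" "n 5 0 = - n 0 5"
    "n 2 1 = - n 1 2" "n 3 1 = - n 1 3" "n 4 1 = - n 1 4" "n 5 1 = - n 1 5" "n 3 2 = - n 2 3"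
    "n 4 2 = - n 2 4" "n 5 2 = - n 2 5" "n 4 3 = - n 3 4" "n 5 3 = - n 3 5" "n 5 4 = - n 4 5"
    by (rule skew6_skew[OF assms]; simp)+
  have d: "n i i = 0" if "i < 6" for i using skew6_skew[OF assms that that] by simp
  have d': "n 0 0 = 0" "n 1 1 = 0" "n 2 2 = 0" "n 3 3 = 0" "n 4 4 = 0" "n 5 5 = 0" by (rule d; simp)+
  show ?thesis unfolding sum6 s d' by (simp add: algebra_simps)
qed

lemma pfa_om:
  assumes a: "alternating o3" and ij: "i < j" "j < 6"
  shows "pfa (om o3 y) i j = y i * (\<Sum>l<6. kmat o3 j l * y l) - y j * (\<Sum>l<6. kmat o3 i l * y l)"
proof -
  have c: "(i = 0 \<and> j = 1) \<or> (i = 0 \<and> j = 2) \<or> (i = 0 \<and> j = 3) \<or> (i = 0 \<and> j = 4) \<or> (i = 0 \<and> j = 5)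
    \<or> (i = 1 \<and> j = 2) \<or> (i = 1 \<and> j = 3) \<or> (i = 1 \<and> j = 4) \<or> (i = 1 \<and> j = 5) \<or> (i = 2 \<and> j = 3)
    \<or> (i = 2 \<and> j = 4) \<or> (i = 2 \<and> j = 5) \<or> (i = 3 \<and> j = 4) \<or> (i = 3 \<and> j = 5) \<or> (i = 4 \<and> j = 5)"
    using ij by presburger
  show ?thesis
    using c
    by (elim disjE conjE; hypsubst; unfold sum6 pfa_entries om_entries[OF a] kmat_def Let_def;
       simp add: dl_def pfa_entries om_entries[OF a, simplified] algebra_simps)
qed

abbreviation kv :: "(nat \<Rightarrow> nat \<Rightarrow> nat \<Rightarrow> complex) \<Rightarrow> (nat \<Rightarrow> complex) \<Rightarrow> nat \<Rightarrow> complex" where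
  "kv o3 y j \<equiv> (\<Sum>l<6. kmat o3 j l * y l)"

lemma dpf6_om:
  assumes a: "alternating o3" and n: "skew6 n"
  shows "dpf6 (om o3 y) n = (\<Sum>i<6. \<Sum>j<6. y i * n i j * kv o3 y j)"
  unfolding dpf6_pfa skew_pairing_expand[OF n] by (simp add: pfa_om[OF a])

lemma upper_pairs:
  assumes "i < j" "j < (6::nat)"
  shows "(i = 0 \<and> j = 1) \<or> (i = 0 \<and> j = 2) \<or> (i = 0 \<and> j = 3) \<or> (i = 0 \<and> j = 4) \<or> (i = 0 \<and> j = 5)
    \<or> (i = 1 \<and> j = 2) \<or> (i = 1 \<and> j = 3) \<or> (i = 1 \<and> j = 4) \<or> (i = 1 \<and> j = 5) \<or> (i = 2 \<and> j = 3)
    \<or> (i = 2 \<and> j = 4) \<or> (i = 2 \<and> j = 5) \<or> (i = 3 \<and> j = 4) \<or> (i = 3 \<and> j = 5) \<or> (i = 4 \<and> j = 5)"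
  using assms by presburger

lemma conf_pfa:
  assumes conf: "conf M z w u F c" and ij: "i < j" "j < 6"
  shows "pfa (val M x) i j = c * (z i x * w j x - z j x * w i x)"
proof -
  let ?n = "\<lambda>a b. if a = i \<and> b = j then 1 else if a = j \<and> b = i then - 1 else 0 :: complex"
  have n: "skew6 ?n" using ij by (auto simp: skew6_def)
  have "pfa (val M x) i j = dpf6 (val M x) ?n"
    unfolding dpf6_pfa using upper_pairs[OF ij] by (elim disjE conjE) simp_all
  also have "\<dots> = c * (z i x * w j x - z j x * w i x)"
    unfolding confD(9)[OF conf n] skew_pairing_expand[OF n]
    using upper_pairs[OF ij] by (elim disjE conjE) simp_all
  finally show ?thesis .
qed

lemma skew6_om:
  assumes a: "alternating o3" shows "om o3 y j i = - om o3 y i j"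
proof -
  have "o3 k j i = - o3 k i j" for k using a unfolding alternating_def by blast
  then show ?thesis unfolding om_def sum_negf[symmetric] by (intro sum.cong refl) simp
qed

lemma skew_quadratic_zero:
  assumes "skew6 n" shows "(\<Sum>j<6. (\<Sum>i<6. n j i * y i) * y j) = 0"
proof -
  have "(\<Sum>j<6. (\<Sum>i<6. n j i * y i) * y j) = (\<Sum>j<6. \<Sum>i<6. y j * n j i * y i)"
    unfolding sum_distrib_right by (intro sum.cong refl) (simp add: mult_ac)
  then show ?thesis unfolding skew_pairing_expand[OF assms] by simp
qed

lemma dpf6_self: "dpf6 m m = 3 * pf6 m"
  unfolding dpf6_def pf6_def by (simp add: algebra_simps)

lemma pf6_om:
  assumes a: "alternating o3" shows "pf6 (om o3 y) = 0"
proof -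
  have z: "(\<Sum>i<6. y i * om o3 y i j) = 0" for j
  proof -
    have s: "o3 i k j = - o3 k i j" for i k using a unfolding alternating_def by blast
    have n: "skew6 (\<lambda>i k. o3 k i j)" unfolding skew6_def using s by blast
    have "(\<Sum>i<6. y i * om o3 y i j) = (\<Sum>i<6. (\<Sum>k<6. o3 k i j * y k) * y i)"
      by (simp add: om_def mult.commute)
    then show ?thesis using skew_quadratic_zero[OF n, of y] by simp
  qed
  have n: "skew6 (om o3 y)" unfolding skew6_def using skew6_om[OF a] by blast
  have "3 * pf6 (om o3 y) = (\<Sum>i<6. \<Sum>j<6. y i * om o3 y i j * kv o3 y j)"
    unfolding dpf6_self[symmetric] by (rule dpf6_om[OF a n])
  also have "\<dots> = (\<Sum>j<6. \<Sum>i<6. y i * om o3 y i j * kv o3 y j)" by (rule sum.swap)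
  also have "\<dots> = 0"
  proof (rule sum.neutral, rule ballI)
    fix j
    have "(\<Sum>i<6. y i * om o3 y i j * kv o3 y j) = (\<Sum>i<6. y i * om o3 y i j) * kv o3 y j"
      by (rule sum_distrib_right[symmetric])
    then show "(\<Sum>i<6. y i * om o3 y i j * kv o3 y j) = 0" unfolding z by simp
  qed
  finally show ?thesis by simp
qed

lemma lin_om: "(\<And>k. k < 6 \<Longrightarrow> lin (z k)) \<Longrightarrow> lin (\<lambda>x. om o3 (\<lambda>k. z k x) i j)"
  unfolding om_def by (intro lin_sum lin_cmult) auto

lemma lin_kv: "(\<And>k. k < 6 \<Longrightarrow> lin (z k)) \<Longrightarrow> lin (\<lambda>x. kv o3 (\<lambda>k. z k x) j)"
  by (intro lin_sum lin_cmult) auto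

lemma conf_om:
  assumes a: "alternating o3" and z: "\<And>k. k < 6 \<Longrightarrow> lin (z k)" and u: "\<And>k. k < 6 \<Longrightarrow> quad (u k)"
    and uz: "\<And>x. (\<Sum>i<6. u i x * z i x) = 0" and F: "\<And>x. (\<Sum>i<6. u i x * kv o3 (\<lambda>k. z k x) i) = F x" "F x0 \<noteq> 0"
  shows "conf (\<lambda>i j x. om o3 (\<lambda>k. z k x) i j) z (\<lambda>j x. kv o3 (\<lambda>k. z k x) j) u F 1"
  unfolding conf_def
proof (intro conjI allI impI)
  show "skewl (\<lambda>i j x. om o3 (\<lambda>k. z k x) i j)"
    by (intro skewlI lin_om z skew6_om[OF a])
  have "cub (\<lambda>x. \<Sum>i<6. u i x * kv o3 (\<lambda>k. z k x) i)"
  proof (rule cub_sum)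
    fix i :: nat assume "i \<in> {..<6}"
    then show "cub (\<lambda>x. u i x * kv o3 (\<lambda>k. z k x) i)" by (intro cub_mult u lin_kv z) auto
  qed
  then show "cub F" unfolding F(1) .
  show "\<exists>x. F x \<noteq> 0" using F(2) by blast
  show "pf6 (val (\<lambda>i j x. om o3 (\<lambda>k. z k x) i j) x) = 0" for x using pf6_om[OF a] by simp
  show "dpf6 (val (\<lambda>i j x. om o3 (\<lambda>k. z k x) i j) x) n =
      1 * (\<Sum>i<6. \<Sum>j<6. z i x * n i j * kv o3 (\<lambda>k. z k x) j)" if "skew6 n" for x n
    using dpf6_om[OF a that] by simp
  show "lin (\<lambda>x. kv o3 (\<lambda>k. z k x) i)" for i by (rule lin_kv[OF z])
qed (use uz F z u in simp_all)

lemma proportional_to_coordinates: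
  assumes f: "lin f" "lin g" and eq: "\<And>x. x 0 * g x = x 1 * f x"
  shows "\<exists>\<mu>. \<forall>x. f x = \<mu> * x 0"
proof -
  have e1: "f (dl 1) = 0" using eq[of "dl 1"] by (simp add: dl_def)
  have "f (dl k) = 0" if "k \<noteq> 0" "k \<noteq> 1" for k
    using eq[of "\<lambda>m. dl 1 m + dl k m"] that e1 by (simp add: lin_add[OF f(1)]) (simp add: dl_def)
  then have z: "f (dl k) = 0" if "k \<noteq> 0" for k using e1 that by (cases "k = 1") auto
  have "f x = f (dl 0) * x 0" for x
    by (subst lin_axes[OF f(1)]) (simp add: sum5 z)
  then show ?thesis by blast
qed

lemma lin_zero_cancel:
  assumes f: "lin f" and eq: "\<And>x. x 0 * f x = 0" shows "f x = 0"
proof -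
  have "f (dl k) = 0" for k
  proof (cases "k = 0")
    case True then show ?thesis using eq[of "dl 0"] by (simp add: dl_def)
  next
    case False
    have "f (dl 0) = 0" using eq[of "dl 0"] by (simp add: dl_def)
    then show ?thesis using eq[of "\<lambda>m. dl 0 m + dl k m"] False by (simp add: lin_add[OF f]) (simp add: dl_def)
  qed
  then show ?thesis by (rule lin_axes_zero[OF f])
qed

lemma kv_of_conf:
  assumes a: "alternating o3" and conf: "conf M z w u F c"
    and M: "\<And>i j x. i < 6 \<Longrightarrow> j < 6 \<Longrightarrow> M i j x = om o3 (\<lambda>k. z k x) i j"
    and z01: "\<And>x. z 0 x = x 0" "\<And>x. z 1 x = x 1"
  shows "(\<Sum>i<6. u i x * kv o3 (\<lambda>k. z k x) i) = c * F x"
proof -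
  define h where "h = (\<lambda>j x. kv o3 (\<lambda>k. z k x) j - c * w j x)"
  have lh: "lin (h j)" if "j < 6" for j
    unfolding h_def by (intro lin_minus lin_kv lin_cmult confD[OF conf] that)
  have wedge: "z i x * h j x = z j x * h i x" if "i < j" "j < 6" for i j x
  proof -
    have "pfa (val M x) i j = pfa (om o3 (\<lambda>k. z k x)) i j"
      by (simp add: pfa_def dpf6_def M)
    then have "c * (z i x * w j x - z j x * w i x) =
        z i x * kv o3 (\<lambda>k. z k x) j - z j x * kv o3 (\<lambda>k. z k x) i"
      unfolding conf_pfa[OF conf that] pfa_om[OF a that] .
    then show ?thesis unfolding h_def by (simp add: algebra_simps)
  qed
  have "\<exists>\<mu>. \<forall>x. h 0 x = \<mu> * x 0"
    by (rule proportional_to_coordinates[OF lh lh[of 1]]) (use wedge[of 0 1] z01 in auto)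
  then obtain \<mu> where mu: "\<And>x. h 0 x = \<mu> * x 0" by blast
  have "h j x = \<mu> * z j x" if j: "j < 6" for j x
  proof (cases "j = 0")
    case True then show ?thesis using mu z01 by simp
  next
    case False
    have "lin (\<lambda>x. h j x - \<mu> * z j x)" by (intro lin_minus lin_cmult lh j confD(2)[OF conf])
    moreover have "x 0 * (h j x - \<mu> * z j x) = 0" for x
      using wedge[of 0 j x] False j z01 mu by (simp add: algebra_simps)
    ultimately have "h j x - \<mu> * z j x = 0" by (rule lin_zero_cancel)
    then show ?thesis by simp
  qed
  then have "kv o3 (\<lambda>k. z k x) j = c * w j x + \<mu> * z j x" if "j < 6" for j
    using that by (simp add: h_def algebra_simps)
  then have "(\<Sum>i<6. u i x * kv o3 (\<lambda>k. z k x) i) = (\<Sum>i<6. c * (u i x * w i x) + \<mu> * (u i x * z i x))"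
    by (intro sum.cong refl) (simp add: algebra_simps)
  also have "\<dots> = c * F x"
    using confD(10,11)[OF conf, of x] by (simp add: sum.distrib sum_distrib_left[symmetric])
  finally show ?thesis .
qed

lemma finite_quadratic_zeros: "(a::complex) \<noteq> 0 \<Longrightarrow> finite {t. a + t * b + t\<^sup>2 * c = 0}"
proof -
  assume "a \<noteq> 0"
  then have "finite {t. poly [:a, b, c:] t = 0}" by (intro poly_roots_finite) simp
  moreover have "{t. a + t * b + t\<^sup>2 * c = 0} = {t. poly [:a, b, c:] t = 0}"
    by (auto simp: algebra_simps power2_eq_square)
  ultimately show ?thesis by simp
qed

lemma reach_perturb:
  assumes a: "alternating o3" and conf: "conf M z w u F c"
    and M: "\<And>i j x. i < 6 \<Longrightarrow> j < 6 \<Longrightarrow> M i j x = om o3 (\<lambda>k. z k x) i j"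
    and z01: "\<And>x. z 0 x = x 0" "\<And>x. z 1 x = x 1"
    and N: "skewl N" and q: "\<And>j. j < 6 \<Longrightarrow> quad (q j)"
    and u: "\<And>j x. j < 6 \<Longrightarrow> u j x = (\<Sum>i<6. N j i x * z i x) + q j x"
    and y: "\<And>k. k < 6 \<Longrightarrow> lin (y k)" and qy: "\<And>x. (\<Sum>j<6. q j x * y j x) = 0"
    and inj: "\<And>t x k. t \<noteq> 0 \<Longrightarrow> (\<And>i. i < 6 \<Longrightarrow> z i x + t * y i x = 0) \<Longrightarrow> k < 5 \<Longrightarrow> x k = 0"
  shows "reach M F"
proof -
  have lz: "\<And>k. k < 6 \<Longrightarrow> lin (z k)" by (rule confD(2)[OF conf])
  obtain x0 where x0: "F x0 \<noteq> 0" using confD(6)[OF conf] by blast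
  have c: "c \<noteq> 0" by (rule confD(7)[OF conf])
  define Kz where "Kz = (\<lambda>j x. kv o3 (\<lambda>k. z k x) j)"
  define Ky where "Ky = (\<lambda>j x. kv o3 (\<lambda>k. y k x) j)"
  define v where "v = (\<lambda>j x. \<Sum>i<6. N j i x * y i x)"
  define G1 where "G1 = (\<lambda>x. 1 / c * ((\<Sum>j<6. u j x * Ky j x) + (\<Sum>j<6. v j x * Kz j x)))"
  define G2 where "G2 = (\<lambda>x. 1 / c * (\<Sum>j<6. v j x * Ky j x))"
  have lin: "lin (Kz j)" "lin (Ky j)" for j unfolding Kz_def Ky_def by (intro lin_kv lz y; simp)+
  have qv: "quad (v j)" if "j < 6" for j
    unfolding v_def by (intro quad_sum quad_mult y skewl_lin[OF N] that) auto
  have cG: "cub G1" "cub G2" unfolding G1_def G2_def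
    by (intro cub_cmult cub_plus cub_sum cub_mult lin confD(4)[OF conf] qv; simp)+
  have FK: "(\<Sum>j<6. u j x * Kz j x) = c * F x" for x
    unfolding Kz_def by (rule kv_of_conf[OF a conf M z01])
  define NN where "NN = (\<lambda>m::nat. if m = 0 then M else if m = 1 then (\<lambda>i j x. om o3 (\<lambda>k. y k x) i j) else (\<lambda>i j x. 0))"
  define GG where "GG = (\<lambda>m::nat. if m = 0 then F else if m = 1 then G1 else G2)"
  have "reach (NN 0) (GG 0)"
  proof (rule reach.limit[where n = 2 and T = "insert 0 {t. F x0 + t * G1 x0 + t\<^sup>2 * G2 x0 = 0}"])
    have "skewl (\<lambda>i j x. 0)" "skewl (\<lambda>i j x. om o3 (\<lambda>k. y k x) i j)"
      by (auto intro!: skewlI lin_om y skew6_om[OF a])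
    then show "skewl (NN i)" for i using confD(1)[OF conf] by (simp add: NN_def)
    show "cub (GG i)" for i using cG confD(5)[OF conf] by (simp add: GG_def)
    show "finite (insert 0 {t. F x0 + t * G1 x0 + t\<^sup>2 * G2 x0 = 0})"
      using finite_quadratic_zeros[OF x0] by simp
    show "pf6 (val (NN 0) x) = 0" for x using confD(8)[OF conf] by (simp add: NN_def)
    fix t assume "t \<notin> insert 0 {t. F x0 + t * G1 x0 + t\<^sup>2 * G2 x0 = 0}"
    then have t: "t \<noteq> 0" "F x0 + t * G1 x0 + t\<^sup>2 * G2 x0 \<noteq> 0" by auto
    let ?z = "\<lambda>k x. z k x + t * y k x"
    let ?u = "\<lambda>j x. 1 / c * (u j x + t * v j x)"
    let ?F = "\<lambda>x. F x + t * G1 x + t\<^sup>2 * G2 x"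
    have u': "u j x + t * v j x = (\<Sum>i<6. N j i x * ?z i x) + q j x" if "j < 6" for j x
      by (simp add: u[OF that] v_def sum_distrib_left sum.distrib algebra_simps)
    have qz: "(\<Sum>j<6. q j x * z j x) = 0" for x
    proof -
      have "(\<Sum>j<6. u j x * z j x) = (\<Sum>j<6. (\<Sum>i<6. N j i x * z i x) * z j x + q j x * z j x)"
        by (intro sum.cong refl) (simp add: u distrib_right)
      then show ?thesis
        using confD(10)[OF conf, of x] skew_quadratic_zero[OF skewl_val[OF N], of x "\<lambda>i. z i x"]
        by (simp add: sum.distrib)
    qed
    have "conf (\<lambda>i j x. om o3 (\<lambda>k. ?z k x) i j) ?z (\<lambda>j x. kv o3 (\<lambda>k. ?z k x) j) ?u ?F 1"
    proof (rule conf_om[OF a])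
      show "(\<Sum>i<6. ?u i x * ?z i x) = 0" for x
      proof -
        have "(\<Sum>i<6. ?u i x * ?z i x) = 1 / c * (\<Sum>j<6. (u j x + t * v j x) * ?z j x)"
          unfolding sum_distrib_left by (intro sum.cong refl) simp
        also have "(\<Sum>j<6. (u j x + t * v j x) * ?z j x) =
            (\<Sum>j<6. (\<Sum>i<6. N j i x * ?z i x) * ?z j x + (q j x * z j x + t * (q j x * y j x)))"
          by (intro sum.cong refl) (simp add: u' algebra_simps)
        also have "\<dots> = 0"
          using skew_quadratic_zero[OF skewl_val[OF N], of x "\<lambda>i. ?z i x"] qz qy
          by (simp add: sum.distrib sum_distrib_left[symmetric])
        finally show ?thesis by simp
      qed
      show "(\<Sum>i<6. ?u i x * kv o3 (\<lambda>k. ?z k x) i) = ?F x" for x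
      proof -
        have kz: "kv o3 (\<lambda>k. ?z k x) i = Kz i x + t * Ky i x" for i
          by (simp add: Kz_def Ky_def sum_distrib_left sum.distrib algebra_simps)
        have "(\<Sum>i<6. ?u i x * kv o3 (\<lambda>k. ?z k x) i) =
            (\<Sum>i<6. 1 / c * (u i x * Kz i x) + (t * (1 / c * (u i x * Ky i x)) + t * (1 / c * (v i x * Kz i x)))
              + t\<^sup>2 * (1 / c * (v i x * Ky i x)))"
          unfolding kz by (intro sum.cong refl) (simp add: algebra_simps power2_eq_square add_divide_distrib)
        also have "\<dots> = 1 / c * (\<Sum>i<6. u i x * Kz i x) + t * G1 x + t\<^sup>2 * G2 x"
          by (simp only: sum.distrib sum_distrib_left[symmetric] G1_def G2_def distrib_left)
        finally show ?thesis using c by (simp add: FK)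
      qed
      show "?F x0 \<noteq> 0" by (rule t)
    qed (intro lin_plus lin_cmult lz y quad_cmult quad_plus confD(4)[OF conf] qv; assumption)+
    then have "reach (\<lambda>i j x. om o3 (\<lambda>k. ?z k x) i j) ?F"
      by (rule reach_injective) (use inj[OF t(1)] in blast)
    moreover have "(\<lambda>x. \<Sum>m\<le>2. t ^ m * GG m x) = ?F" by (auto simp: numeral_2_eq_2 GG_def fun_eq_iff)
    moreover have "(\<lambda>x. \<Sum>m\<le>2. t ^ m * NN m i j x) = (\<lambda>x. om o3 (\<lambda>k. ?z k x) i j)" if "i < 6" "j < 6" for i j
    proof -
      have "om o3 (\<lambda>k. ?z k x) i j = M i j x + t * om o3 (\<lambda>k. y k x) i j" for x
        unfolding M[OF that] by (simp add: om_def sum_distrib_left sum.distrib algebra_simps)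
      then show ?thesis by (auto simp: numeral_2_eq_2 NN_def fun_eq_iff)
    qed
    ultimately show "reach (\<lambda>i j x. \<Sum>m\<le>2. t ^ m * NN m i j x) (\<lambda>x. \<Sum>m\<le>2. t ^ m * GG m x)"
      by (auto intro: reach.same)
  qed
  then show ?thesis by (simp add: NN_def GG_def)
qed

lemma reach_rank4:
  assumes a: "alternating o3" and conf: "conf M z w u F c"
    and M: "\<And>i j x. i < 6 \<Longrightarrow> j < 6 \<Longrightarrow> M i j x = om o3 (\<lambda>k. z k x) i j"
    and z: "\<And>i x. i < 6 \<Longrightarrow> z i x = (if i < 4 then x i else 0)"
  shows "reach M F"
proof -
  obtain N Q where N: "skewl N"
    and u: "\<And>j x. j < 6 \<Longrightarrow> u j x = (\<Sum>i<4. N j i x * x i) + (if j < 4 then 0 else (\<Sum>a=4..<5. \<Sum>b=4..<5. Q j a b * (x a * x b)))"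
    by (rule conf_koszul[OF conf _ z]) auto
  define \<alpha> where "\<alpha> = Q 4 4 4"
  define \<beta> where "\<beta> = Q 5 4 4"
  define q where "q = (\<lambda>j::nat. \<lambda>x::pt. (if j = 4 then \<alpha> else if j = 5 then \<beta> else 0) * (x 4 * x 4))"
  define y where "y = (\<lambda>j::nat. \<lambda>x::pt. (if j = 4 then (if \<alpha> = 0 \<and> \<beta> = 0 then 1 else - \<beta>)
     else if j = 5 then \<alpha> else 0) * x 4)"
  show ?thesis
  proof (rule reach_perturb[OF a conf M _ _ N, of q y])
    show "quad (q j)" for j unfolding q_def by (intro quad_cmult quad_mult lin_coord) auto
    show "lin (y j)" for j unfolding y_def by (intro lin_cmult lin_coord) auto
    show "u j x = (\<Sum>i<6. N j i x * z i x) + q j x" if "j < 6" for j x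
    proof -
      have "(\<Sum>i<6. N j i x * z i x) = (\<Sum>i<6. if i < 4 then N j i x * x i else 0)"
        by (intro sum.cong refl) (simp add: z)
      also have "\<dots> = (\<Sum>i<4. N j i x * x i)" by (rule sum_if_less) simp
      finally show ?thesis using that u[OF that, of x] less6[of j]
        by (auto simp: q_def \<alpha>_def \<beta>_def atLeastLessThanSuc eval_nat_numeral)
    qed
    show "(\<Sum>j<6. q j x * y j x) = 0" for x by (simp add: sum6 q_def y_def algebra_simps)
    fix t :: complex and x and k :: nat
    assume t: "t \<noteq> 0" and zero: "\<And>i. i < 6 \<Longrightarrow> z i x + t * y i x = 0" and k: "k < 5"
    show "x k = 0"
    proof (cases "k = 4")
      case True
      then show ?thesis using zero[of 4] zero[of 5] t by (auto simp: z y_def split: if_splits)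
    next
      case False
      then show ?thesis using zero[of k] k by (auto simp: z y_def)
    qed
  qed (auto simp: z)
qed

text \<open>Rank three\<close>

lemma reach_rank3_generic:
  assumes a: "alternating o3" and conf: "conf M z w u F c"
    and M: "\<And>i j x. i < 6 \<Longrightarrow> j < 6 \<Longrightarrow> M i j x = om o3 (\<lambda>k. z k x) i j"
    and z: "\<And>i x. i < 6 \<Longrightarrow> z i x = (if i < 3 then x i else 0)" and N: "skewl N"
    and u: "\<And>j x. j < 6 \<Longrightarrow> u j x = (\<Sum>i<6. N j i x * z i x) +
      (if j < 3 then 0 else A j * (x 3 * x 3) + B j * (x 3 * x 4) + C j * (x 4 * x 4))"
    and D: "A 3 * (B 4 * C 5 - B 5 * C 4) - B 3 * (A 4 * C 5 - A 5 * C 4) + C 3 * (A 4 * B 5 - A 5 * B 4) \<noteq> 0"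
  shows "reach M F"
proof -
  define q where "q = (\<lambda>j::nat. \<lambda>x::pt. (if j < 3 then 0 else A j * (x 3 * x 3) + B j * (x 3 * x 4) + C j * (x 4 * x 4)))"
  define P where "P = (\<lambda>j::nat. if j = 3 then B 4 * C 5 - B 5 * C 4 else if j = 4 then B 5 * C 3 - B 3 * C 5
    else if j = 5 then B 3 * C 4 - B 4 * C 3 else 0)"
  define R where "R = (\<lambda>j::nat. if j = 3 then C 4 * A 5 - C 5 * A 4 else if j = 4 then C 5 * A 3 - C 3 * A 5
    else if j = 5 then C 3 * A 4 - C 4 * A 3 else 0)"
  define y where "y = (\<lambda>j. \<lambda>x::pt. P j * x 4 - R j * x 3)"
  show ?thesis
  proof (rule reach_perturb[OF a conf M _ _ N, of q y])
    show "quad (q j)" for j unfolding q_def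
      by (cases "j < 3") (auto intro!: quad_plus quad_cmult quad_mult lin_coord)
    show "lin (y j)" for j unfolding y_def by (intro lin_minus lin_cmult lin_coord) auto
    show "u j x = (\<Sum>i<6. N j i x * z i x) + q j x" if "j < 6" for j x
      using u[OF that] by (simp add: q_def)
    show "(\<Sum>j<6. q j x * y j x) = 0" for x by (simp add: sum6 q_def y_def P_def R_def algebra_simps)
    fix t :: complex and x and k :: nat
    assume t: "t \<noteq> 0" and zero: "\<And>i. i < 6 \<Longrightarrow> z i x + t * y i x = 0" and k: "k < 5"
    have y0: "y 3 x = 0" "y 4 x = 0" "y 5 x = 0" using zero[of 3] zero[of 4] zero[of 5] t by (auto simp: z)
    define D where "D = A 3 * (B 4 * C 5 - B 5 * C 4) - B 3 * (A 4 * C 5 - A 5 * C 4) + C 3 * (A 4 * B 5 - A 5 * B 4)"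
    have D0: "D \<noteq> 0" using D unfolding D_def .
    have e1: "A 3 * y 3 x + A 4 * y 4 x + A 5 * y 5 x = D * x 4"
      and e2: "B 3 * y 3 x + B 4 * y 4 x + B 5 * y 5 x = - D * x 3"
      by (simp_all add: y_def P_def R_def D_def algebra_simps)
    have 3: "x 3 = 0" and 4: "x 4 = 0" using e1 e2 D0 unfolding y0 by simp_all
    have l: "x k = 0" if "k < 3" for k using zero[of k] that by (auto simp: z y_def P_def R_def)
    have "k < 3 \<or> k = 3 \<or> k = 4" using k by arith
    then show "x k = 0" using 3 4 l by blast
  qed (auto simp: z)
qed

lemma reach_rank3:
  assumes a: "alternating o3" and conf: "conf M z w u F c"
    and M: "\<And>i j x. i < 6 \<Longrightarrow> j < 6 \<Longrightarrow> M i j x = om o3 (\<lambda>k. z k x) i j"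
    and z: "\<And>i x. i < 6 \<Longrightarrow> z i x = (if i < 3 then x i else 0)"
  shows "reach M F"
proof -
  obtain N Q where N: "skewl N"
    and u: "\<And>j x. j < 6 \<Longrightarrow> u j x = (\<Sum>i<3. N j i x * x i) + (if j < 3 then 0 else (\<Sum>a=3..<5. \<Sum>b=3..<5. Q j a b * (x a * x b)))"
    and Qs: "\<And>j a b. Q j a b = Q j b a"
    by (rule conf_koszul[OF conf _ z]) auto
  define A where "A = (\<lambda>j. Q j 3 3)"
  define B where "B = (\<lambda>j. 2 * Q j 3 4)"
  define C where "C = (\<lambda>j. Q j 4 4)"
  have u': "u j x = (\<Sum>i<6. N j i x * z i x) +
      (if j < 3 then 0 else A j * (x 3 * x 3) + B j * (x 3 * x 4) + C j * (x 4 * x 4))" if j: "j < 6" for j x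
  proof -
    have "(\<Sum>i<6. N j i x * z i x) = (\<Sum>i<6. if i < 3 then N j i x * x i else 0)"
      by (intro sum.cong refl) (simp add: z)
    also have "\<dots> = (\<Sum>i<3. N j i x * x i)" by (rule sum_if_less) simp
    moreover have "{3..<5} = {3, 4::nat}" by auto
    then have "(\<Sum>a=3..<5. \<Sum>b=3..<5. Q j a b * (x a * x b)) = A j * (x 3 * x 3) + B j * (x 3 * x 4) + C j * (x 4 * x 4)"
      by (simp add: A_def B_def C_def Qs[of j 4 3] algebra_simps)
    ultimately show ?thesis using u[OF j, of x] by simp
  qed
  define q where "q = (\<lambda>j::nat. \<lambda>x::pt. if j = 3 then x 3 * x 3 else if j = 4 then x 3 * x 4 else if j = 5 then x 4 * x 4 else 0)"
  define G where "G = (\<lambda>x. \<Sum>j<6. q j x * w j x)"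
  have qq: "quad (q j)" for j 
    using quad_mult[OF lin_coord[of 3] lin_coord[of 3]] quad_mult[OF lin_coord[of 3] lin_coord[of 4]]
      quad_mult[OF lin_coord[of 4] lin_coord[of 4]] 
    by (cases "j = 3"; cases "j = 4"; cases "j = 5") (simp_all add: q_def)
  have cG: "cub G" unfolding G_def by (intro cub_sum cub_mult qq confD(3)[OF conf]) auto
  obtain x0 where x0: "F x0 \<noteq> 0" using confD(6)[OF conf] by blast
  let ?As = "\<lambda>s j. A j + (if j = 3 then s else 0)" and ?Bs = "\<lambda>s j. B j + (if j = 4 then s else 0)"
    and ?Cs = "\<lambda>s j. C j + (if j = 5 then s else 0)"
  let ?D = "\<lambda>s. ?As s 3 * (?Bs s 4 * ?Cs s 5 - ?Bs s 5 * ?Cs s 4) - ?Bs s 3 * (?As s 4 * ?Cs s 5 - ?As s 5 * ?Cs s 4)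
     + ?Cs s 3 * (?As s 4 * ?Bs s 5 - ?As s 5 * ?Bs s 4)"
  define p where "p = [: A 3 * (B 4 * C 5 - B 5 * C 4) - B 3 * (A 4 * C 5 - A 5 * C 4) + C 3 * (A 4 * B 5 - A 5 * B 4),
     A 3 * B 4 + A 3 * C 5 + B 4 * C 5 - B 5 * C 4 - B 3 * A 4 - C 3 * A 5, A 3 + B 4 + C 5, 1 :]"
  have Dp: "?D s = poly p s" for s by (simp add: p_def algebra_simps)
  have fin: "finite {s. poly p s = 0}" by (intro poly_roots_finite) (simp add: p_def)
  define NN where "NN = (\<lambda>m::nat. if m = 0 then M else (\<lambda>i j x. 0))"
  define GG where "GG = (\<lambda>m::nat. if m = 0 then F else G)"
  have "reach (NN 0) (GG 0)"
  proof (rule reach.limit[where n = 1 and T = "{s. poly p s = 0} \<union> {s. F x0 + s * G x0 + s\<^sup>2 * 0 = 0}"])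
    have "skewl (\<lambda>i j x. 0)" by (rule skewlI) auto
    then show "skewl (NN i)" for i using confD(1)[OF conf] by (simp add: NN_def)
    show "cub (GG i)" for i using cG confD(5)[OF conf] by (simp add: GG_def)
    show "finite ({s. poly p s = 0} \<union> {s. F x0 + s * G x0 + s\<^sup>2 * 0 = 0})"
      using fin finite_quadratic_zeros[OF x0, of "G x0" 0] by simp
    show "pf6 (val (NN 0) x) = 0" for x using confD(8)[OF conf] by (simp add: NN_def)
    fix s assume "s \<notin> {s. poly p s = 0} \<union> {s. F x0 + s * G x0 + s\<^sup>2 * 0 = 0}"
    then have s: "?D s \<noteq> 0" "F x0 + s * G x0 \<noteq> 0" unfolding Dp by auto
    have "conf M z w (\<lambda>j x. u j x + s * q j x) (\<lambda>x. F x + s * G x) c"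
      unfolding conf_def
    proof (intro conjI allI impI)
      have "(\<Sum>i<6. q i x * z i x) = 0" for x by (simp add: sum6 q_def z)
      then show "(\<Sum>i<6. (u i x + s * q i x) * z i x) = 0" for x
        using confD(10)[OF conf, of x]
        by (simp add: distrib_right sum.distrib mult.assoc sum_distrib_left[symmetric])
      show "(\<Sum>i<6. (u i x + s * q i x) * w i x) = F x + s * G x" for x
        using confD(11)[OF conf, of x]
        by (simp add: distrib_right sum.distrib mult.assoc sum_distrib_left[symmetric] G_def)
      show "\<exists>x. F x + s * G x \<noteq> 0" using s by blast
      show "quad (\<lambda>x. u i x + s * q i x)" if "i < 6" for i
        by (intro quad_plus quad_cmult qq confD(4)[OF conf that])
      show "cub (\<lambda>x. F x + s * G x)" by (intro cub_plus cub_cmult cG confD(5)[OF conf])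
    qed (use confD[OF conf] in auto)
    then have "reach M (\<lambda>x. F x + s * G x)"
    proof (rule reach_rank3_generic[OF a _ M z N, where A = "?As s" and B = "?Bs s" and C = "?Cs s"])
      fix j :: nat and x assume j: "j < 6"
      show "u j x + s * q j x = (\<Sum>i<6. N j i x * z i x) + (if j < 3 then 0 else
          ?As s j * (x 3 * x 3) + ?Bs s j * (x 3 * x 4) + ?Cs s j * (x 4 * x 4))"
        using j less6[of j] by (auto simp: u'[OF j] q_def algebra_simps)
    qed (use s in auto)
    moreover have "(\<lambda>x. \<Sum>m\<le>1. s ^ m * GG m x) = (\<lambda>x. F x + s * G x)" by (auto simp: GG_def fun_eq_iff)
    moreover have "(\<lambda>x. \<Sum>m\<le>1. s ^ m * NN m i j x) = M i j" for i j by (auto simp: NN_def fun_eq_iff)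
    ultimately show "reach (\<lambda>i j x. \<Sum>m\<le>1. s ^ m * NN m i j x) (\<lambda>x. \<Sum>m\<le>1. s ^ m * GG m x)"
      by simp
  qed
  then show ?thesis by (simp add: NN_def GG_def)
qed

text \<open>Semistability as the absence of destabilizing one-parameter subgroups\<close>

definition sst :: "(nat \<Rightarrow> nat \<Rightarrow> pt \<Rightarrow> complex) \<Rightarrow> bool" where
  "sst M \<longleftrightarrow> (\<forall>k k' a. inverses 6 k k' \<longrightarrow> (\<Sum>i<6. a i) = (0::int) \<longrightarrow>
     (\<exists>i<6. \<exists>j<6. \<exists>x. cg k (val M x) i j \<noteq> 0 \<and> a i + a j \<le> 0))"

lemma sstD:
  assumes "sst M" "inverses 6 k k'" "(\<Sum>i<6. a i) = (0::int)"
  obtains i j x where "i < 6" "j < 6" "cg k (val M x) i j \<noteq> 0" "a i + a j \<le> 0"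
  using assms unfolding sst_def by blast

lemma cg_dl: "i < 6 \<Longrightarrow> j < 6 \<Longrightarrow> cg dl m i j = m i j"
  by (simp add: cg_mp mp_dl_left) (simp add: mp_def)

lemma sst_no_isotropic4:
  assumes st: "sst M" and z: "\<And>i j x. i < 4 \<Longrightarrow> j < 4 \<Longrightarrow> M i j x = 0"
  shows False
proof -
  define a :: "nat \<Rightarrow> int" where "a = (\<lambda>i. if i < 4 then - 1 else 2)"
  have "(\<Sum>i<6. a i) = 0" by (simp add: sum6 a_def)
  then obtain i j x where ij: "i < 6" "j < 6" "cg dl (val M x) i j \<noteq> 0" "a i + a j \<le> 0"
    using sstD[OF st inverses_dl] by metis
  then have "i < 4" "j < 4" by (auto simp: a_def split: if_splits)
  then show False using ij z by (simp add: cg_dl)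
qed

definition ker :: "(nat \<Rightarrow> nat \<Rightarrow> pt \<Rightarrow> complex) \<Rightarrow> (nat \<Rightarrow> pt \<Rightarrow> complex) \<Rightarrow> bool" where
  "ker M z \<longleftrightarrow> (\<forall>x. \<forall>i<6. (\<Sum>j<6. M i j x * z j x) = 0)"

lemma ker_polar:
  assumes ker: "ker M z" and M: "skewl M" and z: "\<And>i. i < 6 \<Longrightarrow> lin (z i)" and i: "i < 6"
  shows "(\<Sum>j<6. M i j x * z j y + M i j y * z j x) = 0"
proof -
  have "(\<Sum>j<6. M i j x * z j y + M i j y * z j x) =
      (\<Sum>j<6. M i j (\<lambda>k. x k + y k) * z j (\<lambda>k. x k + y k)) - (\<Sum>j<6. M i j x * z j x) - (\<Sum>j<6. M i j y * z j y)"
    unfolding sum_subtractf[symmetric]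
    by (intro sum.cong refl) (simp add: lin_add[OF z] lin_add[OF skewl_lin[OF M i]] algebra_simps)
  then show ?thesis using ker i unfolding ker_def by simp
qed

lemma lin_normal: "r \<le> 5 \<Longrightarrow> (\<And>x. z x = (if i < r then x i else 0)) \<Longrightarrow> lin z"
proof -
  assume r: "r \<le> 5" and z: "\<And>x. z x = (if i < r then x i else 0)"
  have "z = (\<lambda>x. if i < r then x i else 0)" using z by (rule ext)
  then show "lin z" using lin_coord[of i] r by (cases "i < r") auto
qed

lemma koszul_axes:
  assumes ker: "ker M z" and M: "skewl M" and z: "\<And>i x. i < 6 \<Longrightarrow> z i x = (if i < r then x i else 0)"
    and r: "r \<le> 5" "i < 6" "j < r"
  shows "k < r \<Longrightarrow> M i j (dl k) = - M i k (dl j)" "r \<le> k \<Longrightarrow> k < 5 \<Longrightarrow> M i j (dl k) = 0"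
proof -
  have lz: "lin (z i)" if "i < 6" for i 
    by (rule lin_normal[where i = i, OF r(1)]) (rule z[OF that])
  have s: "(\<Sum>a<6. f a * z a (dl j)) = (if j < r then f j else 0)" if "j < 5" for f j
  proof -
    have "(\<Sum>a<6. f a * z a (dl j)) = (\<Sum>a<6. (if j < r then f a else 0) * dl j a)"
      by (intro sum.cong refl) (auto simp: z dl_def)
    then show ?thesis using that by simp
  qed
  have p: "k < 5 \<Longrightarrow> (if j < r then M i j (dl k) else 0) + (if k < r then M i k (dl j) else 0) = 0"
    using ker_polar[OF ker M lz r(2), of "dl k" "dl j"] r by (simp add: sum.distrib s)
  show "k < r \<Longrightarrow> M i j (dl k) = - M i k (dl j)" "r \<le> k \<Longrightarrow> k < 5 \<Longrightarrow> M i j (dl k) = 0"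
    using p r by (auto simp: eq_neg_iff_add_eq_0)
qed

lemma proportional_pq:
  assumes f: "lin f" "lin g" and pq: "p < 5" "q < 5" "p \<noteq> q" and eq: "\<And>x. x p * g x = x q * f x"
  shows "\<exists>\<mu>. \<forall>x. f x = \<mu> * x p \<and> g x = \<mu> * x q"
proof -
  have *: "h x = h (dl p) * x p"
    if "lin h" "lin k" "\<And>x. x p * k x = x q * h x" "p < 5" "p \<noteq> q" for h k p q and x :: pt
  proof -
    have e1: "h (dl q) = 0" using that(3)[of "dl q"] that(5) by (simp add: dl_def)
    have "h (dl k) = 0" if "k \<noteq> p" "k \<noteq> q" for k
      using \<open>\<And>x. x p * _ x = x q * h x\<close>[of "\<lambda>m. dl q m + dl k m"] that e1 \<open>p \<noteq> q\<close>
      by (simp add: lin_add[OF \<open>lin h\<close>]) (simp add: dl_def)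
    then have z: "h (dl k) = 0" if "k \<noteq> p" for k using e1 that by (cases "k = q") auto
    have "h x = (\<Sum>k<5. h (dl p) * x k * dl k p)"
      unfolding lin_axes[OF that(1), of x] by (intro sum.cong refl) (use z in \<open>auto simp: dl_def\<close>)
    then show ?thesis using that by simp
  qed
  have F: "f x = f (dl p) * x p" for x by (rule *[OF f eq]) (use pq in auto)
  have G: "g x = g (dl q) * x q" for x by (rule *[OF f(2,1)]) (use eq[symmetric] pq in auto)
  have "g (dl q) = f (dl p)"
    using eq[of "\<lambda>m. dl p m + dl q m"] F[of "\<lambda>m. dl p m + dl q m"] G[of "\<lambda>m. dl p m + dl q m"] pq
    by (simp add: dl_def)
  then show ?thesis using F G by metis
qed

lemma conic_facts:
  assumes conf: "conf M z w u F c" and kz: "ker M z" and z: "\<And>i x. i < 6 \<Longrightarrow> z i x = (if i < 4 then x i else 0)"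
  shows "\<And>i j. i < 6 \<Longrightarrow> j < 4 \<Longrightarrow> M i j (dl 4) = 0" "\<And>i j. i < 4 \<Longrightarrow> j < 6 \<Longrightarrow> M i j (dl 4) = 0"
    "w 4 (dl 4) = 0" "w 5 (dl 4) = 0"
    "M 0 1 x * M 4 5 (dl 4) = c * (x 2 * w 3 (dl 4) - x 3 * w 2 (dl 4))"
    "M 0 2 x * M 4 5 (dl 4) = - c * (x 1 * w 3 (dl 4) - x 3 * w 1 (dl 4))"
    "M 0 3 x * M 4 5 (dl 4) = c * (x 1 * w 2 (dl 4) - x 2 * w 1 (dl 4))"
    "M 1 2 x * M 4 5 (dl 4) = c * (x 0 * w 3 (dl 4) - x 3 * w 0 (dl 4))"
    "M 1 3 x * M 4 5 (dl 4) = - c * (x 0 * w 2 (dl 4) - x 2 * w 0 (dl 4))"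
    "M 2 3 x * M 4 5 (dl 4) = c * (x 0 * w 1 (dl 4) - x 1 * w 0 (dl 4))"
proof -
  note M = confD(1)[OF conf]
  have c: "c \<noteq> 0" by (rule confD(7)[OF conf])
  have r: "M i j (dl 4) = 0" if "i < 6" "j < 4" for i j
    by (rule koszul_axes(2)[OF kz M z _ that(1) that(2)]) auto
  then show "\<And>i j. i < 6 \<Longrightarrow> j < 4 \<Longrightarrow> M i j (dl 4) = 0" .
  have l: "M i j (dl 4) = 0" if "i < 4" "j < 6" for i j
    using r[of j i] skewl_skew[OF M, of j i "dl 4"] that by simp
  then show "\<And>i j. i < 4 \<Longrightarrow> j < 6 \<Longrightarrow> M i j (dl 4) = 0" .
  let ?s = "\<lambda>x::pt. \<lambda>k. x k + dl 4 k"
  have sh: "M i j (?s x) = M i j x + M i j (dl 4)" if "i < 6" "j < 6" for i j x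
    by (rule lin_add[OF skewl_lin[OF M that]])
  have wsh: "w i (?s x) = w i x + w i (dl 4)" if "i < 6" for i x by (rule lin_add[OF confD(3)[OF conf that]])
  have shz: "z i (?s x) = z i x" if "i < 6" for i x using that by (simp add: z dl_def)
  have P: "pfa (val M (?s x)) i j - pfa (val M x) i j = c * (z i x * w j (dl 4) - z j x * w i (dl 4))"
    if "i < j" "j < 6" for i j x
    unfolding conf_pfa[OF conf that] using that by (simp add: shz wsh algebra_simps)
  have e0: "z 0 (dl 0) = 1" "z 4 (dl 0) = 0" "z 5 (dl 0) = 0" by (simp_all add: z dl_def)
  have "c * w 4 (dl 4) = 0" using P[of 0 4 "dl 0"] unfolding e0 pfa_entries by (simp add: sh r l)
  then show "w 4 (dl 4) = 0" using c by simp
  have "c * w 5 (dl 4) = 0" using P[of 0 5 "dl 0"] unfolding e0 pfa_entries by (simp add: sh r l)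
  then show "w 5 (dl 4) = 0" using c by simp
  note A = P[of 2 3 x, unfolded pfa_entries] P[of 1 3 x, unfolded pfa_entries] P[of 1 2 x, unfolded pfa_entries]
    P[of 0 3 x, unfolded pfa_entries] P[of 0 2 x, unfolded pfa_entries] P[of 0 1 x, unfolded pfa_entries]
  show "M 0 1 x * M 4 5 (dl 4) = c * (x 2 * w 3 (dl 4) - x 3 * w 2 (dl 4))"
    using A(1) by (simp add: sh r l z algebra_simps)
  show "M 0 2 x * M 4 5 (dl 4) = - c * (x 1 * w 3 (dl 4) - x 3 * w 1 (dl 4))"
    using A(2) by (simp add: sh r l z algebra_simps)
  show "M 0 3 x * M 4 5 (dl 4) = c * (x 1 * w 2 (dl 4) - x 2 * w 1 (dl 4))"
    using A(3) by (simp add: sh r l z algebra_simps)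
  show "M 1 2 x * M 4 5 (dl 4) = c * (x 0 * w 3 (dl 4) - x 3 * w 0 (dl 4))"
    using A(4) by (simp add: sh r l z algebra_simps)
  show "M 1 3 x * M 4 5 (dl 4) = - c * (x 0 * w 2 (dl 4) - x 2 * w 0 (dl 4))"
    using A(5) by (simp add: sh r l z algebra_simps)
  show "M 2 3 x * M 4 5 (dl 4) = c * (x 0 * w 1 (dl 4) - x 1 * w 0 (dl 4))"
    using A(6) by (simp add: sh r l z algebra_simps)
qed

lemma conic_normalized:
  assumes conf: "conf M z w u F c" and kz: "ker M z" and kw: "ker M w"
    and z: "\<And>i x. i < 6 \<Longrightarrow> z i x = (if i < 4 then x i else 0)"
    and m: "M 4 5 (dl 4) \<noteq> 0" and w: "w 0 (dl 4) \<noteq> 0" "w 1 (dl 4) = 0" "w 2 (dl 4) = 0" "w 3 (dl 4) = 0"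
  shows "reach M F"
proof -
  note M = confD(1)[OF conf]
  note cf = conic_facts[OF conf kz z]
  have lM: "lin (M i j)" if "i < 6" "j < 6" for i j by (rule skewl_lin[OF M that])
  have lw: "lin (w i)" if "i < 6" for i by (rule confD(3)[OF conf that])
  have c: "c \<noteq> 0" by (rule confD(7)[OF conf])
  define e where "e = w 0 (dl 4)"
  define mm where "mm = M 4 5 (dl 4)"
  define \<rho> where "\<rho> = mm / e"
  have e: "e \<noteq> 0" and mm: "mm \<noteq> 0" using w m by (simp_all add: e_def mm_def)
  have M0: "M 0 1 x = 0" "M 0 2 x = 0" "M 0 3 x = 0" for x
    using cf(5-7)[of x] m w by simp_all
  have kx: "M i j (dl k) = - M i k (dl j)" if "i < 6" "j < 4" "k < 4" for i j k
    by (rule koszul_axes(1)[OF kz M z _ that(1) that(2,3)]) auto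
  have sk: "M i j x = - M j i x" if "i < 6" "j < 6" for i j x by (rule skewl_skew[OF M that(2,1)])
  have d0: "M i i x = 0" if "i < 6" for i x using sk[OF that that, of x] by simp
  have M04: "M 0 4 x = \<rho> * w 5 x" and M05: "M 0 5 x = - \<rho> * w 4 x" for x
  proof -
    have A: "M 4 0 x * e + mm * w 5 x = 0"
      using ker_polar[OF kw M lw, of 4 x "dl 4"] unfolding sum6 w
      by (simp add: cf(1-4) d0 e_def mm_def)
    have B: "M 5 0 x * e + M 5 4 (dl 4) * w 4 x = 0"
      using ker_polar[OF kw M lw, of 5 x "dl 4"] unfolding sum6 w
      by (simp add: cf(1-4) d0 e_def mm_def)
    have s: "M 4 0 x = - M 0 4 x" "M 5 0 x = - M 0 5 x" by (rule sk; simp)+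
    have s': "M 5 4 (dl 4) = - mm" unfolding mm_def by (rule sk; simp)
    have "e * M 0 4 x - mm * w 5 x = - (- M 0 4 x * e + mm * w 5 x)"
      "e * M 0 5 x - - (mm * w 4 x) = - (- M 0 5 x * e + - mm * w 4 x)" by (simp_all add: algebra_simps)
    then have E: "e * M 0 4 x = mm * w 5 x" "e * M 0 5 x = - (mm * w 4 x)"
      unfolding A[unfolded s] B[unfolded s s'] by (simp_all add: eq_neg_iff_add_eq_0)
    have "M 0 4 x = (e * M 0 4 x) / e" "M 0 5 x = (e * M 0 5 x) / e" using e by simp_all
    then show "M 0 4 x = \<rho> * w 5 x" "M 0 5 x = - \<rho> * w 4 x"
      unfolding E \<rho>_def by simp_all
  qed
  have \<rho>: "\<rho> \<noteq> 0" using e mm by (simp add: \<rho>_def)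
  have z5: "w 5 (dl 0) = 0" "w 4 (dl 0) = 0"
    using M04[of "dl 0"] M05[of "dl 0"] kx[of 4 0 0] kx[of 5 0 0] sk[of 4 0 "dl 0"] sk[of 5 0 "dl 0"] \<rho> by auto
  define a where "a = (\<lambda>l. w 5 (dl l))"
  define b where "b = (\<lambda>l. w 4 (dl l))"
  have w5: "w 5 x = a 1 * x 1 + a 2 * x 2 + a 3 * x 3" for x
    by (subst lin_axes[OF lw]) (simp_all add: sum5 a_def z5 cf(4))
  have w4: "w 4 x = b 1 * x 1 + b 2 * x 2 + b 3 * x 3" for x
    by (subst lin_axes[OF lw]) (simp_all add: sum5 b_def z5 cf(3))
  have zero: "M i j (dl j) = 0" if "i < 6" "j < 4" for i j using kx[OF that(1,2,2)] by simp
  have M4e: "M 4 l (dl 0) = \<rho> * a l" and M5e: "M 5 l (dl 0) = - \<rho> * b l" if "l < 4" for l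
    using kx[of 4 l 0] kx[of 5 l 0] sk[of 4 0 "dl l"] sk[of 5 0 "dl l"] M04[of "dl l"] M05[of "dl l"] that
    by (simp_all add: a_def b_def)
  have rows: "M i 1 x = M i 1 (dl 0) * x 0 + M i 1 (dl 2) * x 2 + M i 1 (dl 3) * x 3"
    "M i 2 x = M i 2 (dl 0) * x 0 - M i 1 (dl 2) * x 1 + M i 2 (dl 3) * x 3"
    "M i 3 x = M i 3 (dl 0) * x 0 - M i 1 (dl 3) * x 1 - M i 2 (dl 3) * x 2" if "i < 6" for i x
  proof -
    have E: "M i l x = M i l (dl 0) * x 0 + M i l (dl 1) * x 1 + M i l (dl 2) * x 2 + M i l (dl 3) * x 3"
      if "l < 4" for l
      by (subst lin_axes[OF lM]) (use that \<open>i < 6\<close> in \<open>simp_all add: sum5 cf(1)\<close>)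
    show "M i 1 x = M i 1 (dl 0) * x 0 + M i 1 (dl 2) * x 2 + M i 1 (dl 3) * x 3"
      using E[of 1] zero[OF that, of 1] by simp
    show "M i 2 x = M i 2 (dl 0) * x 0 - M i 1 (dl 2) * x 1 + M i 2 (dl 3) * x 3"
      using E[of 2] zero[OF that, of 2] kx[OF that, of 2 1] by simp
    show "M i 3 x = M i 3 (dl 0) * x 0 - M i 1 (dl 3) * x 1 - M i 2 (dl 3) * x 2"
      using E[of 3] zero[OF that, of 3] kx[OF that, of 3 1] kx[OF that, of 3 2] by simp
  qed
  define p q t p' q' t' where "p = M 4 1 (dl 2)" and "q = M 4 1 (dl 3)" and "t = M 4 2 (dl 3)"
    and "p' = M 5 1 (dl 2)" and "q' = M 5 1 (dl 3)" and "t' = M 5 2 (dl 3)"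
  have i6: "(4::nat) < 6" "(5::nat) < 6" "(1::nat) < 4" "(2::nat) < 4" "(3::nat) < 4" by simp_all
  have R4: "M 4 1 x = \<rho> * a 1 * x 0 + p * x 2 + q * x 3" "M 4 2 x = \<rho> * a 2 * x 0 - p * x 1 + t * x 3"
    "M 4 3 x = \<rho> * a 3 * x 0 - q * x 1 - t * x 2" for x
    using rows[OF i6(1), of x] unfolding p_def q_def t_def M4e[OF i6(3)] M4e[OF i6(4)] M4e[OF i6(5)] .
  have R5: "M 5 1 x = - \<rho> * b 1 * x 0 + p' * x 2 + q' * x 3" "M 5 2 x = - \<rho> * b 2 * x 0 - p' * x 1 + t' * x 3"
    "M 5 3 x = - \<rho> * b 3 * x 0 - q' * x 1 - t' * x 2" for x
    using rows[OF i6(2), of x] unfolding p'_def q'_def t'_def M5e[OF i6(3)] M5e[OF i6(4)] M5e[OF i6(5)] .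
  have P23: "c * (x 2 * w 3 x - x 3 * w 2 x) = \<rho> * (w 5 x * M 5 1 x + w 4 x * M 4 1 x)" for x
  proof -
    have "M 0 1 x * M 4 5 x - M 0 4 x * M 1 5 x + M 0 5 x * M 1 4 x = c * (z 2 x * w 3 x - z 3 x * w 2 x)"
      using conf_pfa[OF conf, of 2 3 x] unfolding pfa_entries by simp
    then show ?thesis unfolding M0 M04 M05 using sk[of 1 5 x] sk[of 1 4 x] by (simp add: z algebra_simps)
  qed
  have P13: "c * (x 3 * w 1 x - x 1 * w 3 x) = \<rho> * (w 5 x * M 5 2 x + w 4 x * M 4 2 x)" for x
  proof -
    have "- (M 0 2 x * M 4 5 x - M 0 4 x * M 2 5 x + M 0 5 x * M 2 4 x) = c * (z 1 x * w 3 x - z 3 x * w 1 x)"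
      using conf_pfa[OF conf, of 1 3 x] unfolding pfa_entries by simp
    then show ?thesis unfolding M0 M04 M05 using sk[of 2 5 x] sk[of 2 4 x] by (simp add: z algebra_simps)
  qed
  have P12: "c * (x 1 * w 2 x - x 2 * w 1 x) = \<rho> * (w 5 x * M 5 3 x + w 4 x * M 4 3 x)" for x
  proof -
    have "M 0 3 x * M 4 5 x - M 0 4 x * M 3 5 x + M 0 5 x * M 3 4 x = c * (z 1 x * w 2 x - z 2 x * w 1 x)"
      using conf_pfa[OF conf, of 1 2 x] unfolding pfa_entries by simp
    then show ?thesis unfolding M0 M04 M05 using sk[of 3 5 x] sk[of 3 4 x] by (simp add: z algebra_simps)
  qed
  define h1 where "h1 = (\<lambda>x. c * w 1 x - \<rho> * \<rho> * (a 2 * b 3 - a 3 * b 2) * x 0 - \<rho> * t' * w 5 x - \<rho> * t * w 4 x)"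
  define h2 where "h2 = (\<lambda>x. c * w 2 x - \<rho> * \<rho> * (a 3 * b 1 - a 1 * b 3) * x 0 + \<rho> * q' * w 5 x + \<rho> * q * w 4 x)"
  define h3 where "h3 = (\<lambda>x. c * w 3 x - \<rho> * \<rho> * (a 1 * b 2 - a 2 * b 1) * x 0 - \<rho> * p' * w 5 x - \<rho> * p * w 4 x)"
  have lh: "lin h1" "lin h2" "lin h3" unfolding h1_def h2_def h3_def
    by (intro lin_plus lin_minus lin_cmult lw lin_coord; simp)+
  have h23: "x 2 * h3 x = x 3 * h2 x" for x
  proof -
    have "x 2 * h3 x - x 3 * h2 x = c * (x 2 * w 3 x - x 3 * w 2 x) - \<rho> * (w 5 x * M 5 1 x + w 4 x * M 4 1 x)"
      unfolding h2_def h3_def R4 R5 w4 w5 by (simp add: algebra_simps)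
    then show ?thesis using P23[of x] by simp
  qed
  have h12: "x 1 * h2 x = x 2 * h1 x" for x
  proof -
    have "x 1 * h2 x - x 2 * h1 x = c * (x 1 * w 2 x - x 2 * w 1 x) - \<rho> * (w 5 x * M 5 3 x + w 4 x * M 4 3 x)"
      unfolding h2_def h1_def R4 R5 w4 w5 by (simp add: algebra_simps)
    then show ?thesis using P12[of x] by simp
  qed
  obtain \<mu> where \<mu>: "\<And>x. h2 x = \<mu> * x 2" "\<And>x. h3 x = \<mu> * x 3"
    using proportional_pq[OF lh(2,3), of 2 3] h23 by auto
  obtain \<mu>' where \<mu>': "\<And>x. h1 x = \<mu>' * x 1" "\<And>x. h2 x = \<mu>' * x 2"
    using proportional_pq[OF lh(1,2), of 1 2] h12 by auto
  have "\<mu>' = \<mu>" using \<mu>(1)[of "dl 2"] \<mu>'(2)[of "dl 2"] by (simp add: dl_def)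
  then have h1: "\<And>x. h1 x = \<mu> * x 1" using \<mu>' by simp
  obtain N Q where N: "skewl N"
    and u: "\<And>j x. j < 6 \<Longrightarrow> u j x = (\<Sum>i<4. N j i x * x i) + (if j < 4 then 0 else (\<Sum>a=4..<5. \<Sum>b=4..<5. Q j a b * (x a * x b)))"
    by (rule conf_koszul[OF conf _ z]) auto
  define \<alpha> where "\<alpha> = Q 4 4 4"
  define \<beta> where "\<beta> = Q 5 4 4"
  define \<theta> where "\<theta> = (\<lambda>l. \<alpha> * b l + \<beta> * a l)"
  define la4 where "la4 = (\<rho> * (\<theta> 1 * t - \<theta> 2 * q + \<theta> 3 * p) + \<mu> * \<alpha>) / c"
  define la5 where "la5 = (\<rho> * (\<theta> 1 * t' - \<theta> 2 * q' + \<theta> 3 * p') + \<mu> * \<beta>) / c"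
  have tw: "\<theta> 1 * w 1 x + \<theta> 2 * w 2 x + \<theta> 3 * w 3 x = la4 * w 4 x + la5 * w 5 x" for x
  proof -
    have c4: "c * la4 = \<rho> * (\<theta> 1 * t - \<theta> 2 * q + \<theta> 3 * p) + \<mu> * \<alpha>"
      and c5: "c * la5 = \<rho> * (\<theta> 1 * t' - \<theta> 2 * q' + \<theta> 3 * p') + \<mu> * \<beta>"
      using c by (simp_all add: la4_def la5_def)
    have "c * (\<theta> 1 * w 1 x + \<theta> 2 * w 2 x + \<theta> 3 * w 3 x) - (c * la4 * w 4 x + c * la5 * w 5 x) =
      \<theta> 1 * (h1 x - \<mu> * x 1) + \<theta> 2 * (h2 x - \<mu> * x 2) + \<theta> 3 * (h3 x - \<mu> * x 3)
      + \<mu> * (\<theta> 1 * x 1 + \<theta> 2 * x 2 + \<theta> 3 * x 3 - \<alpha> * w 4 x - \<beta> * w 5 x)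
      + \<rho> * \<rho> * x 0 * (\<theta> 1 * (a 2 * b 3 - a 3 * b 2) + \<theta> 2 * (a 3 * b 1 - a 1 * b 3) + \<theta> 3 * (a 1 * b 2 - a 2 * b 1))"
      unfolding c4 c5 h1_def h2_def h3_def by (simp add: algebra_simps)
    also have "\<dots> = 0" unfolding h1 \<mu> w4 w5 \<theta>_def by (simp add: algebra_simps)
    finally have "c * (\<theta> 1 * w 1 x + \<theta> 2 * w 2 x + \<theta> 3 * w 3 x - (la4 * w 4 x + la5 * w 5 x)) = 0"
      by (simp add: algebra_simps)
    then show ?thesis using c by simp
  qed
  define f where "f = (\<lambda>k. w 0 (dl k))"
  have w0: "w 0 x = f 0 * x 0 + f 1 * x 1 + f 2 * x 2 + f 3 * x 3 + e * x 4" for x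
    by (subst lin_axes[OF lw]) (simp_all add: sum5 f_def e_def)
  define up where "up = (\<lambda>i j. if i = 0 \<and> 1 \<le> j \<and> j \<le> 3 then - \<theta> j
     else if j = 4 \<and> i < 4 then (if i = 0 then la4 else 0) - f i * \<alpha>
     else if j = 5 \<and> i < 4 then (if i = 0 then la5 else 0) - f i * \<beta> else (0::complex))"
  define n1 where "n1 = (\<lambda>i j::nat. if i < j then up i j else if j < i then - up j i else 0)"
  have N1: "skewl (\<lambda>i j x. n1 i j / e * x 4)"
  proof (rule skewlI)
    fix i j :: nat and x :: pt
    show "lin (\<lambda>x. n1 i j / e * x 4)" by (intro lin_cmult lin_coord) simp
    show "n1 j i / e * x 4 = - (n1 i j / e * x 4)" by (simp add: n1_def)
  qed
  have N2: "skewl (\<lambda>i j x. n1 i j / e * x 4 - N i j x)"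
  proof (rule skewlI)
    fix i j :: nat and x :: pt assume ij: "i < 6" "j < 6"
    show "lin (\<lambda>x. n1 i j / e * x 4 - N i j x)"
      by (intro lin_minus lin_cmult lin_coord skewl_lin[OF N] ij) simp
    have "n1 j i / e * x 4 = - (n1 i j / e * x 4)" "N j i x = - N i j x"
      by (rule skewl_skew[OF N1 ij], rule skewl_skew[OF N ij])
    then show "n1 j i / e * x 4 - N j i x = - (n1 i j / e * x 4 - N i j x)" by simp
  qed
  show ?thesis
  proof (rule conf_first_order[OF conf N2, of 1])
    fix x
    have zx: "z 0 x = x 0" "z 1 x = x 1" "z 2 x = x 2" "z 3 x = x 3" "z 4 x = 0" "z 5 x = 0" by (simp_all add: z)
    have nn: "n1 0 1 = - \<theta> 1" "n1 0 2 = - \<theta> 2" "n1 0 3 = - \<theta> 3" "n1 1 2 = 0" "n1 1 3 = 0" "n1 2 3 = 0"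
      "n1 0 4 = la4 - f 0 * \<alpha>" "n1 1 4 = - f 1 * \<alpha>" "n1 2 4 = - f 2 * \<alpha>" "n1 3 4 = - f 3 * \<alpha>"
      "n1 0 5 = la5 - f 0 * \<beta>" "n1 1 5 = - f 1 * \<beta>" "n1 2 5 = - f 2 * \<beta>" "n1 3 5 = - f 3 * \<beta>" "n1 4 5 = 0"
      by (simp_all add: n1_def up_def)
    have n1s: "skew6 n1" by (auto simp: skew6_def n1_def)
    have th: "\<theta> 1 * x 1 + \<theta> 2 * x 2 + \<theta> 3 * x 3 = \<alpha> * w 4 x + \<beta> * w 5 x"
      unfolding \<theta>_def w4 w5 by (simp add: algebra_simps)
    have "(\<Sum>i<6. \<Sum>j<6. z i x * n1 i j * w j x) =
        (\<theta> 1 * x 1 + \<theta> 2 * x 2 + \<theta> 3 * x 3 - \<alpha> * w 4 x - \<beta> * w 5 x) * w 0 x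
        - x 0 * (\<theta> 1 * w 1 x + \<theta> 2 * w 2 x + \<theta> 3 * w 3 x - la4 * w 4 x - la5 * w 5 x)
        + (\<alpha> * w 4 x + \<beta> * w 5 x) * (w 0 x - (f 0 * x 0 + f 1 * x 1 + f 2 * x 2 + f 3 * x 3))"
      unfolding skew_pairing_expand[OF n1s] zx nn by (simp add: algebra_simps)
    also have "\<dots> = (\<alpha> * w 4 x + \<beta> * w 5 x) * (e * x 4)"
      using tw[of x] th w0[of x] by simp
    finally have s1: "(\<Sum>i<6. \<Sum>j<6. z i x * n1 i j * w j x) = (\<alpha> * w 4 x + \<beta> * w 5 x) * (e * x 4)" .
    have "(\<Sum>i<6. \<Sum>j<6. z i x * (n1 i j / e * x 4) * w j x) =
        (\<Sum>i<6. \<Sum>j<6. (z i x * n1 i j * w j x) * (x 4 / e))" by (simp add: mult_ac)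
    also have "\<dots> = (\<Sum>i<6. \<Sum>j<6. z i x * n1 i j * w j x) * (x 4 / e)" by (simp only: sum_distrib_right)
    also have "\<dots> = (\<alpha> * w 4 x + \<beta> * w 5 x) * (x 4 * x 4)" unfolding s1 using e by simp
    finally have s1: "(\<Sum>i<6. \<Sum>j<6. z i x * (n1 i j / e * x 4) * w j x) = (\<alpha> * w 4 x + \<beta> * w 5 x) * (x 4 * x 4)" .
    have s2: "(\<Sum>i<6. \<Sum>j<6. z i x * N i j x * w j x) = - (\<Sum>j<6. (\<Sum>i<4. N j i x * x i) * w j x)"
      by (rule skew_pairing[OF N, of 4]) (simp_all add: z)
    have "F x = (\<Sum>j<6. (\<Sum>i<4. N j i x * x i) * w j x + (if j = 4 then \<alpha> else if j = 5 then \<beta> else 0) * (x 4 * x 4) * w j x)"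
      unfolding confD(11)[OF conf, of x, symmetric]
    proof (rule sum.cong[OF refl])
      fix j :: nat assume "j \<in> {..<6}"
      then have "j < 6" by simp
      then show "u j x * w j x = (\<Sum>i<4. N j i x * x i) * w j x + (if j = 4 then \<alpha> else if j = 5 then \<beta> else 0) * (x 4 * x 4) * w j x"
        using less6[of j] by (auto simp: u \<alpha>_def \<beta>_def atLeastLessThanSuc eval_nat_numeral algebra_simps)
    qed
    also have "\<dots> = (\<Sum>j<6. (\<Sum>i<4. N j i x * x i) * w j x) +
        (\<Sum>j<6. (if j = 4 then \<alpha> else if j = 5 then \<beta> else 0) * (x 4 * x 4) * w j x)" by (rule sum.distrib)
    also have "(\<Sum>j<6. (if j = 4 then \<alpha> else if j = 5 then \<beta> else 0) * (x 4 * x 4) * w j x) =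
        (\<alpha> * w 4 x + \<beta> * w 5 x) * (x 4 * x 4)" by (simp only: sum6) (simp add: algebra_simps)
    finally have F: "F x = (\<Sum>j<6. (\<Sum>i<4. N j i x * x i) * w j x) + (\<alpha> * w 4 x + \<beta> * w 5 x) * (x 4 * x 4)" .
    have "(\<Sum>i<6. \<Sum>j<6. z i x * (n1 i j / e * x 4 - N i j x) * w j x) =
        (\<Sum>i<6. \<Sum>j<6. z i x * (n1 i j / e * x 4) * w j x) - (\<Sum>i<6. \<Sum>j<6. z i x * N i j x * w j x)"
      by (simp only: right_diff_distrib left_diff_distrib sum_subtractf)
    then show "(\<Sum>i<6. \<Sum>j<6. z i x * (n1 i j / e * x 4 - N i j x) * w j x) = 1 * F x"
      unfolding s1 s2 F by simp
  qed simp
qed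

lemma ker_transport:
  assumes ker: "ker M z" and k: "inverses 6 k k'"
  shows "ker (\<lambda>i j x. cg k (val M (app g x)) i j) (\<lambda>i x. \<Sum>l<6. k' l i * z l (app g x))"
  unfolding ker_def
proof (intro allI impI)
  fix x and i :: nat assume i: "i < 6"
  let ?T = "\<lambda>k :: nat \<Rightarrow> nat \<Rightarrow> complex. \<lambda>a b. k b a"
  let ?m = "val M (app g x)" and ?z = "\<lambda>l (j::nat). z l (app g x)"
  have assoc: "mp 6 (mp 6 A B) C = mp 6 A (mp 6 B C)" for A B C :: "nat \<Rightarrow> nat \<Rightarrow> complex"
    by (simp add: fun_eq_iff mp_assoc)
  have "(\<Sum>j<6. cg k ?m i j * (\<Sum>l<6. k' l j * z l (app g x))) = mp 6 (cg k ?m) (mp 6 (?T k') ?z) i 0"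
    by (simp add: mp_def)
  also have "\<dots> = mp 6 k (mp 6 ?m (mp 6 (mp 6 (?T k) (?T k')) ?z)) i 0" by (simp only: cg_mp assoc)
  also have "\<dots> = mp 6 k (mp 6 ?m (mp 6 dl ?z)) i 0"
    using inverses_transpose[OF inverses_commute[OF k]] by (intro mp_cong refl) (auto simp: inverses_def)
  also have "\<dots> = mp 6 k (mp 6 ?m ?z) i 0" by (intro mp_cong refl) (simp add: mp_dl_left)
  also have "\<dots> = 0" using ker unfolding ker_def mp_def by simp
  finally show "(\<Sum>j<6. cg k ?m i j * (\<Sum>l<6. k' l j * z l (app g x))) = 0" .
qed

lemma cg_mp2: "cg k (cg h m) i j = cg (mp 6 k h) m i j"
proof -
  let ?T = "\<lambda>k :: nat \<Rightarrow> nat \<Rightarrow> complex. \<lambda>a b. k b a"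
  have assoc: "mp 6 (mp 6 A B) C = mp 6 A (mp 6 B C)" for A B C :: "nat \<Rightarrow> nat \<Rightarrow> complex"
    by (simp add: fun_eq_iff mp_assoc)
  have "mp 6 (?T h) (?T k) = ?T (mp 6 k h)" by (simp add: fun_eq_iff mp_def mult.commute)
  then show ?thesis unfolding cg_mp by (simp only: assoc)
qed

lemma lin_cong: "lin f \<Longrightarrow> (\<And>k. k < 5 \<Longrightarrow> x k = y k) \<Longrightarrow> f x = f y"
  unfolding lin_def by auto

lemma sst_transport:
  assumes st: "sst M" and M: "skewl M" and h: "inverses 6 h h'" and g: "inverses 5 g g'"
  shows "sst (\<lambda>i j x. cg h (val M (app g x)) i j)"
  unfolding sst_def
proof (intro allI impI)
  fix k k' :: "nat \<Rightarrow> nat \<Rightarrow> complex" and a :: "nat \<Rightarrow> int"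
  assume k: "inverses 6 k k'" and a: "(\<Sum>i<6. a i) = 0"
  obtain i j x where ij: "i < 6" "j < 6" "cg (mp 6 k h) (val M x) i j \<noteq> 0" "a i + a j \<le> 0"
    using sstD[OF st inverses_mp[OF k h] a] by blast
  have "cg k (cg h (val M (app g (app g' x)))) i j = cg (mp 6 k h) (val M x) i j"
    unfolding cg_mp2 by (rule cg_cong) (rule lin_app_app[OF g skewl_lin[OF M]])
  then show "\<exists>i<6. \<exists>j<6. \<exists>x. cg k (cg h (val M (app g x))) i j \<noteq> 0 \<and> a i + a j \<le> 0"
    using ij by metis
qed

lemma cg_rank_one_col:
  assumes ij: "i < 6" "j < 6" "a j = 0"
  shows "cg (rank_one a b) m i j = m i j + a i * (\<Sum>l<6. b l * m l j)"
proof -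
  have "mp 6 m (\<lambda>x y. rank_one a b y x) l j = m l j" for l
    using ij by (simp add: mp_def rank_one_def)
  then show ?thesis unfolding cg_mp mp_rank_one(1)[OF ij(1)] by simp
qed

text \<open>Unstable\<close>

lemma sst_no_pencil:
  assumes st: "sst M" and s: "\<And>i x. i < 6 \<Longrightarrow> M i 0 x = s i * x 1" "\<And>i x. i < 6 \<Longrightarrow> M i 1 x = - s i * x 0"
    and M: "skewl M"
  shows False
proof -
  have sk: "M i j x = - M j i x" if "i < 6" "j < 6" for i j x by (rule skewl_skew[OF M that(2,1)])
  have "M 0 0 (dl 1) = 0" using sk[of 0 0 "dl 1"] by simp
  then have s0: "s 0 = 0" using s(1)[of 0 "dl 1"] by (simp add: dl_def)
  have "M 1 1 (dl 0) = 0" using sk[of 1 1 "dl 0"] by simp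
  then have s1: "s 1 = 0" using s(2)[of 1 "dl 0"] by (simp add: dl_def)
  define p where "p = (if \<exists>i. 2 \<le> i \<and> i < 6 \<and> s i \<noteq> 0 then SOME i. 2 \<le> i \<and> i < 6 \<and> s i \<noteq> 0 else 2)"
  have p: "2 \<le> p \<and> p < 6 \<and> (s p = 0 \<longrightarrow> (\<forall>i. 2 \<le> i \<and> i < 6 \<longrightarrow> s i = 0))"
  proof (cases "\<exists>i. 2 \<le> i \<and> i < 6 \<and> s i \<noteq> 0")
    case True
    then have "p = (SOME i. 2 \<le> i \<and> i < 6 \<and> s i \<noteq> 0)" by (simp add: p_def)
    then show ?thesis using someI_ex[OF True] by simp
  next
    case False then show ?thesis by (auto simp: p_def)
  qed
  define a where "a = (\<lambda>i. if 2 \<le> i \<and> i < 6 \<and> i \<noteq> p then - (s i / s p) else 0)"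
  have "1 + (\<Sum>l<6. dl l p * a l) \<noteq> 0" using p by (simp add: a_def)
  then obtain k' where k: "inverses 6 (rank_one a (\<lambda>l. dl l p)) k'" using inverses_rank_one[where b = "\<lambda>l. dl l p"] by blast
  define wt :: "nat \<Rightarrow> int" where "wt = (\<lambda>i. if i < 2 then - 4 else if i = p then 5 else 1)"
  have p': "p = 2 \<or> p = 3 \<or> p = 4 \<or> p = 5" using p by auto
  have "(\<Sum>i<6. wt i) = 0" using p' unfolding sum6 wt_def by auto
  then obtain i j x where ij: "i < 6" "j < 6" and nz: "cg (rank_one a (\<lambda>l. dl l p)) (val M x) i j \<noteq> 0" and wt: "wt i + wt j \<le> 0"
    using sstD[OF st k] by metis
  have zero: "cg (rank_one a (\<lambda>l. dl l p)) (val M x) i j = 0" if i: "i < 6" "i \<noteq> p" and j: "j < 2" for i j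
  proof -
    have aj: "a j = 0" using j by (simp add: a_def)
    have j01: "j = 0 \<or> j = 1" using j by auto
    have sp: "s i + a i * s p = 0"
    proof (cases "i < 2")
      case True
      then have "i = 0 \<or> i = 1" by auto
      then show ?thesis using s0 s1 by (auto simp: a_def)
    next
      case False then show ?thesis using i p by (auto simp: a_def)
    qed
    have "cg (rank_one a (\<lambda>l. dl l p)) (val M x) i j = M i j x + a i * M p j x"
      using cg_rank_one_col[where a = a and b = "\<lambda>l. dl l p" and m = "val M x", OF i(1) _ aj] j p by simp
    also have "\<dots> = (s i + a i * s p) * (if j = 0 then x 1 else - x 0)"
      using j01 i(1) p by (elim disjE) (simp_all add: s(1) s(2)[unfolded One_nat_def] algebra_simps)
    finally show ?thesis using sp by simp
  qed
  have sym: "cg k (val M x) j i = - cg k (val M x) i j" for k by (rule skew6_skew[OF skew6_cg[OF skewl_val[OF M]] ij])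
  have "(i < 2 \<and> j \<noteq> p) \<or> (j < 2 \<and> i \<noteq> p)" using wt p by (auto simp: wt_def split: if_splits)
  then show False using zero[of i j] zero[of j i] ij nz sym by auto
qed

lemma sst_no_zero_column:
  assumes st: "sst M" and s: "\<And>i x. i < 6 \<Longrightarrow> M i 0 x = 0" and M: "skewl M"
  shows False
proof -
  define wt :: "nat \<Rightarrow> int" where "wt = (\<lambda>i. if i = 0 then - 5 else 1)"
  have "(\<Sum>i<6. wt i) = 0" unfolding sum6 wt_def by simp
  then obtain i j x where ij: "i < 6" "j < 6" "cg dl (val M x) i j \<noteq> 0" "wt i + wt j \<le> 0"
    using sstD[OF st inverses_dl] by metis
  then have "i = 0 \<or> j = 0" by (auto simp: wt_def split: if_splits)
  then show False using ij s skewl_skew[OF M, of i j x] by (auto simp: cg_dl)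
qed

lemma sst_no_isotropic:
  assumes st: "sst M" and M: "skewl M" and z: "\<And>i j x. i < 3 \<Longrightarrow> j < 3 \<Longrightarrow> M i j x = 0"
    and n: "\<And>j x. j < 3 \<Longrightarrow> (\<Sum>l<6. n l * M l j x) = 0" "\<And>l. l < 3 \<Longrightarrow> n l = 0"
    and p: "3 \<le> p" "p < 6" "n p \<noteq> 0"
  shows False
proof -
  define b where "b = (\<lambda>l. n l - dl l p)"
  define a where "a = (\<lambda>l. dl l p :: complex)"
  have "1 + (\<Sum>l<6. b l * a l) = n p" using p by (simp add: a_def) (simp add: b_def dl_def)
  then have "1 + (\<Sum>l<6. b l * a l) \<noteq> 0" using p by simp
  then obtain k' where k: "inverses 6 (rank_one a b) k'" using inverses_rank_one[where a = a and b = b] by blast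
  define wt :: "nat \<Rightarrow> int" where "wt = (\<lambda>i. if i < 3 \<or> i = p then - 1 else 2)"
  have p': "p = 3 \<or> p = 4 \<or> p = 5" using p by auto
  have "(\<Sum>i<6. wt i) = 0" using p' unfolding sum6 wt_def by auto
  then obtain i j x where ij: "i < 6" "j < 6" and nz: "cg (rank_one a b) (val M x) i j \<noteq> 0" and wt: "wt i + wt j \<le> 0"
    using sstD[OF st k] by metis
  have zero: "cg (rank_one a b) (val M x) i j = 0" if i: "i < 3 \<or> i = p" and j: "j < 3" for i j
  proof -
    have aj: "a j = 0" using j p by (simp add: a_def dl_def)
    have i6: "i < 6" "j < 6" using i p j by auto
    have "(\<Sum>l<6. b l * M l j x) = - M p j x"
      using n(1)[OF j, of x] p by (simp add: b_def left_diff_distrib sum_subtractf)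
    then have "cg (rank_one a b) (val M x) i j = M i j x - a i * M p j x"
      using cg_rank_one_col[where a = a and b = b and m = "val M x", OF i6 aj] by simp
    then show ?thesis using i z[OF _ j] p by (auto simp: a_def dl_def)
  qed
  have sym: "cg k (val M x) j i = - cg k (val M x) i j" for k by (rule skew6_skew[OF skew6_cg[OF skewl_val[OF M]] ij])
  have "(i < 3 \<or> i = p) \<and> (j < 3 \<or> j = p)" using wt by (auto simp: wt_def split: if_splits)
  then consider "j < 3" "i < 3 \<or> i = p" | "i < 3" "j < 3 \<or> j = p" | "i = p" "j = p" by blast
  then show False
  proof cases
    case 1 then show False using zero nz by blast
  next
    case 2 then show False using zero[of j i] nz sym by auto
  next
    case 3 then show False using nz sym by auto
  qed
qed

lemma om_of_koszul:
  assumes M: "skewl M" and ker: "ker M z" and z: "\<And>i x. i < 6 \<Longrightarrow> z i x = (if i < r then x i else 0)"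
    and r: "r \<le> 5" and tail: "\<And>i j k. i < 6 \<Longrightarrow> j < 6 \<Longrightarrow> r \<le> k \<Longrightarrow> k < 5 \<Longrightarrow> M i j (dl k) = 0"
  shows "\<exists>o3. alternating o3 \<and> (\<forall>i<6. \<forall>j<6. \<forall>x. M i j x = om o3 (\<lambda>k. z k x) i j)"
proof -
  define o3 where "o3 = (\<lambda>k i j. if k < 6 \<and> i < 6 \<and> j < 6 then
     if k < r then M i j (dl k) else if i < r then M j k (dl i) else if j < r then M k i (dl j) else 0 else 0)"
  have sk: "M i j x = - M j i x" if "i < 6" "j < 6" for i j x by (rule skewl_skew[OF M that(2,1)])
  have K: "M i j (dl k) = - M i k (dl j)" if "i < 6" "j < r" "k < r" for i j k
    by (rule koszul_axes(1)[OF ker M z r that]) auto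
  have cyc: "M j k (dl i) = M k i (dl j)" if "k < 6" "i < r" "j < r" for i j k
    using K[OF that] sk[of j k "dl i"] that r by simp
  have alt: "o3 i j k = - o3 j i k" "o3 i j k = - o3 i k j" for i j k
  proof -
    show "o3 i j k = - o3 j i k"
    proof (cases "i < 6 \<and> j < 6 \<and> k < 6")
      case True
      consider "i < r" "j < r" | "i < r" "\<not> j < r" | "\<not> i < r" "j < r" | "\<not> i < r" "\<not> j < r" by blast
      then show ?thesis
      proof cases
        case 1
        have "M j k (dl i) = - M i k (dl j)" using cyc[of k i j] sk[of k i "dl j"] 1 True by simp
        then show ?thesis using 1 True by (simp add: o3_def)
      next
        case 2 then show ?thesis using True sk[of j k "dl i"] by (simp add: o3_def)
      next
        case 3 then show ?thesis using True sk[of k i "dl j"] by (simp add: o3_def)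
      next
        case 4 then show ?thesis using True sk[of i j "dl k"] by (simp add: o3_def)
      qed
    qed (auto simp: o3_def)
    show "o3 i j k = - o3 i k j"
    proof (cases "i < 6 \<and> j < 6 \<and> k < 6")
      case True
      consider "i < r" | "\<not> i < r" "j < r" "k < r" | "\<not> i < r" "j < r" "\<not> k < r" | "\<not> i < r" "\<not> j < r" by blast
      then show ?thesis
      proof cases
        case 1 then show ?thesis using True sk[of j k "dl i"] by (simp add: o3_def)
      next
        case 2
        have "M k i (dl j) = - M j i (dl k)" using cyc[of i j k] sk[of i j "dl k"] 2 True by simp
        then show ?thesis using 2 True by (simp add: o3_def)
      next
        case 3 then show ?thesis using True sk[of k i "dl j"] by (simp add: o3_def)
      next
        case 4 then show ?thesis using True sk[of i j "dl k"] by (simp add: o3_def)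
      qed
    qed (auto simp: o3_def)
  qed
  have "M i j x = om o3 (\<lambda>k. z k x) i j" if ij: "i < 6" "j < 6" for i j x
  proof -
    have "om o3 (\<lambda>k. z k x) i j = (\<Sum>k<6. if k < r then M i j (dl k) * x k else 0)"
      unfolding om_def using ij by (intro sum.cong refl) (simp add: z o3_def)
    also have "\<dots> = (\<Sum>k<r. M i j (dl k) * x k)" using r by (intro sum_if_less) simp
    also have "\<dots> = (\<Sum>k<5. M i j (dl k) * x k)"
      using r tail[OF ij] by (intro sum.mono_neutral_left) auto
    also have "\<dots> = M i j x" by (rule lin_axes[OF skewl_lin[OF M ij], symmetric])
    finally show ?thesis by simp
  qed
  then show ?thesis using alt unfolding alternating_def by (intro exI[of _ o3]) blast
qed

lemma conic:
  assumes conf: "conf M z w u F c" and kz: "ker M z" and kw: "ker M w" and st: "sst M"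
    and z: "\<And>i x. i < 6 \<Longrightarrow> z i x = (if i < 4 then x i else 0)" and m: "M 4 5 (dl 4) \<noteq> 0"
  shows "reach M F"
proof -
  note M = confD(1)[OF conf]
  note cf = conic_facts[OF conf kz z]
  define \<eta> where "\<eta> = (\<lambda>j. if j < 4 then w j (dl 4) else 0)"
  have w\<eta>: "w j (dl 4) = \<eta> j" if "j < 6" for j using that cf(3,4) less6[of j] by (auto simp: \<eta>_def)
  show ?thesis
  proof (cases "\<forall>j<4. \<eta> j = 0")
    case True
    have w0: "w 0 (dl 4) = 0" "w 1 (dl 4) = 0" "w 2 (dl 4) = 0" "w 3 (dl 4) = 0"
      using True by (simp_all add: w\<eta>)
    have up: "M 0 1 x = 0" "M 0 2 x = 0" "M 0 3 x = 0" "M 1 2 x = 0" "M 1 3 x = 0" "M 2 3 x = 0" for x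
      using cf(5-10)[of x] m unfolding w0 by simp_all
    have sk: "M j i x = - M i j x" if "i < 6" "j < 6" for i j x by (rule skewl_skew[OF M that])
    have "M i j x = 0" if "i < j" "j < 4" for i j x
    proof -
      have "(i = 0 \<and> j = 1) \<or> (i = 0 \<and> j = 2) \<or> (i = 0 \<and> j = 3) \<or> (i = 1 \<and> j = 2) \<or> (i = 1 \<and> j = 3) \<or> (i = 2 \<and> j = 3)"
        using that by presburger
      then show ?thesis using up[of x] by (elim disjE conjE) simp_all
    qed
    then have "M i j x = 0" if "i < 4" "j < 4" for i j x
      using sk[of i j x] sk[of i i x] that by (cases i j rule: linorder_cases) auto
    then show ?thesis using sst_no_isotropic4[OF st] by blast
  next
    case False
    then obtain j0 where j0: "j0 < 4" "\<eta> j0 \<noteq> 0" by blast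
    define b where "b = (\<lambda>l. if \<eta> 0 \<noteq> 0 then dl 0 l / \<eta> 0 else dl j0 l / \<eta> j0 + dl 0 l)"
    define a where "a = (\<lambda>l. dl 0 l - \<eta> l)"
    have b4: "b 4 = 0" "b 5 = 0" using j0 by (simp_all add: b_def dl_def)
    have a4: "a i = 0" if "4 \<le> i" for i using that by (simp add: a_def \<eta>_def dl_def)
    have b\<eta>: "(\<Sum>l<n. b l * \<eta> l) = 1" if n: "5 \<le> n" for n
    proof (cases "\<eta> 0 = 0")
      case True
      then have "(\<Sum>l<n. b l * \<eta> l) = (\<Sum>l<n. dl j0 l * (\<eta> l / \<eta> j0)) + (\<Sum>l<n. dl 0 l * \<eta> l)"
        by (simp add: b_def distrib_right sum.distrib)
      then show ?thesis using True j0 n by (simp del: times_divide_eq_right)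
    next
      case False
      then have "(\<Sum>l<n. b l * \<eta> l) = (\<Sum>l<n. dl 0 l * (\<eta> l / \<eta> 0))" by (simp add: b_def)
      then show ?thesis using False n by (simp del: times_divide_eq_right)
    qed
    have b0: "b 0 \<noteq> 0"
    proof (cases "\<eta> 0 = 0")
      case True
      then have "j0 \<noteq> 0" using j0 by (cases "j0 = 0") auto
      then show ?thesis using True by (simp add: b_def dl_def)
    qed (simp add: b_def dl_def)
    have inv: "1 + (\<Sum>l<n. b l * a l) \<noteq> 0" if n: "5 \<le> n" for n
    proof -
      have "(\<Sum>l<n. b l * a l) = (\<Sum>l<n. b l * dl 0 l) - (\<Sum>l<n. b l * \<eta> l)"
        by (simp add: a_def right_diff_distrib sum_subtractf)
      then show ?thesis using b\<eta>[OF n] b0 n by simp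
    qed
    let ?R = "rank_one a b"
    obtain R6 where R6: "inverses 6 ?R R6" using inverses_rank_one[OF inv[of 6]] by auto
    obtain g where g: "inverses 5 ?R g" using inverses_rank_one[OF inv[of 5]] by auto
    define k where "k = (\<lambda>i j. R6 j i)"
    define k' where "k' = (\<lambda>i j. ?R j i)"
    have k: "inverses 6 k k'" unfolding k_def k'_def by (rule inverses_transpose[OF R6])
    note g' = inverses_commute[OF g]
    have Rapp: "app ?R x i = x i + a i * (\<Sum>l<5. b l * x l)" if "i < 5" for x i
      using mp_rank_one(1)[OF that, of a b "\<lambda>l _. x l" 0] by (simp add: app_def mp_def)
    have zz: "(\<Sum>l<6. k' l i * z l (app g x)) = (if i < 4 then x i else 0)" if i: "i < 6" for i x
    proof -
      let ?y = "app g x"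
      have "(\<Sum>l<6. k' l i * z l ?y) = z i ?y + a i * (\<Sum>l<6. b l * z l ?y)"
        using mp_rank_one(1)[OF i, of a b "\<lambda>l _. z l ?y" 0] by (simp add: k'_def mp_def)
      moreover have "(\<Sum>l<6. b l * z l ?y) = (\<Sum>l<5. b l * ?y l)" by (simp add: sum6 sum5 b4 z)
      moreover have "app ?R ?y i = x i" if "i < 5" by (rule app_app[OF g that])
      ultimately show ?thesis using Rapp[of i ?y] i by (cases "i < 4") (simp_all add: z a4)
    qed
    have R4: "app ?R (dl 4) i = dl 4 i" if "i < 5" for i
      unfolding Rapp[OF that] by (simp add: sum5 b4) (simp add: dl_def)
    have gd: "app g (dl 4) i = dl 4 i" if "i < 5" for i
    proof -
      have "app g (dl 4) i = app g (app ?R (dl 4)) i" unfolding app_def[of g] using R4 by simp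
      then show ?thesis using app_app[OF g' that] by simp
    qed
    have fg: "f (app g (dl 4)) = f (dl 4)" if "lin f" for f by (rule lin_cong[OF that gd])
    have ww: "(\<Sum>l<6. k' l i * w l (app g (dl 4))) = dl 0 i" if i: "i < 6" for i
    proof -
      have "(\<Sum>l<6. k' l i * w l (app g (dl 4))) = (\<Sum>l<6. ?R i l * \<eta> l)"
        unfolding k'_def by (intro sum.cong refl) (simp add: fg[OF confD(3)[OF conf]] w\<eta>)
      also have "\<dots> = \<eta> i + a i * (\<Sum>l<6. b l * \<eta> l)"
        using mp_rank_one(1)[OF i, of a b "\<lambda>l _. \<eta> l" 0] by (simp add: mp_def)
      also have "\<dots> = dl 0 i" using b\<eta>[of 6] by (simp add: a_def)
      finally show ?thesis .
    qed
    have mm: "cg k (val M (app g (dl 4))) 4 5 \<noteq> 0"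
    proof -
      have "cg k' (cg k (val M (app g (dl 4)))) 4 5 = M 4 5 (dl 4)"
        using cg_cg[OF inverses_commute[OF k], of 4 5 "val M (app g (dl 4))"] fg[OF skewl_lin[OF M]] by simp
      moreover have "cg k' m 4 5 = m 4 5" for m
      proof -
        have "cg k' m 4 5 = (\<Sum>a<6. dl a 4 * (\<Sum>b<6. dl b 5 * m a b))"
          unfolding cg_def sum_distrib_left by (intro sum.cong refl) (simp add: k'_def rank_one_def b4)
        then show ?thesis by simp
      qed
      ultimately show ?thesis using m by metis
    qed
    define M' where "M' = (\<lambda>i j x. cg k (val M (app g x)) i j)"
    define z' where "z' = (\<lambda>i x. \<Sum>l<6. k' l i * z l (app g x))"
    define w' where "w' = (\<lambda>i x. \<Sum>l<6. k' l i * w l (app g x))"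
    define u' where "u' = (\<lambda>i x. \<Sum>l<6. k i l * u l (app g x))"
    have C: "conf M' z' w' u' (\<lambda>x. F (app g x)) (det (mat 6 6 (\<lambda>(i, j). k i j)) * c)"
      unfolding M'_def z'_def w'_def u'_def by (rule conf_transport[OF conf k g'])
    have K: "ker M' z'" "ker M' w'"
      unfolding M'_def z'_def w'_def by (rule ker_transport[OF kz k], rule ker_transport[OF kw k])
    have "reach M' (\<lambda>x. F (app g x))"
    proof (rule conic_normalized[OF C K])
      show "z' i x = (if i < 4 then x i else 0)" if "i < 6" for i x unfolding z'_def by (rule zz[OF that])
      show "M' 4 5 (dl 4) \<noteq> 0" unfolding M'_def by (rule mm)
      have "w' i (dl 4) = dl 0 i" if "i < 6" for i unfolding w'_def by (rule ww[OF that])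
      then show "w' 0 (dl 4) \<noteq> 0" "w' 1 (dl 4) = 0" "w' 2 (dl 4) = 0" "w' 3 (dl 4) = 0" by (simp_all add: dl_def)
    qed
    then have "reach (\<lambda>i j x. cg k (val M (app g x)) i j) (\<lambda>x. F (app g x))" unfolding M'_def .
    then show ?thesis using reach_transport_back[OF _ k g' M confD(5)[OF conf]] by blast
  qed
qed

definition low :: "(nat \<Rightarrow> pt \<Rightarrow> complex) \<Rightarrow> bool" where
  "low z \<longleftrightarrow> (\<exists>x y. (\<forall>i<6. z i x = 0 \<and> z i y = 0) \<and>
     (\<forall>\<alpha> \<beta>. (\<forall>k<5. \<alpha> * x k + \<beta> * y k = 0) \<longrightarrow> \<alpha> = 0 \<and> \<beta> = 0))"

lemma lowI:
  "(\<And>i. i < 6 \<Longrightarrow> z i x = 0) \<Longrightarrow> (\<And>i. i < 6 \<Longrightarrow> z i y = 0) \<Longrightarrow>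
   (\<And>\<alpha> \<beta>. (\<And>k. k < 5 \<Longrightarrow> \<alpha> * x k + \<beta> * y k = 0) \<Longrightarrow> \<alpha> = 0 \<and> \<beta> = 0) \<Longrightarrow> low z"
  unfolding low_def by blast

lemma lin_comb: "lin f \<Longrightarrow> f (\<lambda>k. \<alpha> * x k + \<beta> * y k) = \<alpha> * f x + \<beta> * f y"
  using lin_add[of f "\<lambda>k. \<alpha> * x k" "\<lambda>k. \<beta> * y k"] by (simp add: lin_scale)

lemma low_cong: "low z \<Longrightarrow> (\<And>i x. i < 6 \<Longrightarrow> z i x = z' i x) \<Longrightarrow> low z'"
  unfolding low_def by simp

lemma low_vector:
  assumes low: "low z" and z: "\<And>i. i < 6 \<Longrightarrow> lin (z i)" and b: "b < 5"
  obtains x k where "x b = 0" "k < 5" "x k \<noteq> 0" "\<And>i. i < 6 \<Longrightarrow> z i x = 0"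
proof -
  obtain x y where xy: "\<And>i. i < 6 \<Longrightarrow> z i x = 0" "\<And>i. i < 6 \<Longrightarrow> z i y = 0"
    and ind: "\<And>\<alpha> \<beta>. (\<And>k. k < 5 \<Longrightarrow> \<alpha> * x k + \<beta> * y k = 0) \<Longrightarrow> \<alpha> = 0 \<and> \<beta> = 0"
    using low unfolding low_def by blast
  obtain \<alpha> \<beta> where ab: "\<alpha> * x b + \<beta> * y b = 0" "\<not> (\<alpha> = 0 \<and> \<beta> = 0)"
  proof (cases "x b = 0 \<and> y b = 0")
    case True then show ?thesis using that[of 1 0] by simp
  next
    case False then show ?thesis using that[of "y b" "- x b"] by auto
  qed
  obtain k where k: "k < 5" "\<alpha> * x k + \<beta> * y k \<noteq> 0" using ind[of \<alpha> \<beta>] ab(2) by blast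
  show ?thesis by (rule that[of "\<lambda>k. \<alpha> * x k + \<beta> * y k" k]) (use ab k in \<open>auto simp: lin_comb[OF z] xy\<close>)
qed

lemma contragredient_zero:
  assumes k: "inverses 6 k k'" and zero: "\<And>i. i < 6 \<Longrightarrow> (\<Sum>l<6. k' l i * f l) = 0" and j: "j < 6"
  shows "f j = (0::complex)"
proof -
  have "(\<Sum>i<6. (\<Sum>l<6. k i l * dl j l) * (\<Sum>l<6. k' l i * f l)) = f j"
    using contragredient_pairing[OF k, of "dl j" f] j by simp
  then show ?thesis using zero by simp
qed

lemma app_comb: "app g (\<lambda>k. \<alpha> * x k + \<beta> * y k) i = \<alpha> * app g x i + \<beta> * app g y i"
  by (simp add: app_def sum_distrib_left sum.distrib algebra_simps)

lemma app_zero: "(\<And>k. k < 5 \<Longrightarrow> x k = 0) \<Longrightarrow> app g x i = 0"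
  by (simp add: app_def)

lemma low_of_normal_form:
  assumes k: "inverses 6 k k'" and g: "inverses 5 g g'" and r: "r \<le> 3"
    and z: "\<And>i x. i < 6 \<Longrightarrow> (\<Sum>l<6. k' l i * z l (app g x)) = (if i < r then x i else 0)"
  shows "low z"
proof -
  have zero: "z j (app g (dl b)) = 0" if "j < 6" "3 \<le> b" for j b
    by (rule contragredient_zero[OF k _ that(1)]) (use z r that in \<open>auto simp: dl_def\<close>)
  have ind': "\<alpha> = 0 \<and> \<beta> = 0" if h: "\<And>k. k < 5 \<Longrightarrow> \<alpha> * app g (dl 3) k + \<beta> * app g (dl 4) k = 0" for \<alpha> \<beta>
  proof -
    have "app g (\<lambda>k. \<alpha> * dl 3 k + \<beta> * dl 4 k) k = 0" if "k < 5" for k using h[OF that] by (simp add: app_comb)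
    then have e: "app g' (app g (\<lambda>k. \<alpha> * dl 3 k + \<beta> * dl 4 k)) k = 0" for k by (rule app_zero)
    have "\<alpha> * dl 3 k + \<beta> * dl 4 k = 0" if "k < 5" for k
      by (rule trans[OF app_app[OF inverses_commute[OF g] that, of "\<lambda>k. \<alpha> * dl 3 k + \<beta> * dl 4 k", symmetric] e])
    from this[of 3] this[of 4] show ?thesis by (simp add: dl_def)
  qed
  show ?thesis
  proof (rule lowI[of z "app g (dl 3)" "app g (dl 4)"])
    show "z i (app g (dl 3)) = 0" "z i (app g (dl 4)) = 0" if "i < 6" for i by (rule zero[OF that]; simp)+
  qed (rule ind')
qed

lemma low_transport:
  assumes low: "low z" and z: "\<And>i. i < 6 \<Longrightarrow> lin (z i)" and g: "inverses 5 g g'"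
  shows "low (\<lambda>i x. \<Sum>l<6. k' l i * z l (app g x))"
proof -
  obtain x y where xy: "\<And>i. i < 6 \<Longrightarrow> z i x = 0" "\<And>i. i < 6 \<Longrightarrow> z i y = 0"
    and ind: "\<And>\<alpha> \<beta>. (\<And>k. k < 5 \<Longrightarrow> \<alpha> * x k + \<beta> * y k = 0) \<Longrightarrow> \<alpha> = 0 \<and> \<beta> = 0"
    using low unfolding low_def by blast
  have ind': "\<alpha> = 0 \<and> \<beta> = 0" if h: "\<And>k. k < 5 \<Longrightarrow> \<alpha> * app g' x k + \<beta> * app g' y k = 0" for \<alpha> \<beta>
  proof (rule ind)
    have "app g' (\<lambda>k. \<alpha> * x k + \<beta> * y k) k = 0" if "k < 5" for k using h[OF that] by (simp add: app_comb)
    then have e: "app g (app g' (\<lambda>k. \<alpha> * x k + \<beta> * y k)) k = 0" for k by (rule app_zero)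
    show "\<alpha> * x k + \<beta> * y k = 0" if "k < 5" for k
      by (rule trans[OF app_app[OF g that, of "\<lambda>k. \<alpha> * x k + \<beta> * y k", symmetric] e])
  qed
  show ?thesis
  proof (rule lowI[of _ "app g' x" "app g' y"])
    show "(\<Sum>l<6. k' l i * z l (app g (app g' x))) = 0" "(\<Sum>l<6. k' l i * z l (app g (app g' y))) = 0" for i
      by (simp_all add: lin_app_app[OF g z] xy)
  qed (rule ind')
qed

lemma reach_high:
  assumes conf: "conf M z w u F c" and kz: "ker M z" and kw: "ker M w" and st: "sst M" and high: "\<not> low z"
  shows "reach M F"
proof -
  obtain r k k' g g' where r: "r \<le> 5" and k: "inverses 6 k k'" and g: "inverses 5 g g'"
    and nf: "\<And>i x. i < 6 \<Longrightarrow> (\<Sum>l<6. k' l i * z l (app g x)) = (if i < r then x i else 0)"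
    using linear_normal_form[of z, OF confD(2)[OF conf]] by blast
  have "\<not> r \<le> 3" using low_of_normal_form[OF k g _ nf] high by blast
  then have r45: "r = 4 \<or> r = 5" using r by auto
  define M' where "M' = (\<lambda>i j x. cg k (val M (app g x)) i j)"
  define z' where "z' = (\<lambda>i x. \<Sum>l<6. k' l i * z l (app g x))"
  define w' where "w' = (\<lambda>i x. \<Sum>l<6. k' l i * w l (app g x))"
  define u' where "u' = (\<lambda>i x. \<Sum>l<6. k i l * u l (app g x))"
  have C: "conf M' z' w' u' (\<lambda>x. F (app g x)) (det (mat 6 6 (\<lambda>(i, j). k i j)) * c)"
    unfolding M'_def z'_def w'_def u'_def by (rule conf_transport[OF conf k g])
  have K: "ker M' z'" "ker M' w'"
    unfolding M'_def z'_def w'_def by (rule ker_transport[OF kz k], rule ker_transport[OF kw k])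
  have S: "sst M'" unfolding M'_def by (rule sst_transport[OF st confD(1)[OF conf] k g])
  have Z: "z' i x = (if i < r then x i else 0)" if "i < 6" for i x unfolding z'_def by (rule nf[OF that])
  have "reach M' (\<lambda>x. F (app g x))"
  proof (cases "r = 5")
    case True
    then show ?thesis by (intro reach_coordinates[OF C]) (simp add: Z)
  next
    case False
    then have r4: "r = 4" using r45 by simp
    have Z4: "z' i x = (if i < 4 then x i else 0)" if "i < 6" for i x using Z[OF that] r4 by simp
    show ?thesis
    proof (cases "M' 4 5 (dl 4) = 0")
      case m: False
      show ?thesis by (rule conic[OF C K S Z4 m])
    next
      case m: True
      note M' = confD(1)[OF C]
      have tail: "M' i j (dl k) = 0" if "i < 6" "j < 6" "4 \<le> k" "k < 5" for i j k
      proof -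
        have k4: "k = 4" using that by simp
        have "i < 4 \<or> i = 4 \<or> i = 5" "j < 4 \<or> j = 4 \<or> j = 5" using that by auto
        then consider "i < 4" | "j < 4" | "i = j" | "i = 4" "j = 5" | "i = 5" "j = 4" by blast
        then show ?thesis unfolding k4
        proof cases
          case 1 show "M' i j (dl 4) = 0" by (rule conic_facts(2)[OF C K(1) Z4 1 that(2)])
        next
          case 2 show "M' i j (dl 4) = 0" by (rule conic_facts(1)[OF C K(1) Z4 that(1) 2])
        next
          case 3 show "M' i j (dl 4) = 0" using skewl_skew[OF M' that(1,1), of "dl 4"] 3 by simp
        next
          case 4 show "M' i j (dl 4) = 0" using 4 m by simp
        next
          case 5 show "M' i j (dl 4) = 0" using 5 m skewl_skew[OF M', of 4 5 "dl 4"] by simp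
        qed
      qed
      obtain o3 where o3: "alternating o3" "\<And>i j x. i < 6 \<Longrightarrow> j < 6 \<Longrightarrow> M' i j x = om o3 (\<lambda>k. z' k x) i j"
        using om_of_koszul[OF M' K(1) Z4 _ tail] by auto
      show ?thesis by (rule reach_rank4[OF o3(1) C o3(2) Z4])
    qed
  qed
  then show ?thesis unfolding M'_def using reach_transport_back[OF _ k g confD(1,5)[OF conf]] by blast
qed

lemma conf_pencil:
  assumes conf: "conf M z w u F c" and v: "\<And>i. i < 6 \<Longrightarrow> quad (v i)" "\<And>x. (\<Sum>i<6. v i x * z i x) = F x" "\<And>x. (\<Sum>i<6. v i x * w i x) = 0"
  shows "conf M (\<lambda>i x. z i x + s * w i x) w (\<lambda>i x. u i x - s * v i x) F c"
  unfolding conf_def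
proof (intro conjI allI impI)
  show "(\<Sum>i<6. (u i x - s * v i x) * (z i x + s * w i x)) = 0" for x
  proof -
    have "(\<Sum>i<6. (u i x - s * v i x) * (z i x + s * w i x)) = (\<Sum>i<6. u i x * z i x) + s * (\<Sum>i<6. u i x * w i x)
        - s * (\<Sum>i<6. v i x * z i x) - s * s * (\<Sum>i<6. v i x * w i x)"
      unfolding sum_distrib_left sum.distrib[symmetric] sum_subtractf[symmetric]
      by (intro sum.cong refl) (simp add: algebra_simps)
    then show ?thesis by (simp add: confD(10,11)[OF conf] v)
  qed
  show "(\<Sum>i<6. (u i x - s * v i x) * w i x) = F x" for x
  proof -
    have "(\<Sum>i<6. (u i x - s * v i x) * w i x) = (\<Sum>i<6. u i x * w i x) - s * (\<Sum>i<6. v i x * w i x)"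
      unfolding sum_distrib_left sum_subtractf[symmetric]
      by (intro sum.cong refl) (simp add: algebra_simps)
    then show ?thesis by (simp add: confD(11)[OF conf] v)
  qed
  show "dpf6 (val M x) n = c * (\<Sum>i<6. \<Sum>j<6. (z i x + s * w i x) * n i j * w j x)" if "skew6 n" for x n
    unfolding confD(9)[OF conf that] skew_pairing_expand[OF that] by (simp add: algebra_simps)
  show "lin (\<lambda>x. z i x + s * w i x)" if "i < 6" for i by (intro lin_plus lin_cmult confD[OF conf] that)
  show "quad (\<lambda>x. u i x - s * v i x)" if "i < 6" for i by (intro quad_minus quad_cmult confD[OF conf] v that)
qed (use confD[OF conf] in auto)

lemma conf_swap:
  assumes conf: "conf M z w u F c" and v: "\<And>i. i < 6 \<Longrightarrow> quad (v i)" "\<And>x. (\<Sum>i<6. v i x * z i x) = F x" "\<And>x. (\<Sum>i<6. v i x * w i x) = 0"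
  shows "conf M w z v F (- c)"
  unfolding conf_def
proof (intro conjI allI impI)
  show "dpf6 (val M x) n = - c * (\<Sum>i<6. \<Sum>j<6. w i x * n i j * z j x)" if "skew6 n" for x n
    unfolding confD(9)[OF conf that] skew_pairing_expand[OF that] by (simp add: algebra_simps)
qed (use confD[OF conf] v in auto)

lemma ker_pencil: "ker M z \<Longrightarrow> ker M w \<Longrightarrow> ker M (\<lambda>i x. z i x + s * w i x)"
  unfolding ker_def by (simp add: distrib_left sum.distrib mult.left_commute[of _ s] sum_distrib_left[symmetric])

lemma small_pencil:
  assumes w: "\<And>i. i < 6 \<Longrightarrow> lin (w i)" and z: "\<And>i x. i < 6 \<Longrightarrow> z i x = (if i < 3 then x i else 0)"
    and low: "\<And>s. low (\<lambda>i x. z i x + s * w i x)" and r: "3 \<le> r" "r < 6" and b: "b = 3 \<or> b = (4::nat)"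
  shows "w r (dl b) = 0"
proof (rule ccontr)
  assume e: "w r (dl b) \<noteq> 0"
  define E where "E = cmod (w r (dl b))"
  define K where "K = (\<Sum>i<6. \<Sum>k<5. cmod (w i (dl k)))"
  have Kb: "cmod (w i (dl k)) \<le> K" if "i < 6" "k < 5" for i k
  proof -
    have "cmod (w i (dl k)) \<le> (\<Sum>k<5. cmod (w i (dl k)))"
      using that by (intro member_le_sum) auto
    also have "\<dots> \<le> K" unfolding K_def using that
      by (intro member_le_sum[where f = "\<lambda>i. \<Sum>k<5. cmod (w i (dl k))"] sum_nonneg) auto
    finally show ?thesis .
  qed
  have E: "E > 0" using e by (simp add: E_def)
  have b5: "b < 5" using b by auto
  have K: "K > 0" using Kb[OF r(2) b5] E unfolding E_def by linarith
  define s where "s = 1 / (6 * K * (1 + K / E))"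
  have p: "6 * K * (1 + K / E) > 0" using E K by (simp add: add_pos_pos)
  have s: "s > 0" "3 * s * K * (1 + K / E) = 1 / 2" using p by (simp_all add: s_def field_simps)
  let ?b = "7 - b"
  have lz: "lin (\<lambda>x. z i x + of_real s * w i x)" if "i < 6" for i
    by (intro lin_plus lin_cmult w that lin_normal[where i = i and r = 3]) (use z that in auto)
  have "?b < 5" using b by auto
  then obtain x k where x: "x ?b = 0" "k < 5" "x k \<noteq> 0" and zero: "\<And>i. i < 6 \<Longrightarrow> z i x + of_real s * w i x = 0"
    using low_vector[OF low lz, of "7 - b"] by blast
  define m where "m = cmod (x 0) + cmod (x 1) + cmod (x 2)"
  have wx: "w i x = w i (dl 0) * x 0 + w i (dl 1) * x 1 + w i (dl 2) * x 2 + w i (dl b) * x b" if "i < 6" for i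
    using lin_axes[OF w[OF that], of x] b x(1) by (auto simp: sum5)
  have tri: "cmod (a0 + a1 + a2) \<le> cmod a0 + cmod a1 + cmod a2" for a0 a1 a2
    by (rule norm_triangle_le[OF add_right_mono[OF norm_triangle_ineq]])
  have w3: "cmod (w i (dl 0) * x 0 + w i (dl 1) * x 1 + w i (dl 2) * x 2) \<le> K * m" if "i < 6" for i
  proof -
    have "cmod (w i (dl 0) * x 0) \<le> K * cmod (x 0)" "cmod (w i (dl 1) * x 1) \<le> K * cmod (x 1)"
      "cmod (w i (dl 2) * x 2) \<le> K * cmod (x 2)"
      unfolding norm_mult by (rule mult_right_mono[OF Kb[OF that]]; simp)+
    then show ?thesis using tri[of "w i (dl 0) * x 0" "w i (dl 1) * x 1" "w i (dl 2) * x 2"]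
      unfolding m_def by (simp add: distrib_left)
  qed
  have "w r x = 0" using zero[OF r(2)] z[OF r(2)] r s by simp
  then have "(w r (dl 0) * x 0 + w r (dl 1) * x 1 + w r (dl 2) * x 2) + w r (dl b) * x b = 0"
    using wx[OF r(2)] by simp
  then have "- (w r (dl 0) * x 0 + w r (dl 1) * x 1 + w r (dl 2) * x 2) = w r (dl b) * x b" by (rule minus_unique)
  then have "cmod (w r (dl b) * x b) = cmod (w r (dl 0) * x 0 + w r (dl 1) * x 1 + w r (dl 2) * x 2)"
    by (metis norm_minus_cancel)
  then have "E * cmod (x b) = cmod (w r (dl 0) * x 0 + w r (dl 1) * x 1 + w r (dl 2) * x 2)"
    by (simp only: E_def norm_mult)
  then have xb: "cmod (x b) \<le> K / E * m" using w3[OF r(2)] E by (simp add: field_simps)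
  have xi: "cmod (x i) \<le> s * (K * (1 + K / E) * m)" if "i < 3" for i
  proof -
    have i6: "i < 6" using that by simp
    have "x i = - (of_real s * w i x)" using zero[OF i6] z[OF i6] that by (simp add: eq_neg_iff_add_eq_0)
    then have "cmod (x i) = s * cmod (w i x)" using s by (simp add: norm_mult)
    also have "cmod (w i x) \<le> K * m + K * cmod (x b)"
    proof -
      have "cmod (w i (dl b) * x b) \<le> K * cmod (x b)"
        unfolding norm_mult by (rule mult_right_mono[OF Kb[OF i6 b5]]) simp
      then show ?thesis unfolding wx[OF i6] by (rule norm_triangle_le[OF add_mono[OF w3[OF i6]]])
    qed
    also have "\<dots> \<le> K * m + K * (K / E * m)" using xb K by (intro add_left_mono mult_left_mono) auto
    finally show ?thesis using s by (simp add: algebra_simps)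
  qed
  define R where "R = s * (K * (1 + K / E) * m)"
  have "cmod (x 0) \<le> R" "cmod (x 1) \<le> R" "cmod (x 2) \<le> R" unfolding R_def by (rule xi; simp)+
  then have "m \<le> 3 * R" using m_def by linarith
  also have "\<dots> = (3 * s * K * (1 + K / E)) * m" by (simp add: R_def)
  finally have "m \<le> 1 / 2 * m" unfolding s(2) .
  moreover have m0: "m \<ge> 0" by (simp add: m_def)
  ultimately have "m = 0" by linarith
  then have "cmod (x 0) = 0" "cmod (x 1) = 0" "cmod (x 2) = 0"
    using norm_ge_zero[of "x 0"] norm_ge_zero[of "x 1"] norm_ge_zero[of "x 2"] unfolding m_def by linarith+
  moreover have "cmod (x b) = 0" using xb \<open>m = 0\<close> by simp
  moreover have "k = 0 \<or> k = 1 \<or> k = 2 \<or> k = b \<or> k = 7 - b" using x(2) b by auto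
  ultimately show False using x by auto
qed

lemma singular_columns:
  fixes p3 :: complex
  assumes D: "p3 * (q4 * t5 - q5 * t4) - p4 * (q3 * t5 - q5 * t3) + p5 * (q3 * t4 - q4 * t3) = 0"
  obtains n3 n4 n5 where "n3 \<noteq> 0 \<or> n4 \<noteq> 0 \<or> n5 \<noteq> 0" "n3 * p3 + n4 * p4 + n5 * p5 = 0"
    "n3 * q3 + n4 * q4 + n5 * q5 = 0" "n3 * t3 + n4 * t4 + n5 * t5 = 0"
proof -
  have minors: thesis if n: "\<not> (a4 * b5 - a5 * b4 = 0 \<and> a5 * b3 - a3 * b5 = 0 \<and> a3 * b4 - a4 * b3 = 0)"
    and d: "c3 * (a4 * b5 - a5 * b4) + c4 * (a5 * b3 - a3 * b5) + c5 * (a3 * b4 - a4 * b3) = 0"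
    and r: "\<And>n3 n4 n5. n3 \<noteq> 0 \<or> n4 \<noteq> 0 \<or> n5 \<noteq> 0 \<Longrightarrow> n3 * a3 + n4 * a4 + n5 * a5 = 0 \<Longrightarrow>
      n3 * b3 + n4 * b4 + n5 * b5 = 0 \<Longrightarrow> n3 * c3 + n4 * c4 + n5 * c5 = 0 \<Longrightarrow> thesis"
    for a3 a4 a5 b3 b4 b5 c3 c4 c5 :: complex
    by (rule r[of "a4 * b5 - a5 * b4" "a5 * b3 - a3 * b5" "a3 * b4 - a4 * b3"])
      (use n d in \<open>auto simp: algebra_simps\<close>)
  have one: thesis if n: "\<not> (a3 = 0 \<and> a4 = 0 \<and> a5 = (0::complex))"
    and b: "a4 * b5 - a5 * b4 = 0" "a5 * b3 - a3 * b5 = 0" "a3 * b4 - a4 * b3 = 0"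
    and c: "a4 * c5 - a5 * c4 = 0" "a5 * c3 - a3 * c5 = 0" "a3 * c4 - a4 * c3 = 0"
    and r: "\<And>n3 n4 n5. n3 \<noteq> 0 \<or> n4 \<noteq> 0 \<or> n5 \<noteq> 0 \<Longrightarrow> n3 * a3 + n4 * a4 + n5 * a5 = 0 \<Longrightarrow>
      n3 * b3 + n4 * b4 + n5 * b5 = 0 \<Longrightarrow> n3 * c3 + n4 * c4 + n5 * c5 = 0 \<Longrightarrow> thesis"
    for a3 a4 a5 b3 b4 b5 c3 c4 c5 :: complex
  proof (cases "a3 = 0 \<and> a4 = 0")
    case True then show thesis using n b c by (intro r[of 1 0 0]) auto
  next
    case False
    then show thesis using b c by (intro r[of a4 "- a3" 0]) (auto simp: algebra_simps)
  qed
  show thesis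
  proof (cases "p4 * q5 - p5 * q4 = 0 \<and> p5 * q3 - p3 * q5 = 0 \<and> p3 * q4 - p4 * q3 = 0")
    case False
    show thesis by (rule minors[OF False, of t3 t4 t5]) (use D that in \<open>auto simp: algebra_simps\<close>)
  next
    case pq: True
    show thesis
    proof (cases "p4 * t5 - p5 * t4 = 0 \<and> p5 * t3 - p3 * t5 = 0 \<and> p3 * t4 - p4 * t3 = 0")
      case False
      show thesis by (rule minors[OF False, of q3 q4 q5]) (use D that in \<open>auto simp: algebra_simps\<close>)
    next
      case pt: True
      show thesis
      proof (cases "p3 = 0 \<and> p4 = 0 \<and> p5 = 0")
        case False
        show thesis by (rule one[OF False, of q5 q4 q3 t5 t4 t3]) (use pq pt that in auto)
      next
        case p: True
        show thesis
        proof (cases "q4 * t5 - q5 * t4 = 0 \<and> q5 * t3 - q3 * t5 = 0 \<and> q3 * t4 - q4 * t3 = 0")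
          case False
          show thesis by (rule minors[OF False, of p3 p4 p5]) (use D that p in auto)
        next
          case qt: True
          show thesis
          proof (cases "q3 = 0 \<and> q4 = 0 \<and> q5 = 0")
            case False
            show thesis by (rule one[OF False, of p5 p4 p3 t5 t4 t3]) (use qt p that in auto)
          next
            case q: True
            show thesis
            proof (cases "t3 = 0 \<and> t4 = 0 \<and> t5 = 0")
              case False
              show thesis by (rule one[OF False, of p5 p4 p3 q5 q4 q3]) (use p q that in auto)
            next
              case True then show thesis using p q that[of 1 0 0] by simp
            qed
          qed
        qed
      qed
    qed
  qed
qed

lemma rank_three_om:
  assumes conf: "conf M z w u F c" and kz: "ker M z" and st: "sst M"
    and z: "\<And>i x. i < 6 \<Longrightarrow> z i x = (if i < 3 then x i else 0)"
    and lw: "low w" and lp: "\<And>s. low (\<lambda>i x. z i x + s * w i x)"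
    and ij: "i < 6" "j < 6" and b: "b = 3 \<or> b = (4::nat)"
  shows "M i j (dl b) = 0"
proof -
  note M = confD(1)[OF conf]
  have c: "c \<noteq> 0" by (rule confD(7)[OF conf])
  have lM: "lin (M i j)" if "i < 6" "j < 6" for i j by (rule skewl_lin[OF M that])
  have lw': "lin (w i)" if "i < 6" for i by (rule confD(3)[OF conf that])
  have b5: "b < 5" "3 \<le> b" using b by auto
  have sk: "M i j x = - M j i x" if "i < 6" "j < 6" for i j x by (rule skewl_skew[OF M that(2,1)])
  have d0: "M i i x = 0" if "i < 6" for i x using sk[OF that that, of x] by simp
  have kx: "M i j (dl k) = - M i k (dl j)" if "i < 6" "j < 3" "k < 3" for i j k
    by (rule koszul_axes(1)[OF kz M z _ that(1) that(2,3)]) auto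
  have tl: "M i j (dl b) = 0" if "i < 6" "j < 3" "b = 3 \<or> b = 4" for i j b
    by (rule koszul_axes(2)[OF kz M z _ that(1,2)]) (use that in auto)
  have tl': "M i j (dl b) = 0" if "i < 3" "j < 6" for i j
    using tl[of j i b] sk[of i j "dl b"] that b by simp
  define p q t where "p = (\<lambda>i. M i 0 (dl 1))" and "q = (\<lambda>i. M i 0 (dl 2))" and "t = (\<lambda>i. M i 1 (dl 2))"
  have rows: "M i 0 x = p i * x 1 + q i * x 2" "M i 1 x = - p i * x 0 + t i * x 2"
    "M i 2 x = - q i * x 0 - t i * x 1" if i: "i < 6" for i x
  proof -
    have E: "M i l x = M i l (dl 0) * x 0 + M i l (dl 1) * x 1 + M i l (dl 2) * x 2" if "l < 3" for l
      by (subst lin_axes[OF lM]) (use that i tl[OF i that] in \<open>simp_all add: sum5\<close>)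
    have zz: "M i l (dl l) = 0" if "l < 3" for l using kx[OF i that that] by simp
    show "M i 0 x = p i * x 1 + q i * x 2" using E[of 0] zz[of 0] by (simp add: p_def q_def)
    show "M i 1 x = - p i * x 0 + t i * x 2" using E[of 1] zz[of 1] kx[OF i, of 1 0] by (simp add: p_def t_def)
    show "M i 2 x = - q i * x 0 - t i * x 1" using E[of 2] zz[of 2] kx[OF i, of 2 0] kx[OF i, of 2 1] by (simp add: q_def t_def)
  qed
  have wr0: "w r (dl b) = 0" if "3 \<le> r" "r < 6" "b = 3 \<or> b = 4" for r b
    by (rule small_pencil[OF lw' z lp that])
  let ?s = "\<lambda>x::pt. \<lambda>k. x k + dl b k"
  have sh: "M i j (?s x) = M i j x + M i j (dl b)" if "i < 6" "j < 6" for i j x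
    by (rule lin_add[OF lM[OF that]])
  have wsh: "w i (?s x) = w i x + w i (dl b)" if "i < 6" for i x by (rule lin_add[OF lw'[OF that]])
  have shz: "z i (?s x) = z i x" if "i < 6" for i x using that b by (auto simp: z dl_def)
  have P: "pfa (val M (?s x)) i j - pfa (val M x) i j = c * (z i x * w j (dl b) - z j x * w i (dl b))"
    if "i < j" "j < 6" for i j x
    unfolding conf_pfa[OF conf that] using that by (simp add: shz wsh algebra_simps)
  have i6: "(0::nat) < 6" "(1::nat) < 6" "(2::nat) < 6" "(3::nat) < 6" "(4::nat) < 6" "(5::nat) < 6" by simp_all
  have zb: "M l 0 (dl b) = 0" "M l 1 (dl b) = 0" "M l 2 (dl b) = 0" if "l < 6" for l
    by (rule tl[OF that _ b]; simp)+
  have zb': "M 0 l (dl b) = 0" "M 1 l (dl b) = 0" "M 2 l (dl b) = 0" if "l < 6" for l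
    by (rule tl'[OF _ that]; simp)+
  have main: "M 4 5 (dl b) = 0 \<and> M 3 5 (dl b) = 0 \<and> M 3 4 (dl b) = 0"
  proof (cases "t 0 = 0")
    case False
    have "M 0 1 (dl 2) = t 0" by (simp add: t_def)
    moreover have "pfa (val M (?s (dl 2))) 2 3 - pfa (val M (dl 2)) 2 3 = 0"
      "pfa (val M (?s (dl 2))) 2 4 - pfa (val M (dl 2)) 2 4 = 0"
      "pfa (val M (?s (dl 2))) 2 5 - pfa (val M (dl 2)) 2 5 = 0"
      using P[of 2 3 "dl 2"] P[of 2 4 "dl 2"] P[of 2 5 "dl 2"] b
      by (auto simp: wr0 z)
    ultimately show ?thesis using False unfolding pfa_entries
      by ((simp add: sh zb' zb'[unfolded One_nat_def]), (simp add: algebra_simps)?)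
  next
    case t0: True
    have "M 0 0 (dl 1) = 0" "M 0 0 (dl 2) = 0" using d0 by simp_all
    then have pq0: "p 0 = 0" "q 0 = 0" by (simp_all add: p_def q_def)
    have Z0: "M 0 1 x = 0" "M 0 2 x = 0" for x
      unfolding rows[OF i6(1)] pq0 t0 by simp_all
    have Z12: "M 1 2 x = 0" for x
    proof -
      have "M 1 0 y = 0" for y using Z0(1)[of y] sk[of 1 0 y] by simp
      then have "q 1 = 0" by (simp add: q_def)
      moreover have "t 1 = 0" using d0[of 1 "dl 2"] by (simp add: t_def)
      ultimately show ?thesis unfolding rows[OF i6(2)] by simp
    qed
    define D where "D = p 3 * (q 4 * t 5 - q 5 * t 4) - p 4 * (q 3 * t 5 - q 5 * t 3) + p 5 * (q 3 * t 4 - q 4 * t 3)"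
    have D: "D \<noteq> 0"
    proof
      assume "D = 0"
      then obtain n3 n4 n5 where n: "n3 \<noteq> 0 \<or> n4 \<noteq> 0 \<or> n5 \<noteq> 0" and rel: "n3 * p 3 + n4 * p 4 + n5 * p 5 = 0"
        "n3 * q 3 + n4 * q 4 + n5 * q 5 = 0" "n3 * t 3 + n4 * t 4 + n5 * t 5 = 0"
        unfolding D_def using singular_columns by blast
      define n where "n = (\<lambda>l::nat. if l = 3 then n3 else if l = 4 then n4 else if l = 5 then n5 else 0)"
      have "n 3 \<noteq> 0 \<or> n 4 \<noteq> 0 \<or> n 5 \<noteq> 0" using \<open>n3 \<noteq> 0 \<or> n4 \<noteq> 0 \<or> n5 \<noteq> 0\<close> by (simp add: n_def)
      moreover have "(3::nat) \<le> 3 \<and> (3::nat) \<le> 4 \<and> (3::nat) \<le> 5 \<and> (3::nat) < 6 \<and> (4::nat) < 6 \<and> (5::nat) < 6" by simp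
      ultimately obtain m where m: "3 \<le> m" "m < 6" "n m \<noteq> 0" by blast
      show False
      proof (rule sst_no_isotropic[where n = n, OF st M _ _ _ m])
        fix i j :: nat and x :: pt assume "i < 3" "j < 3"
        then have "(i = 0 \<or> i = 1 \<or> i = 2) \<and> (j = 0 \<or> j = 1 \<or> j = 2)" by auto
        moreover have "M 1 0 x = 0" "M 2 0 x = 0" "M 2 1 x = 0"
          using Z0[of x] Z12[of x] sk[of 1 0 x] sk[of 2 0 x] sk[of 2 1 x] by simp_all
        ultimately show "M i j x = 0" using Z0[of x] Z12[of x] d0[of 0 x] d0[of 1 x] d0[of 2 x]
          by (elim conjE disjE) simp_all
      next
        fix j :: nat and x :: pt assume "j < 3"
        then have "j = 0 \<or> j = 1 \<or> j = 2" by auto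
        then show "(\<Sum>l<6. n l * M l j x) = 0"
        proof (elim disjE)
          assume j: "j = 0"
          have "(\<Sum>l<6. n l * M l 0 x) = (n3 * p 3 + n4 * p 4 + n5 * p 5) * x 1 + (n3 * q 3 + n4 * q 4 + n5 * q 5) * x 2"
            unfolding sum6 rows(1)[OF i6(4)] rows(1)[OF i6(5)] rows(1)[OF i6(6)] by (simp add: n_def algebra_simps)
          then show ?thesis unfolding j rel by simp
        next
          assume j: "j = 1"
          have "(\<Sum>l<6. n l * M l 1 x) = - (n3 * p 3 + n4 * p 4 + n5 * p 5) * x 0 + (n3 * t 3 + n4 * t 4 + n5 * t 5) * x 2"
            unfolding sum6 rows(2)[OF i6(4)] rows(2)[OF i6(5)] rows(2)[OF i6(6)] by (simp add: n_def algebra_simps)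
          then show ?thesis unfolding j rel by simp
        next
          assume j: "j = 2"
          have "(\<Sum>l<6. n l * M l 2 x) = - (n3 * q 3 + n4 * q 4 + n5 * q 5) * x 0 - (n3 * t 3 + n4 * t 4 + n5 * t 5) * x 1"
            unfolding sum6 rows(3)[OF i6(4)] rows(3)[OF i6(5)] rows(3)[OF i6(6)] by (simp add: n_def algebra_simps)
          then show ?thesis unfolding j rel by simp
        qed
      qed (auto simp: n_def)
    qed
    define \<Phi> where "\<Phi> = (\<lambda>a b. \<lambda>x::pt. (p a * q b - p b * q a) * x 0 + (p a * t b - p b * t a) * x 1 + (q a * t b - q b * t a) * x 2)"
    have \<Phi>: "M a 1 x * M b 2 x - M b 1 x * M a 2 x = x 0 * \<Phi> a b x" if "a < 6" "b < 6" for a b x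
      unfolding rows[OF that(1)] rows[OF that(2)] \<Phi>_def by (simp add: algebra_simps)
    have l\<Phi>: "lin (\<Phi> a b)" for a b unfolding \<Phi>_def by (intro lin_plus lin_cmult lin_coord; simp)
    have s1: "M 1 l x = - M l 1 x" "M 2 l x = - M l 2 x" if "l < 6" for l x by (rule sk; use that in simp)+
    have canc: "c * w r x = \<Phi> a b x" if "r < 6" "\<And>x. x 0 * (c * w r x) = x 0 * \<Phi> a b x" for r a b x
    proof -
      have "lin (\<lambda>x. c * w r x - \<Phi> a b x)" by (intro lin_minus lin_cmult lw' l\<Phi> that)
      moreover have "x 0 * (c * w r x - \<Phi> a b x) = 0" for x using that(2)[of x] by (simp add: right_diff_distrib)
      ultimately have "c * w r x - \<Phi> a b x = 0" by (rule lin_zero_cancel)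
      then show ?thesis by simp
    qed
    have w3: "c * w 3 x = \<Phi> 5 4 x" for x
    proof (rule canc)
      fix x
      have "M 1 2 x * M 4 5 x - M 1 4 x * M 2 5 x + M 1 5 x * M 2 4 x = c * (z 0 x * w 3 x - z 3 x * w 0 x)"
        using conf_pfa[OF conf, of 0 3 x] unfolding pfa_entries by simp
      then show "x 0 * (c * w 3 x) = x 0 * \<Phi> 5 4 x"
        unfolding Z12 s1[OF i6(5)] s1[OF i6(6)] \<Phi>[OF i6(6) i6(5), symmetric] by (simp add: z algebra_simps)
    qed simp
    have w4: "c * w 4 x = \<Phi> 3 5 x" for x
    proof (rule canc)
      fix x
      have "- (M 1 2 x * M 3 5 x - M 1 3 x * M 2 5 x + M 1 5 x * M 2 3 x) = c * (z 0 x * w 4 x - z 4 x * w 0 x)"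
        using conf_pfa[OF conf, of 0 4 x] unfolding pfa_entries by simp
      then show "x 0 * (c * w 4 x) = x 0 * \<Phi> 3 5 x"
        unfolding Z12 s1[OF i6(4)] s1[OF i6(6)] \<Phi>[OF i6(4) i6(6), symmetric] by (simp add: z algebra_simps)
    qed simp
    have w5: "c * w 5 x = \<Phi> 4 3 x" for x
    proof (rule canc)
      fix x
      have "M 1 2 x * M 3 4 x - M 1 3 x * M 2 4 x + M 1 4 x * M 2 3 x = c * (z 0 x * w 5 x - z 5 x * w 0 x)"
        using conf_pfa[OF conf, of 0 5 x] unfolding pfa_entries by simp
      then show "x 0 * (c * w 5 x) = x 0 * \<Phi> 4 3 x"
        unfolding Z12 s1[OF i6(4)] s1[OF i6(5)] \<Phi>[OF i6(5) i6(4), symmetric] by (simp add: z algebra_simps)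
    qed simp
    have "7 - b < 5" using b by auto
    then obtain x k where x: "x (7 - b) = 0" "k < 5" "x k \<noteq> 0" and wx: "\<And>i. i < 6 \<Longrightarrow> w i x = 0"
      using low_vector[OF lw lw', of "7 - b"] by blast
    have \<Phi>0: "\<Phi> 5 4 x = 0" "\<Phi> 3 5 x = 0" "\<Phi> 4 3 x = 0" using w3[of x] w4[of x] w5[of x] wx by simp_all
    have "D * x 0 = - (t 3 * \<Phi> 5 4 x + t 4 * \<Phi> 3 5 x + t 5 * \<Phi> 4 3 x)"
      "D * x 1 = q 3 * \<Phi> 5 4 x + q 4 * \<Phi> 3 5 x + q 5 * \<Phi> 4 3 x"
      "D * x 2 = - (p 3 * \<Phi> 5 4 x + p 4 * \<Phi> 3 5 x + p 5 * \<Phi> 4 3 x)"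
      unfolding D_def \<Phi>_def by (simp_all add: algebra_simps)
    then have x3: "x 0 = 0" "x 1 = 0" "x 2 = 0" unfolding \<Phi>0 using D by simp_all
    have "k = b" using x x3 b by (auto simp: less_Suc_eq eval_nat_numeral)
    then have xb: "x b \<noteq> 0" using x by simp
    have wb: "w i (dl b) = 0" if "i < 6" for i
    proof -
      have "w i x = w i (dl b) * x b" using lin_axes[OF lw'[OF that], of x] x3 x(1) b by (auto simp: sum5)
      then show ?thesis using wx[OF that] xb by simp
    qed
    define d3 d4 d5 where "d3 = M 4 5 (dl b)" and "d4 = - M 3 5 (dl b)" and "d5 = M 3 4 (dl b)"
    have E01: "M 2 3 x * d3 + M 2 4 x * d4 + M 2 5 x * d5 = 0" for x
      using P[of 0 1 x] unfolding pfa_entries d3_def d4_def d5_def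
      by ((simp add: sh zb' zb'[unfolded One_nat_def] wb[OF i6(1)] wb[OF i6(2), unfolded One_nat_def]), (simp add: algebra_simps)?)
    have E02: "M 1 3 x * d3 + M 1 4 x * d4 + M 1 5 x * d5 = 0" for x
      using P[of 0 2 x] unfolding pfa_entries d3_def d4_def d5_def
      by ((simp add: sh zb' zb'[unfolded One_nat_def] wb[OF i6(1)] wb[OF i6(3)]), (simp add: algebra_simps)?)
    have dq: "q 3 * d3 + q 4 * d4 + q 5 * d5 = 0"
      using E01[of "dl 0"] unfolding s1[OF i6(4)] s1[OF i6(5)] s1[OF i6(6)] rows[OF i6(4)] rows[OF i6(5)] rows[OF i6(6)]
      by (simp add: dl_def)
    have dt: "t 3 * d3 + t 4 * d4 + t 5 * d5 = 0"
      using E01[of "dl 1"] unfolding s1[OF i6(4)] s1[OF i6(5)] s1[OF i6(6)] rows[OF i6(4)] rows[OF i6(5)] rows[OF i6(6)]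
      by (simp add: dl_def)
    have dp: "p 3 * d3 + p 4 * d4 + p 5 * d5 = 0"
      using E02[of "dl 0"] unfolding s1[OF i6(4)] s1[OF i6(5)] s1[OF i6(6)] rows[OF i6(4)] rows[OF i6(5)] rows[OF i6(6)]
      by (simp add: dl_def)
    have "D * d3 = (q 4 * t 5 - q 5 * t 4) * (p 3 * d3 + p 4 * d4 + p 5 * d5)
        - (p 4 * t 5 - p 5 * t 4) * (q 3 * d3 + q 4 * d4 + q 5 * d5) + (p 4 * q 5 - p 5 * q 4) * (t 3 * d3 + t 4 * d4 + t 5 * d5)"
      "D * d4 = - (q 3 * t 5 - q 5 * t 3) * (p 3 * d3 + p 4 * d4 + p 5 * d5)
        + (p 3 * t 5 - p 5 * t 3) * (q 3 * d3 + q 4 * d4 + q 5 * d5) - (p 3 * q 5 - p 5 * q 3) * (t 3 * d3 + t 4 * d4 + t 5 * d5)"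
      "D * d5 = (q 3 * t 4 - q 4 * t 3) * (p 3 * d3 + p 4 * d4 + p 5 * d5)
        - (p 3 * t 4 - p 4 * t 3) * (q 3 * d3 + q 4 * d4 + q 5 * d5) + (p 3 * q 4 - p 4 * q 3) * (t 3 * d3 + t 4 * d4 + t 5 * d5)"
      unfolding D_def by (simp_all add: algebra_simps)
    then have "D * d3 = 0" "D * d4 = 0" "D * d5 = 0" unfolding dp dq dt by simp_all
    then show ?thesis using D by (simp add: d3_def d4_def d5_def)
  qed
  have up: "M i j (dl b) = 0" if "i < j" "j < 6" for i j
  proof -
    have "i < 3 \<or> (i = 3 \<and> j = 4) \<or> (i = 3 \<and> j = 5) \<or> (i = 4 \<and> j = 5)" using upper_pairs[OF that] by auto
    then consider "i < 3" | "i = 3" "j = 4" | "i = 3" "j = 5" | "i = 4" "j = 5" by blast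
    then show ?thesis using main tl'[OF _ that(2)] by cases auto
  qed
  show ?thesis
    using up[of i j] up[of j i] ij sk[of i j "dl b"] d0[of i "dl b"] by (cases i j rule: linorder_cases) auto
qed

lemma reach_low:
  assumes conf: "conf M z w u F c" and kz: "ker M z" and st: "sst M" and r: "r \<le> 3"
    and z: "\<And>i x. i < 6 \<Longrightarrow> z i x = (if i < r then x i else 0)"
    and lw: "low w" and lp: "\<And>s. low (\<lambda>i x. z i x + s * w i x)"
    and v: "\<And>x. (\<Sum>i<6. v i x * z i x) = F x"
  shows "reach M F"
proof -
  note M = confD(1)[OF conf]
  have r5: "r \<le> 5" using r by simp
  consider "r = 0" | "r = 1" | "r = 2" | "r = 3" using r by linarith
  then show ?thesis
  proof cases
    case 1
    obtain x where "F x \<noteq> 0" using confD(6)[OF conf] by blast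
    then show ?thesis using v[of x] 1 by (simp add: z)
  next
    case 2
    have "M i 0 x = 0" if i: "i < 6" for i x
    proof (rule lin_axes_zero[OF skewl_lin[OF M i]])
      fix k :: nat assume k: "k < 5"
      show "M i 0 (dl k) = 0"
        using koszul_axes[OF kz M z r5 i, of 0 k] 2 k by (cases "k = 0") auto
    qed simp
    then show ?thesis using sst_no_zero_column[OF st _ M] by blast
  next
    case 3
    have kx: "M i j (dl k) = - M i k (dl j)" if "i < 6" "j < 2" "k < 2" for i j k
      by (rule koszul_axes(1)[OF kz M z r5]) (use 3 that in auto)
    have tl: "M i j (dl k) = 0" if "i < 6" "j < 2" "2 \<le> k" "k < 5" for i j k
      by (rule koszul_axes(2)[OF kz M z r5]) (use 3 that in auto)
    have E: "M i j x = M i j (dl 0) * x 0 + M i j (dl 1) * x 1" if "i < 6" "j < 2" for i j x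
      by (subst lin_axes[OF skewl_lin[OF M]]) (use that tl[OF that] in \<open>simp_all add: sum5\<close>)
    show ?thesis
    proof (rule FalseE[OF sst_no_pencil[OF st _ _ M, of "\<lambda>i. M i 0 (dl 1)"]])
      show "M i 0 x = M i 0 (dl 1) * x 1" if "i < 6" for i x using E[OF that, of 0 x] kx[OF that, of 0 0] by simp
      show "M i 1 x = - M i 0 (dl 1) * x 0" if "i < 6" for i x
        using E[OF that, of 1 x] kx[OF that, of 1 1] kx[OF that, of 1 0] by simp
    qed
  next
    case 4
    have Z: "z i x = (if i < 3 then x i else 0)" if "i < 6" for i x using z[OF that] 4 by simp
    have tail: "M i j (dl k) = 0" if "i < 6" "j < 6" "3 \<le> k" "k < 5" for i j k
      by (rule rank_three_om[OF conf kz st Z lw lp that(1,2)]) (use that in auto)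
    obtain o3 where o3: "alternating o3" "\<And>i j x. i < 6 \<Longrightarrow> j < 6 \<Longrightarrow> M i j x = om o3 (\<lambda>k. z k x) i j"
      using om_of_koszul[OF M kz Z _ tail] by auto
    show ?thesis by (rule reach_rank3[OF o3(1) conf o3(2) Z])
  qed
qed

theorem reach_factorization:
  assumes conf: "conf M z w u F c" and kz: "ker M z" and kw: "ker M w" and st: "sst M"
    and v: "\<And>i. i < 6 \<Longrightarrow> quad (v i)" "\<And>x. (\<Sum>i<6. v i x * z i x) = F x" "\<And>x. (\<Sum>i<6. v i x * w i x) = 0"
  shows "reach M F"
proof (cases "(\<forall>s. low (\<lambda>i x. z i x + s * w i x)) \<and> low w")
  case False
  then show ?thesis
    using reach_high[OF conf_pencil[OF conf v] ker_pencil[OF kz kw] kw st] reach_high[OF conf_swap[OF conf v] kw kz st]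
    by blast
next
  case True
  note lz = confD(2)[OF conf] and lw = confD(3)[OF conf]
  have "low (\<lambda>i x. z i x + 0 * w i x)" using True by blast
  then have low0: "low z" by simp
  obtain r k k' g g' where r: "r \<le> 5" and k: "inverses 6 k k'" and g: "inverses 5 g g'"
    and nf: "\<And>i x. i < 6 \<Longrightarrow> (\<Sum>l<6. k' l i * z l (app g x)) = (if i < r then x i else 0)"
    using linear_normal_form[of z, OF lz] by blast
  define M' where "M' = (\<lambda>i j x. cg k (val M (app g x)) i j)"
  define z' where "z' = (\<lambda>i x. \<Sum>l<6. k' l i * z l (app g x))"
  define w' where "w' = (\<lambda>i x. \<Sum>l<6. k' l i * w l (app g x))"
  define u' where "u' = (\<lambda>i x. \<Sum>l<6. k i l * u l (app g x))"
  define v' where "v' = (\<lambda>i x. \<Sum>l<6. k i l * v l (app g x))"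
  have C: "conf M' z' w' u' (\<lambda>x. F (app g x)) (det (mat 6 6 (\<lambda>(i, j). k i j)) * c)"
    unfolding M'_def z'_def w'_def u'_def by (rule conf_transport[OF conf k g])
  have K: "ker M' z'" unfolding M'_def z'_def by (rule ker_transport[OF kz k])
  have S: "sst M'" unfolding M'_def by (rule sst_transport[OF st confD(1)[OF conf] k g])
  have Z: "z' i x = (if i < r then x i else 0)" if "i < 6" for i x unfolding z'_def by (rule nf[OF that])
  have V: "(\<Sum>i<6. v' i x * z' i x) = F (app g x)" for x
    unfolding v'_def z'_def contragredient_pairing[OF k] by (rule v(2))
  have lw': "low w'" unfolding w'_def by (rule low_transport[OF _ lw g]) (use True in auto)
  have lz': "low z'" unfolding z'_def by (rule low_transport[OF low0 lz g])
  have lp': "low (\<lambda>i x. z' i x + s * w' i x)" for s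
  proof (rule low_cong)
    show "low (\<lambda>i x. \<Sum>l<6. k' l i * (z l (app g x) + s * w l (app g x)))"
      by (rule low_transport[where z = "\<lambda>i x. z i x + s * w i x", OF _ _ g])
        (use True in \<open>auto intro!: lin_plus lin_cmult lz lw\<close>)
    show "(\<Sum>l<6. k' l i * (z l (app g x) + s * w l (app g x))) = z' i x + s * w' i x" for i x
      by (simp add: z'_def w'_def distrib_left sum.distrib sum_distrib_left mult_ac)
  qed
  have "r \<le> 3"
  proof (rule ccontr)
    assume "\<not> r \<le> 3"
    obtain x k where "x 4 = 0" "k < 5" "x k \<noteq> 0" and zx: "\<And>i. i < 6 \<Longrightarrow> z' i x = 0"
      using low_vector[OF lz' confD(2)[OF C], of 4] by auto
    then show False using zx[of k] \<open>\<not> r \<le> 3\<close> Z[of k x] by (cases "k = 4") auto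
  qed
  then have "reach M' (\<lambda>x. F (app g x))" using reach_low[OF C K S _ Z lw' lp' V] by blast
  then show ?thesis unfolding M'_def using reach_transport_back[OF _ k g confD(1,5)[OF conf]] by blast
qed

definition pfs :: "(nat \<Rightarrow> nat \<Rightarrow> complex) \<Rightarrow> nat \<Rightarrow> nat \<Rightarrow> complex" where
  "pfs m i j = (if i < j then pfa m i j else if j < i then - pfa m j i else 0)"

lemma pfs_skew: "pfs m j i = - pfs m i j"
  by (auto simp: pfs_def)

lemma skew6_entries:
  assumes "skew6 n"
  shows "n 1 0 = - n 0 1" "n 2 0 = - n 0 2" "n 3 0 = - n 0 3" "n 4 0 = - n 0 4" "n 5 0 = - n 0 5"
    "n 2 1 = - n 1 2" "n 3 1 = - n 1 3" "n 4 1 = - n 1 4" "n 5 1 = - n 1 5" "n 3 2 = - n 2 3"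
    "n 4 2 = - n 2 4" "n 5 2 = - n 2 5" "n 4 3 = - n 3 4" "n 5 3 = - n 3 5" "n 5 4 = - n 4 5"
    "n 0 0 = 0" "n 1 1 = 0" "n 2 2 = 0" "n 3 3 = 0" "n 4 4 = 0" "n 5 5 = (0::complex)"
proof -
  have d: "n i i = 0" if "i < 6" for i using skew6_skew[OF assms that that] by simp
  show "n 0 0 = 0" "n 1 1 = 0" "n 2 2 = 0" "n 3 3 = 0" "n 4 4 = 0" "n 5 5 = 0" by (rule d; simp)+
qed (rule skew6_skew[OF assms]; simp)+

lemma triples:
  assumes "i < j" "j < k" "k < (6::nat)"
  shows "(i = 0 \<and> j = 1 \<and> k = 2) \<or> (i = 0 \<and> j = 1 \<and> k = 3) \<or> (i = 0 \<and> j = 1 \<and> k = 4) \<or> (i = 0 \<and> j = 1 \<and> k = 5) \<or> (i = 0 \<and> j = 2 \<and> k = 3) \<or> (i = 0 \<and> j = 2 \<and> k = 4) \<or> (i = 0 \<and> j = 2 \<and> k = 5) \<or> (i = 0 \<and> j = 3 \<and> k = 4) \<or> (i = 0 \<and> j = 3 \<and> k = 5) \<or> (i = 0 \<and> j = 4 \<and> k = 5) \<or> (i = 1 \<and> j = 2 \<and> k = 3) \<or> (i = 1 \<and> j = 2 \<and> k = 4) \<or> (i = 1 \<and> j = 2 \<and> k = 5) \<or> (i = 1 \<and> j = 3 \<and> k = 4) \<or> (i = 1 \<and> j = 3 \<and> k = 5) \<or> (i = 1 \<and> j = 4 \<and> k = 5) \<or> (i = 2 \<and> j = 3 \<and> k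 = 4) \<or> (i = 2 \<and> j = 3 \<and> k = 5) \<or> (i = 2 \<and> j = 4 \<and> k = 5) \<or> (i = 3 \<and> j = 4 \<and> k = 5)"
  using assms by presburger

lemma pfa_wedge_expand:
  fixes z :: "nat \<Rightarrow> complex"
  assumes m: "skew6 m"
  defines "h \<equiv> \<lambda>i. \<Sum>j<6. m i j * z j"
  shows
    "pfa m 0 1 * z 2 - pfa m 0 2 * z 1 + pfa m 1 2 * z 0 =
      - (m 4 5 * h 3 - m 3 5 * h 4 + m 3 4 * h 5)"
    "pfa m 0 1 * z 3 - pfa m 0 3 * z 1 + pfa m 1 3 * z 0 =
      (m 4 5 * h 2 - m 2 5 * h 4 + m 2 4 * h 5)"
    "pfa m 0 1 * z 4 - pfa m 0 4 * z 1 + pfa m 1 4 * z 0 =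
      - (m 3 5 * h 2 - m 2 5 * h 3 + m 2 3 * h 5)"
    "pfa m 0 1 * z 5 - pfa m 0 5 * z 1 + pfa m 1 5 * z 0 =
      (m 3 4 * h 2 - m 2 4 * h 3 + m 2 3 * h 4)"
    "pfa m 0 2 * z 3 - pfa m 0 3 * z 2 + pfa m 2 3 * z 0 =
      - (m 4 5 * h 1 - m 1 5 * h 4 + m 1 4 * h 5)"
    "pfa m 0 2 * z 4 - pfa m 0 4 * z 2 + pfa m 2 4 * z 0 =
      (m 3 5 * h 1 - m 1 5 * h 3 + m 1 3 * h 5)"
    "pfa m 0 2 * z 5 - pfa m 0 5 * z 2 + pfa m 2 5 * z 0 =
      - (m 3 4 * h 1 - m 1 4 * h 3 + m 1 3 * h 4)"
    "pfa m 0 3 * z 4 - pfa m 0 4 * z 3 + pfa m 3 4 * z 0 =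
      - (m 2 5 * h 1 - m 1 5 * h 2 + m 1 2 * h 5)"
    "pfa m 0 3 * z 5 - pfa m 0 5 * z 3 + pfa m 3 5 * z 0 =
      (m 2 4 * h 1 - m 1 4 * h 2 + m 1 2 * h 4)"
    "pfa m 0 4 * z 5 - pfa m 0 5 * z 4 + pfa m 4 5 * z 0 =
      - (m 2 3 * h 1 - m 1 3 * h 2 + m 1 2 * h 3)"
    "pfa m 1 2 * z 3 - pfa m 1 3 * z 2 + pfa m 2 3 * z 1 =
      (m 4 5 * h 0 - m 0 5 * h 4 + m 0 4 * h 5)"
    "pfa m 1 2 * z 4 - pfa m 1 4 * z 2 + pfa m 2 4 * z 1 =
      - (m 3 5 * h 0 - m 0 5 * h 3 + m 0 3 * h 5)"
    "pfa m 1 2 * z 5 - pfa m 1 5 * z 2 + pfa m 2 5 * z 1 =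
      (m 3 4 * h 0 - m 0 4 * h 3 + m 0 3 * h 4)"
    "pfa m 1 3 * z 4 - pfa m 1 4 * z 3 + pfa m 3 4 * z 1 =
      (m 2 5 * h 0 - m 0 5 * h 2 + m 0 2 * h 5)"
    "pfa m 1 3 * z 5 - pfa m 1 5 * z 3 + pfa m 3 5 * z 1 =
      - (m 2 4 * h 0 - m 0 4 * h 2 + m 0 2 * h 4)"
    "pfa m 1 4 * z 5 - pfa m 1 5 * z 4 + pfa m 4 5 * z 1 =
      (m 2 3 * h 0 - m 0 3 * h 2 + m 0 2 * h 3)"
    "pfa m 2 3 * z 4 - pfa m 2 4 * z 3 + pfa m 3 4 * z 2 =
      - (m 1 5 * h 0 - m 0 5 * h 1 + m 0 1 * h 5)"
    "pfa m 2 3 * z 5 - pfa m 2 5 * z 3 + pfa m 3 5 * z 2 =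
      (m 1 4 * h 0 - m 0 4 * h 1 + m 0 1 * h 4)"
    "pfa m 2 4 * z 5 - pfa m 2 5 * z 4 + pfa m 4 5 * z 2 =
      - (m 1 3 * h 0 - m 0 3 * h 1 + m 0 1 * h 3)"
    "pfa m 3 4 * z 5 - pfa m 3 5 * z 4 + pfa m 4 5 * z 3 =
      (m 1 2 * h 0 - m 0 2 * h 1 + m 0 1 * h 2)"
  unfolding h_def sum6 skew6_entries[OF m] pfa_entries by (simp_all add: algebra_simps)

lemma pfa_wedge:
  assumes m: "skew6 m" and z: "\<And>i. i < 6 \<Longrightarrow> (\<Sum>j<6. m i j * z j) = 0" and ijk: "i < j" "j < k" "k < 6"
  shows "pfa m i j * z k - pfa m i k * z j + pfa m j k * z i = 0"
proof -
  have h: "(\<Sum>j<6. m 0 j * z j) = 0" "(\<Sum>j<6. m 1 j * z j) = 0" "(\<Sum>j<6. m 2 j * z j) = 0"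
    "(\<Sum>j<6. m 3 j * z j) = 0" "(\<Sum>j<6. m 4 j * z j) = 0" "(\<Sum>j<6. m 5 j * z j) = 0" by (rule z; simp)+
  note e = pfa_wedge_expand[OF m, of z, unfolded h mult_zero_right diff_self add_0 minus_zero]
  show ?thesis using triples[OF ijk] by (elim disjE conjE) (hypsubst, rule e)+
qed

lemma pfs_wedge:
  assumes m: "skew6 m" and z: "\<And>i. i < 6 \<Longrightarrow> (\<Sum>j<6. m i j * z j) = 0" and ijk: "i < j" "j < 6" "k < 6"
  shows "pfs m i j * z k - pfs m i k * z j + pfs m j k * z i = 0"
proof -
  consider "k < i" | "k = i" | "i < k" "k < j" | "k = j" | "j < k" by linarith
  then show ?thesis
  proof cases
    case 1
    then have "pfs m i j * z k - pfs m i k * z j + pfs m j k * z i = pfa m k i * z j - pfa m k j * z i + pfa m i j * z k"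
      using ijk by (simp add: pfs_def)
    then show ?thesis using pfa_wedge[OF m z 1 ijk(1,2)] by simp
  next
    case 3
    then have "pfs m i j * z k - pfs m i k * z j + pfs m j k * z i = - (pfa m i k * z j - pfa m i j * z k + pfa m k j * z i)"
      using ijk by (simp add: pfs_def)
    then show ?thesis using pfa_wedge[OF m z 3 ijk(2)] by simp
  next
    case 5
    then show ?thesis using pfa_wedge[OF m z ijk(1) 5 ijk(3)] ijk by (simp add: pfs_def)
  qed (use ijk in \<open>simp_all add: pfs_def\<close>)
qed

lemma pfs_contract:
  assumes m: "skew6 m" and z: "\<And>i. i < 6 \<Longrightarrow> (\<Sum>j<6. m i j * z j) = 0" and v: "(\<Sum>k<6. v k * z k) = f"
    and ij: "i < 6" "j < 6"
  shows "f * pfs m i j = z j * (\<Sum>k<6. pfs m i k * v k) - z i * (\<Sum>k<6. pfs m j k * v k)"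
proof -
  have *: "f * pfs m i j = z j * (\<Sum>k<6. pfs m i k * v k) - z i * (\<Sum>k<6. pfs m j k * v k)"
    if ij: "i < j" "j < 6" for i j
  proof -
    have "f * pfs m i j - (z j * (\<Sum>k<6. pfs m i k * v k) - z i * (\<Sum>k<6. pfs m j k * v k)) =
        (\<Sum>k<6. v k * (pfs m i j * z k - pfs m i k * z j + pfs m j k * z i))"
      unfolding v[symmetric] sum_distrib_left sum_distrib_right sum_subtractf[symmetric]
      by (intro sum.cong refl) (simp add: algebra_simps)
    also have "\<dots> = 0" using pfs_wedge[OF m z ij] by (intro sum.neutral) simp
    finally show ?thesis by simp
  qed
  show ?thesis
  proof (cases i j rule: linorder_cases)
    case less then show ?thesis using * ij by blast
  next
    case equal then show ?thesis by (simp add: pfs_def)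
  next
    case greater
    have "f * pfs m i j = - (f * pfs m j i)" by (simp add: pfs_skew[of m i j])
    then show ?thesis unfolding *[OF greater ij(1)] by simp
  qed
qed

lemma dpf6_pfs:
  assumes "skew6 n" shows "2 * dpf6 m n = (\<Sum>i<6. \<Sum>j<6. n i j * pfs m i j)"
proof -
  have "(\<Sum>i<6. \<Sum>j<6. n i j * pfs m i j) = 2 * dpf6 m n"
    unfolding dpf6_pfa sum6 skew6_entries[OF assms] by (simp add: pfs_def)
  then show ?thesis by simp
qed

lemma kernel_pair_derivative:
  assumes m: "skew6 m" and z: "\<And>i. i < 6 \<Longrightarrow> (\<Sum>j<6. m i j * z j) = 0" and w: "\<And>i. i < 6 \<Longrightarrow> (\<Sum>j<6. m i j * w j) = 0"
    and uv: "(\<Sum>k<6. v k * z k) = f" "(\<Sum>k<6. u k * w k) = f" "(\<Sum>k<6. u k * z k) = 0"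
    and f: "f \<noteq> 0" and e: "dpf6 m (\<lambda>i j. v i * u j - u i * v j) = e * f\<^sup>2" and n: "skew6 n"
  shows "dpf6 m n = e * (\<Sum>i<6. \<Sum>j<6. z i * n i j * w j)"
proof -
  define p where "p = (\<lambda>i. \<Sum>k<6. pfs m i k * v k)"
  define q where "q = (\<lambda>i. \<Sum>k<6. pfs m i k * u k)"
  define s where "s = (\<Sum>i<6. u i * p i)"
  have fz: "f * pfs m i j = z j * p i - z i * p j" if "i < 6" "j < 6" for i j
    unfolding p_def by (rule pfs_contract[OF m z uv(1) that])
  have fw: "f * pfs m i j = w j * q i - w i * q j" if "i < 6" "j < 6" for i j
    unfolding q_def by (rule pfs_contract[OF m w uv(2) that])
  have fq: "f * q i = - z i * s" if i: "i < 6" for i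
  proof -
    have "f * q i = (\<Sum>k<6. (f * pfs m i k) * u k)" by (simp add: q_def sum_distrib_left mult_ac)
    also have "\<dots> = (\<Sum>k<6. p i * (u k * z k) - z i * (u k * p k))"
      using i by (intro sum.cong refl) (simp add: fz algebra_simps)
    also have "\<dots> = - z i * s" by (simp add: sum_subtractf sum_distrib_left[symmetric] uv s_def)
    finally show ?thesis .
  qed
  have ss: "s = - e * f\<^sup>2"
  proof -
    have sk: "skew6 (\<lambda>i j. v i * u j - u i * v j)" by (simp add: skew6_def)
    have a: "(\<Sum>i<6. \<Sum>j<6. u i * pfs m i j * v j) = s"
      by (simp add: s_def p_def sum_distrib_left mult_ac)
    have "(\<Sum>i<6. \<Sum>j<6. v i * pfs m i j * u j) = (\<Sum>j<6. \<Sum>i<6. v i * pfs m i j * u j)" by (rule sum.swap)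
    also have "\<dots> = (\<Sum>j<6. \<Sum>i<6. - (u j * pfs m j i * v i))"
      by (intro sum.cong refl) (subst pfs_skew, simp add: mult_ac)
    also have "\<dots> = - s" unfolding a[symmetric] by (simp add: sum_negf)
    finally have b: "(\<Sum>i<6. \<Sum>j<6. v i * pfs m i j * u j) = - s" .
    have "2 * (e * f\<^sup>2) = (\<Sum>i<6. \<Sum>j<6. (v i * u j - u i * v j) * pfs m i j)"
      unfolding e[symmetric] by (rule dpf6_pfs[OF sk])
    also have "\<dots> = (\<Sum>i<6. \<Sum>j<6. v i * pfs m i j * u j) - (\<Sum>i<6. \<Sum>j<6. u i * pfs m i j * v j)"
      unfolding sum_subtractf[symmetric] by (intro sum.cong refl) (simp add: algebra_simps)
    also have "\<dots> = 2 * (- s)" unfolding a b by simp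
    finally show ?thesis by simp
  qed
  have P: "pfs m i j = e * (z i * w j - z j * w i)" if ij: "i < 6" "j < 6" for i j
  proof -
    have "f * (f * pfs m i j) = w j * (f * q i) - w i * (f * q j)" by (simp add: fw[OF ij] algebra_simps)
    also have "\<dots> = f * (f * (e * (z i * w j - z j * w i)))"
      unfolding fq[OF ij(1)] fq[OF ij(2)] ss by (simp add: power2_eq_square algebra_simps)
    finally show ?thesis using f by simp
  qed
  have "2 * dpf6 m n = (\<Sum>i<6. \<Sum>j<6. n i j * (e * (z i * w j - z j * w i)))"
    unfolding dpf6_pfs[OF n] by (intro sum.cong refl) (simp add: P)
  also have "\<dots> = 2 * (e * (\<Sum>i<6. \<Sum>j<6. z i * n i j * w j))"
    unfolding skew_pairing_expand[OF n] unfolding sum6 skew6_entries[OF n] by (simp add: algebra_simps)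
  finally show ?thesis by simp
qed

lemma pf6_kernel:
  assumes "skew6 m" "\<And>n. skew6 n \<Longrightarrow> dpf6 m n = e * (\<Sum>i<6. \<Sum>j<6. z i * n i j * w j)"
    and w: "\<And>i. i < 6 \<Longrightarrow> (\<Sum>j<6. m i j * w j) = 0"
  shows "pf6 m = 0"
proof -
  have "(\<Sum>i<6. \<Sum>j<6. z i * m i j * w j) = (\<Sum>i<6. z i * (\<Sum>j<6. m i j * w j))"
    by (simp add: sum_distrib_left mult_ac)
  then have "3 * pf6 m = 0" using assms(2)[OF assms(1)] w unfolding dpf6_self by simp
  then show ?thesis by simp
qed

definition polyline :: "(pt \<Rightarrow> complex) \<Rightarrow> bool" where
  "polyline f \<longleftrightarrow> (\<forall>x y. \<exists>p. \<forall>t. f (\<lambda>k. (1 - t) * x k + t * y k) = poly p t)"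

lemma polyline_const: "polyline (\<lambda>x. c)"
  unfolding polyline_def by (intro allI exI[of _ "[:c:]"]) simp

lemma polyline_lin: assumes "lin f" shows "polyline f"
  unfolding polyline_def
proof (intro allI)
  fix x y
  have "f (\<lambda>k. (1 - t) * x k + t * y k) = poly [:f x, f y - f x:] t" for t
    unfolding lin_comb[OF assms] by (simp add: algebra_simps)
  then show "\<exists>p. \<forall>t. f (\<lambda>k. (1 - t) * x k + t * y k) = poly p t" by blast
qed

lemma polyline_plus: "polyline f \<Longrightarrow> polyline g \<Longrightarrow> polyline (\<lambda>x. f x + g x)"
  and polyline_minus: "polyline f \<Longrightarrow> polyline g \<Longrightarrow> polyline (\<lambda>x. f x - g x)"
  and polyline_mult: "polyline f \<Longrightarrow> polyline g \<Longrightarrow> polyline (\<lambda>x. f x * g x)"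
  unfolding polyline_def by (metis poly_add, metis poly_diff, metis poly_mult)

lemma polyline_sum: "(\<And>i. i \<in> S \<Longrightarrow> polyline (f i)) \<Longrightarrow> polyline (\<lambda>x. \<Sum>i\<in>S. f i x)"
  by (induction S rule: infinite_finite_induct) (auto intro: polyline_plus polyline_const)

lemma polyline_cub: "cub f \<Longrightarrow> polyline f"
proof -
  assume "cub f"
  then obtain c where "f = (\<lambda>x. \<Sum>a<5. \<Sum>b<5. \<Sum>d<5. c a b d * (x a * x b * x d))"
    unfolding cub_def by blast
  then show ?thesis
    by (simp only:) (intro polyline_sum polyline_mult polyline_const polyline_lin lin_coord; simp)
qed

lemma polyline_identity:
  assumes F: "polyline F" "F y \<noteq> 0" and G: "polyline G" "\<And>x. F x \<noteq> 0 \<Longrightarrow> G x = 0"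
  shows "G x = 0"
proof -
  obtain p where p: "\<And>t. F (\<lambda>k. (1 - t) * x k + t * y k) = poly p t" using F(1) unfolding polyline_def by blast
  obtain q where q: "\<And>t. G (\<lambda>k. (1 - t) * x k + t * y k) = poly q t" using G(1) unfolding polyline_def by blast
  have "poly p 1 \<noteq> 0" using p[of 1] F(2) by simp
  then have "finite {t. poly p t = 0}" by (intro poly_roots_finite) auto
  moreover have "poly q t = 0" if "poly p t \<noteq> 0" for t
    using G(2)[of "\<lambda>k. (1 - t) * x k + t * y k"] that unfolding p q by blast
  then have "{t. poly q t \<noteq> 0} \<subseteq> {t. poly p t = 0}" by blast
  ultimately have fin: "finite {t. poly q t \<noteq> 0}" by (rule rev_finite_subset)
  have "q = 0"
  proof (rule ccontr)
    assume "q \<noteq> 0"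
    then have "finite ({t. poly q t = 0} \<union> {t. poly q t \<noteq> 0})" using poly_roots_finite fin by blast
    moreover have "{t. poly q t = 0} \<union> {t. poly q t \<noteq> 0} = UNIV" by blast
    ultimately show False using infinite_UNIV_char_0[where 'a = complex] by simp
  qed
  then show ?thesis using q[of 0] by simp
qed

lemma reach_of_factorization:
  assumes M: "skewl M" and st: "sst M" and lz: "\<And>i. i < 6 \<Longrightarrow> lin (z i)" and lw: "\<And>i. i < 6 \<Longrightarrow> lin (w i)"
    and qu: "\<And>i. i < 6 \<Longrightarrow> quad (u i)" and qv: "\<And>i. i < 6 \<Longrightarrow> quad (v i)" and F: "cub F" "F y \<noteq> 0"
    and kz: "ker M z" and kw: "ker M w"
    and uv: "\<And>x. (\<Sum>k<6. v k x * z k x) = F x" "\<And>x. (\<Sum>k<6. u k x * w k x) = F x"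
      "\<And>x. (\<Sum>k<6. u k x * z k x) = 0" "\<And>x. (\<Sum>k<6. v k x * w k x) = 0"
    and e: "e \<noteq> 0" "\<And>x. dpf6 (val M x) (\<lambda>i j. v i x * u j x - u i x * v j x) = e * (F x)\<^sup>2"
  shows "reach M F"
proof -
  have D: "dpf6 (val M x) n = e * (\<Sum>i<6. \<Sum>j<6. z i x * n i j * w j x)" if n: "skew6 n" for x n
  proof -
    let ?G = "\<lambda>x. dpf6 (val M x) n - e * (\<Sum>i<6. \<Sum>j<6. z i x * n i j * w j x)"
    have lM: "polyline (M i j)" if "i < 6" "j < 6" for i j by (rule polyline_lin[OF skewl_lin[OF M that]])
    have "polyline ?G" unfolding dpf6_def
      by (intro polyline_minus polyline_plus polyline_mult polyline_const polyline_sum lM polyline_lin lz lw; simp)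
    then have "?G x = 0"
    proof (rule polyline_identity[OF polyline_cub[OF F(1)] F(2)])
      fix x assume "F x \<noteq> 0"
      then show "?G x = 0"
        using kernel_pair_derivative[OF skewl_val[OF M], of x "\<lambda>i. z i x" "\<lambda>i. w i x" "\<lambda>i. v i x" "F x" "\<lambda>i. u i x" e n]
          kz kw uv e n unfolding ker_def by simp
    qed
    then show ?thesis by simp
  qed
  have "conf M z w u F e"
    unfolding conf_def
  proof (intro conjI allI impI)
    show "pf6 (val M x) = 0" for x
      by (rule pf6_kernel[OF skewl_val[OF M] D]) (use kw in \<open>auto simp: ker_def\<close>)
  qed (use M lz lw qu F e uv D in auto)
  then show ?thesis by (rule reach_factorization[OF _ kz kw st qv uv(1) uv(4)])
qed

definition ix :: "5 \<Rightarrow> nat" where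
  "ix = (SOME e. bij_betw e UNIV {..<5})"

lemma ix_bij: "bij_betw ix UNIV {..<5}"
proof -
  have "\<exists>e::5 \<Rightarrow> nat. bij_betw e UNIV {..<5}"
    using ex_bij_betw_finite_nat[of "UNIV :: 5 set"] by (simp add: atLeast0LessThan)
  then show ?thesis unfolding ix_def by (rule someI_ex)
qed

lemma ix_less: "ix i < 5" using bij_betwE[OF ix_bij] by auto

abbreviation iy :: "nat \<Rightarrow> 5" where "iy \<equiv> inv_into UNIV ix"

lemma ix_iy: "k < 5 \<Longrightarrow> ix (iy k) = k"
  using bij_betw_inv_into_right[OF ix_bij, of k] by simp

lemma iy_ix: "iy (ix i) = i"
  using bij_betw_inv_into_left[OF ix_bij, of i] by simp

definition ev :: "form \<Rightarrow> pt \<Rightarrow> complex" where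
  "ev p x = eval p (\<lambda>i. x (ix i))"

lemma ev_add: "ev (p + q) x = ev p x + ev q x" by (simp add: ev_def eval_add)
lemma ev_mult: "ev (p * q) x = ev p x * ev q x" by (simp add: ev_def eval_mult)
lemma ev_const: "ev (const c) x = c" by (simp add: ev_def eval_const)
lemma ev_0: "ev 0 x = 0" by (simp add: ev_def)
lemma ev_uminus: "ev (- p) x = - ev p x"
  using ev_add[of "- p" p x] by (simp add: ev_0 eq_neg_iff_add_eq_0)
lemma ev_diff: "ev (p - q) x = ev p x - ev q x"
  using ev_add[of p "- q" x] by (simp add: ev_uminus)
lemma ev_sum: "ev (\<Sum>i\<in>A. f i) x = (\<Sum>i\<in>A. ev (f i) x)" by (simp add: ev_def eval_sum)
lemma ev_power2: "ev (p ^ 2) x = (ev p x)\<^sup>2" by (simp add: power2_eq_square ev_mult)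

lemma mon_degree_0: "mon_degree m = 0 \<Longrightarrow> m = 0"
  unfolding mon_degree_def by (auto simp: in_keys_iff intro!: poly_mapping_eqI)

lemma mon_degree_single: "mon_degree (Poly_Mapping.single i n) = n"
  by (cases "n = 0") (simp_all add: mon_degree_def)

lemma mon_degree_Suc:
  assumes "mon_degree m = Suc d"
  obtains i m' where "m = Poly_Mapping.single i 1 + m'" "mon_degree m' = d"
proof -
  have "\<exists>i\<in>Poly_Mapping.keys m. Poly_Mapping.lookup m i \<noteq> 0"
    using assms unfolding mon_degree_def by (metis Zero_not_Suc sum.neutral)
  then obtain i where i: "Poly_Mapping.lookup m i \<noteq> 0" by blast
  have m: "m = Poly_Mapping.single i 1 + (m - Poly_Mapping.single i 1)"
    using i by (intro poly_mapping_eqI) (auto simp: lookup_add lookup_minus lookup_single when_def)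
  have "mon_degree m = 1 + mon_degree (m - Poly_Mapping.single i 1)"
    using arg_cong[OF m, of mon_degree] by (simp only: mon_degree_add mon_degree_single)
  then show ?thesis using that[OF m] assms by simp
qed

lemma mon_eval_0: "mon_eval 0 a = 1" by (simp add: mon_eval_def)

lemma mon_eval_single: "mon_eval (Poly_Mapping.single i 1) a = a i" by (simp add: mon_eval_def)

lemma lin_mon: "mon_degree m = 1 \<Longrightarrow> lin (\<lambda>x. mon_eval m (\<lambda>i. x (ix i)))"
proof -
  assume "mon_degree m = 1"
  then obtain i m' where m: "m = Poly_Mapping.single i 1 + m'" "mon_degree m' = 0"
    using mon_degree_Suc[of m 0] by auto
  then have "m' = 0" by (simp add: mon_degree_0)
  then show ?thesis unfolding m(1) by (simp only: add_0_right mon_eval_single) (rule lin_coord[OF ix_less])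
qed

lemma quad_mon: "mon_degree m = 2 \<Longrightarrow> quad (\<lambda>x. mon_eval m (\<lambda>i. x (ix i)))"
proof -
  assume "mon_degree m = 2"
  then obtain i m' where m: "m = Poly_Mapping.single i 1 + m'" "mon_degree m' = 1"
    using mon_degree_Suc[of m 1] by (auto simp: numeral_2_eq_2)
  show ?thesis unfolding m(1) mon_eval_add mon_eval_single
    by (intro quad_mult lin_coord ix_less lin_mon m(2))
qed

lemma cub_mon: "mon_degree m = 3 \<Longrightarrow> cub (\<lambda>x. mon_eval m (\<lambda>i. x (ix i)))"
proof -
  assume "mon_degree m = 3"
  then obtain i m' where m: "m = Poly_Mapping.single i 1 + m'" "mon_degree m' = 2"
    using mon_degree_Suc[of m 2] by (auto simp: numeral_3_eq_3 numeral_2_eq_2)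
  show ?thesis unfolding m(1) mon_eval_add mon_eval_single
    by (intro cub_mult' lin_coord ix_less quad_mon m(2))
qed

lemma ev_expand: "ev p = (\<lambda>x. \<Sum>m\<in>Poly_Mapping.keys p. Poly_Mapping.lookup p m * mon_eval m (\<lambda>i. x (ix i)))"
  by (simp add: ev_def eval_alt fun_eq_iff)

lemma lin_ev: "homogeneous 1 p \<Longrightarrow> lin (ev p)"
  unfolding ev_expand homogeneous_def by (intro lin_sum lin_cmult lin_mon) blast

lemma quad_ev: "homogeneous 2 p \<Longrightarrow> quad (ev p)"
  unfolding ev_expand homogeneous_def by (intro quad_sum quad_cmult quad_mon) blast

lemma cub_ev: "homogeneous 3 p \<Longrightarrow> cub (ev p)"
  unfolding ev_expand homogeneous_def by (intro cub_sum cub_cmult cub_mon) blast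

lemma homogeneous_0_const: "homogeneous 0 p \<Longrightarrow> \<exists>c. p = const c"
proof
  assume "homogeneous 0 p"
  then have "m = 0" if "m \<in> Poly_Mapping.keys p" for m using that mon_degree_0 unfolding homogeneous_def by blast
  then show "p = const (Poly_Mapping.lookup p 0)"
    by (intro poly_mapping_eqI) (auto simp: lookup_single when_def in_keys_iff)
qed

definition coord :: "nat \<Rightarrow> form" where
  "coord k = Poly_Mapping.single (Poly_Mapping.single (iy k) 1) 1"

lemma ev_coord: "k < 5 \<Longrightarrow> ev (coord k) x = x k"
  by (simp only: ev_def coord_def eval_single mon_eval_single ix_iy mult_1)

lemma homogeneous_coord: "homogeneous 1 (coord k)"
  by (simp add: homogeneous_def coord_def mon_degree_single[of _ "Suc 0", unfolded One_nat_def])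

lemma form_of_lin:
  assumes "lin f" obtains p where "homogeneous 1 p" "ev p = f"
proof -
  obtain c where c: "\<And>x. f x = (\<Sum>k<5. c k * x k)" using assms unfolding lin_def by blast
  show ?thesis
  proof (rule that[of "\<Sum>k<5. const (c k) * coord k"])
    show "homogeneous 1 (\<Sum>k<5. const (c k) * coord k)"
      by (intro homogeneous_sum homogeneous_const_mult homogeneous_coord)
    show "ev (\<Sum>k<5. const (c k) * coord k) = f"
      by (rule ext) (simp add: ev_sum ev_mult ev_const ev_coord c)
  qed
qed

lemma form_of_cub:
  assumes "cub f" obtains p where "homogeneous 3 p" "ev p = f"
proof -
  obtain c where c: "\<And>x. f x = (\<Sum>a<5. \<Sum>b<5. \<Sum>d<5. c a b d * (x a * x b * x d))"
    using assms unfolding cub_def by blast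
  let ?p = "\<Sum>a<5. \<Sum>b<5. \<Sum>d<5. const (c a b d) * (coord a * coord b * coord d)"
  have h: "homogeneous 3 (coord a * coord b * coord d)" for a b d
    using homogeneous_mult[OF homogeneous_mult[OF homogeneous_coord[of a] homogeneous_coord[of b]] homogeneous_coord[of d]]
    by (simp add: numeral_3_eq_3)
  show ?thesis
  proof (rule that[of ?p])
    show "homogeneous 3 ?p" by (intro homogeneous_sum homogeneous_const_mult h)
    show "ev ?p = f" by (rule ext) (simp add: ev_sum ev_mult ev_const ev_coord c)
  qed
qed

lemma digits_unique:
  fixes a b :: "nat \<Rightarrow> nat"
  assumes "(\<Sum>k<n. a k * N ^ k) = (\<Sum>k<n. b k * N ^ k)" "\<And>k. k < n \<Longrightarrow> a k < N" "\<And>k. k < n \<Longrightarrow> b k < N" "k < n"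
  shows "a k = b k"
  using assms
proof (induction n arbitrary: a b k)
  case (Suc n)
  have shift: "(\<Sum>k<Suc n. a k * N ^ k) = a 0 + N * (\<Sum>k<n. a (Suc k) * N ^ k)" for a :: "nat \<Rightarrow> nat"
    unfolding sum.lessThan_Suc_shift sum_distrib_left by (simp add: mult_ac)
  have ab: "a 0 < N" "b 0 < N" using Suc.prems(2,3)[of 0] by auto
  have e: "a 0 + N * (\<Sum>k<n. a (Suc k) * N ^ k) = b 0 + N * (\<Sum>k<n. b (Suc k) * N ^ k)"
    using Suc.prems(1) unfolding shift .
  have "(a 0 + N * (\<Sum>k<n. a (Suc k) * N ^ k)) mod N = a 0" "(b 0 + N * (\<Sum>k<n. b (Suc k) * N ^ k)) mod N = b 0"
    using ab by simp_all
  then have 0: "a 0 = b 0" using e by simp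
  then have "(\<Sum>k<n. a (Suc k) * N ^ k) = (\<Sum>k<n. b (Suc k) * N ^ k)" using e ab by simp
  then have "a (Suc k) = b (Suc k)" if "k < n" for k
    by (rule Suc.IH) (use Suc.prems(2,3) that in auto)
  then show ?case using 0 Suc.prems(4) by (cases k) auto
qed simp

lemma ev_eq_0:
  assumes "\<And>x. ev p x = 0" shows "p = 0"
proof (rule ccontr)
  assume "p \<noteq> 0"
  then obtain m0 where m0: "m0 \<in> Poly_Mapping.keys p" by (metis keys_eq_empty ex_in_conv)
  define N where "N = Suc (\<Sum>m\<in>Poly_Mapping.keys p. \<Sum>i\<in>UNIV. Poly_Mapping.lookup m i)"
  have N: "Poly_Mapping.lookup m i < N" if "m \<in> Poly_Mapping.keys p" for m i
  proof -
    have "Poly_Mapping.lookup m i \<le> (\<Sum>i\<in>UNIV. Poly_Mapping.lookup m i)" by (rule member_le_sum) auto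
    also have "\<dots> \<le> (\<Sum>m\<in>Poly_Mapping.keys p. \<Sum>i\<in>UNIV. Poly_Mapping.lookup m i)"
      by (rule member_le_sum[OF that]) auto
    finally show ?thesis by (simp add: N_def)
  qed
  define code where "code = (\<lambda>m::5 \<Rightarrow>\<^sub>0 nat. \<Sum>k<5. Poly_Mapping.lookup m (iy k) * N ^ k)"
  have inj: "m = m'" if "m \<in> Poly_Mapping.keys p" "m' \<in> Poly_Mapping.keys p" "code m = code m'" for m m'
  proof (rule poly_mapping_eqI)
    fix i
    have "Poly_Mapping.lookup m (iy (ix i)) = Poly_Mapping.lookup m' (iy (ix i))"
      by (rule digits_unique[where n = 5 and N = N and a = "\<lambda>k. Poly_Mapping.lookup m (iy k)" and b = "\<lambda>k. Poly_Mapping.lookup m' (iy k)"])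
        (use that N ix_less in \<open>auto simp: code_def\<close>)
    then show "Poly_Mapping.lookup m i = Poly_Mapping.lookup m' i" by (simp add: iy_ix)
  qed
  have me: "mon_eval m (\<lambda>i. t ^ (N ^ ix i)) = t ^ code m" for m and t :: complex
  proof -
    have "mon_eval m (\<lambda>i. t ^ (N ^ ix i)) = (\<Prod>i\<in>UNIV. t ^ (Poly_Mapping.lookup m (iy (ix i)) * N ^ ix i))"
      by (subst mon_eval_superset[of UNIV]) (auto simp: iy_ix power_mult[symmetric] mult.commute)
    also have "\<dots> = (\<Prod>k<5. t ^ (Poly_Mapping.lookup m (iy k) * N ^ k))"
      by (rule prod.reindex_bij_betw[OF ix_bij])
    finally show ?thesis by (simp add: code_def power_sum)
  qed
  define P where "P = (\<Sum>m\<in>Poly_Mapping.keys p. monom (Poly_Mapping.lookup p m) (code m))"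
  have "poly P t = ev p (\<lambda>k. t ^ (N ^ k))" for t
    by (simp add: P_def poly_sum poly_monom ev_expand me)
  then have "poly P t = 0" for t using assms by simp
  then have "P = 0" using poly_all_0_iff_0[of P] by blast
  then have "0 = coeff P (code m0)" by simp
  also have "\<dots> = (\<Sum>m\<in>Poly_Mapping.keys p. if m = m0 then Poly_Mapping.lookup p m else 0)"
    unfolding P_def coeff_sum by (intro sum.cong refl) (use inj m0 in auto)
  also have "\<dots> = Poly_Mapping.lookup p m0" using m0 by simp
  finally show False using m0 by (simp add: in_keys_iff)
qed

lemma ev_inject: "ev p = ev q \<Longrightarrow> p = q"
  using ev_eq_0[of "p - q"] by (simp add: ev_diff fun_eq_iff)

lemma eval_poly:
  assumes "\<And>i. \<exists>q. \<forall>t. a t i = poly q t"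
  shows "\<exists>Q. \<forall>t. eval p (a t) = poly Q t"
proof -
  obtain q where q: "\<And>i t. a t i = poly (q i) t" using assms by metis
  have "eval p (a t) = poly (\<Sum>m\<in>Poly_Mapping.keys p. smult (Poly_Mapping.lookup p m)
      (\<Prod>i\<in>Poly_Mapping.keys m. q i ^ Poly_Mapping.lookup m i)) t" for t
    by (simp add: eval_def q poly_sum poly_prod)
  then show ?thesis by blast
qed

lemma lookup_single_ev:
  assumes "homogeneous 1 p" shows "ev p (dl k) = (if k < 5 then Poly_Mapping.lookup p (Poly_Mapping.single (iy k) 1) else 0)"
proof -
  have "ev p (dl k) = (\<Sum>m\<in>Poly_Mapping.keys p. if m = Poly_Mapping.single (iy k) 1 \<and> k < 5 then Poly_Mapping.lookup p m else 0)"
    unfolding ev_expand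
  proof (intro sum.cong refl)
    fix m assume "m \<in> Poly_Mapping.keys p"
    then have "mon_degree m = Suc 0" using assms unfolding homogeneous_def by simp
    then obtain i m' where m: "m = Poly_Mapping.single i 1 + m'" "mon_degree m' = 0" by (rule mon_degree_Suc)
    then have m: "m = Poly_Mapping.single i 1" by (simp add: mon_degree_0)
    have "(i = iy k \<and> k < 5) \<longleftrightarrow> k = ix i" using ix_iy iy_ix ix_less by metis
    moreover have "m = Poly_Mapping.single (iy k) 1 \<longleftrightarrow> i = iy k"
      unfolding m by (metis lookup_single_eq lookup_single_not_eq one_neq_zero)
    ultimately show "Poly_Mapping.lookup p m * mon_eval m (\<lambda>i. dl k (ix i)) =
        (if m = Poly_Mapping.single (iy k) 1 \<and> k < 5 then Poly_Mapping.lookup p m else 0)"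
      unfolding m by (auto simp: mon_eval_single[unfolded One_nat_def] dl_def)
  qed
  also have "\<dots> = (if k < 5 then Poly_Mapping.lookup p (Poly_Mapping.single (iy k) 1) else 0)"
    by (auto simp: in_keys_iff)
  finally show ?thesis .
qed

abbreviation entries :: "form mat \<Rightarrow> nat \<Rightarrow> nat \<Rightarrow> pt \<Rightarrow> complex" where
  "entries A \<equiv> \<lambda>i j. ev (A $$ (i, j))"

lemma skew_linD:
  assumes "A \<in> skew_lin"
  shows "A \<in> carrier_mat 6 6" "skew A" "\<And>i j. i < 6 \<Longrightarrow> j < 6 \<Longrightarrow> homogeneous 1 (A $$ (i, j))"
  using assms by (auto simp: skew_lin_def form_mats_def)

lemma skewl_entries: assumes "A \<in> skew_lin" shows "skewl (entries A)"
proof (rule skewlI)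
  fix i j :: nat and x assume ij: "i < 6" "j < 6"
  show "lin (ev (A $$ (i, j)))" by (rule lin_ev[OF skew_linD(3)[OF assms ij]])
  show "ev (A $$ (j, i)) x = - ev (A $$ (i, j)) x"
    using skew_entry[OF skew_linD(1,2)[OF assms] ij] by (simp add: ev_uminus)
qed

lemma ev_pfaffian: "A \<in> carrier_mat 6 6 \<Longrightarrow> ev (pfaffian A) x = pf6 (val (entries A) x)"
  by (simp add: pfaffian_6 pf6_def ev_add ev_diff ev_mult)

lemma form_of_skewl:
  assumes N: "skewl N" obtains A where "A \<in> skew_lin" "\<And>i j. i < 6 \<Longrightarrow> j < 6 \<Longrightarrow> ev (A $$ (i, j)) = N i j"
proof -
  define p where "p = (\<lambda>i j. SOME p. homogeneous 1 p \<and> ev p = N i j)"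
  have p: "homogeneous 1 (p i j)" "ev (p i j) = N i j" if "i < 6" "j < 6" for i j
  proof -
    have "\<exists>p. homogeneous 1 p \<and> ev p = N i j" using form_of_lin[OF skewl_lin[OF N that]] by metis
    from someI_ex[OF this] show "homogeneous 1 (p i j)" "ev (p i j) = N i j" by (simp_all add: p_def)
  qed
  have sk: "p j i = - p i j" if "i < 6" "j < 6" for i j
    by (rule ev_inject) (use that p skewl_skew[OF N that] in \<open>auto simp: fun_eq_iff ev_uminus\<close>)
  show ?thesis
  proof (rule that[of "mat 6 6 (\<lambda>(i, j). p i j)"])
    have "skew (mat 6 6 (\<lambda>(i, j). p i j))" unfolding skew_def by (rule eq_matI) (auto intro: sk)
    then show "mat 6 6 (\<lambda>(i, j). p i j) \<in> skew_lin" using p by (simp add: skew_lin_def form_mats_def)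
  qed (simp add: p)
qed

lemma ev_congr_act:
  assumes h: "h \<in> carrier_mat 6 6" and A: "A \<in> carrier_mat 6 6" and ij: "i < 6" "j < 6"
  shows "ev (congr_act h A $$ (i, j)) x = cg (\<lambda>i j. h $$ (i, j)) (val (entries A) x) i j"
proof -
  have "map_mat const h \<in> carrier_mat 6 6" using h by simp
  then have "congr_act h A $$ (i, j) =
      (\<Sum>(a, b)\<in>{0..<6} \<times> {0..<6}. A $$ (a, b) * (const (h $$ (i, a)) * const (h $$ (j, b))))"
    unfolding congr_act_def using mult_congr_entry[OF _ A ij, of "map_mat const h"] h ij
    by (auto intro!: sum.cong)
  then show ?thesis
    unfolding cg_def sum.cartesian_product
    by (simp only: ev_sum) (auto simp: ev_mult ev_const atLeast0LessThan intro!: sum.cong)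
qed

lemma smult_const_twice: "const a \<cdot>\<^sub>m (const b \<cdot>\<^sub>m P) = const (a * b) \<cdot>\<^sub>m (P :: form mat)"
  by (rule eq_matI) (auto simp: mult_single mult.assoc[symmetric])

lemma form_class_self: "G \<in> form_class G"
  unfolding form_class_def by (rule CollectI, rule exI[of _ 1]) (simp add: single_one)

lemma complex_root6: "\<exists>\<mu>::complex. \<mu> ^ 6 = w"
proof
  have "rcis (root 6 (cmod w)) (Arg w / 6) ^ 6 = rcis (root 6 (cmod w) ^ 6) (6 * (Arg w / 6))"
    by (simp add: DeMoivre2)
  then show "rcis (root 6 (cmod w)) (Arg w / 6) ^ 6 = w" by (simp add: rcis_cmod_Arg)
qed

lemma congr_act_SL:
  assumes h: "h \<in> carrier_mat 6 6" and mu: "\<mu> ^ 6 = det h" "det h \<noteq> 0"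
  obtains h' where "h' \<in> SL6" "\<And>M. M \<in> skew_lin \<Longrightarrow> congr_act h M = const (\<mu>\<^sup>2) \<cdot>\<^sub>m congr_act h' M"
proof -
  have m0: "\<mu> \<noteq> 0" using mu by auto
  define h' where "h' = (1 / \<mu>) \<cdot>\<^sub>m h"
  have h': "h' \<in> carrier_mat 6 6" using h by (simp add: h'_def)
  have "det h' = (1 / \<mu>) ^ 6 * det h" unfolding h'_def using h by (simp add: det_smult)
  then have "det h' = 1" using mu m0 by (simp add: power_divide)
  then have S: "h' \<in> SL6" using h' by (simp add: SL6_def)
  let ?G = "map_mat const h' :: form mat"
  have G: "?G \<in> carrier_mat 6 6" using h' by simp
  have e: "map_mat const h = const \<mu> \<cdot>\<^sub>m ?G"
    by (rule eq_matI) (use h m0 in \<open>auto simp: h'_def mult_single\<close>)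
  have "congr_act h M = const (\<mu>\<^sup>2) \<cdot>\<^sub>m congr_act h' M" if M: "M \<in> skew_lin" for M
  proof -
    have Mc: "M \<in> carrier_mat 6 6" by (rule skew_linD(1)[OF M])
    have "congr_act h M = (const \<mu> \<cdot>\<^sub>m ?G) * M * (const \<mu> \<cdot>\<^sub>m transpose_mat ?G)"
      unfolding congr_act_def e transpose_smult by simp
    also have "\<dots> = const \<mu> \<cdot>\<^sub>m (const \<mu> \<cdot>\<^sub>m (?G * M * transpose_mat ?G))"
      using G Mc by (simp add: mult_smult_assoc_mat[of _ 6 6 _ 6] mult_smult_distrib[of _ 6 6 _ 6])
    also have "\<dots> = const (\<mu>\<^sup>2) \<cdot>\<^sub>m congr_act h' M"
      unfolding congr_act_def smult_const_twice by (simp add: power2_eq_square)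
    finally show ?thesis .
  qed
  then show ?thesis by (rule that[OF S])
qed

lemma hom_invariant_congr:
  assumes f: "f \<in> hom_invariants d" and h: "h \<in> carrier_mat 6 6" and mu: "\<mu> ^ 6 = det h" "det h \<noteq> 0"
    and M: "M \<in> skew_lin"
  shows "f (congr_act h M) = \<mu> ^ (2 * d) * f M"
proof -
  obtain p where p: "f = poly_fun p" "homogeneous d p" "SL_invariant (poly_fun p)"
    using f by (auto simp: hom_invariants_def)
  obtain h' where h': "h' \<in> SL6" "congr_act h M = const (\<mu>\<^sup>2) \<cdot>\<^sub>m congr_act h' M"
    using congr_act_SL[OF h mu] M by metis
  have "h' \<in> carrier_mat 6 6" using h'(1) by (simp add: SL6_def)
  then have "f (congr_act h M) = (\<mu>\<^sup>2) ^ d * f (congr_act h' M)"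
    unfolding p(1) h'(2) by (simp add: poly_fun_smult_hom[OF p(2) congr_act_skew_lin[OF _ M]])
  also have "f (congr_act h' M) = f M" using p(3) h'(1) M unfolding p(1) SL_invariant_def by blast
  finally show ?thesis by (simp add: power_mult)
qed

lemma power_int_prod:
  assumes "t \<noteq> (0::complex)" shows "(\<Prod>i\<in>S. t powi a i) = t powi (\<Sum>i\<in>S. a i)"
  by (induction S rule: infinite_finite_induct) (auto simp: power_int_add assms)

lemma det_scale_rows:
  fixes K :: "complex mat"
  assumes K: "K \<in> carrier_mat n n"
  shows "det (mat n n (\<lambda>(i, j). s i * K $$ (i, j))) = (\<Prod>i<n. s i) * det K"
proof -
  let ?S = "mat n n (\<lambda>(i, j). s i * K $$ (i, j))"
  have "det ?S = (\<Sum>p | p permutes {0..<n}. signof p * (\<Prod>i = 0..<n. ?S $$ (i, p i)))"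
    by (rule det_def') simp
  also have "\<dots> = (\<Sum>p | p permutes {0..<n}. (\<Prod>i<n. s i) * (signof p * (\<Prod>i = 0..<n. K $$ (i, p i))))"
  proof (intro sum.cong refl)
    fix p assume "p \<in> {p. p permutes {0..<n}}"
    then have "p i < n" if "i < n" for i using permutes_in_image[of p "{0..<n}" i] that by simp
    then have "(\<Prod>i = 0..<n. ?S $$ (i, p i)) = (\<Prod>i = 0..<n. s i * K $$ (i, p i))"
      by (intro prod.cong refl) simp
    then show "signof p * (\<Prod>i = 0..<n. ?S $$ (i, p i)) = (\<Prod>i<n. s i) * (signof p * (\<Prod>i = 0..<n. K $$ (i, p i)))"
      by (simp add: prod.distrib atLeast0LessThan)
  qed
  also have "\<dots> = (\<Prod>i<n. s i) * det K" unfolding det_def'[OF K] by (simp add: sum_distrib_left)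
  finally show ?thesis .
qed

lemma poly_const_off_0:
  assumes "\<And>t. t \<noteq> 0 \<Longrightarrow> poly Q t = (C::complex)" shows "poly Q 0 = C"
proof -
  have "UNIV - {0} \<subseteq> {t. poly (Q - [:C:]) t = 0}" using assms by auto
  moreover have "infinite (UNIV - {0::complex})" by (simp add: infinite_UNIV_char_0)
  ultimately have "Q - [:C:] = 0" using poly_roots_finite finite_subset by blast
  then show ?thesis by simp
qed

lemma mat_coords_ev:
  assumes A: "A \<in> skew_lin"
  shows "mat_coords A (i, j, l) = (if i < 6 \<and> j < 6 then ev (A $$ (i, j)) (dl (ix l)) else 0)"
  using skew_linD[OF A] by (simp add: mat_coords_def lookup_single_ev iy_ix ix_less)

lemma semistable_sst:
  assumes "semistable A" shows "sst (entries A)"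
proof (rule ccontr)
  have A: "A \<in> skew_lin" using assms by (simp add: semistable_def)
  obtain d f where d: "d > 0" and f: "f \<in> hom_invariants d" and fA: "f A \<noteq> 0"
    using assms by (auto simp: semistable_def)
  assume "\<not> sst (entries A)"
  then obtain k k' and a :: "nat \<Rightarrow> int" where k: "inverses 6 k k'" and a: "(\<Sum>i<6. a i) = 0"
    and zero: "\<And>i j x. i < 6 \<Longrightarrow> j < 6 \<Longrightarrow> a i + a j \<le> 0 \<Longrightarrow> cg k (val (entries A) x) i j = 0"
    unfolding sst_def by blast
  define K where "K = mat 6 6 (\<lambda>(i, j). k i j)"
  define g where "g = (\<lambda>t. mat 6 6 (\<lambda>(i, j). t powi a i * K $$ (i, j)))"
  have K: "K \<in> carrier_mat 6 6" and gc: "g t \<in> carrier_mat 6 6" for t by (simp_all add: K_def g_def)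
  have dK: "det K \<noteq> 0" unfolding K_def by (rule det_inverses[OF k])
  have dg: "det (g t) = det K" if "t \<noteq> 0" for t
    unfolding g_def det_scale_rows[OF K] power_int_prod[OF that] a by simp
  obtain \<mu> where mu: "\<mu> ^ 6 = det K" using complex_root6 by blast
  obtain p where p: "f = poly_fun p" "homogeneous d p" using f by (auto simp: hom_invariants_def)
  define c where "c = (\<lambda>i j l. cg k (val (entries A) (dl (ix l))) i j)"
  define q where "q = (\<lambda>(i, j, l). if i < 6 \<and> j < 6 \<and> a i + a j > 0 then monom (c i j l) (nat (a i + a j)) else 0)"
  have coords: "mat_coords (congr_act (g t) A) v = poly (q v) t" if t: "t \<noteq> 0" for t v
  proof -
    obtain i j l where v: "v = (i, j, l)" by (cases v) auto
    show ?thesis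
    proof (cases "i < 6 \<and> j < 6")
      case True
      then have ij: "i < 6" "j < 6" by auto
      have "mat_coords (congr_act (g t) A) v = cg (\<lambda>i j. g t $$ (i, j)) (val (entries A) (dl (ix l))) i j"
        unfolding v mat_coords_ev[OF congr_act_skew_lin[OF gc A]] using ij ev_congr_act[OF gc skew_linD(1)[OF A] ij] by simp
      also have "\<dots> = t powi a i * t powi a j * c i j l"
        unfolding cg_def c_def sum_distrib_left using ij
        by (intro sum.cong refl) (simp add: g_def K_def mult_ac)
      also have "\<dots> = t powi (a i + a j) * c i j l" using t by (simp add: power_int_add)
      also have "\<dots> = poly (q v) t"
      proof (cases "a i + a j > 0")
        case True
        then have "t powi (a i + a j) = t ^ nat (a i + a j)" by (simp add: power_int_def)
        then show ?thesis using True ij by (simp add: q_def v poly_monom)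
      next
        case False
        then show ?thesis using zero[OF ij] by (simp add: q_def v c_def)
      qed
      finally show ?thesis .
    next
      case False
      then show ?thesis unfolding v mat_coords_ev[OF congr_act_skew_lin[OF gc A]] by (auto simp: q_def)
    qed
  qed
  obtain Q where Q: "\<And>t. eval p (\<lambda>v. poly (q v) t) = poly Q t"
    using eval_poly[of "\<lambda>t v. poly (q v) t" p] by blast
  have "poly Q t = \<mu> ^ (2 * d) * f A" if t: "t \<noteq> 0" for t
  proof -
    have "f (congr_act (g t) A) = \<mu> ^ (2 * d) * f A"
      by (rule hom_invariant_congr[OF f gc _ _ A]) (use dg[OF t] mu dK in auto)
    moreover have "f (congr_act (g t) A) = eval p (mat_coords (congr_act (g t) A))"
      unfolding p(1) poly_fun_def using congr_act_skew_lin[OF gc A] by simp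
    moreover have "mat_coords (congr_act (g t) A) = (\<lambda>v. poly (q v) t)" using coords[OF t] by (rule ext)
    ultimately show ?thesis using Q by simp
  qed
  then have "poly Q 0 = \<mu> ^ (2 * d) * f A" by (rule poly_const_off_0)
  moreover have "poly Q 0 = 0"
  proof -
    have "poly (q v) 0 = 0 * (0::complex)" for v by (cases v) (auto simp: q_def poly_monom power_0_left)
    then have "poly Q 0 = eval p (\<lambda>v. 0 * 0)" unfolding Q[symmetric] by simp
    also have "\<dots> = 0 ^ d * eval p (\<lambda>_. 0)" by (rule eval_homogeneous_scale[OF p(2)])
    finally show ?thesis using d by simp
  qed
  moreover have "\<mu> \<noteq> 0" using mu dK by auto
  ultimately show False using fA by simp
qed

lemma semistable_nonzero: assumes "semistable A" shows "A \<in> skew_lin - {0\<^sub>m 6 6}"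
proof -
  have "\<not> sst (entries (0\<^sub>m 6 6))"
  proof
    assume "sst (entries (0\<^sub>m 6 6))"
    then show False by (rule sst_no_isotropic4) (simp add: ev_0)
  qed
  then show ?thesis using semistable_sst[OF assms] assms by (auto simp: semistable_def)
qed

lemma eval_bihomogeneous:
  assumes "bihomogeneous d e p"
  shows "eval p (case_sum (\<lambda>i. c * a i) (\<lambda>j. c' * b j)) = c ^ d * c' ^ e * eval p (case_sum a b)"
proof -
  have "mon_eval m (case_sum (\<lambda>i. c * a i) (\<lambda>j. c' * b j)) = c ^ d * c' ^ e * mon_eval m (case_sum a b)"
    if "m \<in> Poly_Mapping.keys p" for m
  proof -
    let ?L = "Poly_Mapping.keys m \<inter> range Inl" and ?R = "Poly_Mapping.keys m \<inter> range Inr" and ?l = "Poly_Mapping.lookup m"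
    have k: "Poly_Mapping.keys m = ?L \<union> ?R" by (auto) (metis sum.exhaust rangeI)
    have split: "(\<Prod>v\<in>Poly_Mapping.keys m. g v) = (\<Prod>v\<in>?L. g v) * (\<Prod>v\<in>?R. g v)" for g :: "_ \<Rightarrow> complex"
      by (subst k, rule prod.union_disjoint) auto
    have de: "(\<Sum>v\<in>?L. ?l v) = d" "(\<Sum>v\<in>?R. ?l v) = e" using assms that unfolding bihomogeneous_def by auto
    have "(\<Prod>v\<in>?L. case_sum (\<lambda>i. c * a i) (\<lambda>j. c' * b j) v ^ ?l v) = (\<Prod>v\<in>?L. c ^ ?l v * case_sum a b v ^ ?l v)"
      by (intro prod.cong refl) (auto simp: power_mult_distrib)
    moreover have "(\<Prod>v\<in>?R. case_sum (\<lambda>i. c * a i) (\<lambda>j. c' * b j) v ^ ?l v) = (\<Prod>v\<in>?R. c' ^ ?l v * case_sum a b v ^ ?l v)"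
      by (intro prod.cong refl) (auto simp: power_mult_distrib)
    ultimately show ?thesis unfolding mon_eval_def split
      by (simp add: prod.distrib power_sum[symmetric] de)
  qed
  then show ?thesis by (simp add: eval_alt sum_distrib_left mult_ac)
qed

lemma zariski_curve:
  assumes c: "\<And>v. \<exists>q. \<forall>t. mat_coords (A t) v = poly q t" "\<And>m. \<exists>q. \<forall>t. Poly_Mapping.lookup (F t) m = poly q t"
    and A: "\<And>t. A t \<in> skew_lin" "\<And>t. F t \<in> cubics" and E: "finite E" "\<And>t. t \<notin> E \<Longrightarrow> A t \<noteq> 0\<^sub>m 6 6 \<and> F t \<noteq> 0"
    and V: "openin zariski V" "(mat_class (A 0), form_class (F 0)) \<in> V"
  shows "finite {t. (mat_class (A t), form_class (F t)) \<notin> V}"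
proof -
  have "generate_topology_on {nonvanishing p | p d e. bihomogeneous d e p} V"
    using V(1) unfolding zariski_def openin_topology_generated_by_iff .
  then show ?thesis using V(2)
  proof (induction rule: generate_topology_on.induct)
    case (Int a b)
    have "{t. (mat_class (A t), form_class (F t)) \<notin> a \<inter> b} =
        {t. (mat_class (A t), form_class (F t)) \<notin> a} \<union> {t. (mat_class (A t), form_class (F t)) \<notin> b}" by blast
    then show ?case using Int by simp
  next
    case (UN K)
    then obtain k where "k \<in> K" "(mat_class (A 0), form_class (F 0)) \<in> k" by blast
    then have "finite {t. (mat_class (A t), form_class (F t)) \<notin> k}" using UN.IH by blast
    then show ?case by (rule rev_finite_subset) (use \<open>k \<in> K\<close> in blast)
  next
    case (Basis s)
    then obtain p d e where s: "s = nonvanishing p" and p: "bihomogeneous d e p" by blast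
    obtain M G where M: "mat_class (A 0) = mat_class M" "form_class (F 0) = form_class G"
      and nz: "eval p (case_sum (mat_coords M) (Poly_Mapping.lookup G)) \<noteq> 0"
      using Basis.prems unfolding s nonvanishing_def by auto
    have "M \<in> mat_class (A 0)" unfolding M(1) by (rule mat_class_self)
    then obtain c where c: "M = const c \<cdot>\<^sub>m A 0" by (auto simp: mat_class_def)
    have "G \<in> form_class (F 0)" unfolding M(2) by (rule form_class_self)
    then obtain c' where c': "G = const c' * F 0" by (auto simp: form_class_def)
    have "Poly_Mapping.lookup G = (\<lambda>m. c' * Poly_Mapping.lookup (F 0) m)"
      by (rule ext) (simp add: c' lookup_const_mult)
    then have nz0: "eval p (case_sum (mat_coords (A 0)) (Poly_Mapping.lookup (F 0))) \<noteq> 0"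
      using nz unfolding c mat_coords_smult by (auto simp: eval_bihomogeneous[OF p])
    have "\<exists>Q. \<forall>t. eval p (case_sum (mat_coords (A t)) (Poly_Mapping.lookup (F t))) = poly Q t"
    proof (rule eval_poly)
      fix v show "\<exists>q. \<forall>t. case_sum (mat_coords (A t)) (Poly_Mapping.lookup (F t)) v = poly q t"
        using assms(1,2) by (cases v) auto
    qed
    then obtain Q where Q: "\<And>t. eval p (case_sum (mat_coords (A t)) (Poly_Mapping.lookup (F t))) = poly Q t" by blast
    have "Q \<noteq> 0" using nz0 Q[of 0] by auto
    then have fin: "finite ({t. poly Q t = 0} \<union> E)" using E(1) poly_roots_finite by blast
    show ?case
    proof (rule finite_subset[OF _ fin], rule subsetI)
      fix t assume t: "t \<in> {t. (mat_class (A t), form_class (F t)) \<notin> s}"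
      show "t \<in> {t. poly Q t = 0} \<union> E"
      proof (rule ccontr)
        assume "t \<notin> {t. poly Q t = 0} \<union> E"
        then have "A t \<in> skew_lin - {0\<^sub>m 6 6} \<and> F t \<in> cubics - {0} \<and>
            eval p (case_sum (mat_coords (A t)) (Poly_Mapping.lookup (F t))) \<noteq> 0"
          using A[of t] E(2)[of t] Q[of t] by simp
        then have "(mat_class (A t), form_class (F t)) \<in> s" unfolding s nonvanishing_def by blast
        then show False using t by simp
      qed
    qed
  qed simp
qed

lemma semistable_curve:
  assumes c: "\<And>v. \<exists>q. \<forall>t. mat_coords (A t) v = poly q t" and A: "\<And>t. A t \<in> skew_lin" and st: "semistable (A 0)"
  shows "finite {t. \<not> semistable (A t)}"
proof -
  obtain d p where d: "d > 0" "poly_fun p \<in> hom_invariants d" "poly_fun p (A 0) \<noteq> 0"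
    using st by (auto simp: semistable_def hom_invariants_def)
  obtain Q where Q: "\<And>t. eval p (mat_coords (A t)) = poly Q t"
    using eval_poly[of "\<lambda>t. mat_coords (A t)" p] c by blast
  have v: "poly_fun p (A t) = poly Q t" for t using A by (simp add: poly_fun_def Q)
  have "Q \<noteq> 0" using d(3) v[of 0] by auto
  then have "finite {t. poly Q t = 0}" by (rule poly_roots_finite)
  moreover have "semistable (A t)" if "poly Q t \<noteq> 0" for t
    unfolding semistable_def using A d that v by (metis)
  then have "{t. \<not> semistable (A t)} \<subseteq> {t. poly Q t = 0}" by blast
  ultimately show ?thesis by (rule rev_finite_subset)
qed

lemma semistable_S_ss: "semistable A \<Longrightarrow> mat_class A \<in> S_ss"
  unfolding S_ss_def using semistable_nonzero by blast

lemma T_nonzero_in_closure: "a \<in> T_nonzero \<Longrightarrow> a \<in> S_tilde_ss"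
proof -
  assume a: "a \<in> T_nonzero"
  have "T_space \<subseteq> S_space \<times> C_space"
    by (auto simp: T_space_def S_ss_def S_space_def C_space_def)
  moreover have "T_nonzero \<subseteq> T_space" by (auto simp: T_nonzero_def)
  ultimately have "T_nonzero \<subseteq> topspace (subtopology zariski T_space)" by (auto simp: topspace_zariski)
  then show ?thesis unfolding S_tilde_ss_def using closure_of_subset a by blast
qed

lemma reach_closure:
  assumes "reach M F" and "semistable A" "\<And>i j. i < 6 \<Longrightarrow> j < 6 \<Longrightarrow> ev (A $$ (i, j)) = M i j"
    and "F' \<in> cubics - {0}" "ev F' = F"
  shows "(mat_class A, form_class F') \<in> S_tilde_ss"
  using assms
proof (induction arbitrary: A F' rule: reach.induct)
  case (pfaffian M F c x0)
  have A: "A \<in> skew_lin" using pfaffian.prems(1) by (simp add: semistable_def)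
  have "pfaffian A = const c * F'"
  proof (rule ev_inject, rule ext)
    fix x
    have "pf6 (val (entries A) x) = pf6 (val M x)" using pfaffian.prems(2) by (simp add: pf6_def)
    then show "ev (pfaffian A) x = ev (const c * F') x"
      using pfaffian.hyps(4) pfaffian.prems(4) by (simp add: ev_pfaffian[OF skew_linD(1)[OF A]] ev_mult ev_const)
  qed
  moreover have "const c \<noteq> (0 :: form)"
  proof
    assume "const c = (0 :: form)"
    then have "Poly_Mapping.lookup (const c :: form) 0 = Poly_Mapping.lookup 0 0" by simp
    then show False using pfaffian.hyps(3) by simp
  qed
  ultimately have d: "F' dvd pfaffian A" and nz: "pfaffian A \<noteq> 0"
    using pfaffian.prems(3) by simp_all
  have "pfaffian B \<noteq> 0" if B: "B \<in> mat_class A" for B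
  proof
    assume 0: "pfaffian B = 0"
    obtain s where s: "s \<noteq> 0" "B = const s \<cdot>\<^sub>m A" using B by (auto simp: mat_class_def)
    have "ev (pfaffian B) x = s ^ 3 * ev (pfaffian A) x" for x
      using skew_linD(1)[OF A] unfolding s(2)
      by (simp add: ev_pfaffian pf6_def ev_mult ev_const algebra_simps power3_eq_cube)
    then have "ev (pfaffian A) x = 0" for x using 0 s(1) by (simp add: ev_0)
    then show False using nz ev_eq_0 by blast
  qed
  then have "(mat_class A, form_class F') \<in> T_nonzero"
    unfolding T_nonzero_def T_space_def using semistable_S_ss[OF pfaffian.prems(1)] A pfaffian.prems(3) d by blast
  then show ?case by (rule T_nonzero_in_closure)
next
  case (same M F M')
  then show ?case by simp
next
  case (limit n N G T)
  have A: "A \<in> skew_lin" using limit.prems(1) by (simp add: semistable_def)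
  have "\<forall>m. \<exists>B. m \<le> n \<longrightarrow> B \<in> skew_lin \<and> (\<forall>i<6. \<forall>j<6. ev (B $$ (i, j)) = N m i j)"
    using form_of_skewl[OF limit.hyps(1)] by metis
  then obtain B where B: "\<And>m. m \<le> n \<Longrightarrow> B m \<in> skew_lin" "\<And>m i j. m \<le> n \<Longrightarrow> i < 6 \<Longrightarrow> j < 6 \<Longrightarrow> ev (B m $$ (i, j)) = N m i j"
    by metis
  have "\<forall>m. \<exists>p. m \<le> n \<longrightarrow> homogeneous 3 p \<and> ev p = G m"
    using form_of_cub[OF limit.hyps(2)] by metis
  then obtain H where H: "\<And>m. m \<le> n \<Longrightarrow> homogeneous 3 (H m)" "\<And>m. m \<le> n \<Longrightarrow> ev (H m) = G m" by metis
  define At where "At = (\<lambda>t. mat 6 6 (\<lambda>(i, j). \<Sum>m\<le>n. const (t ^ m) * B m $$ (i, j)))"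
  define Ft where "Ft = (\<lambda>t. \<Sum>m\<le>n. const (t ^ m) * H m)"
  have sk: "B m $$ (j, i) = - B m $$ (i, j)" if "m \<le> n" "i < 6" "j < 6" for m i j
    by (rule skew_entry[OF skew_linD(1,2)[OF B(1)[OF that(1)]] that(2,3)])
  have Atl: "At t \<in> skew_lin" for t
  proof -
    have "skew (At t)" unfolding skew_def
    proof (rule eq_matI)
      fix i j assume "i < dim_row (- At t)" "j < dim_col (- At t)"
      then have ij: "i < 6" "j < 6" by (simp_all add: At_def)
      have "(\<Sum>m\<le>n. const (t ^ m) * B m $$ (j, i)) = (\<Sum>m\<le>n. - (const (t ^ m) * B m $$ (i, j)))"
      proof (intro sum.cong refl)
        fix m assume "m \<in> {..n}"
        then have m: "m \<le> n" by simp
        show "const (t ^ m) * B m $$ (j, i) = - (const (t ^ m) * B m $$ (i, j))"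
          unfolding sk[OF m ij] by simp
      qed
      then show "transpose_mat (At t) $$ (i, j) = (- At t) $$ (i, j)" using ij by (simp add: At_def sum_negf)
    qed (simp_all add: At_def)
    moreover have "homogeneous (Suc 0) (\<Sum>m\<le>n. const (t ^ m) * B m $$ (i, j))" if "i < 6" "j < 6" for i j
      using skew_linD(3)[OF B(1) that] by (intro homogeneous_sum homogeneous_const_mult) auto
    ultimately show ?thesis by (auto simp: skew_lin_def form_mats_def At_def)
  qed
  have Ftc: "Ft t \<in> cubics" for t
    unfolding Ft_def cubics_def using H(1) by (auto intro!: homogeneous_sum homogeneous_const_mult)
  have evA: "ev (At t $$ (i, j)) = (\<lambda>x. \<Sum>m\<le>n. t ^ m * N m i j x)" if "i < 6" "j < 6" for t i j
    by (rule ext) (use that B(2) in \<open>simp add: At_def ev_sum ev_mult ev_const\<close>)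
  have evF: "ev (Ft t) = (\<lambda>x. \<Sum>m\<le>n. t ^ m * G m x)" for t
    by (rule ext) (use H(2) in \<open>simp add: Ft_def ev_sum ev_mult ev_const\<close>)
  have z: "(\<Sum>m\<le>n. 0 ^ m * f m) = (f 0 :: complex)" for f
  proof -
    have "(\<Sum>m\<le>n. 0 ^ m * f m) = (\<Sum>m\<le>n. if m = 0 then f m else 0)" by (intro sum.cong refl) (simp add: power_0_left)
    then show ?thesis by simp
  qed
  have A0: "At 0 = A"
  proof (rule eq_matI)
    fix i j assume "i < dim_row A" "j < dim_col A"
    then have ij: "i < 6" "j < 6" using skew_linD(1)[OF A] by auto
    show "At 0 $$ (i, j) = A $$ (i, j)"
      by (rule ev_inject) (simp only: evA[OF ij] z limit.prems(2)[OF ij])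
  qed (use skew_linD(1)[OF A] in \<open>auto simp: At_def\<close>)
  have F0: "Ft 0 = F'" by (rule ev_inject) (simp only: evF z limit.prems(4))
  have cA: "\<exists>q. \<forall>t. mat_coords (At t) v = poly q t" for v
  proof -
    obtain i j l where v: "v = (i, j, l)" by (cases v) auto
    let ?q = "if i < 6 \<and> j < 6 then \<Sum>m\<le>n. monom (N m i j (dl (ix l))) m else 0"
    have "mat_coords (At t) v = poly ?q t" for t
      unfolding v mat_coords_ev[OF Atl] by (simp add: evA poly_sum poly_monom mult.commute)
    then show ?thesis by blast
  qed
  have cF: "\<exists>q. \<forall>t. Poly_Mapping.lookup (Ft t) m = poly q t" for m
  proof -
    have "Poly_Mapping.lookup (Ft t) m = poly (\<Sum>k\<le>n. monom (Poly_Mapping.lookup (H k) m) k) t" for t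
      by (simp add: Ft_def lookup_sum lookup_const_mult poly_sum poly_monom) (simp add: mult.commute)
    then show ?thesis by blast
  qed
  have fss: "finite {t. \<not> semistable (At t)}"
    by (rule semistable_curve[OF cA Atl]) (simp add: A0 limit.prems(1))
  have fF: "finite {t. Ft t = 0}"
  proof -
    obtain m where m: "Poly_Mapping.lookup F' m \<noteq> 0" using limit.prems(3) by (metis Diff_iff insertI1 lookup_zero poly_mapping_eqI)
    obtain q where q: "\<And>t. Poly_Mapping.lookup (Ft t) m = poly q t" using cF by blast
    have "q \<noteq> 0" using m q[of 0] by (auto simp: F0)
    then have "finite {t. poly q t = 0}" by (rule poly_roots_finite)
    then show ?thesis by (rule rev_finite_subset) (use q in \<open>auto simp: q[symmetric]\<close>)
  qed
  let ?E = "{t. \<not> semistable (At t)} \<union> {t. Ft t = 0}"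
  have E: "finite ?E" using fss fF by simp
  have En: "At t \<noteq> 0\<^sub>m 6 6 \<and> Ft t \<noteq> 0" if "t \<notin> ?E" for t using that semistable_nonzero[of "At t"] by auto
  have inT: "(mat_class A, form_class F') \<in> T_space"
  proof -
    have "pfaffian A = 0"
    proof (rule ev_eq_0)
      fix x
      have "pf6 (val (entries A) x) = pf6 (val (N 0) x)" using limit.prems(2) by (simp add: pf6_def)
      then show "ev (pfaffian A) x = 0" using limit.hyps(5) by (simp add: ev_pfaffian[OF skew_linD(1)[OF A]])
    qed
    then have "F' dvd pfaffian A" by simp
    then show ?thesis unfolding T_space_def using semistable_S_ss[OF limit.prems(1)] A limit.prems(3) by blast
  qed
  show ?case
    unfolding S_tilde_ss_def in_closure_of
  proof (intro conjI allI impI)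
    show "(mat_class A, form_class F') \<in> topspace (subtopology zariski T_space)"
      using inT semistable_nonzero[OF limit.prems(1)] limit.prems(3)
      by (auto simp: topspace_zariski S_space_def C_space_def)
    fix U assume "(mat_class A, form_class F') \<in> U \<and> openin (subtopology zariski T_space) U"
    then obtain V where V: "openin zariski V" "U = V \<inter> T_space" "(mat_class A, form_class F') \<in> V"
      unfolding openin_subtopology by blast
    have "finite {t. (mat_class (At t), form_class (Ft t)) \<notin> V}"
      by (rule zariski_curve[OF cA cF Atl Ftc E En V(1)]) (simp_all add: A0 F0 V(3))
    then have fin: "finite (?E \<union> T \<union> {t. (mat_class (At t), form_class (Ft t)) \<notin> V})" using E limit.hyps(3) by simp
    obtain t where t: "t \<notin> ?E \<union> T \<union> {t. (mat_class (At t), form_class (Ft t)) \<notin> V}"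
      using ex_new_if_finite[OF infinite_UNIV_char_0 fin] by (elim exE) (rule that)
    have "(mat_class (At t), form_class (Ft t)) \<in> S_tilde_ss"
      by (rule limit.IH[of t]) (use t evA evF Ftc in auto)
    then have cl: "(mat_class (At t), form_class (Ft t)) \<in> topspace (subtopology zariski T_space)"
      "\<And>W. (mat_class (At t), form_class (Ft t)) \<in> W \<Longrightarrow> openin (subtopology zariski T_space) W \<Longrightarrow> \<exists>y. y \<in> T_nonzero \<and> y \<in> W"
      unfolding S_tilde_ss_def in_closure_of by blast+
    have "openin (subtopology zariski T_space) U" unfolding openin_subtopology using V by blast
    moreover have "(mat_class (At t), form_class (Ft t)) \<in> U" using cl(1) t V(2) by auto
    ultimately show "\<exists>y. y \<in> T_nonzero \<and> y \<in> U" using cl(2) by blast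
  qed
qed

lemma less8: "(\<Sum>k<8. f k) = f 0 + f 1 + (\<Sum>j<6. f (j + 2))" for f :: "nat \<Rightarrow> 'a::comm_monoid_add"
proof -
  have "(\<Sum>k<8. f k) = (\<Sum>k<Suc (Suc 6). f k)" by simp
  then show ?thesis unfolding sum.lessThan_Suc_shift by (simp add: add.assoc)
qed

lemma skew_matI:
  assumes A: "A \<in> carrier_mat n n" and e: "\<And>i j. i < n \<Longrightarrow> j < n \<Longrightarrow> A $$ (j, i) = - A $$ (i, j)"
  shows "skew A"
  unfolding skew_def
proof (rule eq_matI)
  fix i j assume "i < dim_row (- A)" "j < dim_col (- A)"
  then have ij: "i < n" "j < n" using A by auto
  show "transpose_mat A $$ (i, j) = (- A) $$ (i, j)" using ij A e[OF ij] by simp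
qed (use A in auto)

definition wt :: "nat \<Rightarrow> nat" where "wt i = (if i < 2 then 1 else 0)"

lemma A_space_iff:
  "A \<in> A_space \<longleftrightarrow> A \<in> carrier_mat 8 8 \<and> skew A \<and> (\<forall>i<8. \<forall>j<8. homogeneous (wt i + wt j + 1) (A $$ (i, j)))"
proof
  assume "A \<in> A_space"
  then obtain A3 A2 A1 where A: "A = four_block_mat A3 A2 (- transpose_mat A2) A1"
    and 3: "A3 \<in> form_mats 3 2 2" "skew A3" and 2: "A2 \<in> form_mats 2 2 6" and 1: "A1 \<in> form_mats 1 6 6" "skew A1"
    unfolding A_space_def by blast
  have d: "A3 \<in> carrier_mat 2 2" "A2 \<in> carrier_mat 2 6" "A1 \<in> carrier_mat 6 6" using 1 2 3 by (auto simp: form_mats_def)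
  have c: "A \<in> carrier_mat 8 8" unfolding A using four_block_carrier_mat[OF d(1,3)] by simp
  have s3: "A3 $$ (j, i) = - A3 $$ (i, j)" if "i < 2" "j < 2" for i j by (rule skew_entry[OF d(1) 3(2) that])
  have s1: "A1 $$ (j, i) = - A1 $$ (i, j)" if "i < 6" "j < 6" for i j by (rule skew_entry[OF d(3) 1(2) that])
  have "A $$ (j, i) = - A $$ (i, j)" if ij: "i < 8" "j < 8" for i j
  proof (cases "i < 2")
    case i: True
    show ?thesis
    proof (cases "j < 2")
      case True then show ?thesis unfolding A using i d s3[OF i True] by simp
    next
      case False then show ?thesis unfolding A using i ij d by simp
    qed
  next
    case i: False
    show ?thesis
    proof (cases "j < 2")
      case True then show ?thesis unfolding A using i ij d by simp
    next
      case False then show ?thesis unfolding A using i ij d s1[of "i - 2" "j - 2"] by simp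
    qed
  qed
  then have "skew A" by (rule skew_matI[OF c])
  moreover have "homogeneous (wt i + wt j + 1) (A $$ (i, j))" if ij: "i < 8" "j < 8" for i j
  proof -
    have m: "homogeneous e (- p)" if "homogeneous e p" for e and p :: form
      using homogeneous_const_mult[OF that, of "- 1"] by (simp add: single_uminus single_one)
    have e: "homogeneous 3 (A3 $$ (i, j))" if "i < 2" "j < 2" for i j using that 3 by (simp add: form_mats_def)
    have f: "homogeneous 2 (A2 $$ (i, j))" if "i < 2" "j < 6" for i j using that 2 by (simp add: form_mats_def)
    have g: "homogeneous (Suc 0) (A1 $$ (i, j))" if "i < 6" "j < 6" for i j using that 1 by (simp add: form_mats_def)
    show ?thesis unfolding A using ij d e[of i j] f[of i "j - 2"] m[OF f[of j "i - 2"]] g[of "i - 2" "j - 2"]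
      by (cases "i < 2"; cases "j < 2") (simp_all add: wt_def numeral_2_eq_2 numeral_3_eq_3)
  qed
  ultimately show "A \<in> carrier_mat 8 8 \<and> skew A \<and> (\<forall>i<8. \<forall>j<8. homogeneous (wt i + wt j + 1) (A $$ (i, j)))"
    using c by blast
next
  assume r: "A \<in> carrier_mat 8 8 \<and> skew A \<and> (\<forall>i<8. \<forall>j<8. homogeneous (wt i + wt j + 1) (A $$ (i, j)))"
  then have c: "A \<in> carrier_mat 8 8" and s: "skew A" and h: "\<And>i j. i < 8 \<Longrightarrow> j < 8 \<Longrightarrow> homogeneous (wt i + wt j + 1) (A $$ (i, j))"
    by auto
  have sk: "A $$ (j, i) = - A $$ (i, j)" if "i < 8" "j < 8" for i j by (rule skew_entry[OF c s that])
  let ?A3 = "mat 2 2 (\<lambda>(i, j). A $$ (i, j))" and ?A2 = "mat 2 6 (\<lambda>(i, j). A $$ (i, j + 2))" and ?A1 = "mat 6 6 (\<lambda>(i, j). A $$ (i + 2, j + 2))"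
  have "A = four_block_mat ?A3 ?A2 (- transpose_mat ?A2) ?A1"
  proof (rule eq_matI)
    fix i j assume "i < dim_row (four_block_mat ?A3 ?A2 (- transpose_mat ?A2) ?A1)" "j < dim_col (four_block_mat ?A3 ?A2 (- transpose_mat ?A2) ?A1)"
    then have ij: "i < 8" "j < 8" by simp_all
    have r: "\<not> j < 2 \<Longrightarrow> Suc (Suc (j - 2)) = j" "\<not> i < 2 \<Longrightarrow> Suc (Suc (i - 2)) = i" by auto
    show "A $$ (i, j) = four_block_mat ?A3 ?A2 (- transpose_mat ?A2) ?A1 $$ (i, j)"
      using ij sk[OF ij(2,1)] by (cases "i < 2"; cases "j < 2") (simp_all add: r)
  qed (use c in auto)
  moreover have "skew ?A3"
  proof (rule skew_matI)
    show "?A3 $$ (j, i) = - ?A3 $$ (i, j)" if "i < 2" "j < 2" for i j using that sk[of i j] by simp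
  qed simp
  moreover have "skew ?A1"
  proof (rule skew_matI)
    show "?A1 $$ (j, i) = - ?A1 $$ (i, j)" if "i < 6" "j < 6" for i j using that sk[of "i + 2" "j + 2"] by simp
  qed simp
  moreover have "?A3 \<in> form_mats 3 2 2"
  proof -
    have "homogeneous 3 (A $$ (i, j))" if "i < 2" "j < 2" for i j
      using h[of i j] that by (simp add: wt_def numeral_2_eq_2 numeral_3_eq_3)
    then show ?thesis by (simp add: form_mats_def)
  qed
  moreover have "?A2 \<in> form_mats 2 2 6"
  proof -
    have "homogeneous 2 (A $$ (i, j + 2))" if "i < 2" "j < 6" for i j
      using h[of i "j + 2"] that by (simp add: wt_def numeral_2_eq_2)
    then show ?thesis by (simp add: form_mats_def)
  qed
  moreover have "?A1 \<in> form_mats 1 6 6"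
  proof -
    have "homogeneous 1 (A $$ (i + 2, j + 2))" if "i < 6" "j < 6" for i j
      using h[of "i + 2" "j + 2"] that by (simp add: wt_def)
    then show ?thesis by (simp add: form_mats_def)
  qed
  ultimately show "A \<in> A_space" unfolding A_space_def by blast
qed

lemma B_space_iff:
  "B \<in> B_space \<longleftrightarrow> B \<in> carrier_mat 8 8 \<and> skew B \<and> (\<forall>i<8. \<forall>j<8. homogeneous ((1 - wt i) + (1 - wt j)) (B $$ (i, j)))"
proof
  assume "B \<in> B_space"
  then obtain B0 B1 B2 where B: "B = four_block_mat B0 (transpose_mat B1) (- B1) B2"
    and 0: "B0 \<in> form_mats 0 2 2" "skew B0" and 1: "B1 \<in> form_mats 1 6 2" and 2: "B2 \<in> form_mats 2 6 6" "skew B2"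
    unfolding B_space_def by blast
  have d: "B0 \<in> carrier_mat 2 2" "B1 \<in> carrier_mat 6 2" "B2 \<in> carrier_mat 6 6" using 0 1 2 by (auto simp: form_mats_def)
  have c: "B \<in> carrier_mat 8 8" unfolding B using four_block_carrier_mat[OF d(1,3)] by simp
  have s0: "B0 $$ (j, i) = - B0 $$ (i, j)" if "i < 2" "j < 2" for i j by (rule skew_entry[OF d(1) 0(2) that])
  have s2: "B2 $$ (j, i) = - B2 $$ (i, j)" if "i < 6" "j < 6" for i j by (rule skew_entry[OF d(3) 2(2) that])
  have "B $$ (j, i) = - B $$ (i, j)" if ij: "i < 8" "j < 8" for i j
  proof (cases "i < 2")
    case i: True
    show ?thesis
    proof (cases "j < 2")
      case True then show ?thesis unfolding B using i d s0[OF i True] by simp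
    next
      case False then show ?thesis unfolding B using i ij d by simp
    qed
  next
    case i: False
    show ?thesis
    proof (cases "j < 2")
      case True then show ?thesis unfolding B using i ij d by simp
    next
      case False then show ?thesis unfolding B using i ij d s2[of "i - 2" "j - 2"] by simp
    qed
  qed
  then have "skew B" by (rule skew_matI[OF c])
  moreover have "homogeneous ((1 - wt i) + (1 - wt j)) (B $$ (i, j))" if ij: "i < 8" "j < 8" for i j
  proof -
    have m: "homogeneous e (- p)" if "homogeneous e p" for e and p :: form
      using homogeneous_const_mult[OF that, of "- 1"] by (simp add: single_uminus single_one)
    have e: "homogeneous 0 (B0 $$ (i, j))" if "i < 2" "j < 2" for i j using that 0 by (simp add: form_mats_def)
    have f: "homogeneous (Suc 0) (B1 $$ (i, j))" if "i < 6" "j < 2" for i j using that 1 by (simp add: form_mats_def)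
    have g: "homogeneous 2 (B2 $$ (i, j))" if "i < 6" "j < 6" for i j using that 2 by (simp add: form_mats_def)
    show ?thesis unfolding B using ij d e[of i j] f[of "j - 2" i] m[OF f[of "i - 2" j]] g[of "i - 2" "j - 2"]
      by (cases "i < 2"; cases "j < 2") (simp_all add: wt_def numeral_2_eq_2)
  qed
  ultimately show "B \<in> carrier_mat 8 8 \<and> skew B \<and> (\<forall>i<8. \<forall>j<8. homogeneous ((1 - wt i) + (1 - wt j)) (B $$ (i, j)))"
    using c by blast
next
  assume r: "B \<in> carrier_mat 8 8 \<and> skew B \<and> (\<forall>i<8. \<forall>j<8. homogeneous ((1 - wt i) + (1 - wt j)) (B $$ (i, j)))"
  then have c: "B \<in> carrier_mat 8 8" and s: "skew B" and h: "\<And>i j. i < 8 \<Longrightarrow> j < 8 \<Longrightarrow> homogeneous ((1 - wt i) + (1 - wt j)) (B $$ (i, j))"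
    by auto
  have sk: "B $$ (j, i) = - B $$ (i, j)" if "i < 8" "j < 8" for i j by (rule skew_entry[OF c s that])
  let ?B0 = "mat 2 2 (\<lambda>(i, j). B $$ (i, j))" and ?B1 = "mat 6 2 (\<lambda>(i, j). B $$ (j, i + 2))" and ?B2 = "mat 6 6 (\<lambda>(i, j). B $$ (i + 2, j + 2))"
  have "B = four_block_mat ?B0 (transpose_mat ?B1) (- ?B1) ?B2"
  proof (rule eq_matI)
    fix i j assume "i < dim_row (four_block_mat ?B0 (transpose_mat ?B1) (- ?B1) ?B2)" "j < dim_col (four_block_mat ?B0 (transpose_mat ?B1) (- ?B1) ?B2)"
    then have ij: "i < 8" "j < 8" by simp_all
    have r: "\<not> j < 2 \<Longrightarrow> Suc (Suc (j - 2)) = j" "\<not> i < 2 \<Longrightarrow> Suc (Suc (i - 2)) = i" by auto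
    show "B $$ (i, j) = four_block_mat ?B0 (transpose_mat ?B1) (- ?B1) ?B2 $$ (i, j)"
      using ij sk[OF ij(2,1)] by (cases "i < 2"; cases "j < 2") (simp_all add: r)
  qed (use c in auto)
  moreover have "skew ?B0"
  proof (rule skew_matI)
    show "?B0 $$ (j, i) = - ?B0 $$ (i, j)" if "i < 2" "j < 2" for i j using that sk[of i j] by simp
  qed simp
  moreover have "skew ?B2"
  proof (rule skew_matI)
    show "?B2 $$ (j, i) = - ?B2 $$ (i, j)" if "i < 6" "j < 6" for i j using that sk[of "i + 2" "j + 2"] by simp
  qed simp
  moreover have "?B0 \<in> form_mats 0 2 2"
  proof -
    have "homogeneous 0 (B $$ (i, j))" if "i < 2" "j < 2" for i j using h[of i j] that by (simp add: wt_def)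
    then show ?thesis by (simp add: form_mats_def)
  qed
  moreover have "?B1 \<in> form_mats 1 6 2"
  proof -
    have "homogeneous 1 (B $$ (j, i + 2))" if "i < 6" "j < 2" for i j using h[of j "i + 2"] that by (simp add: wt_def)
    then show ?thesis by (simp add: form_mats_def)
  qed
  moreover have "?B2 \<in> form_mats 2 6 6"
  proof -
    have "homogeneous 2 (B $$ (i + 2, j + 2))" if "i < 6" "j < 6" for i j
      using h[of "i + 2" "j + 2"] that by (simp add: wt_def numeral_2_eq_2)
    then show ?thesis by (simp add: form_mats_def)
  qed
  ultimately show "B \<in> B_space" unfolding B_space_def by blast
qed

lemma pfs_adjugate:
  assumes m: "skew6 m" and ik: "i < 6" "k < 6"
  shows "(\<Sum>j<6. pfs m k j * m i j) = (if i = k then pf6 m else 0)"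
  using ik unfolding less6
  by (elim disjE; hypsubst; simp add: sum6 pfs_def pfa_entries pfa_entries[unfolded One_nat_def]
    skew6_entries[OF m] skew6_entries[OF m, unfolded One_nat_def] pf6_def algebra_simps)

lemma dpf6_scale: "dpf6 m (\<lambda>i j. s * n i j) = s * dpf6 m n"
  unfolding dpf6_def by (simp add: algebra_simps)

lemma block_A1_skew_lin: assumes "A \<in> A_space" shows "block_A1 A \<in> skew_lin"
proof -
  have c: "A \<in> carrier_mat 8 8" and s: "skew A" and h: "\<And>i j. i < 8 \<Longrightarrow> j < 8 \<Longrightarrow> homogeneous (wt i + wt j + 1) (A $$ (i, j))"
    using assms by (auto simp: A_space_iff)
  have "skew (block_A1 A)"
  proof (rule skew_matI)
    show "block_A1 A $$ (j, i) = - block_A1 A $$ (i, j)" if "i < 6" "j < 6" for i j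
      using skew_entry[OF c s, of "i + 2" "j + 2"] that by (simp add: block_A1_def)
  qed (simp add: block_A1_def)
  moreover have "homogeneous 1 (A $$ (i + 2, j + 2))" if "i < 6" "j < 6" for i j
    using h[of "i + 2" "j + 2"] that by (simp add: wt_def)
  ultimately show ?thesis by (simp add: skew_lin_def form_mats_def block_A1_def)
qed

lemma reach_of_MF:
  assumes A: "A \<in> A_space" and B: "B \<in> B_space" and F: "F \<in> cubics - {0}"
    and AB: "A * B = const \<kappa> \<cdot>\<^sub>m (F \<cdot>\<^sub>m 1\<^sub>m 8)" "\<kappa> \<noteq> 0" and pf: "pfaffian A = const \<kappa>' * F\<^sup>2" "\<kappa>' \<noteq> 0"
    and ss: "semistable (block_A1 A)"
  shows "reach (entries (block_A1 A)) (ev F)"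
proof -
  have Ac: "A \<in> carrier_mat 8 8" and As: "skew A" and Ah: "\<And>i j. i < 8 \<Longrightarrow> j < 8 \<Longrightarrow> homogeneous (wt i + wt j + 1) (A $$ (i, j))"
    using A by (auto simp: A_space_iff)
  have Bc: "B \<in> carrier_mat 8 8" and Bs: "skew B" and Bh: "\<And>i j. i < 8 \<Longrightarrow> j < 8 \<Longrightarrow> homogeneous ((1 - wt i) + (1 - wt j)) (B $$ (i, j))"
    using B by (auto simp: B_space_iff)
  let ?M = "entries (block_A1 A)"
  define f where "f = ev F"
  have Msl: "skewl ?M" by (rule skewl_entries[OF block_A1_skew_lin[OF A]])
  have f: "cub f" unfolding f_def using F by (intro cub_ev) (simp add: cubics_def)
  obtain y where y: "f y \<noteq> 0" using F ev_eq_0[of F] unfolding f_def by auto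
  define \<alpha> where "\<alpha> = (\<lambda>i j x. ev (A $$ (i, j)) x)"
  define \<beta> where "\<beta> = (\<lambda>i j x. ev (B $$ (i, j)) x)"
  have M: "?M i j x = \<alpha> (i + 2) (j + 2) x" if "i < 6" "j < 6" for i j x using that by (simp add: block_A1_def \<alpha>_def)
  have as: "\<alpha> j i x = - \<alpha> i j x" if "i < 8" "j < 8" for i j x
    using skew_entry[OF Ac As that] by (simp add: \<alpha>_def ev_uminus)
  have bs: "\<beta> j i x = - \<beta> i j x" if "i < 8" "j < 8" for i j x
    using skew_entry[OF Bc Bs that] by (simp add: \<beta>_def ev_uminus)
  have prod: "(\<Sum>k<8. \<alpha> i k x * \<beta> k j x) = (if i = j then \<kappa> * f x else 0)" if ij: "i < 8" "j < 8" for i j x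
  proof -
    have "(\<Sum>k<8. \<alpha> i k x * \<beta> k j x) = ev ((A * B) $$ (i, j)) x"
      using Ac Bc ij by (simp add: scalar_prod_def ev_sum ev_mult \<alpha>_def \<beta>_def atLeast0LessThan)
    also have "\<dots> = (if i = j then \<kappa> * f x else 0)"
      unfolding AB(1) using ij by (simp add: ev_mult ev_const ev_0 ev_const[of 1, unfolded single_one] f_def)
    finally show ?thesis .
  qed
  define u0 where "u0 = (\<lambda>j. \<alpha> 0 (j + 2))"
  define u1 where "u1 = (\<lambda>j. \<alpha> 1 (j + 2))"
  define z where "z = (\<lambda>j. \<beta> (j + 2) 0)"
  define w where "w = (\<lambda>j. \<beta> (j + 2) 1)"
  have "homogeneous 0 (B $$ (0, 1))" using Bh[of 0 1] by (simp add: wt_def)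
  then obtain b where b0: "B $$ (0, 1) = const b" using homogeneous_0_const by blast
  have b: "\<beta> 0 1 x = b" "\<beta> 1 0 x = - b" for x using bs[of 0 1 x] by (simp_all add: \<beta>_def b0[unfolded One_nat_def] b0 ev_const)
  have diag: "\<alpha> 0 0 x = 0" "\<alpha> 1 1 x = 0" "\<beta> 0 0 x = 0" "\<beta> 1 1 x = 0" for x
    using as[of 0 0 x] as[of 1 1 x] bs[of 0 0 x] bs[of 1 1 x] by simp_all
  have r00: "- \<alpha> 0 1 x * b + (\<Sum>j<6. u0 j x * z j x) = \<kappa> * f x"
    and r01: "(\<Sum>j<6. u0 j x * w j x) = 0" and r10: "(\<Sum>j<6. u1 j x * z j x) = 0"
    and r11: "\<alpha> 1 0 x * b + (\<Sum>j<6. u1 j x * w j x) = \<kappa> * f x" for x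
    using prod[of 0 0 x] prod[of 0 1 x] prod[of 1 0 x] prod[of 1 1 x]
    unfolding less8 diag b u0_def u1_def z_def w_def by simp_all
  have a2: "\<alpha> (i + 2) 0 x = - u0 i x" "\<alpha> (i + 2) 1 x = - u1 i x" if "i < 6" for i x
    unfolding u0_def u1_def by (rule as; use that in simp)+
  have kz: "(\<Sum>j<6. ?M i j x * z j x) = - (b * u1 i x)" if i: "i < 6" for i x
  proof -
    have "(\<Sum>j<6. ?M i j x * z j x) = (\<Sum>j<6. \<alpha> (i + 2) (j + 2) x * \<beta> (j + 2) 0 x)"
      by (intro sum.cong refl) (use i in \<open>simp add: M z_def\<close>)
    moreover have "u1 i x * b + (\<Sum>j<6. \<alpha> (i + 2) (j + 2) x * \<beta> (j + 2) 0 x) = 0"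
      using prod[of "i + 2" 0 x] i unfolding less8 diag b a2[OF i] by simp
    ultimately show ?thesis by (simp add: eq_neg_iff_add_eq_0 add.commute mult.commute)
  qed
  have kw: "(\<Sum>j<6. ?M i j x * w j x) = b * u0 i x" if i: "i < 6" for i x
  proof -
    have "(\<Sum>j<6. ?M i j x * w j x) = (\<Sum>j<6. \<alpha> (i + 2) (j + 2) x * \<beta> (j + 2) 1 x)"
      by (intro sum.cong refl) (use i in \<open>simp add: M w_def\<close>)
    moreover have "- u0 i x * b + (\<Sum>j<6. \<alpha> (i + 2) (j + 2) x * \<beta> (j + 2) 1 x) = 0"
      using prod[of "i + 2" 1 x] i unfolding less8 diag b a2[OF i] by simp
    ultimately show ?thesis by (simp add: algebra_simps)
  qed
  have pfA: "\<kappa>' * (f x)\<^sup>2 = \<alpha> 0 1 x * pf6 (val ?M x) - dpf6 (val ?M x) (\<lambda>i j. u0 i x * u1 j x - u1 i x * u0 j x)" for x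
  proof -
    have "ev (pfaffian A) x = \<kappa>' * (f x)\<^sup>2" unfolding pf by (simp add: ev_mult ev_const ev_power2 f_def)
    moreover have "ev (pfaffian A) x = \<alpha> 0 1 x * pf6 (\<lambda>i j. \<alpha> (i + 2) (j + 2) x)
        - dpf6 (\<lambda>i j. \<alpha> (i + 2) (j + 2) x) (\<lambda>i j. u0 i x * u1 j x - u1 i x * u0 j x)"
      unfolding pfaffian_8[OF Ac] pf6_def dpf6_def u0_def u1_def \<alpha>_def
      by (simp only: ev_add ev_diff ev_mult)
    moreover have "pf6 (\<lambda>i j. \<alpha> (i + 2) (j + 2) x) = pf6 (val ?M x)" unfolding pf6_def by (simp add: M)
    moreover have "dpf6 (\<lambda>i j. \<alpha> (i + 2) (j + 2) x) n = dpf6 (val ?M x) n" for n unfolding dpf6_def by (simp add: M)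
    ultimately show ?thesis by simp
  qed
  have adj: "(\<Sum>j<6. pfs (val ?M x) k j * (\<Sum>l<6. ?M j l x * z l x)) = - (pf6 (val ?M x) * z k x)" if k: "k < 6" for k x
  proof -
    have sk: "?M j l x = - ?M l j x" if "j < 6" "l < 6" for j l by (rule skewl_skew[OF Msl that(2,1)])
    have "(\<Sum>j<6. pfs (val ?M x) k j * (\<Sum>l<6. ?M j l x * z l x)) = (\<Sum>j<6. \<Sum>l<6. pfs (val ?M x) k j * ?M j l x * z l x)"
      by (simp add: sum_distrib_left mult.assoc)
    also have "\<dots> = (\<Sum>l<6. \<Sum>j<6. pfs (val ?M x) k j * ?M j l x * z l x)" by (rule sum.swap)
    also have "\<dots> = (\<Sum>l<6. - ((\<Sum>j<6. pfs (val ?M x) k j * ?M l j x) * z l x))"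
    proof (intro sum.cong refl)
      fix l :: nat assume "l \<in> {..<6}"
      then have l: "l < 6" by simp
      have "(\<Sum>j<6. pfs (val ?M x) k j * ?M j l x * z l x) = (\<Sum>j<6. - (pfs (val ?M x) k j * ?M l j x * z l x))"
      proof (intro sum.cong refl)
        fix j :: nat assume "j \<in> {..<6}"
        then have j: "j < 6" by simp
        show "pfs (val ?M x) k j * ?M j l x * z l x = - (pfs (val ?M x) k j * ?M l j x * z l x)"
          unfolding sk[OF j l] by simp
      qed
      then show "(\<Sum>j<6. pfs (val ?M x) k j * ?M j l x * z l x) = - ((\<Sum>j<6. pfs (val ?M x) k j * ?M l j x) * z l x)"
        by (simp only: sum_negf sum_distrib_right)
    qed
    also have "\<dots> = (\<Sum>l<6. - ((if l = k then pf6 (val ?M x) else 0) * z l x))"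
      by (intro sum.cong refl) (simp only: pfs_adjugate[OF skewl_val[OF Msl] _ k] lessThan_iff)
    also have "\<dots> = (\<Sum>l<6. if l = k then - (pf6 (val ?M x) * z k x) else 0)" by (intro sum.cong refl) auto
    also have "\<dots> = - (pf6 (val ?M x) * z k x)" using k by simp
    finally show ?thesis .
  qed
  have lM: "polyline (?M i j)" if "i < 6" "j < 6" for i j by (rule polyline_lin[OF skewl_lin[OF Msl that]])
  have pl: "polyline (\<lambda>x. pf6 (val ?M x))" unfolding pf6_def
    by (intro polyline_plus polyline_minus polyline_mult lM; simp)
  show ?thesis
  proof (cases "b = 0")
    case True
    have uz: "(\<Sum>j<6. u0 j x * z j x) = \<kappa> * f x" "(\<Sum>j<6. u1 j x * w j x) = \<kappa> * f x" for x
      using r00[of x] r11[of x] True by simp_all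
    have pf0: "pf6 (val ?M x) = 0" for x
    proof (rule polyline_identity[OF polyline_cub[OF f] y pl])
      fix x assume fx: "f x \<noteq> 0"
      have nz: "(\<Sum>j<6. u0 j x * z j x) \<noteq> 0" using uz fx AB(2) by simp
      have "\<exists>k<6. z k x \<noteq> 0"
      proof (rule ccontr)
        assume "\<not> (\<exists>k<6. z k x \<noteq> 0)"
        then have "(\<Sum>j<6. u0 j x * z j x) = 0" by (intro sum.neutral) simp
        then show False using nz by simp
      qed
      then obtain k where k: "k < 6" "z k x \<noteq> 0" by blast
      have "pf6 (val ?M x) * z k x = 0" using adj[OF k(1), of x] kz True by simp
      then show "pf6 (val ?M x) = 0" using k by simp
    qed
    define u where "u = (\<lambda>j x. 1 / \<kappa> * u1 j x)"
    define v where "v = (\<lambda>j x. 1 / \<kappa> * u0 j x)"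
    have lz: "lin (z j)" and lw: "lin (w j)" if "j < 6" for j
      unfolding z_def w_def \<beta>_def using Bh[of "j + 2" 0] Bh[of "j + 2" 1] that by (auto simp: wt_def intro!: lin_ev)
    have "quad (u0 j)" "quad (u1 j)" if "j < 6" for j
      unfolding u0_def u1_def \<alpha>_def using Ah[of 0 "j + 2"] Ah[of 1 "j + 2"] that
      by (auto simp: wt_def numeral_2_eq_2[symmetric] intro!: quad_ev)
    then have qu: "quad (u j)" and qv: "quad (v j)" if "j < 6" for j
      unfolding u_def v_def using that by (auto intro!: quad_cmult simp del: times_divide_eq_left)
    have sc: "(\<Sum>j<6. (1 / \<kappa> * p j) * r j) = 1 / \<kappa> * (\<Sum>j<6. p j * r j)" for p r :: "nat \<Rightarrow> complex"
      by (simp add: sum_distrib_left mult.assoc)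
    have "reach ?M f"
    proof (rule reach_of_factorization[OF Msl semistable_sst[OF ss] lz lw qu qv f y])
      show "ker ?M z" "ker ?M w" unfolding ker_def using kz kw True by simp_all
      show "(\<Sum>k<6. v k x * z k x) = f x" "(\<Sum>k<6. u k x * w k x) = f x"
        "(\<Sum>k<6. u k x * z k x) = 0" "(\<Sum>k<6. v k x * w k x) = 0" for x
        unfolding u_def v_def sc uz r01 r10 using AB(2) by simp_all
      show "- (\<kappa>' / \<kappa>\<^sup>2) \<noteq> 0" using pf(2) AB(2) by simp
      show "dpf6 (val ?M x) (\<lambda>i j. v i x * u j x - u i x * v j x) = - (\<kappa>' / \<kappa>\<^sup>2) * (f x)\<^sup>2" for x
      proof -
        have e: "- (\<kappa>' * (f x)\<^sup>2) = dpf6 (val ?M x) (\<lambda>i j. u0 i x * u1 j x - u1 i x * u0 j x)"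
          unfolding pfA pf0 by simp
        have "dpf6 (val ?M x) (\<lambda>i j. v i x * u j x - u i x * v j x) =
            1 / \<kappa>\<^sup>2 * dpf6 (val ?M x) (\<lambda>i j. u0 i x * u1 j x - u1 i x * u0 j x)"
        proof -
          have "(\<lambda>i j. v i x * u j x - u i x * v j x) = (\<lambda>i j. 1 / \<kappa>\<^sup>2 * (u0 i x * u1 j x - u1 i x * u0 j x))"
            by (intro ext) (simp add: u_def v_def power2_eq_square right_diff_distrib)
          then show ?thesis by (simp only: dpf6_scale)
        qed
        then show ?thesis unfolding e[symmetric] by simp
      qed
    qed
    then show ?thesis by (simp only: f_def)
  next
    case False
    have P: "pf6 (val ?M x) = - (\<kappa>' * b / \<kappa>) * f x" for x
    proof -
      have "pf6 (val ?M x) - (- (\<kappa>' * b / \<kappa>) * f x) = 0"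
      proof (rule polyline_identity[where G = "\<lambda>x. pf6 (val ?M x) - (- (\<kappa>' * b / \<kappa>) * f x)", OF polyline_cub[OF f] y])
        show "polyline (\<lambda>x. pf6 (val ?M x) - (- (\<kappa>' * b / \<kappa>) * f x))"
          by (intro polyline_minus polyline_mult polyline_const pl polyline_cub[OF f])
        fix x assume fx: "f x \<noteq> 0"
        let ?n = "\<lambda>i j. u0 i x * u1 j x - u1 i x * u0 j x"
        let ?P = "pfs (val ?M x)"
        have n: "skew6 ?n" by (simp add: skew6_def)
        have "2 * dpf6 (val ?M x) ?n = (\<Sum>i<6. \<Sum>j<6. u0 i x * (?P i j * u1 j x)) - (\<Sum>i<6. \<Sum>j<6. u1 i x * (?P i j * u0 j x))"
          unfolding dpf6_pfs[OF n] sum_subtractf[symmetric] by (intro sum.cong refl) (simp add: algebra_simps)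
        also have "(\<Sum>i<6. \<Sum>j<6. u1 i x * (?P i j * u0 j x)) = (\<Sum>j<6. \<Sum>i<6. u1 i x * (?P i j * u0 j x))" by (rule sum.swap)
        also have "\<dots> = (\<Sum>j<6. \<Sum>i<6. - (u0 j x * (?P j i * u1 i x)))"
          by (intro sum.cong refl) (subst pfs_skew, simp add: mult_ac)
        also have "\<dots> = - (\<Sum>i<6. \<Sum>j<6. u0 i x * (?P i j * u1 j x))" by (simp only: sum_negf)
        finally have "2 * dpf6 (val ?M x) ?n = 2 * (\<Sum>i<6. \<Sum>j<6. u0 i x * (?P i j * u1 j x))"
          by (simp only: diff_minus_eq_add mult_2)
        then have "dpf6 (val ?M x) ?n = (\<Sum>i<6. \<Sum>j<6. u0 i x * (?P i j * u1 j x))"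
          by (simp only: mult_cancel_left) simp
        then have "dpf6 (val ?M x) ?n = (\<Sum>i<6. u0 i x * (\<Sum>j<6. ?P i j * u1 j x))"
          by (simp only: sum_distrib_left)
        moreover have "(\<Sum>j<6. ?P i j * u1 j x) = pf6 (val ?M x) * z i x / b" if i: "i < 6" for i
        proof -
          have "(\<Sum>j<6. ?P i j * (\<Sum>l<6. ?M j l x * z l x)) = (\<Sum>j<6. (?P i j * u1 j x) * (- b))"
            by (intro sum.cong refl) (simp add: kz)
          also have "\<dots> = (\<Sum>j<6. ?P i j * u1 j x) * (- b)" by (rule sum_distrib_right[symmetric])
          finally show ?thesis using adj[OF i, of x] False by (simp add: field_simps)
        qed
        ultimately have "dpf6 (val ?M x) ?n = (\<Sum>i<6. u0 i x * (pf6 (val ?M x) * z i x / b))" by simp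
        also have "\<dots> = pf6 (val ?M x) / b * (\<Sum>i<6. u0 i x * z i x)"
          by (simp add: sum_distrib_left mult_ac)
        finally have D: "dpf6 (val ?M x) ?n = pf6 (val ?M x) / b * (\<Sum>i<6. u0 i x * z i x)" .
        have "b * (\<kappa>' * (f x)\<^sup>2) = pf6 (val ?M x) * (\<alpha> 0 1 x * b - (\<Sum>i<6. u0 i x * z i x))"
          unfolding pfA D using False by (simp add: field_simps)
        also have "\<alpha> 0 1 x * b - (\<Sum>i<6. u0 i x * z i x) = - (\<kappa> * f x)" using r00[of x, symmetric] by simp
        finally have "f x * (pf6 (val ?M x) * \<kappa> + b * \<kappa>' * f x) = 0"
          by (simp add: power2_eq_square algebra_simps)
        then have "pf6 (val ?M x) * \<kappa> + b * \<kappa>' * f x = 0" using fx by simp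
        then show "pf6 (val ?M x) - (- (\<kappa>' * b / \<kappa>) * f x) = 0" using AB(2) by (simp add: field_simps)
      qed
      then show ?thesis by (simp only: right_minus_eq)
    qed
    have "reach ?M f"
      by (rule reach.pfaffian[OF Msl f _ P y]) (use False AB(2) pf(2) in simp)
    then show ?thesis by (simp only: f_def)
  qed
qed

lemma mat_class_image: "mat_class M = (\<lambda>c. const c \<cdot>\<^sub>m M) ` {c. c \<noteq> 0}"
  by (auto simp: mat_class_def)

lemma mat_class_smult: assumes s: "s \<noteq> 0" shows "mat_class (const s \<cdot>\<^sub>m M) = mat_class M"
proof (intro equalityI subsetI)
  fix X assume "X \<in> mat_class (const s \<cdot>\<^sub>m M)"
  then obtain c where "c \<noteq> 0" "X = const (c * s) \<cdot>\<^sub>m M" unfolding mat_class_def smult_const_twice by blast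
  then show "X \<in> mat_class M" using s unfolding mat_class_def by (intro CollectI exI[of _ "c * s"]) simp
next
  fix X assume "X \<in> mat_class M"
  then obtain c where c: "c \<noteq> 0" "X = const c \<cdot>\<^sub>m M" unfolding mat_class_def by blast
  then have "X = const (c / s) \<cdot>\<^sub>m (const s \<cdot>\<^sub>m M)" using s by (simp add: smult_const_twice)
  then show "X \<in> mat_class (const s \<cdot>\<^sub>m M)" using s c(1) unfolding mat_class_def by (intro CollectI exI[of _ "c / s"]) simp
qed

lemma form_class_mult: assumes s: "s \<noteq> 0" shows "form_class (const s * F) = form_class F"
proof (intro equalityI subsetI)
  have m: "const a * (const b * F) = const (a * b) * F" for a b by (simp add: mult.assoc[symmetric] mult_single)
  {
    fix X assume "X \<in> form_class (const s * F)"
    then obtain c where "c \<noteq> 0" "X = const (c * s) * F" unfolding form_class_def m by blast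
    then show "X \<in> form_class F" using s unfolding form_class_def by (intro CollectI exI[of _ "c * s"]) simp
  next
    fix X assume "X \<in> form_class F"
    then obtain c where c: "c \<noteq> 0" "X = const c * F" unfolding form_class_def by blast
    then have "X = const (c / s) * (const s * F)" using s by (simp add: m)
    then show "X \<in> form_class (const s * F)" using s c(1) unfolding form_class_def by (intro CollectI exI[of _ "c / s"]) simp
  }
qed

lemma semistable_smult: assumes "semistable M" "c \<noteq> 0" shows "semistable (const c \<cdot>\<^sub>m M)"
proof -
  have M: "M \<in> skew_lin" using assms by (simp add: semistable_def)
  obtain d p where d: "d > 0" "homogeneous d p" "poly_fun p \<in> hom_invariants d" "poly_fun p M \<noteq> 0"
    using assms(1) by (auto simp: semistable_def hom_invariants_def)
  have "poly_fun p (const c \<cdot>\<^sub>m M) \<noteq> 0" using d(4) assms(2) by (simp add: poly_fun_smult_hom[OF d(2) M])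
  then show ?thesis unfolding semistable_def using d skew_lin_smult[OF M] by blast
qed

lemma S_ss_semistable: assumes "mat_class A \<in> S_ss" shows "semistable A"
proof -
  obtain M where M: "mat_class A = mat_class M" "semistable M" using assms by (auto simp: S_ss_def)
  have "A \<in> mat_class M" unfolding M(1)[symmetric] by (rule mat_class_self)
  then show ?thesis using semistable_smult[OF M(2)] by (auto simp: mat_class_def)
qed

lemma semistable_congr:
  assumes "semistable M" "k \<in> carrier_mat 6 6" "det k \<noteq> 0" shows "semistable (congr_act k M)"
proof -
  have M: "M \<in> skew_lin" using assms by (simp add: semistable_def)
  obtain d f where d: "d > 0" "f \<in> hom_invariants d" "f M \<noteq> 0" using assms(1) by (auto simp: semistable_def)
  obtain \<mu> where mu: "\<mu> ^ 6 = det k" using complex_root6 by blast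
  then have "\<mu> \<noteq> 0" using assms(3) by auto
  then have "f (congr_act k M) \<noteq> 0" using d(3) by (simp add: hom_invariant_congr[OF d(2) assms(2) mu assms(3) M])
  then show ?thesis unfolding semistable_def using d congr_act_skew_lin[OF assms(2) M] by blast
qed

lemma quot_map_congr:
  assumes M: "M \<in> skew_lin" and k: "k \<in> carrier_mat 6 6" "det k \<noteq> 0"
  shows "quot_map (mat_class (congr_act k M)) = quot_map (mat_class M)"
proof -
  obtain \<mu> where mu: "\<mu> ^ 6 = det k" using complex_root6 by blast
  then have m0: "\<mu>\<^sup>2 \<noteq> 0" using k(2) by auto
  obtain h where h: "h \<in> SL6" "congr_act k M = const (\<mu>\<^sup>2) \<cdot>\<^sub>m congr_act h M"
    using congr_act_SL[OF k(1) mu k(2)] M by metis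
  have hc: "h \<in> carrier_mat 6 6" using h(1) by (simp add: SL6_def)
  have inv: "f (const c \<cdot>\<^sub>m congr_act h M) = f (const c \<cdot>\<^sub>m M)" if f: "f \<in> invariants" for f c
  proof -
    obtain p where "f = poly_fun p" "SL_invariant (poly_fun p)" using f by (rule invariantsE)
    then have "f (congr_act h (const c \<cdot>\<^sub>m M)) = f (const c \<cdot>\<^sub>m M)"
      using h(1) skew_lin_smult[OF M] unfolding SL_invariant_def by blast
    then show ?thesis by (simp add: congr_act_smult[OF hc M])
  qed
  have "quot_map (mat_class (congr_act k M)) = quot_map (mat_class (congr_act h M))"
    unfolding h(2) mat_class_smult[OF m0] ..
  also have "\<dots> = quot_map (mat_class M)" 
    unfolding quot_map_def mat_class_image ball_simps
    by (intro Collect_cong conj_cong refl) (simp add: inv)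
  finally show ?thesis .
qed

lemma block_A1_class: "A \<in> carrier_mat 8 8 \<Longrightarrow> block_A1 ` mat_class A = mat_class (block_A1 A)"
proof -
  assume A: "A \<in> carrier_mat 8 8"
  have "block_A1 (const c \<cdot>\<^sub>m A) = const c \<cdot>\<^sub>m block_A1 A" for c
    by (rule eq_matI) (use A in \<open>auto simp: block_A1_def\<close>)
  then show ?thesis unfolding mat_class_image image_image by simp
qed

lemma form_class_eqD: "form_class p = form_class q \<Longrightarrow> \<exists>c. c \<noteq> 0 \<and> p = const c * q"
  using form_class_self[of p] by (auto simp: form_class_def)

lemma mat_class_eqD: "mat_class P = mat_class Q \<Longrightarrow> \<exists>c. c \<noteq> 0 \<and> P = const c \<cdot>\<^sub>m Q"
  using mat_class_self[of P] by (auto simp: mat_class_def)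

lemma is_factorizationD:
  assumes "is_factorization A B F"
  shows "\<exists>\<kappa>. \<kappa> \<noteq> 0 \<and> A * B = const \<kappa> \<cdot>\<^sub>m (F \<cdot>\<^sub>m 1\<^sub>m 8)" "\<exists>\<kappa>. \<kappa> \<noteq> 0 \<and> B * A = const \<kappa> \<cdot>\<^sub>m (F \<cdot>\<^sub>m 1\<^sub>m 8)"
    "\<exists>\<kappa>. \<kappa> \<noteq> 0 \<and> pfaffian A = const \<kappa> * F\<^sup>2"
proof -
  have "mat_class (A * B) = mat_class (F \<cdot>\<^sub>m 1\<^sub>m 8)" using assms unfolding is_factorization_def by (elim conjE)
  then show "\<exists>\<kappa>. \<kappa> \<noteq> 0 \<and> A * B = const \<kappa> \<cdot>\<^sub>m (F \<cdot>\<^sub>m 1\<^sub>m 8)" by (rule mat_class_eqD)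
  have "mat_class (B * A) = mat_class (F \<cdot>\<^sub>m 1\<^sub>m 8)" using assms unfolding is_factorization_def by (elim conjE)
  then show "\<exists>\<kappa>. \<kappa> \<noteq> 0 \<and> B * A = const \<kappa> \<cdot>\<^sub>m (F \<cdot>\<^sub>m 1\<^sub>m 8)" by (rule mat_class_eqD)
  have "form_class (pfaffian A) = form_class (F\<^sup>2)" using assms unfolding is_factorization_def by (elim conjE)
  then show "\<exists>\<kappa>. \<kappa> \<noteq> 0 \<and> pfaffian A = const \<kappa> * F\<^sup>2" by (rule form_class_eqD)
qed

lemma MF_ssE:
  assumes "x \<in> MF_ss"
  obtains A B F where "x = (mat_class A, mat_class B, form_class F)" "A \<in> A_space" "B \<in> B_space" "F \<in> cubics - {0}"
    "is_factorization A B F" "semistable (block_A1 A)" "psi x = (mat_class (block_A1 A), form_class F)"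
proof -
  obtain A B F where x: "x = (mat_class A, mat_class B, form_class F)" and A: "A \<in> A_space" and B: "B \<in> B_space"
    and F: "F \<in> cubics - {0}" and fac: "is_factorization A B F" and ss: "block_A1 ` mat_class A \<in> S_ss"
    using assms by (auto simp: MF_ss_def MF_def)
  have Ac: "A \<in> carrier_mat 8 8" using A by (simp add: A_space_iff)
  have "semistable (block_A1 A)" using ss unfolding block_A1_class[OF Ac] by (rule S_ss_semistable)
  moreover have "psi x = (mat_class (block_A1 A), form_class F)" unfolding x psi_def by (simp add: block_A1_class[OF Ac])
  ultimately show ?thesis using that[OF x A B F fac] by blast
qed

theorem psi_in_closure: assumes x: "x \<in> MF_ss" shows "psi x \<in> S_tilde_ss"
proof -
  obtain A B F where "x = (mat_class A, mat_class B, form_class F)" and A: "A \<in> A_space" "B \<in> B_space" "F \<in> cubics - {0}"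
    and fac: "is_factorization A B F" and ss: "semistable (block_A1 A)" and psi: "psi x = (mat_class (block_A1 A), form_class F)"
    by (rule MF_ssE[OF x])
  obtain \<kappa> where k: "\<kappa> \<noteq> 0" "A * B = const \<kappa> \<cdot>\<^sub>m (F \<cdot>\<^sub>m 1\<^sub>m 8)"
    using is_factorizationD(1)[OF fac] by blast
  obtain \<kappa>' where k': "\<kappa>' \<noteq> 0" "pfaffian A = const \<kappa>' * F\<^sup>2"
    using is_factorizationD(3)[OF fac] by blast
  have "reach (entries (block_A1 A)) (ev F)" by (rule reach_of_MF[OF A k(2,1) k'(2,1) ss])
  then show ?thesis unfolding psi by (rule reach_closure[OF _ ss _ A(3)]) simp_all
qed

lemma homogeneous_uminus: "homogeneous d p \<Longrightarrow> homogeneous d (- p)"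
  using homogeneous_const_mult[of d p "- 1"] by (simp add: single_uminus single_one)

lemma homogeneous_prod: "(\<And>i. i \<in> S \<Longrightarrow> homogeneous 0 (f i)) \<Longrightarrow> homogeneous 0 (\<Prod>i\<in>S. f i)"
proof (induction S rule: infinite_finite_induct)
  case (insert i S)
  then show ?case using homogeneous_mult[of 0 "f i" 0 "\<Prod>i\<in>S. f i"] by simp
qed (use homogeneous_const[of 1] in \<open>simp_all add: single_one\<close>)

lemma homogeneous_det:
  assumes "g \<in> form_mats 0 n n" shows "homogeneous 0 (det g)"
proof -
  have g: "g \<in> carrier_mat n n" "\<And>i j. i < n \<Longrightarrow> j < n \<Longrightarrow> homogeneous 0 (g $$ (i, j))"
    using assms by (auto simp: form_mats_def)
  have "homogeneous 0 (signof p * (\<Prod>i = 0..<n. g $$ (i, p i)))" if "p permutes {0..<n}" for p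
  proof -
    have "p i < n" if "i < n" for i using permutes_in_image[OF \<open>p permutes {0..<n}\<close>, of i] that by simp
    then have h: "homogeneous 0 (\<Prod>i = 0..<n. g $$ (i, p i))" by (intro homogeneous_prod g) auto
    show ?thesis using h homogeneous_uminus[OF h] by (simp add: sign_def)
  qed
  then show ?thesis unfolding det_def'[OF g(1)] by (intro homogeneous_sum) simp
qed

lemma End_E_iff:
  assumes "\<gamma> \<in> End_E"
  shows "\<gamma> \<in> carrier_mat 8 8" "\<And>i j. i < 8 \<Longrightarrow> j < 8 \<Longrightarrow> wt i < wt j \<Longrightarrow> \<gamma> $$ (i, j) = 0"
    "\<And>i j. i < 8 \<Longrightarrow> j < 8 \<Longrightarrow> homogeneous (wt i - wt j) (\<gamma> $$ (i, j))" "homogeneous 0 (det \<gamma>)"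
proof -
  obtain g h k where G: "\<gamma> = four_block_mat g h (0\<^sub>m 6 2) k" and ghk: "g \<in> form_mats 0 2 2" "h \<in> form_mats 1 2 6" "k \<in> form_mats 0 6 6"
    using assms unfolding End_E_def by blast
  have d: "g \<in> carrier_mat 2 2" "h \<in> carrier_mat 2 6" "k \<in> carrier_mat 6 6" using ghk by (auto simp: form_mats_def)
  show "\<gamma> \<in> carrier_mat 8 8" unfolding G using four_block_carrier_mat[OF d(1,3)] by simp
  show "\<gamma> $$ (i, j) = 0" if "i < 8" "j < 8" "wt i < wt j" for i j
    unfolding G using that d by (cases "i < 2"; cases "j < 2") (simp_all add: wt_def)
  show "homogeneous (wt i - wt j) (\<gamma> $$ (i, j))" if ij: "i < 8" "j < 8" for i j
  proof -
    have e: "homogeneous 0 (g $$ (i, j))" if "i < 2" "j < 2" for i j using that ghk by (simp add: form_mats_def)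
    have f: "homogeneous (Suc 0) (h $$ (i, j))" if "i < 2" "j < 6" for i j using that ghk by (simp add: form_mats_def)
    have l: "homogeneous 0 (k $$ (i, j))" if "i < 6" "j < 6" for i j using that ghk by (simp add: form_mats_def)
    show ?thesis unfolding G using ij d e[of i j] f[of i "j - 2"] l[of "i - 2" "j - 2"]
      by (cases "i < 2"; cases "j < 2") (simp_all add: wt_def)
  qed
  have "det \<gamma> = det g * det k" unfolding G by (rule det_four_block_mat_lower_left_zero[OF d(1,2) _ d(3)]) simp
  then show "homogeneous 0 (det \<gamma>)"
    using homogeneous_mult[OF homogeneous_det[OF ghk(1)] homogeneous_det[OF ghk(3)]] by simp
qed

lemma congr_A_space:
  assumes "\<gamma> \<in> End_E" "A \<in> A_space" shows "\<gamma> * A * transpose_mat \<gamma> \<in> A_space"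
proof -
  note G = End_E_iff[OF assms(1)]
  have c: "A \<in> carrier_mat 8 8" and s: "skew A" and h: "\<And>i j. i < 8 \<Longrightarrow> j < 8 \<Longrightarrow> homogeneous (wt i + wt j + 1) (A $$ (i, j))"
    using assms(2) by (auto simp: A_space_iff)
  have "homogeneous (wt i + wt j + 1) ((\<gamma> * A * transpose_mat \<gamma>) $$ (i, j))" if ij: "i < 8" "j < 8" for i j
    unfolding mult_congr_entry[OF G(1) c ij]
  proof (rule homogeneous_sum, clarify)
    fix a b :: nat assume ab: "a \<in> {0..<8}" "b \<in> {0..<8}"
    show "homogeneous (wt i + wt j + 1) (A $$ (a, b) * (\<gamma> $$ (i, a) * \<gamma> $$ (j, b)))"
    proof (cases "wt i < wt a \<or> wt j < wt b")
      case True then show ?thesis using G(2)[of i a] G(2)[of j b] ij ab by auto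
    next
      case False
      then have "wt i + wt j + 1 = (wt a + wt b + 1) + ((wt i - wt a) + (wt j - wt b))" by simp
      then show ?thesis using ab ij by (simp only:) (intro homogeneous_mult h G(3); simp)
    qed
  qed
  then show ?thesis unfolding A_space_iff using skew_congr[OF G(1) c s] G(1) c by (auto intro!: mult_carrier_mat)
qed

lemma congr_B_space:
  assumes "\<delta> \<in> End_E" "B \<in> B_space" shows "transpose_mat \<delta> * B * \<delta> \<in> B_space"
proof -
  note G = End_E_iff[OF assms(1)]
  have c: "B \<in> carrier_mat 8 8" and s: "skew B" and h: "\<And>i j. i < 8 \<Longrightarrow> j < 8 \<Longrightarrow> homogeneous ((1 - wt i) + (1 - wt j)) (B $$ (i, j))"
    using assms(2) by (auto simp: B_space_iff)
  have T: "transpose_mat \<delta> \<in> carrier_mat 8 8" using G(1) by simp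
  have w1: "wt i \<le> 1" for i by (simp add: wt_def)
  have "homogeneous ((1 - wt i) + (1 - wt j)) ((transpose_mat \<delta> * B * transpose_mat (transpose_mat \<delta>)) $$ (i, j))"
    if ij: "i < 8" "j < 8" for i j
    unfolding mult_congr_entry[OF T c ij]
  proof (rule homogeneous_sum, clarify)
    fix a b :: nat assume ab: "a \<in> {0..<8}" "b \<in> {0..<8}"
    have t: "transpose_mat \<delta> $$ (i, a) = \<delta> $$ (a, i)" "transpose_mat \<delta> $$ (j, b) = \<delta> $$ (b, j)" using ab ij G(1) by simp_all
    show "homogeneous ((1 - wt i) + (1 - wt j)) (B $$ (a, b) * (transpose_mat \<delta> $$ (i, a) * transpose_mat \<delta> $$ (j, b)))"
    proof (cases "wt a < wt i \<or> wt b < wt j")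
      case True then show ?thesis using G(2)[of a i] G(2)[of b j] ij ab unfolding t by auto
    next
      case False
      then have "(1 - wt i) + (1 - wt j) = ((1 - wt a) + (1 - wt b)) + ((wt a - wt i) + (wt b - wt j))"
        using w1[of a] w1[of b] by simp
      then show ?thesis unfolding t using ab ij by (simp only:) (intro homogeneous_mult h G(3); simp)
    qed
  qed
  then show ?thesis unfolding B_space_iff using skew_congr[OF T c s] G(1) c by (auto intro!: mult_carrier_mat)
qed

lemma mat_inv_eq:
  assumes "X \<in> carrier_mat n n" "Y \<in> carrier_mat n n" "X * Y = 1\<^sub>m n" "Y * X = 1\<^sub>m n"
  shows "mat_inv X = Y"
  unfolding mat_inv_def
proof (rule the_equality)
  show "Y \<in> carrier_mat (dim_col X) (dim_row X) \<and> inverts_mat X Y \<and> inverts_mat Y X"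
    using assms by (simp add: inverts_mat_def)
  fix Z assume Z: "Z \<in> carrier_mat (dim_col X) (dim_row X) \<and> inverts_mat X Z \<and> inverts_mat Z X"
  then have Zc: "Z \<in> carrier_mat n n" "Z * X = 1\<^sub>m n" using assms(1) by (auto simp: inverts_mat_def)
  have "Z = Z * (X * Y)" using assms Zc by simp
  also have "\<dots> = Z * X * Y" by (rule assoc_mult_mat[OF Zc(1) assms(1,2), symmetric])
  also have "\<dots> = Y" using Zc assms by simp
  finally show "Z = Y" .
qed

lemma congr_smult:
  assumes "P \<in> carrier_mat n n" "M \<in> carrier_mat n n" "Q \<in> carrier_mat n n"
  shows "P * (c \<cdot>\<^sub>m M) * Q = c \<cdot>\<^sub>m (P * M * Q :: form mat)"
  using assms by (simp add: mult_smult_assoc_mat[of _ n n _ n] mult_smult_distrib[of _ n n _ n])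

lemma congr_class:
  assumes "P \<in> carrier_mat n n" "M \<in> carrier_mat n n" "Q \<in> carrier_mat n n"
  shows "(\<lambda>M. P * M * Q) ` mat_class M = mat_class (P * M * Q)"
  unfolding mat_class_image image_image congr_smult[OF assms] ..

lemma scalar_congr:
  assumes "P \<in> carrier_mat n n" "Q \<in> carrier_mat n n" "P * Q = 1\<^sub>m n" "S = c \<cdot>\<^sub>m (1\<^sub>m n :: form mat)"
  shows "P * S * Q = S"
proof -
  have "P * S * Q = c \<cdot>\<^sub>m (P * 1\<^sub>m n * Q)" unfolding assms(4) by (rule congr_smult) (use assms in auto)
  then show ?thesis using assms by simp
qed

lemma pfaffian_const_congr:
  assumes "C \<in> carrier_mat 8 8" "A \<in> carrier_mat 8 8" "skew A" "det C = const c" "c \<noteq> 0"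
  shows "form_class (pfaffian (C * A * transpose_mat C)) = form_class (pfaffian A)"
  using pfaffian_congr[of C 4 A] assms by (simp add: form_class_mult)

lemma Gamma_act_MF_ss:
  assumes x: "x \<in> MF_ss" and g: "\<gamma> \<in> Gamma"
  shows "Gamma_act \<gamma> x \<in> MF_ss \<and> psi_bar (Gamma_act \<gamma> x) = psi_bar x"
proof -
  obtain A B F where xe: "x = (mat_class A, mat_class B, form_class F)" and A: "A \<in> A_space" and B: "B \<in> B_space"
    and F: "F \<in> cubics - {0}" and fac: "is_factorization A B F" and ss: "semistable (block_A1 A)"
    and psi: "psi x = (mat_class (block_A1 A), form_class F)"
    by (rule MF_ssE[OF x])
  obtain \<delta> where gE: "\<gamma> \<in> End_E" and dE: "\<delta> \<in> End_E" and gd: "\<gamma> * \<delta> = 1\<^sub>m 8" "\<delta> * \<gamma> = 1\<^sub>m 8"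
    using g unfolding Gamma_def by blast
  note G = End_E_iff[OF gE] and D = End_E_iff[OF dE]
  note Gc = G(1) and Dc = D(1)
  have Tc: "transpose_mat \<gamma> \<in> carrier_mat 8 8" "transpose_mat \<delta> \<in> carrier_mat 8 8" using Gc Dc by simp_all
  have T: "transpose_mat \<gamma> * transpose_mat \<delta> = 1\<^sub>m 8" "transpose_mat \<delta> * transpose_mat \<gamma> = 1\<^sub>m 8"
    unfolding transpose_mult[OF Dc Gc, symmetric] transpose_mult[OF Gc Dc, symmetric] gd by simp_all
  have inv: "mat_inv \<gamma> = \<delta>" "mat_inv (transpose_mat \<gamma>) = transpose_mat \<delta>"
    by (rule mat_inv_eq[OF Gc Dc gd], rule mat_inv_eq[OF Tc T])
  have Ac: "A \<in> carrier_mat 8 8" "skew A" using A by (auto simp: A_space_iff)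
  have Bc: "B \<in> carrier_mat 8 8" "skew B" using B by (auto simp: B_space_iff)
  define A' where "A' = \<gamma> * A * transpose_mat \<gamma>"
  define B' where "B' = transpose_mat \<delta> * B * \<delta>"
  have A': "A' \<in> A_space" unfolding A'_def by (rule congr_A_space[OF gE A])
  have B': "B' \<in> B_space" unfolding B'_def by (rule congr_B_space[OF dE B])
  have A'c: "A' \<in> carrier_mat 8 8" using A' by (simp add: A_space_iff)
  have act: "Gamma_act \<gamma> x = (mat_class A', mat_class B', form_class F)"
    unfolding xe Gamma_act_def inv A'_def B'_def
    by (simp add: congr_class[OF Gc Ac(1) Tc(1)] congr_class[OF Tc(2) Bc(1) Dc])
  obtain \<kappa> where k: "A * B = const \<kappa> \<cdot>\<^sub>m (F \<cdot>\<^sub>m 1\<^sub>m 8)"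
    using is_factorizationD(1)[OF fac] by blast
  obtain \<kappa>2 where k2: "B * A = const \<kappa>2 \<cdot>\<^sub>m (F \<cdot>\<^sub>m 1\<^sub>m 8)"
    using is_factorizationD(2)[OF fac] by blast
  have sm: "const s \<cdot>\<^sub>m (F \<cdot>\<^sub>m 1\<^sub>m 8) = (const s * F) \<cdot>\<^sub>m (1\<^sub>m 8 :: form mat)" for s
    by (rule eq_matI) (auto simp: mult.assoc)
  have mid: "P * X * Q * (R * Y * S) = P * (X * Y) * S"
    if "P \<in> carrier_mat 8 8" "X \<in> carrier_mat 8 8" "Q \<in> carrier_mat 8 8" "R \<in> carrier_mat 8 8"
      "Y \<in> carrier_mat 8 8" "S \<in> carrier_mat 8 8" "Q * R = 1\<^sub>m 8" for P X Q R Y S :: "form mat"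
  proof -
    have "P * X * Q * (R * Y * S) = P * X * (Q * (R * (Y * S)))"
      using that by (simp add: assoc_mult_mat[of _ 8 8 _ 8 _ 8])
    also have "Q * (R * (Y * S)) = Q * R * (Y * S)"
      by (rule assoc_mult_mat[symmetric, OF that(3,4) mult_carrier_mat[OF that(5,6)]])
    also have "\<dots> = Y * S" using that by simp
    finally show ?thesis using that by (simp add: assoc_mult_mat[of _ 8 8 _ 8 _ 8])
  qed
  have AB: "A' * B' = A * B"
    unfolding A'_def B'_def mid[OF Gc Ac(1) Tc(1) Tc(2) Bc(1) Dc T(1)]
    by (rule scalar_congr[OF Gc Dc gd(1)]) (use k sm in simp)
  have BA: "B' * A' = B * A"
    unfolding A'_def B'_def mid[OF Tc(2) Bc(1) Dc Gc Ac(1) Tc(1) gd(2)]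
    by (rule scalar_congr[OF Tc(2) Tc(1) T(2)]) (use k2 sm in simp)
  obtain c where c: "det \<gamma> = const c" using homogeneous_0_const[OF G(4)] by blast
  obtain d where d: "det \<delta> = const d" using homogeneous_0_const[OF D(4)] by blast
  have "det \<gamma> * det \<delta> = 1" using det_mult[OF Gc Dc] gd by simp
  then have cd: "c \<noteq> 0" "d \<noteq> 0" using c d by auto
  have pA: "form_class (pfaffian A') = form_class (pfaffian A)"
    unfolding A'_def by (rule pfaffian_const_congr[OF Gc Ac c cd(1)])
  have pB: "form_class (pfaffian B') = form_class (pfaffian B)"
  proof -
    have "det (transpose_mat \<delta>) = const d" using det_transpose[OF Dc] d by simp
    then show ?thesis using pfaffian_const_congr[OF Tc(2) Bc _ cd(2)] by (simp add: B'_def)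
  qed
  have nz: "p \<noteq> 0" if "form_class p = form_class q" "q \<noteq> 0" for p q :: form
  proof
    assume "p = 0"
    then have "q \<in> {0}" using that(1) form_class_self[of q] by (auto simp: form_class_def)
    then show False using that(2) by simp
  qed
  have fac': "is_factorization A' B' F"
    using fac nz[OF pA] nz[OF pB] unfolding is_factorization_def AB BA pA pB by blast
  have z: "A' \<noteq> 0\<^sub>m 8 8" "B' \<noteq> 0\<^sub>m 8 8"
    using fac' B' A'c unfolding is_factorization_def by (auto simp: B_space_iff)
  define K where "K = mat 6 6 (\<lambda>(i, j). Poly_Mapping.lookup (\<gamma> $$ (i + 2, j + 2)) 0)"
  define L where "L = mat 6 6 (\<lambda>(i, j). Poly_Mapping.lookup (\<delta> $$ (i + 2, j + 2)) 0)"
  have Kc: "K \<in> carrier_mat 6 6" and Lc: "L \<in> carrier_mat 6 6" by (simp_all add: K_def L_def)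
  have hc: "const (Poly_Mapping.lookup p 0) = p" if "homogeneous 0 p" for p :: form
    using homogeneous_0_const[OF that] by auto
  have Ke: "const (K $$ (i, j)) = \<gamma> $$ (i + 2, j + 2)" if "i < 6" "j < 6" for i j
    using that G(3)[of "i + 2" "j + 2"] by (simp add: K_def hc wt_def)
  have Le: "const (L $$ (i, j)) = \<delta> $$ (i + 2, j + 2)" if "i < 6" "j < 6" for i j
    using that D(3)[of "i + 2" "j + 2"] by (simp add: L_def hc wt_def)
  have g0: "\<gamma> $$ (i + 2, a) = 0" if "i < 6" "a < 2" for i a using G(2)[of "i + 2" a] that by (simp add: wt_def)
  have KL: "K * L = 1\<^sub>m 6"
  proof (rule eq_matI)
    fix i j assume "i < dim_row (1\<^sub>m 6 :: complex mat)" "j < dim_col (1\<^sub>m 6 :: complex mat)"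
    then have ij: "i < 6" "j < 6" by simp_all
    have "ev ((\<gamma> * \<delta>) $$ (i + 2, j + 2)) (\<lambda>_. 0) = (\<Sum>k<8. ev (\<gamma> $$ (i + 2, k) * \<delta> $$ (k, j + 2)) (\<lambda>_. 0))"
      using ij Gc Dc by (simp add: scalar_prod_def ev_sum atLeast0LessThan)
    also have "\<dots> = (\<Sum>k<6. K $$ (i, k) * L $$ (k, j))"
      unfolding less8 using ij g0[OF ij(1), of 0] g0[OF ij(1), of 1]
      by (simp add: ev_0 ev_mult ev_const Ke[symmetric, simplified] Le[symmetric, simplified])
    finally have "(K * L) $$ (i, j) = ev ((1\<^sub>m 8 :: form mat) $$ (i + 2, j + 2)) (\<lambda>_. 0)"
      using ij Kc Lc unfolding gd by (simp add: scalar_prod_def atLeast0LessThan)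
    then show "(K * L) $$ (i, j) = (1\<^sub>m 6) $$ (i, j)" using ij by (simp add: ev_0 ev_const[of 1, unfolded single_one])
  qed (simp_all add: K_def L_def)
  have "det K * det L = 1" using det_mult[OF Kc Lc] KL by simp
  then have dK: "det K \<noteq> 0" by auto
  have blk: "block_A1 A' = congr_act K (block_A1 A)"
  proof (rule eq_matI)
    fix i j assume "i < dim_row (congr_act K (block_A1 A))" "j < dim_col (congr_act K (block_A1 A))"
    then have ij: "i < 6" "j < 6" using Kc by (simp_all add: congr_act_def)
    have m: "map_mat const K \<in> carrier_mat 6 6" "block_A1 A \<in> carrier_mat 6 6" using Kc by (simp_all add: block_A1_def)
    have "block_A1 A' $$ (i, j) = A' $$ (i + 2, j + 2)" using ij by (simp add: block_A1_def)
    also have "\<dots> = (\<Sum>a<8. \<Sum>b<8. A $$ (a, b) * (\<gamma> $$ (i + 2, a) * \<gamma> $$ (j + 2, b)))"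
      unfolding A'_def using ij mult_congr_entry[OF Gc Ac(1), of "i + 2" "j + 2"]
      by (simp add: sum.cartesian_product atLeast0LessThan)
    also have "\<dots> = (\<Sum>a<6. \<Sum>b<6. A $$ (a + 2, b + 2) * (\<gamma> $$ (i + 2, a + 2) * \<gamma> $$ (j + 2, b + 2)))"
      unfolding less8 using g0[OF ij(1), of 0] g0[OF ij(1), of 1] g0[OF ij(2), of 0] g0[OF ij(2), of 1] by simp
    also have "\<dots> = (\<Sum>a<6. \<Sum>b<6. block_A1 A $$ (a, b) * (map_mat const K $$ (i, a) * map_mat const K $$ (j, b)))"
    proof (intro sum.cong refl)
      fix a b :: nat assume ab: "a \<in> {..<6}" "b \<in> {..<6}"
      then have "map_mat const K $$ (i, a) = \<gamma> $$ (i + 2, a + 2)" "map_mat const K $$ (j, b) = \<gamma> $$ (j + 2, b + 2)"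
        using ij Kc Ke[OF ij(1), of a] Ke[OF ij(2), of b] by simp_all
      then show "A $$ (a + 2, b + 2) * (\<gamma> $$ (i + 2, a + 2) * \<gamma> $$ (j + 2, b + 2)) =
          block_A1 A $$ (a, b) * (map_mat const K $$ (i, a) * map_mat const K $$ (j, b))"
        using ab by (simp add: block_A1_def)
    qed
    also have "\<dots> = congr_act K (block_A1 A) $$ (i, j)"
      unfolding congr_act_def mult_congr_entry[OF m ij] by (simp only: sum.cartesian_product atLeast0LessThan)
    finally show "block_A1 A' $$ (i, j) = congr_act K (block_A1 A) $$ (i, j)" .
  qed (use Kc in \<open>simp_all add: congr_act_def block_A1_def\<close>)
  have ss': "semistable (block_A1 A')" unfolding blk by (rule semistable_congr[OF ss Kc dK])
  have "Gamma_act \<gamma> x \<in> MF" unfolding act MF_def using A' B' F fac' z by blast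
  moreover have "block_A1 ` mat_class A' \<in> S_ss" unfolding block_A1_class[OF A'c] by (rule semistable_S_ss[OF ss'])
  ultimately have mem: "Gamma_act \<gamma> x \<in> MF_ss" unfolding act MF_ss_def by simp
  have "psi (Gamma_act \<gamma> x) = (mat_class (block_A1 A'), form_class F)"
    unfolding act psi_def by (simp add: block_A1_class[OF A'c])
  then have "psi_bar (Gamma_act \<gamma> x) = psi_bar x"
    unfolding psi_bar_def to_M_tilde_def using psi quot_map_congr[OF block_A1_skew_lin[OF A] Kc dK] by (simp add: blk)
  with mem show ?thesis by blast
qed

theorem proposition2p6:
  shows "psi \<in> MF_ss \<rightarrow> S_tilde_ss \<and>
    psi_bar \<in> MF_ss \<rightarrow> M_tilde \<and>
    (\<forall>x\<in>MF_ss. \<forall>\<gamma>\<in>Gamma. Gamma_act \<gamma> x \<in> MF_ss \<and> psi_bar (Gamma_act \<gamma> x) = psi_bar x)"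
proof (intro conjI ballI)
  show "psi \<in> MF_ss \<rightarrow> S_tilde_ss" using psi_in_closure by blast
  then show "psi_bar \<in> MF_ss \<rightarrow> M_tilde" unfolding psi_bar_def M_tilde_def by (auto simp: Pi_iff)
  show "Gamma_act \<gamma> x \<in> MF_ss" "psi_bar (Gamma_act \<gamma> x) = psi_bar x" if "x \<in> MF_ss" "\<gamma> \<in> Gamma" for x \<gamma>
    using Gamma_act_MF_ss[OF that] by auto
qed

end
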